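(* Let $m,n$ be positive integers. Let $H$ be an $n\times n$ random matrix taken from one of the six ensembles $GOE_n$, $GUE_n$, $GSE_n$, $LOE_{(m,n)}$, $LUE_{(m,n)}$, $LSE_{(m,n)}$, and put $\beta=1,2,4$ for the orthogonal, unitary, symplectic cases, respectively. Let $\Gamma=(\Gamma_{jk})_{j,k=1}^n$ be a random $n\times n$ Hermitian matrix with real (if $\beta=1$), complex (if $\beta=2$), or quaternion (if $\beta=4$) entries, such that $\Gamma\ge \mathbf{0}$ (positive semi-definite), $\operatorname{rank}\Gamma=1$, and $\Gamma$ is independent of $H$. Then, with probability $1$, $H_{eff}=H+i\Gamma$ is unitarily equivalent to $$\mathcal J+i\,l\,I_{1\times 1},$$ where $\mathcal J$ is a random $n\times n$ Jacobi matrix distributed as the Gaussian $\beta$-ensemble $G\beta E_n$ (if $H$ is from $GOE_n$, $GUE_n$, $GSE_n$) or as the Laguerre $\beta$-ensemble $L\beta E_{(m,n)}$ (if $H$ is from $LOE_{(m,n)}$, $LUE_{(m,n)}$, $LSE_{(m,n)}$), and $l=\|\Gamma\|_{HS}=\big(\sum_{j,k=1}^n|\Gamma_{jk}|^2\big)^{1/2}$ is independent of $\mathcal J$.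
   Context: Notation. $I_{1\times1}$ is the $n\times n$ matrix with $(1,1)$-entry equal to $1$ and all other entries $0$. Distributions. $N(0,\sigma)$ denotes the real normal law with density $\frac{1}{\sqrt{2\pi\sigma^2}}e^{-x^2/2\sigma^2}$. A complex random variable is $N(0,\sigma\mathbf I_2)$ if its real and imaginary parts are independent $N(0,\sigma)$; a quaternion random variable $\xi_1+\xi_2\mathsf i+\xi_3\mathsf j+\xi_4\mathsf k$ is $N(0,\sigma\mathbf I_4)$ if $\xi_1,\dots,\xi_4$ are independent $N(0,\sigma)$. For $k>0$, $\chi_k$ is the law on $(0,\infty)$ with density $\frac{2^{1-k/2}}{\Gamma(k/2)}x^{k-1}e^{-x^2/2}$, and $\tilde\chi_k$ is the law on $(0,\infty)$ with density $\frac{2}{\Gamma(k/2)}x^{k-1}e^{-x^2}$. Ensembles. If $Y$ is an $n\times n$ matrix with i.i.d. entries from $N(0,1)$, $N(0,\mathbf I_2)$ or $N(0,\mathbf I_4)$, then $X=\frac12(Y+Y^* )$ belongs to $GOE_n$, $GUE_n$, $GSE_n$, respectively. If $Y$ is an $m\times n$ matrix with i.i.d. entries from $N(0,1)$, $N(0,\mathbf I_2)$ or $N(0,\mathbf I_4)$, then the $n\times n$ matrix $X=Y^*Y$ belongs to $LOE_{(m,n)}$, $LUE_{(m,n)}$, $LSE_{(m,n)}$, respectively. Jacobi matrices. An $n\times n$ Jacobi matrix is a real symmetric tridiagonal matrix with diagonal entries $b_1,\dots,b_n\in\mathbb R$ and off-diagonal entries (in positions $(j,j+1)$ and $(j+1,j)$)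 $a_1,\dots,a_{n-1}\ge0$. $G\beta E_n$: the random $n\times n$ Jacobi matrix with independent coefficients $a_j\sim\tilde\chi_{\beta(n-j)}$ ($1\le j\le n-1$), $b_j\sim N(0,1)$ ($1\le j\le n$). $L\beta E_{(m,n)}$: the random $n\times n$ Jacobi matrix $\mathcal J=B^*B$, where $B$ is the $n\times n$ upper bidiagonal matrix with diagonal entries $x_1,\dots,x_n$, superdiagonal entries ($(j,j+1)$-entry) $y_1,\dots,y_{n-1}$, and zeros elsewhere, with all nonzero entries independent and: (i) if $m\ge n$: $x_j\sim\chi_{\beta(m-j+1)}$ ($1\le j\le n$), $y_j\sim\chi_{\beta(n-j)}$ ($1\le j\le n-1$); (ii) if $m\le n-1$: $x_j\sim\chi_{\beta(m-j+1)}$ for $1\le j\le m$ and $x_j=0$ for $m+1\le j\le n$; $y_j\sim\chi_{\beta(n-j)}$ for $1\le j\le m$ and $y_j=0$ for $m+1\le j\le n-1$. Unitary equivalence of $A$ and $A'$ means $A=W^*A'W$ for some (random) unitary matrix $W$. In the case $\beta=4$, matrices have quaternion entries, the rank is the (right) rank over quaternions, $W$ is a quaternionic unitary matrix, entries of $\mathcal J$ are regarded as quaternions with zero $\mathsf i,\mathsf j,\mathsf k$ parts, and $i$ is the complex imaginary unit, viewed as a scalar commuting with the quaternion units $\mathsf i,\mathsf j,\mathsf k$. *)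

theory Defs
  imports
    "HOL-Probability.Probability"
    "Jordan_Normal_Form.Matrix"
    "Jordan_Normal_Form.DL_Rank"
begin

section \<open>Quaternions over a commutative ring\<close>

text \<open>The type \<open>real quaternion\<close> is Hamilton's algebra.  The type \<open>complex quaternion\<close> is its
  complexification: there the complex imaginary unit is the scalar \<open>Quaternion \<i> 0 0 0\<close>, which
  commutes with the three quaternion units.\<close>

datatype 'a quaternion = Quaternion (qre: 'a) (qim1: 'a) (qim2: 'a) (qim3: 'a)

lemma quaternion_eq_iff:
  "x = y \<longleftrightarrow> qre x = qre y \<and> qim1 x = qim1 y \<and> qim2 x = qim2 y \<and> qim3 x = qim3 y"
  by (cases x; cases y) simp

instantiation quaternion :: (ab_group_add) ab_group_add
begin

definition "0 = Quaternion 0 0 0 0"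
definition "x + y = Quaternion (qre x + qre y) (qim1 x + qim1 y) (qim2 x + qim2 y) (qim3 x + qim3 y)"
definition "x - y = Quaternion (qre x - qre y) (qim1 x - qim1 y) (qim2 x - qim2 y) (qim3 x - qim3 y)"
definition "- x = Quaternion (- qre x) (- qim1 x) (- qim2 x) (- qim3 x)"

instance
  by standard
    (simp_all add: quaternion_eq_iff zero_quaternion_def plus_quaternion_def minus_quaternion_def
      uminus_quaternion_def add.assoc add.commute)

end

lemma quaternion_add_sel [simp]:
  "qre (x + y) = qre x + qre y" "qim1 (x + y) = qim1 x + qim1 y"
  "qim2 (x + y) = qim2 x + qim2 y" "qim3 (x + y) = qim3 x + qim3 y"
  "qre (x - y) = qre x - qre y" "qim1 (x - y) = qim1 x - qim1 y"
  "qim2 (x - y) = qim2 x - qim2 y" "qim3 (x - y) = qim3 x - qim3 y"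
  "qre (- x) = - qre x" "qim1 (- x) = - qim1 x" "qim2 (- x) = - qim2 x" "qim3 (- x) = - qim3 x"
  "qre 0 = 0" "qim1 0 = 0" "qim2 0 = 0" "qim3 0 = 0"
  by (simp_all add: zero_quaternion_def plus_quaternion_def minus_quaternion_def
      uminus_quaternion_def)

instantiation quaternion :: (comm_ring_1) ring_1
begin

definition "1 = Quaternion 1 0 0 0"
definition "x * y = Quaternion
  (qre x * qre y - qim1 x * qim1 y - qim2 x * qim2 y - qim3 x * qim3 y)
  (qre x * qim1 y + qim1 x * qre y + qim2 x * qim3 y - qim3 x * qim2 y)
  (qre x * qim2 y - qim1 x * qim3 y + qim2 x * qre y + qim3 x * qim1 y)
  (qre x * qim3 y + qim1 x * qim2 y - qim2 x * qim1 y + qim3 x * qre y)"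

instance
  by standard
    (simp_all add: quaternion_eq_iff one_quaternion_def times_quaternion_def algebra_simps)

end

lemma quaternion_mult_sel [simp]:
  "qre (x * y) = qre x * qre y - qim1 x * qim1 y - qim2 x * qim2 y - qim3 x * qim3 y"
  "qim1 (x * y) = qre x * qim1 y + qim1 x * qre y + qim2 x * qim3 y - qim3 x * qim2 y"
  "qim2 (x * y) = qre x * qim2 y - qim1 x * qim3 y + qim2 x * qre y + qim3 x * qim1 y"
  "qim3 (x * y) = qre x * qim3 y + qim1 x * qim2 y - qim2 x * qim1 y + qim3 x * qre y"
  "qre 1 = 1" "qim1 1 = 0" "qim2 1 = 0" "qim3 1 = 0"
  by (simp_all add: times_quaternion_def one_quaternion_def)

instantiation quaternion :: (real_vector) real_vector
begin

definition "r *\<^sub>R x = Quaternion (r *\<^sub>R qre x) (r *\<^sub>R qim1 x) (r *\<^sub>R qim2 x) (r *\<^sub>R qim3 x)"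

instance
  by standard (simp_all add: quaternion_eq_iff scaleR_quaternion_def scaleR_add_left
      scaleR_add_right)

end

lemma quaternion_scaleR_sel [simp]:
  "qre (r *\<^sub>R x) = r *\<^sub>R qre x" "qim1 (r *\<^sub>R x) = r *\<^sub>R qim1 x"
  "qim2 (r *\<^sub>R x) = r *\<^sub>R qim2 x" "qim3 (r *\<^sub>R x) = r *\<^sub>R qim3 x"
  by (simp_all add: scaleR_quaternion_def)

instance quaternion :: ("{comm_ring_1, real_algebra_1}") real_algebra_1
  by standard (simp_all add: quaternion_eq_iff scaleR_diff_right scaleR_add_right)

instantiation quaternion :: (real_inner) real_inner
begin

definition inner_quaternion_def:
  "inner x y = inner (qre x) (qre y) + inner (qim1 x) (qim1 y)
    + inner (qim2 x) (qim2 y) + inner (qim3 x) (qim3 y)"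
definition norm_quaternion_def: "norm (x :: 'a quaternion) = sqrt (inner x x)"
definition sgn_quaternion_def: "sgn (x :: 'a quaternion) = x /\<^sub>R norm x"
definition dist_quaternion_def: "dist (x :: 'a quaternion) y = norm (x - y)"
definition uniformity_quaternion_def:
  "(uniformity :: ('a quaternion \<times> 'a quaternion) filter)
    = (INF e\<in>{0 <..}. principal {(x, y). dist x y < e})"
definition open_quaternion_def:
  "open (U :: 'a quaternion set) \<longleftrightarrow>
    (\<forall>x\<in>U. eventually (\<lambda>(x', y). x' = x \<longrightarrow> y \<in> U) uniformity)"

instance
proof
  fix x y z :: "'a quaternion" and r :: real and U :: "'a quaternion set"
  show "inner x y = inner y x"
    by (simp add: inner_quaternion_def inner_commute)
  show "inner (x + y) z = inner x z + inner y z"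
    by (simp add: inner_quaternion_def inner_add_left)
  show "inner (r *\<^sub>R x) y = r * inner x y"
    by (simp add: inner_quaternion_def distrib_left)
  show "0 \<le> inner x x"
    by (simp add: inner_quaternion_def)
  show "inner x x = 0 \<longleftrightarrow> x = 0"
    by (simp add: inner_quaternion_def quaternion_eq_iff add_nonneg_eq_0_iff)
qed (simp_all only: norm_quaternion_def sgn_quaternion_def dist_quaternion_def
      uniformity_quaternion_def open_quaternion_def)

end

instantiation quaternion :: (euclidean_space) euclidean_space
begin

definition Basis_quaternion_def:
  "Basis = (\<lambda>u. Quaternion u 0 0 0) ` Basis \<union> (\<lambda>u. Quaternion 0 u 0 0) ` Basis
    \<union> (\<lambda>u. Quaternion 0 0 u 0) ` Basis \<union> (\<lambda>u. Quaternion 0 0 0 u) ` Basis"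

instance
proof
  fix u v x :: "'a quaternion"
  show "(Basis :: 'a quaternion set) \<noteq> {}" "finite (Basis :: 'a quaternion set)"
    by (simp_all add: Basis_quaternion_def)
  show "inner u v = (if u = v then 1 else 0)" if "u \<in> Basis" "v \<in> Basis"
    using that unfolding Basis_quaternion_def
    by (auto simp: inner_quaternion_def inner_Basis split: if_split_asm)
  show "(\<forall>u\<in>Basis. inner x u = 0) \<longleftrightarrow> x = 0"
    by (simp add: Basis_quaternion_def ball_Un inner_quaternion_def euclidean_all_zero_iff
        quaternion_eq_iff)
qed

end

instantiation quaternion :: (ab_group_add) conjugate
begin

definition "conjugate x = Quaternion (qre x) (- qim1 x) (- qim2 x) (- qim3 x)"

instance
  by standard (auto simp: conjugate_quaternion_def quaternion_eq_iff)

end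

abbreviation complexify :: "real quaternion \<Rightarrow> complex quaternion" where
  "complexify \<equiv> map_quaternion complex_of_real"

abbreviation imag_unit :: "complex quaternion" where
  "imag_unit \<equiv> Quaternion \<i> 0 0 0"


section \<open>Matrices\<close>

definition conj_transpose :: "'a :: conjugate mat \<Rightarrow> 'a mat" where
  "conj_transpose A = map_mat conjugate (transpose_mat A)"

definition unitary :: "nat \<Rightarrow> 'a :: {semiring_1, conjugate} mat \<Rightarrow> bool" where
  "unitary n W \<longleftrightarrow> W \<in> carrier_mat n n \<and> conj_transpose W * W = 1\<^sub>m n \<and> W * conj_transpose W = 1\<^sub>m n"

definition pos_semidef :: "nat \<Rightarrow> 'a :: {real_algebra_1, conjugate} mat \<Rightarrow> bool" where
  "pos_semidef n A \<longleftrightarrow> A \<in> carrier_mat n n \<and> conj_transpose A = A \<and>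
    (\<forall>v\<in>carrier_vec n. \<exists>r\<ge>0. scalar_prod (conjugate v) (A *\<^sub>v v) = of_real r)"

text \<open>The library rank needs a field.  Over the quaternions vectors are multiplied by scalars from
  the right, and the rank is the largest number of right linearly independent columns.\<close>

definition right_indep_cols :: "'a :: semiring_0 mat \<Rightarrow> nat set \<Rightarrow> bool" where
  "right_indep_cols A S \<longleftrightarrow>
    (\<forall>c. (\<forall>i<dim_row A. (\<Sum>j\<in>S. A $$ (i, j) * c j) = 0) \<longrightarrow> (\<forall>j\<in>S. c j = 0))"

definition right_rank :: "'a :: semiring_0 mat \<Rightarrow> nat" where
  "right_rank A = Max {card S | S. S \<subseteq> {..<dim_col A} \<and> right_indep_cols A S}"

definition hs_norm :: "'a :: real_normed_vector mat \<Rightarrow> real" where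
  "hs_norm A = sqrt (\<Sum>i<dim_row A. \<Sum>j<dim_col A. (norm (A $$ (i, j)))\<^sup>2)"

definition unit11 :: "nat \<Rightarrow> 'a :: zero_neq_one mat" where
  "unit11 n = mat n n (\<lambda>(i, j). if i = 0 \<and> j = 0 then 1 else 0)"

text \<open>Matrix positions count from 0, whereas the coefficients \<open>a\<close>, \<open>b\<close> of a Jacobi matrix and
  \<open>x\<close>, \<open>y\<close> of a bidiagonal matrix count from 1.\<close>

definition jacobi_mat :: "nat \<Rightarrow> (nat \<Rightarrow> real) \<Rightarrow> (nat \<Rightarrow> real) \<Rightarrow> real mat" where
  "jacobi_mat n a b = mat n n (\<lambda>(i, j).
    if i = j then b (i + 1) else if j = i + 1 then a (i + 1) else if i = j + 1 then a (j + 1) else 0)"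

definition is_jacobi :: "nat \<Rightarrow> real mat \<Rightarrow> bool" where
  "is_jacobi n A \<longleftrightarrow> (\<exists>a b. (\<forall>j\<in>{1..<n}. 0 \<le> a j) \<and> A = jacobi_mat n a b)"

definition bidiag_mat :: "nat \<Rightarrow> (nat \<Rightarrow> real) \<Rightarrow> (nat \<Rightarrow> real) \<Rightarrow> real mat" where
  "bidiag_mat n x y = mat n n (\<lambda>(i, j).
    if i = j then x (i + 1) else if j = i + 1 then y (i + 1) else 0)"


section \<open>Random matrices\<close>

text \<open>The \<open>\<sigma>\<close>-algebra generated by the entries.\<close>

definition mat_borel :: "nat \<Rightarrow> nat \<Rightarrow> 'a :: topological_space mat measure" where
  "mat_borel m n = vimage_algebra (carrier_mat m n)
    (\<lambda>A. \<lambda>ij\<in>{..<m} \<times> {..<n}. A $$ ij) (Pi\<^sub>M ({..<m} \<times> {..<n}) (\<lambda>_. borel))"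

definition has_law :: "'w measure \<Rightarrow> nat \<Rightarrow> ('w \<Rightarrow> 'a :: topological_space mat) \<Rightarrow> 'a mat measure \<Rightarrow> bool"
  where "has_law M n X L \<longleftrightarrow> X \<in> M \<rightarrow>\<^sub>M mat_borel n n \<and> distr M (mat_borel n n) X = L"

definition random_unitary ::
  "'w measure \<Rightarrow> nat \<Rightarrow> ('w \<Rightarrow> 'a :: {semiring_1, conjugate, topological_space} mat) \<Rightarrow> bool" where
  "random_unitary M n W \<longleftrightarrow> W \<in> M \<rightarrow>\<^sub>M mat_borel n n \<and> (\<forall>\<omega>\<in>space M. unitary n (W \<omega>))"


text \<open>The library constant \<open>indep_var\<close> requires both random variables to have the same value type.\<close>

definition indep_rv ::
  "'w measure \<Rightarrow> 'b measure \<Rightarrow> ('w \<Rightarrow> 'b) \<Rightarrow> 'c measure \<Rightarrow> ('w \<Rightarrow> 'c) \<Rightarrow> bool" where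
  "indep_rv M N1 X N2 Y \<longleftrightarrow> X \<in> M \<rightarrow>\<^sub>M N1 \<and> Y \<in> M \<rightarrow>\<^sub>M N2 \<and>
    prob_space.indep_set M {X -` A \<inter> space M | A. A \<in> sets N1} {Y -` A \<inter> space M | A. A \<in> sets N2}"


section \<open>Distributions\<close>

definition normal_law :: "real \<Rightarrow> real measure" where
  "normal_law \<sigma> = density lborel (normal_density 0 \<sigma>)"

definition complex_normal_law :: "real \<Rightarrow> complex measure" where
  "complex_normal_law \<sigma> = distr (normal_law \<sigma> \<Otimes>\<^sub>M normal_law \<sigma>) borel (\<lambda>(x, y). Complex x y)"

definition quaternion_normal_law :: "real \<Rightarrow> real quaternion measure" where
  "quaternion_normal_law \<sigma> =
    distr (normal_law \<sigma> \<Otimes>\<^sub>M normal_law \<sigma> \<Otimes>\<^sub>M normal_law \<sigma> \<Otimes>\<^sub>M normal_law \<sigma>) borel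
      (\<lambda>(x1, x2, x3, x4). Quaternion x1 x2 x3 x4)"

definition chi_law :: "real \<Rightarrow> real measure" where
  "chi_law k = density lborel (\<lambda>x.
    if 0 < x then 2 powr (1 - k / 2) / Gamma (k / 2) * x powr (k - 1) * exp (- x\<^sup>2 / 2) else 0)"

definition chi_tilde_law :: "real \<Rightarrow> real measure" where
  "chi_tilde_law k = density lborel (\<lambda>x.
    if 0 < x then 2 / Gamma (k / 2) * x powr (k - 1) * exp (- x\<^sup>2) else 0)"


section \<open>Ensembles\<close>

definition iid_mat_law :: "'a :: topological_space measure \<Rightarrow> nat \<Rightarrow> nat \<Rightarrow> 'a mat measure" where
  "iid_mat_law \<nu> m n = distr (Pi\<^sub>M ({..<m} \<times> {..<n}) (\<lambda>_. \<nu>)) (mat_borel m n) (mat m n)"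

definition gaussian_ensemble ::
  "'a :: {real_normed_vector, conjugate} measure \<Rightarrow> nat \<Rightarrow> 'a mat measure" where
  "gaussian_ensemble \<nu> n = distr (iid_mat_law \<nu> n n) (mat_borel n n)
    (\<lambda>Y. map_mat (\<lambda>z. (1 / 2) *\<^sub>R z) (Y + conj_transpose Y))"

definition laguerre_ensemble ::
  "'a :: {semiring_0, conjugate, topological_space} measure \<Rightarrow> nat \<Rightarrow> nat \<Rightarrow> 'a mat measure" where
  "laguerre_ensemble \<nu> m n = distr (iid_mat_law \<nu> m n) (mat_borel n n) (\<lambda>Y. conj_transpose Y * Y)"

definition "GOE n = gaussian_ensemble (normal_law 1) n"
definition "GUE n = gaussian_ensemble (complex_normal_law 1) n"
definition "GSE n = gaussian_ensemble (quaternion_normal_law 1) n"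

definition "LOE m n = laguerre_ensemble (normal_law 1) m n"
definition "LUE m n = laguerre_ensemble (complex_normal_law 1) m n"
definition "LSE m n = laguerre_ensemble (quaternion_normal_law 1) m n"

definition GbetaE :: "real \<Rightarrow> nat \<Rightarrow> real mat measure" where
  "GbetaE \<beta> n =
    distr
      (Pi\<^sub>M {1..<n} (\<lambda>j. chi_tilde_law (\<beta> * (real n - real j))) \<Otimes>\<^sub>M Pi\<^sub>M {1..n} (\<lambda>_. normal_law 1))
      (mat_borel n n) (\<lambda>(a, b). jacobi_mat n a b)"

text \<open>The two cases \<open>m \<ge> n\<close> and \<open>m \<le> n - 1\<close> are merged: the entries that vanish in the
  second case are given the point mass at 0 as their law, and for \<open>m \<ge> n\<close> the condition
  \<open>j \<le> m\<close> always holds.\<close>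

definition LbetaE :: "real \<Rightarrow> nat \<Rightarrow> nat \<Rightarrow> real mat measure" where
  "LbetaE \<beta> m n =
    distr
      (Pi\<^sub>M {1..n} (\<lambda>j. if j \<le> m then chi_law (\<beta> * (real m - real j + 1)) else return borel 0) \<Otimes>\<^sub>M
       Pi\<^sub>M {1..<n} (\<lambda>j. if j \<le> m then chi_law (\<beta> * (real n - real j)) else return borel 0))
      (mat_borel n n) (\<lambda>(x, y). transpose_mat (bidiag_mat n x y) * bidiag_mat n x y)"

end

theory Submission
  imports Defs
begin

text \<open>A positive semidefinite \<open>\<Gamma>\<close> of rank one is \<open>l u u\<^sup>*\<close> with a unit vector \<open>u\<close>. A unitary \<open>F\<close>
  that depends measurably on \<open>\<Gamma>\<close> alone sends \<open>u\<close> to the first basis vector \<open>e\<close>. By unitary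
  invariance of the ensembles and Fubini, \<open>F H F\<^sup>*\<close> is independent of \<open>\<Gamma>\<close> and has the same law as
  \<open>H\<close>. It remains to bring \<open>F H F\<^sup>*\<close> to Jacobi form by a unitary \<open>Q\<close> that fixes \<open>e\<close>, which therefore
  does not disturb \<open>F \<Gamma> F\<^sup>* = l e e\<^sup>*\<close>: rotate the first column below the diagonal onto
  its first entry and recurse on the remaining block. In the Gaussian case that block is
  independent of the first column and its law is invariant, so the off-diagonal entry is the norm of
  a Gaussian vector, and the recursion is that of \<open>G\<beta>E\<close>. In the Laguerre case one
  first rotates the first column of \<open>Y\<close> from the left, then the rest of the first row from the
  right; the remaining block of \<open>Y\<close> is again Gaussian, which is the recursion of \<open>B\<close>.\<close>

section \<open>Product measures\<close>

text \<open>The scalars need not commute, so no determinant over them turns a unitary change of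
  variables into a statement about Lebesgue measure. Invariance is therefore proved only for the
  explicit matrices of \<open>align\<close>, factor by factor, and no other rotation is ever applied
  to Gaussian data. The three number systems are instances of \<open>hermitian_scalars\<close>, with
  \<beta> as the real dimension \<open>DIM('a)\<close>. Every rotation is chosen from random data,
  so invariance under a fixed matrix is not enough. \<open>distr_pair_skew\<close> closes this gap:
  if a map of the second variable depends on the first, but gives the same law for each frozen value
  of the first, then its result is independent of the first. The Laguerre recursion leaves a
  multiple of the corner projection behind; it does no harm because the corner entry influences no
  rotation. The factor \<open>1 / sqrt 2\<close> between \<open>chi_law\<close> and
  \<open>chi_tilde_law\<close> is the standard deviation of a real coordinate of an off-diagonal
  entry in the Gaussian ensembles.\<close>

lemma distr_pair_skew:
  assumes "sigma_finite_measure P" "sigma_finite_measure Q"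
    and f [measurable]: "(\<lambda>(x, y). f x y) \<in> P \<Otimes>\<^sub>M Q \<rightarrow>\<^sub>M Q'"
    and eq: "\<And>x. x \<in> space P \<Longrightarrow> distr Q Q' (f x) = Q''"
    and Q'': "sigma_finite_measure Q''" "sets Q'' = sets Q'"
  shows "distr (P \<Otimes>\<^sub>M Q) (P \<Otimes>\<^sub>M Q') (\<lambda>(x, y). (x, f x y)) = P \<Otimes>\<^sub>M Q''"
proof (rule pair_measure_eqI[symmetric])
  interpret Q: sigma_finite_measure Q by fact
  show "sigma_finite_measure P" "sigma_finite_measure Q''" by fact+
  show "sets (P \<Otimes>\<^sub>M Q'') = sets (distr (P \<Otimes>\<^sub>M Q) (P \<Otimes>\<^sub>M Q') (\<lambda>(x, y). (x, f x y)))"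
    using Q'' by (simp cong: sets_pair_measure_cong)
  fix A B assume A [measurable]: "A \<in> sets P" and B: "B \<in> sets Q''"
  have B' [measurable]: "B \<in> sets Q'" using B Q'' by simp
  let ?S = "(\<lambda>(x, y). (x, f x y)) -` (A \<times> B) \<inter> space (P \<Otimes>\<^sub>M Q)"
  have S: "?S \<in> sets (P \<Otimes>\<^sub>M Q)" by measurable
  have "emeasure (distr (P \<Otimes>\<^sub>M Q) (P \<Otimes>\<^sub>M Q') (\<lambda>(x, y). (x, f x y))) (A \<times> B) = emeasure (P \<Otimes>\<^sub>M Q) ?S"
    by (rule emeasure_distr) measurable
  also have "\<dots> = (\<integral>\<^sup>+x. emeasure Q (Pair x -` ?S) \<partial>P)"
    by (rule Q.emeasure_pair_measure_alt[OF S])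
  also have "\<dots> = (\<integral>\<^sup>+x. emeasure Q'' B * indicator A x \<partial>P)"
  proof (rule nn_integral_cong)
    fix x assume x: "x \<in> space P"
    have m: "f x \<in> Q \<rightarrow>\<^sub>M Q'"
      using measurable_compose[OF measurable_Pair1'[OF x] f] by simp
    \<comment> \<open>Freezing \<open>x\<close> leaves either the whole preimage of \<open>B\<close>
      under \<open>f x\<close> or nothing, and by \<open>eq\<close> the mass of that preimage does
      not depend on \<open>x\<close>.\<close>
    have "Pair x -` ?S = (if x \<in> A then f x -` B \<inter> space Q else {})"
      using x by (auto simp: space_pair_measure)
    then show "emeasure Q (Pair x -` ?S) = emeasure Q'' B * indicator A x"
      using eq[OF x] emeasure_distr[OF m B'] by auto
  qed
  also have "\<dots> = emeasure P A * emeasure Q'' B"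
    by (subst nn_integral_cmult_indicator) (auto simp: mult.commute)
  finally show "emeasure P A * emeasure Q'' B =
    emeasure (distr (P \<Otimes>\<^sub>M Q) (P \<Otimes>\<^sub>M Q') (\<lambda>(x, y). (x, f x y))) (A \<times> B)" ..
qed

lemma distr_map_prod:
  assumes "prob_space A" "prob_space B" and [measurable]: "f \<in> A \<rightarrow>\<^sub>M A'" "g \<in> B \<rightarrow>\<^sub>M B'"
  shows "distr (A \<Otimes>\<^sub>M B) (A' \<Otimes>\<^sub>M B') (\<lambda>(x, y). (f x, g y)) = distr A A' f \<Otimes>\<^sub>M distr B B' g"
proof -
  interpret B: prob_space "distr B B' g"
    using assms by (simp add: prob_space.prob_space_distr)
  show ?thesis
    by (rule pair_measure_distr[symmetric]) (auto intro: B.sigma_finite_measure_axioms)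
qed

text \<open>Tonelli: both sides integrate an indicator over \<open>A\<close>, then \<open>B\<close>,
  then \<open>C\<close>. With the target law repeated as codomain, equalities of this shape can be
  chained as rewriting steps for \<open>distr\<close>.\<close>

lemma distr_pair_assoc:
  assumes "sigma_finite_measure A" "sigma_finite_measure B" "sigma_finite_measure C"
  shows "distr ((A \<Otimes>\<^sub>M B) \<Otimes>\<^sub>M C) (A \<Otimes>\<^sub>M (B \<Otimes>\<^sub>M C)) (\<lambda>p. (fst (fst p), (snd (fst p), snd p))) =
      A \<Otimes>\<^sub>M (B \<Otimes>\<^sub>M C)"
proof (rule measure_eqI)
  interpret B: sigma_finite_measure B by fact
  interpret C: sigma_finite_measure C by fact
  interpret BC: pair_sigma_finite B C ..
  fix S assume "S \<in> sets (distr ((A \<Otimes>\<^sub>M B) \<Otimes>\<^sub>M C) (A \<Otimes>\<^sub>M (B \<Otimes>\<^sub>M C))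
      (\<lambda>p. (fst (fst p), (snd (fst p), snd p))))"
  then have S [measurable]: "S \<in> sets (A \<Otimes>\<^sub>M (B \<Otimes>\<^sub>M C))" by simp
  have "emeasure (distr ((A \<Otimes>\<^sub>M B) \<Otimes>\<^sub>M C) (A \<Otimes>\<^sub>M (B \<Otimes>\<^sub>M C))
      (\<lambda>p. (fst (fst p), (snd (fst p), snd p)))) S =
      (\<integral>\<^sup>+p. indicator S ((\<lambda>p. (fst (fst p), (snd (fst p), snd p))) p) \<partial>((A \<Otimes>\<^sub>M B) \<Otimes>\<^sub>M C))"
    by (subst nn_integral_indicator[symmetric], simp, subst nn_integral_distr) auto
  also have "\<dots> = (\<integral>\<^sup>+p. \<integral>\<^sup>+z. indicator S (fst p, (snd p, z)) \<partial>C \<partial>(A \<Otimes>\<^sub>M B))"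
    by (subst C.nn_integral_fst[symmetric]) auto
  also have "\<dots> = (\<integral>\<^sup>+x. \<integral>\<^sup>+y. \<integral>\<^sup>+z. indicator S (x, (y, z)) \<partial>C \<partial>B \<partial>A)"
    by (subst B.nn_integral_fst[symmetric]) auto
  also have "\<dots> = (\<integral>\<^sup>+x. \<integral>\<^sup>+p. indicator S (x, p) \<partial>(B \<Otimes>\<^sub>M C) \<partial>A)"
    by (rule nn_integral_cong, subst C.nn_integral_fst[symmetric]) auto
  also have "\<dots> = emeasure (A \<Otimes>\<^sub>M (B \<Otimes>\<^sub>M C)) S"
    by (subst BC.nn_integral_fst) auto
  finally show "emeasure (distr ((A \<Otimes>\<^sub>M B) \<Otimes>\<^sub>M C) (A \<Otimes>\<^sub>M (B \<Otimes>\<^sub>M C))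
      (\<lambda>p. (fst (fst p), (snd (fst p), snd p)))) S =
    emeasure (A \<Otimes>\<^sub>M (B \<Otimes>\<^sub>M C)) S" .
qed simp

lemma prob_space_pair: "prob_space A \<Longrightarrow> prob_space B \<Longrightarrow> prob_space (A \<Otimes>\<^sub>M B)"
  by (simp add: pair_prob_space.intro pair_prob_space_def pair_sigma_finite_def
      prob_space_imp_sigma_finite prob_space_pair)

lemma PiM_eqI_prob:
  assumes "finite K" "\<And>k. k \<in> K \<Longrightarrow> prob_space (N k)" "sets P = sets (Pi\<^sub>M K N)"
    and "\<And>A. (\<And>k. k \<in> K \<Longrightarrow> A k \<in> sets (N k)) \<Longrightarrow> emeasure P (Pi\<^sub>E K A) = (\<Prod>k\<in>K. emeasure (N k) (A k))"
  shows "P = Pi\<^sub>M K N"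
proof -
  \<comment> \<open>\<open>product_sigma_finite\<close> constrains the whole family, so indices
    outside \<open>K\<close> receive the measure on an empty space; the product over
    \<open>K\<close> does not see them.\<close>
  define N' where "N' k = (if k \<in> K then N k else count_space {})" for k
  interpret product_sigma_finite N'
    unfolding product_sigma_finite_def N'_def
    using assms(2) by (auto simp: prob_space_imp_sigma_finite intro:
        sigma_finite_measure_count_space_finite)
  have eq: "Pi\<^sub>M K N' = Pi\<^sub>M K N"
    by (rule PiM_cong) (auto simp: N'_def)
  show ?thesis
    unfolding eq[symmetric]
    using assms by (intro PiM_eqI) (auto simp: eq N'_def)
qed

lemma emeasure_PiM_prob:
  assumes "finite K" "\<And>k. k \<in> K \<Longrightarrow> prob_space (N k)" "\<And>k. k \<in> K \<Longrightarrow> A k \<in> sets (N k)"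
  shows "emeasure (Pi\<^sub>M K N) (Pi\<^sub>E K A) = (\<Prod>k\<in>K. emeasure (N k) (A k))"
proof -
  have "prod_emb K N K (Pi\<^sub>E K A) = Pi\<^sub>E K A"
    using assms(3)[THEN sets.sets_into_space] by (auto simp: prod_emb_def PiE_iff)
  with emeasure_PiM_emb[of K N K A] assms show ?thesis by auto
qed

text \<open>\<open>h\<close> sorts the indices into two groups, so one family of independent
  variables becomes a pair of independent families. The splittings into rows and columns, and the
  coordinate count in \<open>distr_\<nu>_norm_sum\<close>, are instances. It suffices to compare
  both measures on boxes.\<close>

lemma PiM_split:
  fixes h :: "'k \<Rightarrow> 'i + 'j"
  assumes K: "finite K" and h: "bij_betw h K (I <+> J)"
    and prob: "\<And>i. i \<in> I \<Longrightarrow> prob_space (M1 i)" "\<And>j. j \<in> J \<Longrightarrow> prob_space (M2 j)"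
    and N: "\<And>k. k \<in> K \<Longrightarrow> N k = case_sum M1 M2 (h k)"
  shows "distr (Pi\<^sub>M I M1 \<Otimes>\<^sub>M Pi\<^sub>M J M2) (Pi\<^sub>M K N) (\<lambda>(x, y). \<lambda>k\<in>K. case_sum x y (h k)) = Pi\<^sub>M K N"
    (is "distr ?P _ ?m = _")
    and "(\<lambda>(x, y). \<lambda>k\<in>K. case_sum x y (h k)) \<in> Pi\<^sub>M I M1 \<Otimes>\<^sub>M Pi\<^sub>M J M2 \<rightarrow>\<^sub>M Pi\<^sub>M K N"
proof -
  have finIJ: "finite I" "finite J"
    using bij_betw_finite[OF h] K by (auto simp: finite_Plus_iff)
  have hK: "h k \<in> I <+> J" if "k \<in> K" for k using h that by (auto simp: bij_betw_def)
  have probN: "prob_space (N k)" if "k \<in> K" for k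
    using hK[OF that] prob N[OF that] by auto
  interpret J: prob_space "Pi\<^sub>M J M2" by (rule prob_space_PiM) (use prob in auto)
  show m [measurable]: "?m \<in> ?P \<rightarrow>\<^sub>M Pi\<^sub>M K N"
    unfolding split_beta
  proof (rule measurable_restrict)
    fix k assume k: "k \<in> K"
    show "(\<lambda>z. case_sum (fst z) (snd z) (h k)) \<in> ?P \<rightarrow>\<^sub>M N k"
    proof (cases "h k")
      case (Inl i)
      with hK[OF k] N[OF k] have [measurable]: "i \<in> I" and [simp]: "N k = M1 i" by auto
      show ?thesis unfolding Inl by simp
    next
      case (Inr j)
      with hK[OF k] N[OF k] have [measurable]: "j \<in> J" and [simp]: "N k = M2 j" by auto
      show ?thesis unfolding Inr by simp
    qed
  qed
  show "distr ?P (Pi\<^sub>M K N) ?m = Pi\<^sub>M K N"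
  proof (rule PiM_eqI_prob[OF K probN])
    fix A assume A: "\<And>k. k \<in> K \<Longrightarrow> A k \<in> sets (N k)"
    \<comment> \<open>The inverse of \<open>h\<close> splits a box over \<open>K\<close> into a box
      over \<open>I\<close> and one over \<open>J\<close>, which makes the preimage a
      rectangle.\<close>
    define g where "g = the_inv_into K h"
    have gh: "g (h k) = k" if "k \<in> K" for k
      unfolding g_def using h that by (auto simp: bij_betw_def the_inv_into_f_f)
    have gK: "g z \<in> K" "h (g z) = z" if "z \<in> I <+> J" for z
      unfolding g_def using h that
      by (auto simp: bij_betw_def intro: the_inv_into_into f_the_inv_into_f)
    let ?A1 = "\<lambda>i. A (g (Inl i))" and ?A2 = "\<lambda>j. A (g (Inr j))"
    have A1: "?A1 i \<in> sets (M1 i)" if "i \<in> I" for i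
      using gK[of "Inl i"] A[of "g (Inl i)"] N[of "g (Inl i)"] that by (metis InlI old.sum.simps(5))
    have A2: "?A2 j \<in> sets (M2 j)" if "j \<in> J" for j
      using gK[of "Inr j"] A[of "g (Inr j)"] N[of "g (Inr j)"] that by (metis InrI old.sum.simps(6))
    have sub1: "Pi\<^sub>E I ?A1 \<subseteq> space (Pi\<^sub>M I M1)"
      using A1[THEN sets.sets_into_space] by (auto simp: space_PiM PiE_iff)
    have sub2: "Pi\<^sub>E J ?A2 \<subseteq> space (Pi\<^sub>M J M2)"
      using A2[THEN sets.sets_into_space] by (auto simp: space_PiM PiE_iff)
    have "?m -` Pi\<^sub>E K A \<inter> space ?P = Pi\<^sub>E I ?A1 \<times> Pi\<^sub>E J ?A2"
    proof (intro equalityI subsetI)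
      fix z assume z: "z \<in> ?m -` Pi\<^sub>E K A \<inter> space ?P"
      obtain x y where [simp]: "z = (x, y)" by fastforce
      have *: "case_sum x y (h k) \<in> A k" if "k \<in> K" for k
        using z that by (auto simp: PiE_iff)
      have "x i \<in> ?A1 i" if "i \<in> I" for i
        using *[of "g (Inl i)"] gK[of "Inl i"] that by (simp add: Plus_def)
      moreover have "y i \<in> ?A2 i" if "i \<in> J" for i
        using *[of "g (Inr i)"] gK[of "Inr i"] that by (simp add: Plus_def)
      ultimately show "z \<in> Pi\<^sub>E I ?A1 \<times> Pi\<^sub>E J ?A2"
        using z by (auto simp: space_pair_measure space_PiM PiE_iff)
    next
      fix z assume z: "z \<in> Pi\<^sub>E I ?A1 \<times> Pi\<^sub>E J ?A2"
      obtain x y where [simp]: "z = (x, y)" by fastforce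
      have "case_sum x y (h k) \<in> A k" if "k \<in> K" for k
      proof (cases "h k")
        case (Inl i)
        then show ?thesis using z hK[OF that] gh[OF that] by (auto simp: PiE_iff)
      next
        case (Inr i)
        then show ?thesis using z hK[OF that] gh[OF that] by (auto simp: PiE_iff)
      qed
      then show "z \<in> ?m -` Pi\<^sub>E K A \<inter> space ?P"
        using z sub1 sub2 by (auto simp: space_pair_measure)
    qed
    then have "emeasure (distr ?P (Pi\<^sub>M K N) ?m) (Pi\<^sub>E K A) = emeasure ?P (Pi\<^sub>E I ?A1 \<times> Pi\<^sub>E J ?A2)"
      using A K by (subst emeasure_distr) (auto intro!: sets_PiM_I_finite)
    also have "\<dots> = emeasure (Pi\<^sub>M I M1) (Pi\<^sub>E I ?A1) * emeasure (Pi\<^sub>M J M2) (Pi\<^sub>E J ?A2)"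
      using A1 A2 finIJ by (intro J.emeasure_pair_measure_Times sets_PiM_I_finite) auto
    also have "\<dots> = (\<Prod>i\<in>I. emeasure (M1 i) (?A1 i)) * (\<Prod>j\<in>J. emeasure (M2 j) (?A2 j))"
      using A1 A2 finIJ prob by (simp add: emeasure_PiM_prob)
    also have "\<dots> = (\<Prod>z\<in>I <+> J. emeasure (case_sum M1 M2 z) (A (g z)))"
      using finIJ by (simp add: prod.Plus)
    also have "\<dots> = (\<Prod>k\<in>K. emeasure (N k) (A k))"
      by (rule prod.reindex_bij_betw[OF h, symmetric, THEN trans], rule prod.cong) (auto simp: gh N)
    finally show "emeasure (distr ?P (Pi\<^sub>M K N) ?m) (Pi\<^sub>E K A) = (\<Prod>k\<in>K. emeasure (N k) (A k))" .
  qed auto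
qed

lemma PiM_singleton:
  assumes "prob_space M0"
  shows "distr M0 (Pi\<^sub>M {i} (\<lambda>_. M0)) (\<lambda>x. \<lambda>k\<in>{i}. x) = Pi\<^sub>M {i} (\<lambda>_. M0)"
proof (rule PiM_eqI_prob)
  fix A assume A: "\<And>k. k \<in> {i} \<Longrightarrow> A k \<in> sets M0"
  have "(\<lambda>x. \<lambda>k\<in>{i}. x) -` (Pi\<^sub>E {i} A) \<inter> space M0 = A i"
    using A[THEN sets.sets_into_space] by (auto simp: PiE_iff)
  then show "emeasure (distr M0 (Pi\<^sub>M {i} (\<lambda>_. M0)) (\<lambda>x. \<lambda>k\<in>{i}. x)) (Pi\<^sub>E {i} A) =
      (\<Prod>k\<in>{i}. emeasure M0 (A k))"
    using A by (subst emeasure_distr) (auto intro!: sets_PiM_I_finite measurable_restrict)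
qed (use assms in auto)

text \<open>Here the first group has one member, and it is represented by its value instead of a
  function on a singleton; this is why \<open>option\<close> replaces the sum type.\<close>

lemma PiM_split_one:
  fixes h :: "'k \<Rightarrow> 'j option"
  assumes K: "finite K" and h: "bij_betw h K (insert None (Some ` J))"
    and prob: "prob_space M0" "\<And>j. j \<in> J \<Longrightarrow> prob_space (M2 j)"
    and N: "\<And>k. k \<in> K \<Longrightarrow> N k = case_option M0 M2 (h k)"
  shows "distr (M0 \<Otimes>\<^sub>M Pi\<^sub>M J M2) (Pi\<^sub>M K N) (\<lambda>(x, y). \<lambda>k\<in>K. case_option x y (h k)) = Pi\<^sub>M K N"
    and "(\<lambda>(x, y). \<lambda>k\<in>K. case_option x y (h k)) \<in> M0 \<Otimes>\<^sub>M Pi\<^sub>M J M2 \<rightarrow>\<^sub>M Pi\<^sub>M K N"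
proof -
  define s :: "'j option \<Rightarrow> unit + 'j" where "s = case_option (Inl ()) Inr"
  have "bij_betw s (insert None (Some ` J)) ({()} <+> J)"
    by (rule bij_betwI[of _ _ _ "case_sum (\<lambda>_. None) Some"]) (auto simp: s_def)
  from bij_betw_trans[OF h this] have bij: "bij_betw (s \<circ> h) K ({()} <+> J)" .
  have N': "N k = case_sum (\<lambda>_. M0) M2 ((s \<circ> h) k)" if "k \<in> K" for k
    using N[OF that] by (auto simp: s_def split: option.split)
  note split = PiM_split[OF K bij prob N', simplified]
  have one [measurable]: "(\<lambda>x. \<lambda>k\<in>{()}. x) \<in> M0 \<rightarrow>\<^sub>M Pi\<^sub>M {()} (\<lambda>_. M0)"
    by (rule measurable_restrict) simp
  have J: "prob_space (Pi\<^sub>M J M2)" by (rule prob_space_PiM) (use prob in auto)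
  have map: "distr (M0 \<Otimes>\<^sub>M Pi\<^sub>M J M2) (Pi\<^sub>M {()} (\<lambda>_. M0) \<Otimes>\<^sub>M Pi\<^sub>M J M2) (\<lambda>(x, y). (\<lambda>k\<in>{()}. x, y))
      = Pi\<^sub>M {()} (\<lambda>_. M0) \<Otimes>\<^sub>M Pi\<^sub>M J M2"
    using distr_map_prod[OF prob(1) J one, of "\<lambda>y. y" "Pi\<^sub>M J M2"] PiM_singleton[OF prob(1),
        of "()"]
    by (simp add: distr_id)
  have comp: "(\<lambda>(x, y). \<lambda>k\<in>K. case_option x y (h k)) =
      (\<lambda>(x, y). \<lambda>k\<in>K. case_sum x y (s (h k))) \<circ> (\<lambda>(x, y). (\<lambda>k\<in>{()}. x, y))"
    by (auto simp: fun_eq_iff s_def split: option.split)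
  show "(\<lambda>(x, y). \<lambda>k\<in>K. case_option x y (h k)) \<in> M0 \<Otimes>\<^sub>M Pi\<^sub>M J M2 \<rightarrow>\<^sub>M Pi\<^sub>M K N"
    unfolding comp by (rule measurable_comp[OF _ split(2)]) auto
  show "distr (M0 \<Otimes>\<^sub>M Pi\<^sub>M J M2) (Pi\<^sub>M K N) (\<lambda>(x, y). \<lambda>k\<in>K. case_option x y (h k)) = Pi\<^sub>M K N"
    unfolding comp by (subst distr_distr[symmetric, OF split(2)]) (auto simp: map split)
qed

section \<open>Random matrices\<close>

lemma space_mat_borel [simp]: "space (mat_borel m n) = carrier_mat m n"
  by (simp add: mat_borel_def)

text \<open>\<open>mat_borel\<close> is pulled back along the map to the entries, so measurability
  can be tested entry by entry. The carrier condition stays because the dimensions belong to the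
  value of a matrix, not to its type.\<close>

lemma measurable_mat_borel_iff:
  "f \<in> M \<rightarrow>\<^sub>M mat_borel m n \<longleftrightarrow>
    (\<forall>x\<in>space M. f x \<in> carrier_mat m n) \<and> (\<forall>i<m. \<forall>j<n. (\<lambda>x. f x $$ (i, j)) \<in> borel_measurable M)"
proof safe
  assume f: "f \<in> M \<rightarrow>\<^sub>M mat_borel m n"
  show "f x \<in> carrier_mat m n" if "x \<in> space M" for x
    using measurable_space[OF f that] by simp
  fix i j assume "i < m" "j < n"
  then have ij: "(i, j) \<in> {..<m} \<times> {..<n}" by auto
  have "(\<lambda>A. \<lambda>ij\<in>{..<m} \<times> {..<n}. A $$ ij) \<in> mat_borel m n \<rightarrow>\<^sub>M (Pi\<^sub>M ({..<m} \<times> {..<n}) (\<lambda>_. borel))"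
    unfolding mat_borel_def by (rule measurable_vimage_algebra1) (auto simp: space_PiM)
  from measurable_compose[OF measurable_compose[OF f this] measurable_component_singleton[OF ij]]
  show "(\<lambda>x. f x $$ (i, j)) \<in> borel_measurable M"
    using ij by simp
next
  assume car: "\<forall>x\<in>space M. f x \<in> carrier_mat m n"
    and ent: "\<forall>i<m. \<forall>j<n. (\<lambda>x. f x $$ (i, j)) \<in> borel_measurable M"
  show "f \<in> M \<rightarrow>\<^sub>M mat_borel m n"
    unfolding mat_borel_def
  proof (rule measurable_vimage_algebra2)
    show "f \<in> space M \<rightarrow> carrier_mat m n" using car by auto
    show "(\<lambda>x. \<lambda>ij\<in>{..<m} \<times> {..<n}. f x $$ ij) \<in> M \<rightarrow>\<^sub>M Pi\<^sub>M ({..<m} \<times> {..<n}) (\<lambda>_. borel)"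
      using ent by (intro measurable_restrict) auto
  qed
qed

lemma measurable_mat_borelI:
  assumes "\<And>x. x \<in> space M \<Longrightarrow> f x \<in> carrier_mat m n"
    and "\<And>i j. i < m \<Longrightarrow> j < n \<Longrightarrow> (\<lambda>x. f x $$ (i, j)) \<in> borel_measurable M"
  shows "f \<in> M \<rightarrow>\<^sub>M mat_borel m n"
  using assms by (simp add: measurable_mat_borel_iff)

lemma measurable_mat_entry:
  "f \<in> M \<rightarrow>\<^sub>M mat_borel m n \<Longrightarrow> i < m \<Longrightarrow> j < n \<Longrightarrow> (\<lambda>x. f x $$ (i, j)) \<in> borel_measurable M"
  by (simp add: measurable_mat_borel_iff)

lemma measurable_mat_carrier:
  "f \<in> M \<rightarrow>\<^sub>M mat_borel m n \<Longrightarrow> x \<in> space M \<Longrightarrow> f x \<in> carrier_mat m n"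
  by (simp add: measurable_mat_borel_iff)

lemma measurable_mat [measurable]:
  "mat m n \<in> Pi\<^sub>M ({..<m} \<times> {..<n}) (\<lambda>_. borel) \<rightarrow>\<^sub>M mat_borel m n"
  by (rule measurable_mat_borelI) (auto intro!: measurable_component_singleton)

section \<open>Random matrices assembled from independent blocks\<close>

definition col_cons :: "'a mat \<Rightarrow> 'a mat \<Rightarrow> 'a mat" where
  "col_cons y Y = mat (dim_row Y) (Suc (dim_col Y))
      (\<lambda>(i, j). if j = 0 then y $$ (i, 0) else Y $$ (i, j - 1))"

definition row_cons :: "'a mat \<Rightarrow> 'a mat \<Rightarrow> 'a mat" where
  "row_cons r Z = mat (Suc (dim_row Z)) (dim_col Z)
      (\<lambda>(i, j). if i = 0 then r $$ (0, j) else Z $$ (i - 1, j))"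

text \<open>Vectors are one-column matrices throughout, so \<open>mat_borel\<close>, matrix products
  and \<open>iid_mat_law\<close> serve for them too. The top entry is a bare scalar: its law is then
  \<nu> itself and not a law on 1 by 1 matrices.\<close>

definition vec_cons :: "'a \<Rightarrow> 'a mat \<Rightarrow> 'a mat" where
  "vec_cons x v = mat (Suc (dim_row v)) 1 (\<lambda>(i, j). if i = 0 then x else v $$ (i - 1, 0))"

lemma col_cons_carrier [simp]: "Y \<in> carrier_mat m n \<Longrightarrow> col_cons y Y \<in> carrier_mat m (Suc n)"
  and row_cons_carrier [simp]: "Y \<in> carrier_mat m n \<Longrightarrow> row_cons y Y \<in> carrier_mat (Suc m) n"
  and vec_cons_carrier [simp]: "v \<in> carrier_mat m k \<Longrightarrow> vec_cons x v \<in> carrier_mat (Suc m) (Suc 0)"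
  by (auto simp: col_cons_def row_cons_def vec_cons_def)

lemma measurable_col_cons:
  "(\<lambda>(y, Y). col_cons y Y) \<in> mat_borel m 1 \<Otimes>\<^sub>M mat_borel m n \<rightarrow>\<^sub>M mat_borel m (Suc n)"
proof (rule measurable_mat_borelI)
  fix i j assume ij: "i < m" "j < Suc n"
  have "(\<lambda>z. if j = 0 then fst z $$ (i, 0) else snd z $$ (i, j - 1)) \<in>
      borel_measurable (mat_borel m 1 \<Otimes>\<^sub>M mat_borel m n)"
    using ij measurable_mat_entry[OF measurable_fst[of "mat_borel m 1" "mat_borel m n"], of i 0]
       measurable_mat_entry[OF measurable_snd[of "mat_borel m 1" "mat_borel m n"], of i "j - 1"]
    by (cases j) auto
  then show "(\<lambda>x. (case x of (y, Y) \<Rightarrow> col_cons y Y) $$ (i, j)) \<in>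
      borel_measurable (mat_borel m 1 \<Otimes>\<^sub>M mat_borel m n)"
    by (rule measurable_cong[THEN iffD1, rotated])
        (use ij in \<open>auto simp: col_cons_def space_pair_measure\<close>)
qed (auto simp: space_pair_measure)

lemma measurable_row_cons:
  "(\<lambda>(y, Y). row_cons y Y) \<in> mat_borel 1 n \<Otimes>\<^sub>M mat_borel m n \<rightarrow>\<^sub>M mat_borel (Suc m) n"
proof (rule measurable_mat_borelI)
  fix i j assume ij: "i < Suc m" "j < n"
  have "(\<lambda>z. if i = 0 then fst z $$ (0, j) else snd z $$ (i - 1, j)) \<in>
      borel_measurable (mat_borel 1 n \<Otimes>\<^sub>M mat_borel m n)"
    using ij measurable_mat_entry[OF measurable_fst[of "mat_borel 1 n" "mat_borel m n"], of 0 j]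
       measurable_mat_entry[OF measurable_snd[of "mat_borel 1 n" "mat_borel m n"], of "i - 1" j]
    by (cases i) auto
  then show "(\<lambda>x. (case x of (y, Y) \<Rightarrow> row_cons y Y) $$ (i, j)) \<in>
      borel_measurable (mat_borel 1 n \<Otimes>\<^sub>M mat_borel m n)"
    by (rule measurable_cong[THEN iffD1, rotated])
        (use ij in \<open>auto simp: row_cons_def space_pair_measure\<close>)
qed (auto simp: space_pair_measure)

lemma measurable_vec_cons:
  "(\<lambda>(y, Y). vec_cons y Y) \<in> borel \<Otimes>\<^sub>M mat_borel m 1 \<rightarrow>\<^sub>M mat_borel (Suc m) 1"
proof (rule measurable_mat_borelI)
  fix i j assume ij: "i < Suc m" "j < (1::nat)"
  have "(\<lambda>z. if i = 0 then fst z else snd z $$ (i - 1, 0)) \<in>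
      borel_measurable (borel \<Otimes>\<^sub>M mat_borel m 1)"
    using ij measurable_mat_entry[OF measurable_snd[of borel "mat_borel m 1"], of "i - 1" 0]
    by (cases i) auto
  then show "(\<lambda>x. (case x of (y, Y) \<Rightarrow> vec_cons y Y) $$ (i, j)) \<in>
      borel_measurable (borel \<Otimes>\<^sub>M mat_borel m 1)"
    by (rule measurable_cong[THEN iffD1, rotated])
        (use ij in \<open>auto simp: vec_cons_def space_pair_measure\<close>)
qed (auto simp: space_pair_measure)

lemma sets_PiM_borel:
  assumes "sets \<nu> = sets borel"
  shows "sets (Pi\<^sub>M K (\<lambda>_. \<nu>)) = sets (Pi\<^sub>M K (\<lambda>_. borel))"
  using assms by (intro sets_PiM_cong) auto

lemma measurable_mat':
  assumes "sets \<nu> = sets borel"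
  shows "mat m n \<in> Pi\<^sub>M ({..<m} \<times> {..<n}) (\<lambda>_. \<nu>) \<rightarrow>\<^sub>M mat_borel m n"
  using measurable_mat measurable_cong_sets[OF sets_PiM_borel[OF assms] refl] by blast

lemma sets_iid_mat_law [simp, measurable_cong]: "sets (iid_mat_law \<nu> m n) = sets (mat_borel m n)"
  by (simp add: iid_mat_law_def)

lemma space_iid_mat_law [simp]: "space (iid_mat_law \<nu> m n) = carrier_mat m n"
  by (simp add: iid_mat_law_def)

lemma prob_space_iid_mat_law:
  assumes "prob_space \<nu>" "sets \<nu> = sets borel"
  shows "prob_space (iid_mat_law \<nu> m n)"
  unfolding iid_mat_law_def using assms
  by (intro prob_space.prob_space_distr prob_space_PiM measurable_mat')

text \<open>The first row and the other rows are disjoint groups of independent coordinates;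
  \<open>h\<close> names the group and lowers the row index in the second one. The column version
  only changes \<open>h\<close>.\<close>

lemma iid_mat_law_row_cons:
  assumes \<nu>: "prob_space \<nu>" "sets \<nu> = sets borel"
  shows "iid_mat_law \<nu> (Suc m) n =
    distr (iid_mat_law \<nu> 1 n \<Otimes>\<^sub>M iid_mat_law \<nu> m n) (mat_borel (Suc m) n) (\<lambda>(r, Z). row_cons r Z)"
proof -
  let ?K = "{..<Suc m} \<times> {..<n}" and ?I = "{..<1::nat} \<times> {..<n}" and ?J = "{..<m} \<times> {..<n}"
  define h where "h = (\<lambda>(i::nat, j::nat). if i = 0 then Inl (0::nat, j) else Inr (i - 1, j))"
  have h: "bij_betw h ?K (?I <+> ?J)"
    by (rule bij_betwI[of _ _ _ "case_sum (\<lambda>(i, j). (i, j)) (\<lambda>(i, j). (Suc i, j))"])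
      (auto simp: h_def split: if_splits)
  note split = PiM_split[OF _ h, of "\<lambda>_. \<nu>" "\<lambda>_. \<nu>" "\<lambda>_. \<nu>"]
  have pr: "prob_space (Pi\<^sub>M ?I (\<lambda>_. \<nu>))" "prob_space (Pi\<^sub>M ?J (\<lambda>_. \<nu>))"
    using \<nu> by (auto intro: prob_space_PiM)
  note [measurable] = measurable_mat'[OF \<nu>(2)]
  have [measurable]: "(\<lambda>(x, y). \<lambda>k\<in>?K. case_sum x y (h k)) \<in>
      Pi\<^sub>M ?I (\<lambda>_. \<nu>) \<Otimes>\<^sub>M Pi\<^sub>M ?J (\<lambda>_. \<nu>) \<rightarrow>\<^sub>M Pi\<^sub>M ?K (\<lambda>_. \<nu>)"
    by (rule split(2)) (use \<nu> in \<open>auto split: sum.split\<close>)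
  have "iid_mat_law \<nu> (Suc m) n =
    distr (distr (Pi\<^sub>M ?I (\<lambda>_. \<nu>) \<Otimes>\<^sub>M Pi\<^sub>M ?J (\<lambda>_. \<nu>)) (Pi\<^sub>M ?K (\<lambda>_. \<nu>))
      (\<lambda>(x, y). \<lambda>k\<in>?K. case_sum x y (h k))) (mat_borel (Suc m) n) (mat (Suc m) n)"
    unfolding iid_mat_law_def by (subst split(1)) (use \<nu> in \<open>auto split: sum.split\<close>)
  also have "\<dots> = distr (Pi\<^sub>M ?I (\<lambda>_. \<nu>) \<Otimes>\<^sub>M Pi\<^sub>M ?J (\<lambda>_. \<nu>)) (mat_borel (Suc m) n)
      (mat (Suc m) n \<circ> (\<lambda>(x, y). \<lambda>k\<in>?K. case_sum x y (h k)))"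
    by (rule distr_distr) measurable
  also have "\<dots> = distr (Pi\<^sub>M ?I (\<lambda>_. \<nu>) \<Otimes>\<^sub>M Pi\<^sub>M ?J (\<lambda>_. \<nu>)) (mat_borel (Suc m) n)
      ((\<lambda>(r, Z). row_cons r Z) \<circ> (\<lambda>(x, y). (mat 1 n x, mat m n y)))"
    by (rule distr_cong) (auto intro!: eq_matI simp: row_cons_def h_def)
  also have "\<dots> = distr (distr (Pi\<^sub>M ?I (\<lambda>_. \<nu>) \<Otimes>\<^sub>M Pi\<^sub>M ?J (\<lambda>_. \<nu>))
      (mat_borel 1 n \<Otimes>\<^sub>M mat_borel m n)
      (\<lambda>(x, y). (mat 1 n x, mat m n y))) (mat_borel (Suc m) n) (\<lambda>(r, Z). row_cons r Z)"
    by (rule distr_distr[symmetric]) (auto intro: measurable_row_cons[unfolded One_nat_def])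
  also have "distr (Pi\<^sub>M ?I (\<lambda>_. \<nu>) \<Otimes>\<^sub>M Pi\<^sub>M ?J (\<lambda>_. \<nu>)) (mat_borel 1 n \<Otimes>\<^sub>M mat_borel m n)
      (\<lambda>(x, y). (mat 1 n x, mat m n y)) = iid_mat_law \<nu> 1 n \<Otimes>\<^sub>M iid_mat_law \<nu> m n"
    unfolding iid_mat_law_def by (rule distr_map_prod[OF pr]) measurable
  finally show ?thesis .
qed

lemma iid_mat_law_col_cons:
  assumes \<nu>: "prob_space \<nu>" "sets \<nu> = sets borel"
  shows "iid_mat_law \<nu> m (Suc n) =
    distr (iid_mat_law \<nu> m 1 \<Otimes>\<^sub>M iid_mat_law \<nu> m n) (mat_borel m (Suc n)) (\<lambda>(y, Y). col_cons y Y)"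
proof -
  let ?K = "{..<m} \<times> {..<Suc n}" and ?I = "{..<m} \<times> {..<1::nat}" and ?J = "{..<m} \<times> {..<n}"
  define h where "h = (\<lambda>(i::nat, j::nat). if j = 0 then Inl (i, 0::nat) else Inr (i, j - 1))"
  have h: "bij_betw h ?K (?I <+> ?J)"
    by (rule bij_betwI[of _ _ _ "case_sum (\<lambda>(i, j). (i, j)) (\<lambda>(i, j). (i, Suc j))"])
      (auto simp: h_def split: if_splits)
  note split = PiM_split[OF _ h, of "\<lambda>_. \<nu>" "\<lambda>_. \<nu>" "\<lambda>_. \<nu>"]
  have pr: "prob_space (Pi\<^sub>M ?I (\<lambda>_. \<nu>))" "prob_space (Pi\<^sub>M ?J (\<lambda>_. \<nu>))"
    using \<nu> by (auto intro: prob_space_PiM)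
  note [measurable] = measurable_mat'[OF \<nu>(2)]
  have [measurable]: "(\<lambda>(x, y). \<lambda>k\<in>?K. case_sum x y (h k)) \<in>
      Pi\<^sub>M ?I (\<lambda>_. \<nu>) \<Otimes>\<^sub>M Pi\<^sub>M ?J (\<lambda>_. \<nu>) \<rightarrow>\<^sub>M Pi\<^sub>M ?K (\<lambda>_. \<nu>)"
    by (rule split(2)) (use \<nu> in \<open>auto split: sum.split\<close>)
  have "iid_mat_law \<nu> m (Suc n) =
    distr (distr (Pi\<^sub>M ?I (\<lambda>_. \<nu>) \<Otimes>\<^sub>M Pi\<^sub>M ?J (\<lambda>_. \<nu>)) (Pi\<^sub>M ?K (\<lambda>_. \<nu>))
      (\<lambda>(x, y). \<lambda>k\<in>?K. case_sum x y (h k))) (mat_borel m (Suc n)) (mat m (Suc n))"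
    unfolding iid_mat_law_def by (subst split(1)) (use \<nu> in \<open>auto split: sum.split\<close>)
  also have "\<dots> = distr (Pi\<^sub>M ?I (\<lambda>_. \<nu>) \<Otimes>\<^sub>M Pi\<^sub>M ?J (\<lambda>_. \<nu>)) (mat_borel m (Suc n))
      (mat m (Suc n) \<circ> (\<lambda>(x, y). \<lambda>k\<in>?K. case_sum x y (h k)))"
    by (rule distr_distr) measurable
  also have "\<dots> = distr (Pi\<^sub>M ?I (\<lambda>_. \<nu>) \<Otimes>\<^sub>M Pi\<^sub>M ?J (\<lambda>_. \<nu>)) (mat_borel m (Suc n))
      ((\<lambda>(r, Z). col_cons r Z) \<circ> (\<lambda>(x, y). (mat m 1 x, mat m n y)))"
    by (rule distr_cong) (auto intro!: eq_matI simp: col_cons_def h_def)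
  also have "\<dots> = distr (distr (Pi\<^sub>M ?I (\<lambda>_. \<nu>) \<Otimes>\<^sub>M Pi\<^sub>M ?J (\<lambda>_. \<nu>))
      (mat_borel m 1 \<Otimes>\<^sub>M mat_borel m n)
      (\<lambda>(x, y). (mat m 1 x, mat m n y))) (mat_borel m (Suc n)) (\<lambda>(r, Z). col_cons r Z)"
    by (rule distr_distr[symmetric]) (auto intro: measurable_col_cons[unfolded One_nat_def])
  also have "distr (Pi\<^sub>M ?I (\<lambda>_. \<nu>) \<Otimes>\<^sub>M Pi\<^sub>M ?J (\<lambda>_. \<nu>)) (mat_borel m 1 \<Otimes>\<^sub>M mat_borel m n)
      (\<lambda>(x, y). (mat m 1 x, mat m n y)) = iid_mat_law \<nu> m 1 \<Otimes>\<^sub>M iid_mat_law \<nu> m n"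
    unfolding iid_mat_law_def by (rule distr_map_prod[OF pr]) measurable
  finally show ?thesis .
qed

lemma iid_mat_law_vec_cons:
  assumes \<nu>: "prob_space \<nu>" "sets \<nu> = sets borel"
  shows "iid_mat_law \<nu> (Suc m) 1 =
    distr (\<nu> \<Otimes>\<^sub>M iid_mat_law \<nu> m 1) (mat_borel (Suc m) 1) (\<lambda>(x, v). vec_cons x v)"
proof -
  let ?K = "{..<Suc m} \<times> {..<1::nat}" and ?J = "{..<m} \<times> {..<1::nat}"
  define h where "h = (\<lambda>(i::nat, j::nat). if i = 0 then None else Some (i - 1, j))"
  have h: "bij_betw h ?K (insert None (Some ` ?J))"
    by (rule bij_betwI[of _ _ _ "case_option (0, 0) (\<lambda>(i, j). (Suc i, j))"])
      (auto simp: h_def image_iff split: if_splits)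
  note split = PiM_split_one[OF _ h, of \<nu> "\<lambda>_. \<nu>" "\<lambda>_. \<nu>"]
  have pr: "prob_space (Pi\<^sub>M ?J (\<lambda>_. \<nu>))"
    using \<nu> by (auto intro: prob_space_PiM)
  note [measurable] = measurable_mat'[OF \<nu>(2)]
  note [measurable_cong] = \<nu>(2)
  have [measurable]: "(\<lambda>(x, y). \<lambda>k\<in>?K. case_option x y (h k)) \<in>
      \<nu> \<Otimes>\<^sub>M Pi\<^sub>M ?J (\<lambda>_. \<nu>) \<rightarrow>\<^sub>M Pi\<^sub>M ?K (\<lambda>_. \<nu>)"
    by (rule split(2)) (use \<nu> in \<open>auto split: option.split\<close>)
  have "iid_mat_law \<nu> (Suc m) 1 =
    distr (distr (\<nu> \<Otimes>\<^sub>M Pi\<^sub>M ?J (\<lambda>_. \<nu>)) (Pi\<^sub>M ?K (\<lambda>_. \<nu>))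
      (\<lambda>(x, y). \<lambda>k\<in>?K. case_option x y (h k))) (mat_borel (Suc m) 1) (mat (Suc m) 1)"
    unfolding iid_mat_law_def by (subst split(1)) (use \<nu> in \<open>auto split: option.split\<close>)
  also have "\<dots> = distr (\<nu> \<Otimes>\<^sub>M Pi\<^sub>M ?J (\<lambda>_. \<nu>)) (mat_borel (Suc m) 1)
      (mat (Suc m) 1 \<circ> (\<lambda>(x, y). \<lambda>k\<in>?K. case_option x y (h k)))"
    by (rule distr_distr) measurable
  also have "\<dots> = distr (\<nu> \<Otimes>\<^sub>M Pi\<^sub>M ?J (\<lambda>_. \<nu>)) (mat_borel (Suc m) 1)
      ((\<lambda>(r, Z). vec_cons r Z) \<circ> (\<lambda>(x, y). (x, mat m 1 y)))"
    by (rule distr_cong) (auto intro!: eq_matI simp: vec_cons_def h_def)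
  also have "\<dots> = distr (distr (\<nu> \<Otimes>\<^sub>M Pi\<^sub>M ?J (\<lambda>_. \<nu>)) (borel \<Otimes>\<^sub>M mat_borel m 1)
      (\<lambda>(x, y). (x, mat m 1 y))) (mat_borel (Suc m) 1) (\<lambda>(r, Z). vec_cons r Z)"
    by (rule distr_distr[symmetric]) (auto intro: measurable_vec_cons[unfolded One_nat_def])
  also have "distr (\<nu> \<Otimes>\<^sub>M Pi\<^sub>M ?J (\<lambda>_. \<nu>)) (borel \<Otimes>\<^sub>M mat_borel m 1)
      (\<lambda>(x, y). (x, mat m 1 y)) = \<nu> \<Otimes>\<^sub>M iid_mat_law \<nu> m 1"
  proof -
    have "distr \<nu> borel (\<lambda>x. x) = \<nu>" using \<nu>(2) by (intro distr_id2) auto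
    with distr_map_prod[OF \<nu>(1) pr, of "\<lambda>x. x" borel "mat m 1" "mat_borel m 1"]
    show ?thesis by (simp add: iid_mat_law_def)
  qed
  finally show ?thesis .
qed

section \<open>Hermitian scalars\<close>

text \<open>The common ground of real, complex and quaternion scalars. Conjugation is given as
  reflection in the real axis, from which additivity and measurability are immediate. The only link
  between norm and product is the last equation, and the product is not assumed to commute.\<close>

locale hermitian_scalars =
  fixes \<nu> :: "'a :: {real_algebra_1, euclidean_space, conjugate} measure"
  assumes \<nu>_density: "\<nu> = density lborel (\<lambda>x. \<Prod>b\<in>Basis. ennreal (normal_density 0 1 (inner x b)))"
    and one_Basis: "(1 :: 'a) \<in> Basis"
    and conj_eq: "conjugate (x :: 'a) = of_real (2 * inner x 1) - x"
    and conj_mult: "conjugate (x * y :: 'a) = conjugate y * conjugate x"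
    and conj_mult_self: "conjugate x * (x :: 'a) = of_real ((norm x)\<^sup>2)"
begin

lemma of_real_commute: "x * of_real r = of_real r * (x :: 'a)"
  by (simp add: of_real_def)

lemma conj_add: "conjugate (x + y :: 'a) = conjugate x + conjugate y"
  by (simp add: conj_eq inner_add_left algebra_simps)

lemma conj_minus: "conjugate (- x :: 'a) = - conjugate x"
  by (simp add: conj_eq)

lemma inner_one [simp]: "inner (1 :: 'a) 1 = 1"
  using one_Basis by (simp add: inner_same_Basis)

lemma norm_one [simp]: "norm (1 :: 'a) = 1"
  using one_Basis by simp

lemma of_real_inner_one [simp]: "inner (of_real r :: 'a) 1 = r"
  by (simp add: of_real_def)

lemma norm_of_real' [simp]: "norm (of_real r :: 'a) = \<bar>r\<bar>"
  by (simp add: of_real_def)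

lemma conj_of_real [simp]: "conjugate (of_real r :: 'a) = of_real r"
  by (simp only: conj_eq of_real_inner_one flip: of_real_diff) simp

lemma conj_zero [simp]: "conjugate (0 :: 'a) = 0"
  using conj_of_real[of 0] by (simp del: conj_of_real)

lemma conj_one [simp]: "conjugate (1 :: 'a) = 1"
  using conj_of_real[of 1] by (simp del: conj_of_real)

lemma conj_scaleR: "conjugate (r *\<^sub>R x :: 'a) = r *\<^sub>R conjugate x"
  by (simp add: conj_eq of_real_def scaleR_diff_right mult.left_commute)

lemma conj_sum: "conjugate (\<Sum>i\<in>I. f i :: 'a) = (\<Sum>i\<in>I. conjugate (f i))"
  by (induction I rule: infinite_finite_induct) (auto simp: conj_add)

text \<open>The square of the norm of \<open>x * y\<close> is conj y (conj x x) y, and the inner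
  factor is real, hence can be moved to the front.\<close>

lemma norm_mult': "norm (x * y :: 'a) = norm x * norm y"
proof -
  have "of_real ((norm (x * y))\<^sup>2) = conjugate (x * y) * (x * y)"
    by (simp only: conj_mult_self)
  also have "\<dots> = conjugate y * (conjugate x * x) * y"
    by (simp only: conj_mult mult.assoc)
  also have "\<dots> = of_real ((norm x)\<^sup>2) * (conjugate y * y)"
    by (metis conj_mult_self of_real_commute mult.assoc)
  also have "\<dots> = of_real ((norm x * norm y)\<^sup>2)"
    by (simp only: conj_mult_self of_real_mult power_mult_distrib)
  finally have "(norm (x * y))\<^sup>2 = (norm x * norm y)\<^sup>2"
    by (simp only: of_real_eq_iff)
  then show ?thesis by (simp add: power2_eq_iff_nonneg)
qed

text \<open>The opposite order is not an axiom. The difference of both sides is annihilated by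
  \<open>x\<close> from the right, and multiplicativity of the norm excludes zero divisors.\<close>

lemma mult_conj_self: "x * conjugate (x :: 'a) = of_real ((norm x)\<^sup>2)"
proof (cases "x = 0")
  case False
  have "x * conjugate x * x = x * of_real ((norm x)\<^sup>2)"
    by (simp only: mult.assoc conj_mult_self)
  then have "(x * conjugate x - of_real ((norm x)\<^sup>2)) * x = 0"
    by (simp only: left_diff_distrib of_real_commute[of x]) simp
  then have "norm (x * conjugate x - of_real ((norm x)\<^sup>2)) * norm x = 0"
    by (simp only: norm_mult'[symmetric] norm_zero)
  with False show ?thesis by simp
qed simp

lemma norm_conj [simp]: "norm (conjugate x :: 'a) = norm x"
proof -
  have "of_real ((norm (conjugate x))\<^sup>2) = (of_real ((norm x)\<^sup>2) :: 'a)"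
    by (metis conj_mult_self mult_conj_self conjugate_id)
  then have "(norm (conjugate x))\<^sup>2 = (norm x)\<^sup>2"
    by (simp only: of_real_eq_iff)
  then show ?thesis by (simp add: power2_eq_iff_nonneg)
qed

text \<open>\<open>real_algebra_1\<close> and \<open>euclidean_space\<close> are unrelated classes,
  so the continuity of the product, and with it its measurability, has to come from
  \<open>norm_mult'\<close>.\<close>

lemma bounded_bilinear_mult': "bounded_bilinear (\<lambda>x y :: 'a. x * y)"
  by (rule bounded_bilinear.intro)
    (auto simp: algebra_simps norm_mult' intro!: exI[of _ 1])

lemma borel_measurable_mult' [measurable (raw)]:
  fixes f g :: "'b \<Rightarrow> 'a"
  assumes "f \<in> borel_measurable M" "g \<in> borel_measurable M"
  shows "(\<lambda>x. f x * g x) \<in> borel_measurable M"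
  by (rule borel_measurable_continuous_Pair[OF assms])
    (intro bounded_bilinear.continuous_on[OF bounded_bilinear_mult'] continuous_intros)

lemma borel_measurable_of_real' [measurable (raw)]:
  assumes "f \<in> borel_measurable M"
  shows "(\<lambda>x. of_real (f x) :: 'a) \<in> borel_measurable M"
  unfolding of_real_def using assms by simp

lemma borel_measurable_conj [measurable (raw)]:
  assumes [measurable]: "f \<in> borel_measurable M"
  shows "(\<lambda>x. conjugate (f x :: 'a)) \<in> borel_measurable M"
  unfolding conj_eq by measurable

end

section \<open>Unitary matrices\<close>

lemma conj_transpose_carrier [simp]:
  "A \<in> carrier_mat m n \<Longrightarrow> conj_transpose A \<in> carrier_mat n m"
  by (auto simp: conj_transpose_def)

lemma conj_transpose_index [simp]:
  "i < dim_col A \<Longrightarrow> j < dim_row A \<Longrightarrow> conj_transpose A $$ (i, j) = conjugate (A $$ (j, i))"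
  by (simp add: conj_transpose_def)

lemma conj_transpose_dim [simp]:
  "dim_row (conj_transpose A) = dim_col A" "dim_col (conj_transpose A) = dim_row A"
  by (auto simp: conj_transpose_def)

lemma conj_transpose_conj_transpose [simp]: "conj_transpose (conj_transpose A) = A"
  by (rule eq_matI) auto

lemma index_mult_mat_sum:
  "A \<in> carrier_mat m k \<Longrightarrow> B \<in> carrier_mat k n \<Longrightarrow> i < m \<Longrightarrow> j < n \<Longrightarrow>
    (A * B) $$ (i, j) = (\<Sum>l<k. A $$ (i, l) * B $$ (l, j))"
  by (auto simp: scalar_prod_def lessThan_atLeast0)

lemma mult_carrier_square [simp]:
  "A \<in> carrier_mat n n \<Longrightarrow> B \<in> carrier_mat n n \<Longrightarrow> A * B \<in> carrier_mat n n"
  by (rule mult_carrier_mat)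

definition sub_col :: "'a mat \<Rightarrow> 'a mat" where
  "sub_col A = mat (dim_row A - 1) 1 (\<lambda>(i, j). A $$ (Suc i, 0))"

definition sub_mat :: "'a mat \<Rightarrow> 'a mat" where
  "sub_mat A = mat (dim_row A - 1) (dim_col A - 1) (\<lambda>(i, j). A $$ (Suc i, Suc j))"

definition scalar_mat :: "'a \<Rightarrow> 'a mat" where
  "scalar_mat x = mat 1 1 (\<lambda>_. x)"

definition unit_col :: "nat \<Rightarrow> 'a :: zero_neq_one mat" where
  "unit_col n = mat n 1 (\<lambda>(i, j). if i = 0 then 1 else 0)"

lemma sub_col_carrier [simp]: "A \<in> carrier_mat (Suc m) n \<Longrightarrow> sub_col A \<in> carrier_mat m (Suc 0)"
  and sub_mat_carrier [simp]: "A \<in> carrier_mat (Suc m) (Suc n) \<Longrightarrow> sub_mat A \<in> carrier_mat m n"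
  and scalar_mat_carrier [simp]: "scalar_mat x \<in> carrier_mat (Suc 0) (Suc 0)"
  and unit_col_carrier [simp]: "unit_col n \<in> carrier_mat n (Suc 0)"
  by (auto simp: sub_col_def sub_mat_def scalar_mat_def unit_col_def)

lemma vec_cons_sub_col: "v \<in> carrier_mat (Suc n) 1 \<Longrightarrow> vec_cons (v $$ (0, 0)) (sub_col v) = v"
  by (rule eq_matI) (auto simp: sub_col_def vec_cons_def)

lemma vec_cons_index [simp]: "vec_cons x v $$ (0, 0) = x"
  by (simp add: vec_cons_def)

definition one_block :: "'a :: zero_neq_one mat \<Rightarrow> 'a mat" where
  "one_block F = four_block_mat (scalar_mat 1) (0\<^sub>m 1 (dim_col F)) (0\<^sub>m (dim_row F) 1) F"

lemma one_block_carrier [simp]: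
  "F \<in> carrier_mat m n \<Longrightarrow> one_block F \<in> carrier_mat (Suc m) (Suc n)"
  by (auto simp: one_block_def scalar_mat_def)

lemma one_block_one [simp]: "one_block (1\<^sub>m n) = 1\<^sub>m (Suc n)"
  by (rule eq_matI) (auto simp: one_block_def scalar_mat_def)

definition two_block :: "nat \<Rightarrow> 'a \<Rightarrow> 'a \<Rightarrow> 'a \<Rightarrow> 'a \<Rightarrow> 'a :: zero_neq_one mat" where
  "two_block n a b c d = mat (Suc (Suc n)) (Suc (Suc n)) (\<lambda>(i, j).
    if i = 0 then (if j = 0 then a else if j = 1 then b else 0)
    else if i = 1 then (if j = 0 then c else if j = 1 then d else 0)
    else if i = j then 1 else 0)"

lemma two_block_carrier [simp]: "two_block n a b c d \<in> carrier_mat (Suc (Suc n)) (Suc (Suc n))"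
  by (simp add: two_block_def)

lemma two_block_one: "two_block n 1 0 0 1 = 1\<^sub>m (Suc (Suc n))"
  by (rule eq_matI) (auto simp: two_block_def)

lemma two_block_mult:
  fixes Y :: "'a :: ring_1 mat"
  assumes Y: "Y \<in> carrier_mat (Suc (Suc n)) k"
  shows "two_block n a b c d * Y = mat (Suc (Suc n)) k (\<lambda>(i, j).
    if i = 0 then a * Y $$ (0, j) + b * Y $$ (1, j)
    else if i = 1 then c * Y $$ (0, j) + d * Y $$ (1, j)
    else Y $$ (i, j))"
proof (rule eq_matI)
  fix i j assume ij: "i < dim_row (mat (Suc (Suc n)) k (\<lambda>(i, j).
    if i = 0 then a * Y $$ (0, j) + b * Y $$ (1, j)
    else if i = 1 then c * Y $$ (0, j) + d * Y $$ (1, j)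
    else Y $$ (i, j)))" "j < dim_col (mat (Suc (Suc n)) k (\<lambda>(i, j).
    if i = 0 then a * Y $$ (0, j) + b * Y $$ (1, j)
    else if i = 1 then c * Y $$ (0, j) + d * Y $$ (1, j)
    else Y $$ (i, j)))"
  have "(two_block n a b c d * Y) $$ (i, j) =
      two_block n a b c d $$ (i, 0) * Y $$ (0, j) + (two_block n a b c d $$ (i, 1) * Y $$ (1, j)
      + (\<Sum>l<n. two_block n a b c d $$ (i, Suc (Suc l)) * Y $$ (Suc (Suc l), j)))"
    using ij by (subst index_mult_mat_sum[OF two_block_carrier Y])
      (auto simp only: sum.lessThan_Suc_shift One_nat_def, auto)
  \<comment> \<open>Beyond the first two columns \<open>two_block\<close> is the identity, so at
    most the term \<open>l = i - 2\<close> survives.\<close>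
  also have "(\<Sum>l<n. two_block n a b c d $$ (i, Suc (Suc l)) * Y $$ (Suc (Suc l), j)) =
      (\<Sum>l<n. if l = i - 2 then (if 2 \<le> i then Y $$ (i, j) else 0) else 0)"
    using ij by (intro sum.cong) (auto simp: two_block_def)
  also have "\<dots> = (if 2 \<le> i then Y $$ (i, j) else 0)"
    using ij by (auto simp: sum.delta)
  finally show "(two_block n a b c d * Y) $$ (i, j) = mat (Suc (Suc n)) k (\<lambda>(i, j).
    if i = 0 then a * Y $$ (0, j) + b * Y $$ (1, j)
    else if i = 1 then c * Y $$ (0, j) + d * Y $$ (1, j)
    else Y $$ (i, j)) $$ (i, j)"
    using ij by (auto simp: two_block_def)
qed (use Y in \<open>auto simp: two_block_def\<close>)

lemma two_block_mult_two_block: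
  fixes a :: "'a :: ring_1"
  shows "two_block n a b c d * two_block n a' b' c' d' =
    two_block n (a * a' + b * c') (a * b' + b * d') (c * a' + d * c') (c * b' + d * d')"
  by (rule eq_matI) (subst two_block_mult[OF two_block_carrier], auto simp: two_block_def)+

lemma one_block_mult:
  fixes F :: "'a :: ring_1 mat"
  assumes "F \<in> carrier_mat m n" "G \<in> carrier_mat n k"
  shows "one_block F * one_block G = one_block (F * G)"
  using assms unfolding one_block_def
  by (subst mult_four_block_mat[where ?nr1.0 = 1 and ?n1.0 = 1 and ?n2.0 = n and ?nr2.0 =
      m and ?nc1.0 = 1 and ?nc2.0 = k])
    (auto simp: scalar_mat_def scalar_prod_def intro!:
        arg_cong2[where f = "\<lambda>A D. four_block_mat A _ _ D"])

lemma one_block_mult_vec_cons: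
  fixes F :: "'a :: ring_1 mat"
  assumes F: "F \<in> carrier_mat m n" and v: "v \<in> carrier_mat n 1"
  shows "one_block F * vec_cons x v = vec_cons x (F * v)"
proof (rule eq_matI)
  fix i j assume ij: "i < dim_row (vec_cons x (F * v))" "j < dim_col (vec_cons x (F * v))"
  have "(one_block F * vec_cons x v) $$ (i, j) =
      one_block F $$ (i, 0) * x + (\<Sum>l<n. one_block F $$ (i, Suc l) * v $$ (l, 0))"
    using ij F v by (subst index_mult_mat_sum[OF one_block_carrier[OF F], of _ 1])
      (auto simp: sum.lessThan_Suc_shift vec_cons_def simp del: sum.lessThan_Suc)
  also have "\<dots> = vec_cons x (F * v) $$ (i, j)"
  proof (cases i)
    case 0
    then show ?thesis using F v ij by (auto simp: one_block_def scalar_mat_def vec_cons_def)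
  next
    case (Suc l)
    then show ?thesis using F v ij index_mult_mat_sum[OF F v, of l 0]
      by (auto simp: one_block_def scalar_mat_def vec_cons_def)
  qed
  finally show "(one_block F * vec_cons x v) $$ (i, j) = vec_cons x (F * v) $$ (i, j)" .
qed (use F v in \<open>auto simp: vec_cons_def one_block_def scalar_mat_def\<close>)

lemma four_block_decompose:
  assumes "A \<in> carrier_mat (Suc m) (Suc n)"
  shows "A = four_block_mat (scalar_mat (A $$ (0, 0))) (mat 1 n (\<lambda>(i, j). A $$ (0, Suc j)))
      (sub_col A) (sub_mat A)"
  by (rule eq_matI) (use assms in \<open>auto simp: scalar_mat_def sub_col_def sub_mat_def\<close>)

lemma scalar_mat_one: "scalar_mat 1 = 1\<^sub>m 1"
  by (rule eq_matI) (auto simp: scalar_mat_def)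

lemma one_block_mult_four_block:
  fixes G :: "'a :: ring_1 mat"
  assumes "G \<in> carrier_mat n n" "A \<in> carrier_mat 1 1" "B \<in> carrier_mat 1 n" "C \<in> carrier_mat n 1"
      "D \<in> carrier_mat n n"
  shows "one_block G * four_block_mat A B C D = four_block_mat A B (G * C) (G * D)"
    and "four_block_mat A B C D * one_block G = four_block_mat A (B * G) C (D * G)"
proof -
  have G: "one_block G = four_block_mat (1\<^sub>m 1) (0\<^sub>m 1 n) (0\<^sub>m n 1) G"
    using assms by (simp add: one_block_def scalar_mat_one)
  have one: "1\<^sub>m 1 \<in> carrier_mat 1 1" "0\<^sub>m 1 n \<in> carrier_mat 1 n" "0\<^sub>m n 1 \<in> carrier_mat n 1"
    by auto
  show "one_block G * four_block_mat A B C D = four_block_mat A B (G * C) (G * D)"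
    unfolding G mult_four_block_mat[OF one assms(1) assms(2-5)]
    using assms by (simp add: left_mult_one_mat[of _ 1 1] left_mult_one_mat[of _ 1 n]
        left_mult_zero_mat[of _ n 1]
        left_mult_zero_mat[of _ n n] left_mult_zero_mat[of _ 1 1] left_mult_zero_mat[of _ 1 n]
            right_add_zero_mat[of _ 1 1]
        right_add_zero_mat[of _ 1 n] left_add_zero_mat[of _ n 1] left_add_zero_mat[of _ n n]
            mult_carrier_mat[of _ n n _ 1] del: One_nat_def)
  show "four_block_mat A B C D * one_block G = four_block_mat A (B * G) C (D * G)"
    unfolding G mult_four_block_mat[OF assms(2-5) one assms(1)]
    using assms by (simp add: right_mult_one_mat[of _ 1 1] right_mult_one_mat[of _ n 1]
        right_mult_zero_mat[of _ 1 n]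
        right_mult_zero_mat[of _ n n] right_mult_zero_mat[of _ 1 1] right_mult_zero_mat[of _ n 1]
            right_add_zero_mat[of _ 1 1]
        right_add_zero_mat[of _ n 1] left_add_zero_mat[of _ 1 n] left_add_zero_mat[of _ n n]
            mult_carrier_mat[of _ 1 n _ n] del: One_nat_def)
qed

lemma carrier_mat_one: "unit_col n \<in> carrier_mat n 1"
  by simp

lemma smult_unit_col_carrier [simp]: "c \<cdot>\<^sub>m unit_col n \<in> carrier_mat n (Suc 0)"
  by simp

lemma one_block_unit_col:
  fixes F :: "'a :: ring_1 mat"
  assumes "F \<in> carrier_mat n n"
  shows "one_block F * unit_col (Suc n) = unit_col (Suc n)"
proof -
  have "unit_col (Suc n) = vec_cons 1 (0\<^sub>m n 1 :: 'a mat)"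
    by (rule eq_matI) (auto simp: unit_col_def vec_cons_def)
  then show ?thesis using assms by (simp add: one_block_mult_vec_cons right_mult_zero_mat[of _ n n])
qed

lemma vec_cons_smult_unit_col:
  "vec_cons x (c \<cdot>\<^sub>m unit_col (Suc n)) = mat (Suc (Suc n)) 1 (\<lambda>(i, j). if i = 0 then x else if i =
      1 then c else 0 :: 'a :: ring_1)"
  by (rule eq_matI) (auto simp: vec_cons_def unit_col_def)

lemma hs_norm_nonneg [simp]: "0 \<le> hs_norm A"
  by (simp add: hs_norm_def sum_nonneg)

lemma hs_norm_vec_cons:
  assumes "v \<in> carrier_mat n 1"
  shows "(hs_norm (vec_cons x v))\<^sup>2 = (norm x)\<^sup>2 + (hs_norm v)\<^sup>2"
  using assms by (simp add: hs_norm_def sum_nonneg vec_cons_def sum.lessThan_Suc_shift del: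
      sum.lessThan_Suc)

context hermitian_scalars
begin

lemma conj_transpose_mult:
  fixes A B :: "'a mat"
  assumes "A \<in> carrier_mat m k" "B \<in> carrier_mat k n"
  shows "conj_transpose (A * B) = conj_transpose B * conj_transpose A"
  by (rule eq_matI) (use assms in \<open>auto simp: scalar_prod_def conj_sum conj_mult\<close>)

lemma conj_transpose_one [simp]: "conj_transpose (1\<^sub>m n :: 'a mat) = 1\<^sub>m n"
  by (rule eq_matI) auto

lemma conj_transpose_one_block:
  "conj_transpose (one_block (F :: 'a mat)) = one_block (conj_transpose F)"
  by (rule eq_matI) (auto simp: one_block_def scalar_mat_def)

lemma conj_transpose_two_block:
  "conj_transpose (two_block n a b c (d :: 'a)) =
    two_block n (conjugate a) (conjugate c) (conjugate b) (conjugate d)"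
  by (rule eq_matI) (auto simp: two_block_def)

lemma unitary_carrier: "unitary n (U :: 'a mat) \<Longrightarrow> U \<in> carrier_mat n n"
  by (simp add: unitary_def)

lemma unitary_one: "unitary n (1\<^sub>m n :: 'a mat)"
  by (simp add: unitary_def)

lemma unitary_mult:
  assumes "unitary n (U :: 'a mat)" "unitary n V"
  shows "unitary n (U * V)"
proof -
  have [simp]: "U \<in> carrier_mat n n" "V \<in> carrier_mat n n"
    using assms by (auto simp: unitary_def)
  have "conj_transpose (U * V) * (U * V) = conj_transpose V * (conj_transpose U * U) * V"
    by (simp add: conj_transpose_mult[of _ n n _ n] assoc_mult_mat[of _ n n _ n _ n])
  also have "\<dots> = 1\<^sub>m n"
    using assms by (simp add: unitary_def right_mult_one_mat[of _ n n])
  finally have 1: "conj_transpose (U * V) * (U * V) = 1\<^sub>m n" .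
  have "(U * V) * conj_transpose (U * V) = U * (V * conj_transpose V) * conj_transpose U"
    by (simp add: conj_transpose_mult[of _ n n _ n] assoc_mult_mat[of _ n n _ n _ n])
  also have "\<dots> = 1\<^sub>m n"
    using assms by (simp add: unitary_def right_mult_one_mat[of _ n n])
  finally show ?thesis using 1 by (simp add: unitary_def)
qed

lemma unitary_one_block: "unitary n (U :: 'a mat) \<Longrightarrow> unitary (Suc n) (one_block U)"
  by (auto simp: unitary_def conj_transpose_one_block one_block_mult[of _ n n _ n])

text \<open>The off-diagonal entries are real and thus commute with \<open>q\<close>; for this
  reason the off-diagonal entries of both products cancel even over the quaternions.\<close>

lemma unitary_two_block:
  assumes "(norm (q :: 'a))\<^sup>2 + p\<^sup>2 = 1"
  shows "unitary (Suc (Suc n)) (two_block n (conjugate q) (of_real p) (- of_real p) q)"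
proof -
  have eq: "of_real ((norm q)\<^sup>2) + of_real (p * p) = (1 :: 'a)"
    using arg_cong[OF assms, of "of_real :: real \<Rightarrow> 'a"] by (simp add: power2_eq_square)
  then have eq': "of_real (p * p) + of_real ((norm q)\<^sup>2) = (1 :: 'a)"
    by (simp add: add.commute)
  show ?thesis
    unfolding unitary_def
    by (auto simp: conj_transpose_two_block two_block_mult_two_block conj_minus conj_mult_self
        mult_conj_self of_real_commute[of q] of_real_commute[of "conjugate q"] two_block_one eq eq'
            simp del: of_real_power of_real_mult simp flip: of_real_mult)
qed

end

section \<open>Aligning a vector with the first coordinate axis\<close>

text \<open>The value 1 at 0 keeps the norm equal to 1 everywhere, so that \<open>align\<close> is
  unitary also for the zero vector.\<close>

definition scalar_phase :: "'a :: {real_normed_vector, one} \<Rightarrow> 'a" where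
  "scalar_phase z = (if z = 0 then 1 else z /\<^sub>R norm z)"

text \<open>A product of rotations of two adjacent coordinates and one phase that sends \<open>w\<close> to
  \<open>hs_norm w\<close> times the first unit vector. Unlike for a general unitary matrix, invariance of the
  Gaussian law under each of these factors is elementary, also over the quaternions.\<close>

fun align :: "nat \<Rightarrow> 'a :: {real_algebra_1, euclidean_space, conjugate} mat \<Rightarrow> 'a mat" where
  "align 0 w = 1\<^sub>m 0"
| "align (Suc 0) w = scalar_mat (conjugate (scalar_phase (w $$ (0, 0))))"
| "align (Suc (Suc n)) w =
    (let q = (if hs_norm w = 0 then 1 else w $$ (0, 0) /\<^sub>R hs_norm w);
         p = hs_norm (sub_col w) / hs_norm w
     in two_block n (conjugate q) (of_real p) (- of_real p) q * one_block
         (align (Suc n) (sub_col w)))"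

context hermitian_scalars
begin

lemma norm_scalar_phase: "norm (scalar_phase z :: 'a) = 1"
  by (simp add: scalar_phase_def)

lemma unitary_scalar_mat: "norm (q :: 'a) = 1 \<Longrightarrow> unitary (Suc 0) (scalar_mat q)"
  unfolding unitary_def
  by (auto intro!: eq_matI simp: scalar_mat_def scalar_prod_def conj_mult_self mult_conj_self)

text \<open>For \<open>w \<noteq> 0\<close> this is Pythagoras for the top entry and the rest. For
  \<open>w = 0\<close> the default \<open>q = 1\<close> and the quotient \<open>p = 0\<close>
  (division by zero) still satisfy it.\<close>

lemma align_rotation:
  assumes w: "w \<in> carrier_mat (Suc (Suc n)) 1"
  shows "(norm (if hs_norm w = 0 then 1 else w $$ (0, 0) /\<^sub>R hs_norm w :: 'a))\<^sup>2
    + (hs_norm (sub_col w) / hs_norm w)\<^sup>2 = 1"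
proof -
  have eq: "(hs_norm w)\<^sup>2 = (norm (w $$ (0, 0)))\<^sup>2 + (hs_norm (sub_col w))\<^sup>2"
    using hs_norm_vec_cons[of "sub_col w" "Suc n" "w $$ (0, 0)"] vec_cons_sub_col[OF w] w by simp
  show ?thesis
  proof (cases "hs_norm w = 0")
    case False
    then have "(norm (if hs_norm w = 0 then 1 else w $$ (0, 0) /\<^sub>R hs_norm w))\<^sup>2
      + (hs_norm (sub_col w) / hs_norm w)\<^sup>2 = ((norm (w $$ (0, 0)))\<^sup>2 + (hs_norm (sub_col w))\<^sup>2) /
          (hs_norm w)\<^sup>2"
      by (simp add: power_mult_distrib power_divide distrib_right divide_inverse power_inverse)
    with False show ?thesis by (simp flip: eq)
  qed simp
qed

lemma unitary_align: "w \<in> carrier_mat n 1 \<Longrightarrow> unitary n (align n (w :: 'a mat))"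
proof (induction n w rule: align.induct)
  case (3 n w)
  show ?case
    unfolding align.simps Let_def
    using 3 by (intro unitary_mult unitary_one_block unitary_two_block align_rotation) auto
qed (auto intro: unitary_one unitary_scalar_mat simp: norm_scalar_phase)

lemma align_carrier [simp]: "w \<in> carrier_mat n (Suc 0) \<Longrightarrow> align n (w :: 'a mat) \<in> carrier_mat n n"
  using unitary_align[of w n] unitary_carrier[of n] by simp

text \<open>Induction from the bottom up: once the tail is rotated onto its own first entry, which
  becomes its norm, a rotation in the first two coordinates merges the top entry with that norm. Its
  coefficients are these two numbers divided by the norm of \<open>w\<close>, so the second
  coordinate cancels and the first becomes the norm.\<close>

lemma align_mult: "w \<in> carrier_mat n 1 \<Longrightarrow> align n (w :: 'a mat) * w =
    of_real (hs_norm w) \<cdot>\<^sub>m unit_col n"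
proof (induction n w rule: align.induct)
  case (1 w)
  then show ?case by (auto intro!: eq_matI simp: unit_col_def)
next
  case (2 w)
  then show ?case
    by (auto intro!: eq_matI simp: scalar_mat_def scalar_prod_def unit_col_def hs_norm_def
        scalar_phase_def
        conj_scaleR conj_mult_self power2_eq_square of_real_def)
next
  case (3 n w)
  let ?z = "w $$ (0, 0)" and ?v = "sub_col w" and ?s = "hs_norm w"
  define q where "q = (if ?s = 0 then 1 else ?z /\<^sub>R ?s)"
  define p where "p = hs_norm ?v / ?s"
  have w: "w \<in> carrier_mat (Suc (Suc n)) 1" by fact
  have v: "?v \<in> carrier_mat (Suc n) 1" using w by simp
  have sq: "?s\<^sup>2 = (norm ?z)\<^sup>2 + (hs_norm ?v)\<^sup>2"
    using hs_norm_vec_cons[OF v, of ?z] vec_cons_sub_col[OF w] by simp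
  have IH: "align (Suc n) ?v * ?v = of_real (hs_norm ?v) \<cdot>\<^sub>m unit_col (Suc n)"
    using 3 v by (auto simp: Let_def)
  have F: "align (Suc n) ?v \<in> carrier_mat (Suc n) (Suc n)" using v by simp
  have z0: "?z = 0 \<and> hs_norm ?v = 0" if "?s = 0"
    using sq that by (auto simp: add_nonneg_eq_0_iff)
  have 1: "conjugate q * ?z + of_real p * of_real (hs_norm ?v) = of_real ?s"
  proof (cases "?s = 0")
    case False
    have "conjugate q * ?z + of_real p * of_real (hs_norm ?v) =
        of_real (((norm ?z)\<^sup>2 + (hs_norm ?v)\<^sup>2) / ?s)"
      using False by (simp add: q_def p_def conj_scaleR conj_mult_self power2_eq_square of_real_def
          algebra_simps divide_simps flip: scaleR_add_left)
    also have "\<dots> = of_real ?s"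
      using False unfolding sq[symmetric] by (simp add: power2_eq_square)
    finally show ?thesis .
  qed (use z0 in auto)
  have 2: "- of_real p * ?z + q * of_real (hs_norm ?v) = 0"
    using z0 by (cases "?s = 0") (auto simp: q_def p_def of_real_def divide_inverse)
  have "align (Suc (Suc n)) w * w =
      two_block n (conjugate q) (of_real p) (- of_real p) q * (one_block (align (Suc n) ?v) * w)"
    using w F by (auto simp: Let_def q_def p_def
        assoc_mult_mat[of _ "Suc (Suc n)" "Suc (Suc n)" _ "Suc (Suc n)" _ 1])
  also have "one_block (align (Suc n) ?v) * w =
      vec_cons ?z (of_real (hs_norm ?v) \<cdot>\<^sub>m unit_col (Suc n))"
    using one_block_mult_vec_cons[OF F v, of ?z] vec_cons_sub_col[OF w] IH by simp
  also have "two_block n (conjugate q) (of_real p) (- of_real p) q * \<dots> =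
      of_real ?s \<cdot>\<^sub>m unit_col (Suc (Suc n))"
    unfolding vec_cons_smult_unit_col
    by (subst two_block_mult[of _ _ 1]) (use 1 2 in \<open>auto intro!: eq_matI simp: unit_col_def\<close>)
  finally show ?case .
qed

lemma hs_norm_smult: "hs_norm (of_real t \<cdot>\<^sub>m (w :: 'a mat)) = \<bar>t\<bar> * hs_norm w"
  by (simp add: hs_norm_def norm_mult' power_mult_distrib sum_distrib_left[symmetric]
      real_sqrt_mult)

lemma sub_col_smult: "sub_col (c \<cdot>\<^sub>m (w :: 'a mat)) = c \<cdot>\<^sub>m sub_col w" if
    "w \<in> carrier_mat (Suc n) 1"
  using that by (auto intro!: eq_matI simp: sub_col_def)

text \<open>All coefficients of \<open>align\<close> are phases or quotients of norms, hence
  homogeneous of degree 0. In the Laguerre recursion this frees the rotation from the random length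
  of the first column.\<close>

lemma align_smult:
  assumes "0 < t" "w \<in> carrier_mat n 1"
  shows "align n (of_real t \<cdot>\<^sub>m (w :: 'a mat)) = align n w"
  using assms(2)
proof (induction n w rule: align.induct)
  case (2 w)
  have "scalar_phase (of_real t * z) = scalar_phase z" for z :: 'a
    using assms(1) by (simp add: scalar_phase_def of_real_def)
  with 2 show ?case by simp
next
  case (3 n w)
  then have IH: "align (Suc n) (of_real t \<cdot>\<^sub>m sub_col w) = align (Suc n) (sub_col w)"
    by auto
  have t: "inverse t * x * t = x" for x :: real
    using assms(1) by simp
  have *: "(of_real t \<cdot>\<^sub>m w) $$ (0, 0) = t *\<^sub>R (w $$ (0, 0))"
    using 3 by (simp add: of_real_def)
  show ?case
    using 3 assms(1) unfolding align.simps Let_def sub_col_smult[OF "3.prems"] IH hs_norm_smult *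
    by (auto simp: t)
qed simp

end

section \<open>Tridiagonalization\<close>

text \<open>Householder reduction with the rotations of \<open>align\<close>. Only the first column
  and the real part of the corner are read, so the result is a real Jacobi matrix for every
  argument, while its meaning as a change of basis is confined to Hermitian ones.\<close>

fun tridiag :: "nat \<Rightarrow> 'a :: {real_algebra_1, euclidean_space, conjugate} mat \<Rightarrow> real mat" where
  "tridiag 0 H = 0\<^sub>m 0 0"
| "tridiag (Suc n) H =
    (let F = align n (sub_col H); l = hs_norm (sub_col H) in
     four_block_mat (scalar_mat (inner (H $$ (0, 0)) 1)) (l \<cdot>\<^sub>m transpose_mat (unit_col n))
         (l \<cdot>\<^sub>m unit_col n)
       (tridiag n (F * sub_mat H * conj_transpose F)))"

text \<open>The change of basis accumulated by \<open>tridiag\<close>: align the column first, then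
  continue with the rotated block. The outer \<open>one_block\<close> is what fixes the first basis
  vector.\<close>

fun tridiag_basis :: "nat \<Rightarrow> 'a :: {real_algebra_1, euclidean_space, conjugate} mat \<Rightarrow> 'a mat" where
  "tridiag_basis 0 H = 1\<^sub>m 0"
| "tridiag_basis (Suc n) H =
    (let F = align n (sub_col H) in
     one_block (tridiag_basis n (F * sub_mat H * conj_transpose F) * F))"

lemma tridiag_carrier [simp]: "tridiag n H \<in> carrier_mat n n"
  by (induction n H rule: tridiag.induct)
    (auto simp: Let_def intro!: four_block_carrier_mat[of _ 1 1 _ n n for n, simplified])

lemma four_block_jacobi_mat:
  "four_block_mat (scalar_mat b1) (l \<cdot>\<^sub>m transpose_mat (unit_col n)) (l \<cdot>\<^sub>m unit_col n)
      (jacobi_mat n a b) =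
    jacobi_mat (Suc n) (\<lambda>j. if j = 1 then l else a (j - 1)) (\<lambda>j. if j = 1 then b1 else b (j - 1))"
  by (rule eq_matI) (auto simp: scalar_mat_def unit_col_def jacobi_mat_def)

lemma is_jacobi_tridiag: "is_jacobi n (tridiag n H)"
proof (induction n H rule: tridiag.induct)
  case (1 H)
  show ?case by (auto simp: is_jacobi_def jacobi_mat_def intro!: exI[of _ "\<lambda>_. 0"])
next
  case (2 n H)
  from "2"[OF refl refl] obtain a b where ab: "\<forall>j\<in>{1..<n}. 0 \<le> a j"
    "tridiag n (align n (sub_col H) * sub_mat H * conj_transpose (align n (sub_col H))) =
        jacobi_mat n a b"
    by (auto simp: is_jacobi_def)
  show ?case
    unfolding is_jacobi_def tridiag.simps Let_def ab(2) four_block_jacobi_mat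
    by (intro exI conjI refl) (use ab(1) in \<open>auto simp: Suc_le_eq less_Suc_eq_le\<close>)
qed

context hermitian_scalars
begin

lemma unitary_tridiag_basis:
  "H \<in> carrier_mat n n \<Longrightarrow> unitary n (tridiag_basis n (H :: 'a mat))"
proof (induction n H rule: tridiag_basis.induct)
  case (2 n H)
  then show ?case
    unfolding tridiag_basis.simps Let_def
    by (intro unitary_one_block unitary_mult unitary_align 2) auto
qed (auto intro: unitary_one)

lemma tridiag_basis_carrier [simp]:
  "H \<in> carrier_mat n n \<Longrightarrow> tridiag_basis n (H :: 'a mat) \<in> carrier_mat n n"
  using unitary_tridiag_basis unitary_carrier by blast

lemma tridiag_basis_unit_col:
  "H \<in> carrier_mat n n \<Longrightarrow> tridiag_basis n (H :: 'a mat) * unit_col n = unit_col n"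
proof (cases n)
  case (Suc k)
  assume "H \<in> carrier_mat n n"
  then show ?thesis unfolding Suc tridiag_basis.simps Let_def
    by (intro one_block_unit_col mult_carrier_square tridiag_basis_carrier) auto
qed (auto intro!: eq_matI simp: unit_col_def)

lemma mult_of_real_smult:
  assumes "A \<in> carrier_mat m k" "B \<in> carrier_mat k n"
  shows "A * (of_real r \<cdot>\<^sub>m (B :: 'a mat)) = of_real r \<cdot>\<^sub>m (A * B)"
    and "(of_real r \<cdot>\<^sub>m A) * B = of_real r \<cdot>\<^sub>m (A * B)"
proof -
  have *: "x * (of_real r * y) = of_real r * (x * y)" for x y :: 'a
    by (metis mult.assoc of_real_commute)
  show "A * (of_real r \<cdot>\<^sub>m B) = of_real r \<cdot>\<^sub>m (A * B)"
    by (rule eq_matI) (use assms in \<open>auto simp: scalar_prod_def sum_distrib_left * intro!: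
        sum.cong\<close>)
  show "(of_real r \<cdot>\<^sub>m A) * B = of_real r \<cdot>\<^sub>m (A * B)"
    by (rule eq_matI) (use assms in \<open>auto simp: scalar_prod_def sum_distrib_left mult.assoc intro!:
        sum.cong\<close>)
qed

lemma hermitian_conjugation:
  fixes U H :: "'a mat"
  assumes "U \<in> carrier_mat n n" "H \<in> carrier_mat n n" "conj_transpose H = H"
  shows "conj_transpose (U * H * conj_transpose U) = U * H * conj_transpose U"
  using assms by (simp add: conj_transpose_mult[of _ n n _ n] assoc_mult_mat[of _ n n _ n _ n])

lemma hermitian_sub_mat:
  "H \<in> carrier_mat (Suc n) (Suc n) \<Longrightarrow> conj_transpose H = H \<Longrightarrow> conj_transpose (sub_mat (H :: 'a mat)) =
      sub_mat H"
proof (rule eq_matI)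
  fix i j assume H: "H \<in> carrier_mat (Suc n) (Suc n)" "conj_transpose H = H"
    and ij: "i < dim_row (sub_mat H)" "j < dim_col (sub_mat H)"
  have "conj_transpose H $$ (Suc i, Suc j) = H $$ (Suc i, Suc j)" using H(2) by simp
  then show "conj_transpose (sub_mat H) $$ (i, j) = sub_mat H $$ (i, j)"
    using H(1) ij by (simp add: sub_mat_def)
qed (auto simp: sub_mat_def)

text \<open>Write H in blocks as the corner h, the column w, its adjoint and the block B.
  Conjugation by 1 + G (a block sum) keeps h and replaces w by \<open>G w\<close> and B by
  \<open>G B G^H\<close>. Since \<open>align\<close> sends w to a multiple of the first basis vector
  and the later basis change fixes that vector, \<open>G w\<close> has the required form; the block
  is the induction hypothesis.\<close>

lemma tridiag_eq:
  "H \<in> carrier_mat n n \<Longrightarrow> conj_transpose H = H \<Longrightarrow>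
    tridiag_basis n H * (H :: 'a mat) * conj_transpose (tridiag_basis n H) =
        map_mat of_real (tridiag n H)"
proof (induction n H rule: tridiag.induct)
  case (1 H)
  then show ?case by (auto intro!: eq_matI)
next
  case (2 n H)
  let ?w = "sub_col H" and ?B = "sub_mat H"
  define F where "F = align n ?w"
  define H' where "H' = F * ?B * conj_transpose F"
  define G where "G = tridiag_basis n H' * F"
  define l where "l = hs_norm ?w"
  have H: "H \<in> carrier_mat (Suc n) (Suc n)" "conj_transpose H = H" by fact+
  have [simp]: "?w \<in> carrier_mat n 1" "?w \<in> carrier_mat n (Suc 0)" "?B \<in> carrier_mat n n" using H by
      auto
  have F [simp]: "F \<in> carrier_mat n n" by (simp add: F_def)
  have H' [simp]: "H' \<in> carrier_mat n n" by (simp add: H'_def)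
  have G [simp]: "G \<in> carrier_mat n n"
    unfolding G_def using F H' by simp
  have "conj_transpose ?B = ?B"
    by (rule hermitian_sub_mat[OF H])
  then have "conj_transpose H' = H'"
    unfolding H'_def by (intro hermitian_conjugation[of _ n]) auto
  then have IH: "tridiag_basis n H' * H' * conj_transpose (tridiag_basis n H') =
      map_mat of_real (tridiag n H')"
    using 2 by (auto simp: H'_def F_def Let_def)
  have Hij: "H $$ (i, j) = conjugate (H $$ (j, i))" if "i < Suc n" "j < Suc n" for i j
  proof -
    have "conj_transpose H $$ (i, j) = H $$ (i, j)" by (simp add: H)
    then show ?thesis using H(1) that by simp
  qed
  \<comment> \<open>A Hermitian matrix has a self-conjugate corner, and a scalar equal to its own
    reflection in the real axis is real.\<close>
  have "2 *\<^sub>R H $$ (0, 0) = 2 *\<^sub>R of_real (inner (H $$ (0, 0)) 1)"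
    using Hij[of 0 0] by (simp add: conj_eq of_real_def scaleR_2 eq_diff_eq)
  then have h: "H $$ (0, 0) = of_real (inner (H $$ (0, 0)) 1)"
    by (simp del: of_real_inner_one)
  have dec: "H = four_block_mat (scalar_mat (H $$ (0, 0))) (conj_transpose ?w) ?w ?B"
    by (rule trans[OF four_block_decompose[OF H(1)]],
        rule arg_cong2[where f = "\<lambda>X Y. four_block_mat X Y ?w ?B"])
      (use H(1) in \<open>auto intro!: eq_matI Hij simp: sub_col_def\<close>)
  have Gw: "G * ?w = of_real l \<cdot>\<^sub>m unit_col n"
    unfolding G_def using align_mult[of ?w n] tridiag_basis_unit_col[OF H']
    by (simp add: assoc_mult_mat[of _ n n _ n _ 1] F_def[symmetric] mult_of_real_smult[of _ n n _ 1]
        l_def)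
  have wG: "conj_transpose ?w * conj_transpose G = of_real l \<cdot>\<^sub>m transpose_mat (unit_col n)"
    unfolding conj_transpose_mult[of G n n ?w 1, OF G, symmetric, simplified] Gw
    by (rule eq_matI) (auto simp: conj_mult unit_col_def)
  have "G * ?B * conj_transpose G = tridiag_basis n H' * H' * conj_transpose (tridiag_basis n H')"
    unfolding G_def H'_def
    by (simp add: conj_transpose_mult[of _ n n _ n] assoc_mult_mat[of _ n n _ n _ n])
  then have GB: "G * ?B * conj_transpose G = map_mat of_real (tridiag n H')" using IH by simp
  let ?S = "scalar_mat (H $$ (0, 0))"
  have TB: "tridiag_basis (Suc n) H = one_block G"
    by (simp add: Let_def G_def F_def H'_def)
  have w: "?w \<in> carrier_mat n 1" "conj_transpose ?w \<in> carrier_mat 1 n" "?S \<in> carrier_mat 1 1"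
    "G * ?w \<in> carrier_mat n 1" "G * ?B \<in> carrier_mat n n" "conj_transpose G \<in> carrier_mat n n"
    using H(1) G mult_carrier_mat[OF G, of ?w 1] by auto
  have "tridiag_basis (Suc n) H * H = one_block G * four_block_mat ?S (conj_transpose ?w) ?w ?B"
    by (rule arg_cong2[where f = "(*)", OF TB dec])
  also have "\<dots> = four_block_mat ?S (conj_transpose ?w) (G * ?w) (G * ?B)"
    using w H(1) by (intro one_block_mult_four_block[of _ n]) auto
  finally have "tridiag_basis (Suc n) H * H * conj_transpose (tridiag_basis (Suc n) H) =
      four_block_mat ?S (conj_transpose ?w) (G * ?w) (G * ?B) * one_block (conj_transpose G)"
    by (simp only: TB conj_transpose_one_block)
  also have "\<dots> = four_block_mat ?S (conj_transpose ?w * conj_transpose G) (G * ?w)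
      (G * ?B * conj_transpose G)"
    using w H(1) by (intro one_block_mult_four_block[of _ n]) auto
  also have "\<dots> = map_mat of_real (tridiag (Suc n) H)"
    unfolding Gw wG GB
    by (simp add: Let_def map_four_block_mat[where ?nr1.0 = 1 and ?nc1.0 = 1 and ?nr2.0 =
        n and ?nc2.0 = n] flip: F_def H'_def l_def)
      (auto intro!: eq_matI simp: scalar_mat_def unit_col_def h[symmetric]
          carrier_matD[OF tridiag_carrier])
  finally show ?case .
qed

end

section \<open>Measurability of matrix operations\<close>

lemma measurable_mat_dim:
  assumes "f \<in> M \<rightarrow>\<^sub>M mat_borel m n" "x \<in> space M"
  shows "dim_row (f x) = m" "dim_col (f x) = n"
  using measurable_mat_carrier[OF assms] by auto

lemma hs_norm_measurable:
  assumes f: "f \<in> M \<rightarrow>\<^sub>M mat_borel m n"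
  shows "(\<lambda>x. hs_norm (f x :: 'a :: euclidean_space mat)) \<in> borel_measurable M"
proof -
  have [measurable]: "(\<lambda>x. f x $$ (i, j)) \<in> borel_measurable M" if "i < m" "j < n" for i j
    by (rule measurable_mat_entry[OF f that])
  have "(\<lambda>x. sqrt (\<Sum>i<m. \<Sum>j<n. (norm (f x $$ (i, j)))\<^sup>2)) \<in> borel_measurable M"
    by measurable
  then show ?thesis
    by (rule measurable_cong[THEN iffD1, rotated])
      (use measurable_mat_carrier[OF f] in \<open>auto simp: hs_norm_def\<close>)
qed

lemma sub_col_measurable:
  assumes f: "f \<in> M \<rightarrow>\<^sub>M mat_borel (Suc m) (Suc n)"
  shows "(\<lambda>x. sub_col (f x)) \<in> M \<rightarrow>\<^sub>M mat_borel m 1"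
proof (rule measurable_mat_borelI)
  fix i j assume ij: "i < m" "j < (1::nat)"
  from measurable_mat_entry[OF f, of "Suc i" 0] ij
  show "(\<lambda>x. sub_col (f x) $$ (i, j)) \<in> borel_measurable M"
    by (subst measurable_cong[where g = "\<lambda>x. f x $$ (Suc i, 0)"])
      (use measurable_mat_dim[OF f] ij in \<open>auto simp: sub_col_def\<close>)
qed (use measurable_mat_carrier[OF f, THEN sub_col_carrier] in auto)

lemma sub_mat_measurable:
  assumes f: "f \<in> M \<rightarrow>\<^sub>M mat_borel (Suc m) (Suc n)"
  shows "(\<lambda>x. sub_mat (f x)) \<in> M \<rightarrow>\<^sub>M mat_borel m n"
proof (rule measurable_mat_borelI)
  fix i j assume ij: "i < m" "j < n"
  from measurable_mat_entry[OF f, of "Suc i" "Suc j"] ij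
  show "(\<lambda>x. sub_mat (f x) $$ (i, j)) \<in> borel_measurable M"
    by (subst measurable_cong[where g = "\<lambda>x. f x $$ (Suc i, Suc j)"])
      (use measurable_mat_dim[OF f] ij in \<open>auto simp: sub_mat_def\<close>)
qed (use measurable_mat_carrier[OF f] in auto)

lemma scalar_mat_measurable:
  "f \<in> borel_measurable M \<Longrightarrow> (\<lambda>x. scalar_mat (f x)) \<in> M \<rightarrow>\<^sub>M mat_borel 1 1"
  by (rule measurable_mat_borelI) (auto simp: scalar_mat_def)

lemma four_block_mat_measurable:
  assumes A: "A \<in> M \<rightarrow>\<^sub>M mat_borel m1 n1" and B: "B \<in> M \<rightarrow>\<^sub>M mat_borel m1 n2"
    and C: "C \<in> M \<rightarrow>\<^sub>M mat_borel m2 n1" and D: "D \<in> M \<rightarrow>\<^sub>M mat_borel m2 n2"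
  shows "(\<lambda>x. four_block_mat (A x) (B x) (C x) (D x)) \<in> M \<rightarrow>\<^sub>M mat_borel (m1 + m2) (n1 + n2)"
proof (rule measurable_mat_borelI)
  note car = measurable_mat_carrier[OF A] measurable_mat_carrier[OF B]
    measurable_mat_carrier[OF C] measurable_mat_carrier[OF D]
  fix i j assume ij: "i < m1 + m2" "j < n1 + n2"
  have "(\<lambda>x. if i < m1 then if j < n1 then A x $$ (i, j) else B x $$ (i, j - n1)
      else if j < n1 then C x $$ (i - m1, j) else D x $$ (i - m1, j - n1)) \<in> borel_measurable M"
    using ij measurable_mat_entry[OF A, of i j] measurable_mat_entry[OF B, of i "j - n1"]
      measurable_mat_entry[OF C, of "i - m1" j] measurable_mat_entry[OF D, of "i - m1" "j - n1"]
    by (cases "i < m1"; cases "j < n1") (simp_all add: less_diff_conv2 add.commute)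
  then show "(\<lambda>x. four_block_mat (A x) (B x) (C x) (D x) $$ (i, j)) \<in> borel_measurable M"
  proof (rule measurable_cong[THEN iffD1, rotated])
    fix x assume "x \<in> space M"
    with car have [simp]: "dim_row (A x) = m1" "dim_col (A x) = n1" "dim_row (D x) = m2"
        "dim_col (D x) = n2"
      by fastforce+
    show "(if i < m1 then if j < n1 then A x $$ (i, j) else B x $$ (i, j - n1)
      else if j < n1 then C x $$ (i - m1, j) else D x $$ (i - m1, j - n1)) =
          four_block_mat (A x) (B x) (C x) (D x) $$ (i, j)"
      using ij by auto
  qed
qed (use measurable_mat_carrier[OF A] measurable_mat_carrier[OF D] in auto)

lemma mat_const_measurable: "A \<in> carrier_mat m n \<Longrightarrow> (\<lambda>_. A) \<in> M \<rightarrow>\<^sub>M mat_borel m n"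
  by (rule measurable_mat_borelI) auto

lemma one_block_measurable:
  assumes F: "F \<in> M \<rightarrow>\<^sub>M mat_borel n n"
  shows "(\<lambda>x. one_block (F x)) \<in> M \<rightarrow>\<^sub>M mat_borel (Suc n) (Suc n)"
proof -
  have "(\<lambda>x. four_block_mat (scalar_mat 1) (0\<^sub>m 1 n) (0\<^sub>m n 1) (F x)) \<in>
      M \<rightarrow>\<^sub>M mat_borel (1 + n) (1 + n)"
    by (rule four_block_mat_measurable[OF _ _ _ F]) (auto intro!: mat_const_measurable)
  then show ?thesis
    unfolding plus_1_eq_Suc
  proof (rule measurable_cong[THEN iffD1, rotated])
    fix x assume "x \<in> space M"
    with measurable_mat_carrier[OF F] have "F x \<in> carrier_mat n n" by auto
    then show "four_block_mat (scalar_mat 1) (0\<^sub>m 1 n) (0\<^sub>m n 1) (F x) = one_block (F x)"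
      by (simp add: one_block_def)
  qed
qed

lemma two_block_measurable:
  assumes "a \<in> borel_measurable M" "b \<in> borel_measurable M" "c \<in> borel_measurable M"
      "d \<in> borel_measurable M"
  shows "(\<lambda>x. two_block n (a x) (b x) (c x) (d x)) \<in> M \<rightarrow>\<^sub>M mat_borel (Suc (Suc n)) (Suc (Suc n))"
proof (rule measurable_mat_borelI)
  fix i j assume "i < Suc (Suc n)" "j < Suc (Suc n)"
  then show "(\<lambda>x. two_block n (a x) (b x) (c x) (d x) $$ (i, j)) \<in> borel_measurable M"
    using assms by (simp add: two_block_def)
qed auto

lemma map_mat_measurable:
  assumes h: "h \<in> borel_measurable borel" and f: "f \<in> M \<rightarrow>\<^sub>M mat_borel m n"
  shows "(\<lambda>x. map_mat h (f x)) \<in> M \<rightarrow>\<^sub>M mat_borel m n"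
proof (rule measurable_mat_borelI)
  fix i j assume ij: "i < m" "j < n"
  from measurable_compose[OF measurable_mat_entry[OF f ij] h]
  show "(\<lambda>x. map_mat h (f x) $$ (i, j)) \<in> borel_measurable M"
    by (rule measurable_cong[THEN iffD1, rotated])
      (use measurable_mat_dim[OF f] ij in auto)
qed (use measurable_mat_carrier[OF f] in auto)

lemma scaleR_unit_col_measurable:
  assumes [measurable]: "l \<in> borel_measurable M"
  shows "(\<lambda>x. l x \<cdot>\<^sub>m (unit_col n :: real mat)) \<in> M \<rightarrow>\<^sub>M mat_borel n 1"
    and "(\<lambda>x. l x \<cdot>\<^sub>m transpose_mat (unit_col n :: real mat)) \<in> M \<rightarrow>\<^sub>M mat_borel 1 n"
  by (auto intro!: measurable_mat_borelI simp: unit_col_def)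

context hermitian_scalars
begin

lemma mat_mult_measurable:
  assumes f: "f \<in> M \<rightarrow>\<^sub>M mat_borel m k" and g: "g \<in> M \<rightarrow>\<^sub>M mat_borel k n"
  shows "(\<lambda>x. f x * g x :: 'a mat) \<in> M \<rightarrow>\<^sub>M mat_borel m n"
proof (rule measurable_mat_borelI)
  note car = measurable_mat_carrier[OF f] measurable_mat_carrier[OF g]
  show "f x * g x \<in> carrier_mat m n" if "x \<in> space M" for x
    using car[OF that] by (rule mult_carrier_mat)
  fix i j assume ij: "i < m" "j < n"
  have [measurable]: "(\<lambda>x. f x $$ (i, l)) \<in> borel_measurable M"
      "(\<lambda>x. g x $$ (l, j)) \<in> borel_measurable M" if "l < k" for l
    using measurable_mat_entry[OF f ij(1) that] measurable_mat_entry[OF g that ij(2)] by auto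
  have "(\<lambda>x. \<Sum>l<k. f x $$ (i, l) * g x $$ (l, j)) \<in> borel_measurable M"
    by measurable
  then show "(\<lambda>x. (f x * g x) $$ (i, j)) \<in> borel_measurable M"
    by (rule measurable_cong[THEN iffD1, rotated]) (use ij index_mult_mat_sum[OF car] in auto)
qed

lemma conj_transpose_measurable:
  assumes f: "f \<in> M \<rightarrow>\<^sub>M mat_borel m n"
  shows "(\<lambda>x. conj_transpose (f x :: 'a mat)) \<in> M \<rightarrow>\<^sub>M mat_borel n m"
proof (rule measurable_mat_borelI)
  fix i j assume ij: "i < n" "j < m"
  from borel_measurable_conj[OF measurable_mat_entry[OF f ij(2,1)]]
  show "(\<lambda>x. conj_transpose (f x) $$ (i, j)) \<in> borel_measurable M"
    by (rule measurable_cong[THEN iffD1, rotated])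
      (use measurable_mat_dim[OF f] ij in auto)
qed (use measurable_mat_carrier[OF f] in auto)

lemma mat_add_measurable:
  assumes f: "f \<in> M \<rightarrow>\<^sub>M mat_borel m n" and g: "g \<in> M \<rightarrow>\<^sub>M mat_borel m n"
  shows "(\<lambda>x. f x + g x :: 'a mat) \<in> M \<rightarrow>\<^sub>M mat_borel m n"
proof (rule measurable_mat_borelI)
  fix i j assume ij: "i < m" "j < n"
  from borel_measurable_add[OF measurable_mat_entry[OF f ij] measurable_mat_entry[OF g ij]]
  show "(\<lambda>x. (f x + g x) $$ (i, j)) \<in> borel_measurable M"
    by (rule measurable_cong[THEN iffD1, rotated])
      (use measurable_mat_dim[OF f] measurable_mat_dim[OF g] ij in auto)
qed (use measurable_mat_carrier[OF f] measurable_mat_carrier[OF g] in auto)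

lemma mat_smult_measurable:
  assumes [measurable]: "c \<in> borel_measurable M" and g: "g \<in> M \<rightarrow>\<^sub>M mat_borel m n"
  shows "(\<lambda>x. of_real (c x) \<cdot>\<^sub>m g x :: 'a mat) \<in> M \<rightarrow>\<^sub>M mat_borel m n"
proof (rule measurable_mat_borelI)
  fix i j assume ij: "i < m" "j < n"
  have [measurable]: "(\<lambda>x. g x $$ (i, j)) \<in> borel_measurable M"
    by (rule measurable_mat_entry[OF g ij])
  have "(\<lambda>x. of_real (c x) * g x $$ (i, j)) \<in> borel_measurable M"
    by measurable
  then show "(\<lambda>x. (of_real (c x) \<cdot>\<^sub>m g x) $$ (i, j)) \<in> borel_measurable M"
    by (rule measurable_cong[THEN iffD1, rotated])
      (use measurable_mat_dim[OF g] ij in auto)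
qed (use measurable_mat_carrier[OF g] in auto)

text \<open>The explicit formula pays off here: \<open>align\<close> is not continuous at 0, but it
  is built from Borel functions and case distinctions, so the random orthonormal basis is measurable
  without any selection argument.\<close>

lemma align_measurable:
  "w \<in> M \<rightarrow>\<^sub>M mat_borel n 1 \<Longrightarrow> (\<lambda>x. align n (w x :: 'a mat)) \<in> M \<rightarrow>\<^sub>M mat_borel n n"
proof (induction n arbitrary: w rule: induct_nat_012)
  case 0
  show ?case by (auto intro: mat_const_measurable)
next
  case 1
  have [measurable]: "(\<lambda>x. w x $$ (0, 0)) \<in> borel_measurable M"
    by (rule measurable_mat_entry[OF 1]) auto
  have "(\<lambda>x. conjugate (scalar_phase (w x $$ (0, 0)))) \<in> borel_measurable M"
    unfolding scalar_phase_def by measurable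
  from scalar_mat_measurable[OF this] show ?case by simp
next
  case (ge2 n)
  note w = ge2.prems
  have v: "(\<lambda>x. sub_col (w x)) \<in> M \<rightarrow>\<^sub>M mat_borel (Suc n) 1"
    by (rule sub_col_measurable) (use w in simp)
  note [measurable] = hs_norm_measurable[OF w] hs_norm_measurable[OF v]
  have [measurable]: "(\<lambda>x. w x $$ (0, 0)) \<in> borel_measurable M"
    by (rule measurable_mat_entry[OF w]) auto
  have q: "(\<lambda>x. if hs_norm (w x) = 0 then 1 else w x $$ (0, 0) /\<^sub>R hs_norm (w x)) \<in>
      borel_measurable M"
    by measurable
  have p: "(\<lambda>x. of_real (hs_norm (sub_col (w x)) / hs_norm (w x)) :: 'a) \<in> borel_measurable M"
    by measurable
  show ?case
    unfolding align.simps Let_def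
    by (intro mat_mult_measurable[where k = "Suc (Suc n)"] two_block_measurable
        one_block_measurable ge2.IH(2)[OF v] q p borel_measurable_conj borel_measurable_uminus)
qed

lemma conjugation_measurable:
  assumes "U \<in> M \<rightarrow>\<^sub>M mat_borel n n" "H \<in> M \<rightarrow>\<^sub>M mat_borel n n"
  shows "(\<lambda>x. U x * H x * conj_transpose (U x :: 'a mat)) \<in> M \<rightarrow>\<^sub>M mat_borel n n"
  by (intro mat_mult_measurable[where k = n] conj_transpose_measurable assms)

lemma tridiag_measurable:
  "H \<in> M \<rightarrow>\<^sub>M mat_borel n n \<Longrightarrow> (\<lambda>x. tridiag n (H x :: 'a mat)) \<in> M \<rightarrow>\<^sub>M mat_borel n n"
proof (induction n arbitrary: H)
  case 0
  show ?case by (auto intro: mat_const_measurable)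
next
  case (Suc n)
  note w = sub_col_measurable[OF Suc.prems]
  note [measurable] = hs_norm_measurable[OF w]
  have [measurable]: "(\<lambda>x. H x $$ (0, 0)) \<in> borel_measurable M"
    by (rule measurable_mat_entry[OF Suc.prems]) auto
  show ?case
    unfolding tridiag.simps Let_def
    by (intro four_block_mat_measurable[of _ M 1 1 _ n _ n, unfolded plus_1_eq_Suc]
        scalar_mat_measurable scaleR_unit_col_measurable Suc.IH
        conjugation_measurable align_measurable w sub_mat_measurable[OF Suc.prems]) measurable
qed

lemma tridiag_basis_measurable:
  "H \<in> M \<rightarrow>\<^sub>M mat_borel n n \<Longrightarrow> (\<lambda>x. tridiag_basis n (H x :: 'a mat)) \<in> M \<rightarrow>\<^sub>M mat_borel n n"
proof (induction n arbitrary: H)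
  case 0
  show ?case by (auto intro: mat_const_measurable)
next
  case (Suc n)
  note w = sub_col_measurable[OF Suc.prems]
  show ?case
    unfolding tridiag_basis.simps Let_def
    by (intro one_block_measurable mat_mult_measurable[where k = n] Suc.IH
        conjugation_measurable align_measurable w sub_mat_measurable[OF Suc.prems])
qed

end

section \<open>Invariance of the Gaussian law\<close>

lemma normal_law_eq: "normal_law 1 = density lborel (\<lambda>x. ennreal (normal_density 0 1 x))"
  by (simp add: normal_law_def)

lemma prob_space_normal_law: "prob_space (normal_law 1)"
  unfolding normal_law_eq by (rule prob_space_normal_density) simp

lemma sets_normal_law [simp, measurable_cong]: "sets (normal_law 1) = sets borel"
  by (simp add: normal_law_def)

text \<open>On a box both measures factor into the same one-dimensional integrals, and boxes
  determine a finite product of probability measures.\<close>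

lemma PiM_normal_law:
  assumes "finite I"
  shows "Pi\<^sub>M I (\<lambda>_. normal_law 1) =
    density (Pi\<^sub>M I (\<lambda>_. lborel)) (\<lambda>f. \<Prod>i\<in>I. ennreal (normal_density 0 1 (f i)))"
proof (rule PiM_eqI_prob[symmetric, OF assms prob_space_normal_law])
  interpret product_sigma_finite "\<lambda>_. lborel :: real measure" ..
  show "sets (density (Pi\<^sub>M I (\<lambda>_. lborel)) (\<lambda>f. \<Prod>i\<in>I. ennreal (normal_density 0 1 (f i)))) =
      sets (Pi\<^sub>M I (\<lambda>_. normal_law 1))"
    unfolding sets_density by (intro sets_PiM_cong) auto
  fix A assume "\<And>k. k \<in> I \<Longrightarrow> A k \<in> sets (normal_law 1)"
  then have A [measurable]: "\<And>k. k \<in> I \<Longrightarrow> A k \<in> sets borel" by simp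
  have S: "Pi\<^sub>E I A \<in> sets (Pi\<^sub>M I (\<lambda>_. lborel))"
    using assms by (intro sets_PiM_I_finite) auto
  have "emeasure (density (Pi\<^sub>M I (\<lambda>_. lborel)) (\<lambda>f. \<Prod>i\<in>I. ennreal (normal_density 0 1 (f i))))
      (Pi\<^sub>E I A) =
      (\<integral>\<^sup>+f. (\<Prod>i\<in>I. ennreal (normal_density 0 1 (f i))) * indicator (Pi\<^sub>E I A) f \<partial>Pi\<^sub>M I
          (\<lambda>_. lborel))"
    using S assms by (subst emeasure_density) auto
  also have "\<dots> = (\<integral>\<^sup>+f. (\<Prod>i\<in>I. ennreal (normal_density 0 1 (f i)) * indicator (A i) (f i)) \<partial>Pi\<^sub>M I
      (\<lambda>_. lborel))"
  proof (rule nn_integral_cong)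
    fix f assume "f \<in> space (Pi\<^sub>M I (\<lambda>_. lborel :: real measure))"
    \<comment> \<open>Being extensional, \<open>f\<close> can miss the box only at an index of
      \<open>I\<close>.\<close>
    then have f: "f \<in> extensional I" by (simp add: space_PiM PiE_iff)
    have "indicator (Pi\<^sub>E I A) f = (\<Prod>i\<in>I. indicator (A i) (f i) :: ennreal)"
    proof (cases "f \<in> Pi\<^sub>E I A")
      case True
      then show ?thesis by (simp add: PiE_iff)
    next
      case False
      then obtain i where "i \<in> I" "f i \<notin> A i" using f by (auto simp: PiE_iff)
      then have "(\<Prod>i\<in>I. indicator (A i) (f i) :: ennreal) = 0"
        using assms by (intro prod_zero) (auto intro!: bexI[of _ i])
      with False show ?thesis by simp
    qed
    then show "(\<Prod>i\<in>I. ennreal (normal_density 0 1 (f i))) * indicator (Pi\<^sub>E I A) f =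
        (\<Prod>i\<in>I. ennreal (normal_density 0 1 (f i)) * indicator (A i) (f i))"
      by (simp add: prod.distrib)
  qed
  also have "\<dots> = (\<Prod>i\<in>I. \<integral>\<^sup>+x. ennreal (normal_density 0 1 x) * indicator (A i) x \<partial>lborel)"
    using assms by (subst product_nn_integral_prod) auto
  also have "\<dots> = (\<Prod>i\<in>I. emeasure (normal_law 1) (A i))"
    by (rule prod.cong) (auto simp: normal_law_def emeasure_density)
  finally show "emeasure (density (Pi\<^sub>M I (\<lambda>_. lborel))
      (\<lambda>f. \<Prod>i\<in>I. ennreal (normal_density 0 1 (f i)))) (Pi\<^sub>E I A) =
      (\<Prod>i\<in>I. emeasure (normal_law 1) (A i))" .
qed

context hermitian_scalars
begin

text \<open>Lebesgue measure is the image of the product of one-dimensional Lebesgue measures under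
  the coordinate expansion (\<open>lborel_eq\<close>), and the density of \<nu> is a product in
  these coordinates. Hence the coordinates are independent standard normals.\<close>

lemma \<nu>_coords: "\<nu> = distr (Pi\<^sub>M Basis (\<lambda>_. normal_law 1)) borel (\<lambda>f. \<Sum>b\<in>Basis. f b *\<^sub>R b)"
proof -
  have m [measurable]: "(\<lambda>f. \<Sum>b\<in>Basis. f b *\<^sub>R b :: 'a) \<in> Pi\<^sub>M Basis (\<lambda>_. lborel) \<rightarrow>\<^sub>M borel"
    by measurable
  have "\<nu> = density (distr (Pi\<^sub>M Basis (\<lambda>_. lborel)) borel (\<lambda>f. \<Sum>b\<in>Basis. f b *\<^sub>R b))
      (\<lambda>x. \<Prod>b\<in>Basis. ennreal (normal_density 0 1 (inner x b)))"
    unfolding \<nu>_density by (subst lborel_eq) simp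
  also have "\<dots> = distr (density (Pi\<^sub>M Basis (\<lambda>_. lborel))
      (\<lambda>f. \<Prod>b\<in>Basis. ennreal (normal_density 0 1 (inner (\<Sum>b\<in>Basis. f b *\<^sub>R b :: 'a) b)))) borel
          (\<lambda>f. \<Sum>b\<in>Basis. f b *\<^sub>R b)"
    by (rule density_distr) auto
  also have "density (Pi\<^sub>M Basis (\<lambda>_. lborel))
      (\<lambda>f. \<Prod>b\<in>Basis. ennreal (normal_density 0 1 (inner (\<Sum>b\<in>Basis. f b *\<^sub>R b :: 'a) b))) =
          Pi\<^sub>M Basis (\<lambda>_. normal_law 1)"
    by (subst PiM_normal_law) (auto intro!: density_cong prod.cong)
  finally show ?thesis .
qed

lemma sets_\<nu> [simp, measurable_cong]: "sets \<nu> = sets borel"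
  by (simp add: \<nu>_density)

lemma space_\<nu> [simp]: "space \<nu> = UNIV"
  by (simp add: \<nu>_density)

lemma prob_space_\<nu>: "prob_space \<nu>"
  unfolding \<nu>_coords
  by (intro prob_space.prob_space_distr prob_space_PiM prob_space_normal_law) measurable

text \<open>Only the norm enters the density. Invariance of \<nu> under a linear isometry thus
  reduces to invariance of Lebesgue measure.\<close>

lemma \<nu>_radial: "\<nu> = density lborel (\<lambda>x. ennreal
    ((1 / sqrt (2 * pi)) ^ DIM('a) * exp (- (norm x)\<^sup>2 / 2)))"
proof -
  have "(\<Prod>b\<in>Basis. ennreal (normal_density 0 1 (inner x b))) =
      ennreal ((1 / sqrt (2 * pi)) ^ DIM('a) * exp (- (norm x)\<^sup>2 / 2))" for x :: 'a
  proof -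
    have "(norm x)\<^sup>2 = (\<Sum>b\<in>Basis. (inner x b)\<^sup>2)"
      unfolding power2_norm_eq_inner by (subst euclidean_inner) (simp add: power2_eq_square)
    then have "exp (- (norm x)\<^sup>2 / 2) = (\<Prod>b\<in>Basis. exp (- (inner x b)\<^sup>2 / 2))"
      by (simp add: exp_sum[symmetric] sum_negf sum_divide_distrib)
    moreover have "(\<Prod>b\<in>Basis. normal_density 0 1 (inner x b)) =
        (\<Prod>b\<in>Basis. (1 / sqrt (2 * pi)) * exp (- (inner x b)\<^sup>2 / 2))"
      by (rule prod.cong) (auto simp: normal_density_def)
    ultimately show ?thesis
      by (simp add: prod_ennreal prod_dividef power_one_over)
  qed
  then show ?thesis by (simp add: \<nu>_density)
qed

text \<open>Polarization of the identity conj x x = |x|^2. Its consequence is that left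
  multiplications by \<open>s\<close> and by conj s are adjoint.\<close>

lemma inner_eq: "inner x y = inner (conjugate x * y) (1 :: 'a)"
proof -
  have "of_real ((norm (x + y))\<^sup>2) = conjugate (x + y) * (x + y)"
    by (simp only: conj_mult_self)
  also have "\<dots> = of_real ((norm x)\<^sup>2) + of_real ((norm y)\<^sup>2) +
      (conjugate x * y + conjugate (conjugate x * y))"
    by (simp only: conj_add conj_mult distrib_left distrib_right conj_mult_self conjugate_id add_ac)
  also have "conjugate x * y + conjugate (conjugate x * y) =
      of_real (2 * inner (conjugate x * y) 1)"
    by (simp only: conj_eq[of "conjugate x * y"]) simp
  finally have "(norm (x + y))\<^sup>2 = (norm x)\<^sup>2 + (norm y)\<^sup>2 + 2 * inner (conjugate x * y) 1"
    by (simp only: of_real_add[symmetric] of_real_eq_iff)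
  then show ?thesis
    by (simp add: power2_norm_eq_inner inner_add_left inner_add_right inner_commute)
qed

lemma inner_mult_left_adjoint: "inner (s * x) y = inner x (conjugate s * y :: 'a)"
  by (simp add: inner_eq[of "s * x"] inner_eq[of x] conj_mult mult.assoc)

text \<open>Expanding both squares, the two cross terms are the same inner product with opposite
  signs, because left multiplications by \<open>s\<close> and by its conjugate are adjoint.\<close>

lemma rotation_norm:
  assumes "c\<^sup>2 + (norm s)\<^sup>2 = 1"
  shows "(norm (of_real c * x + conjugate s * y))\<^sup>2 + (norm (- s * x + of_real c * y))\<^sup>2 =
      (norm x)\<^sup>2 + (norm (y :: 'a))\<^sup>2"
proof -
  have n: "(norm (u + v))\<^sup>2 = (norm u)\<^sup>2 + (norm v)\<^sup>2 + 2 * inner u v" for u v :: 'a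
    by (simp add: power2_norm_eq_inner inner_add_left inner_add_right inner_commute)
  have "(norm (of_real c * x + conjugate s * y))\<^sup>2 + (norm (- s * x + of_real c * y))\<^sup>2 =
      (c\<^sup>2 + (norm s)\<^sup>2) * ((norm x)\<^sup>2 + (norm y)\<^sup>2)
      + 2 * (inner (of_real c * x) (conjugate s * y) - inner (s * x) (of_real c * y))"
    unfolding n by (simp add: norm_mult' power_mult_distrib algebra_simps inner_minus_left)
  also have "inner (of_real c * x) (conjugate s * y) = inner (s * x) (of_real c * y)"
    by (simp add: inner_mult_left_adjoint of_real_def)
  finally show ?thesis using assms by simp
qed

abbreviation "lborel2 \<equiv> lborel \<Otimes>\<^sub>M (lborel :: 'a measure)"

text \<open>With \<open>x\<close> frozen the shear translates \<open>y\<close> by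
  \<open>a * x\<close>, so \<open>distr_pair_skew\<close> applies.\<close>

lemma lborel2_shear:
  "distr lborel2 lborel2 (\<lambda>(x, y). (x, a * x + y)) = lborel2"
proof -
  have "distr (lborel :: 'a measure) lborel ((+) c) = lborel" for c
    using lborel_distr_plus[of c] by (simp cong: distr_cong)
  then show ?thesis
    by (intro distr_pair_skew) (auto intro: lborel.sigma_finite_measure_axioms)
qed

lemma lborel2_swap: "distr lborel2 lborel2 (\<lambda>(x, y). (y, x)) = lborel2"
  by (rule lborel_pair.distr_pair_swap[symmetric])

lemma distr_comp_eq:
  assumes "distr M M f = M" "distr M M g = M" "f \<in> M \<rightarrow>\<^sub>M M" "g \<in> M \<rightarrow>\<^sub>M M"
  shows "distr M M (f \<circ> g) = M"
  using assms by (metis distr_distr)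

lemma lborel2_shear':
  "distr lborel2 lborel2 (\<lambda>(x, y). (x + a * y, y)) = lborel2"
proof -
  have "distr lborel2 lborel2 ((\<lambda>(x, y). (y, x)) \<circ> ((\<lambda>(x, y). (x, a * x + y)) \<circ> (\<lambda>(x, y). (y, x))))
      = lborel2"
    by (intro distr_comp_eq lborel2_shear lborel2_swap) measurable
  also have "(\<lambda>(x, y). (y, x)) \<circ> ((\<lambda>(x, y). (x, a * x + y)) \<circ> (\<lambda>(x, y). (y, x))) =
      (\<lambda>(x, y). (x + a * y, y))"
    by (auto simp: add.commute)
  finally show ?thesis .
qed

text \<open>A rotation of \<open>'a \<times> 'a\<close> other than a half turn is a product of three shears, and
  shears preserve Lebesgue measure by translation invariance.\<close>

lemma lborel2_rotation:
  assumes c: "0 \<le> c" and cs: "c\<^sup>2 + (norm s)\<^sup>2 = 1"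
  shows "distr lborel2 lborel2 (\<lambda>(x, y). (of_real c * x + conjugate s * y, - s * x + of_real c * y))
      = lborel2"
proof -
  \<comment> \<open>The tangent of half the angle; \<open>c \<ge> 0\<close> keeps the denominator
    away from 0. The shears are by \<open>t\<close>, \<open>- s\<close> and \<open>t\<close> again,
    and \<open>s * t = t * s = 1 - c\<close> is the half-angle identity that makes their product the
    rotation.\<close>
  define t where "t = conjugate s /\<^sub>R (1 + c)"
  have st: "s * t = of_real (1 - c)"
  proof -
    have "(norm s)\<^sup>2 = (1 - c) * (1 + c)" using cs by (simp add: algebra_simps power2_eq_square)
    then show ?thesis using c by (simp add: t_def mult_conj_self of_real_def divide_inverse)
  qed
  have "conjugate s * s = s * conjugate s" by (simp only: conj_mult_self mult_conj_self)
  then have ts: "t * s = of_real (1 - c)"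
    using st by (simp add: t_def)
  have t: "(1 + c) *\<^sub>R t = conjugate s"
    using c by (simp add: t_def)
  have "distr lborel2 lborel2 ((\<lambda>(x, y). (x + t * y, y)) \<circ>
      ((\<lambda>(x, y). (x, (- s) * x + y)) \<circ> (\<lambda>(x, y). (x + t * y, y)))) = lborel2"
    by (intro distr_comp_eq lborel2_shear lborel2_shear') measurable
  also have "(\<lambda>(x, y). (x + t * y, y)) \<circ> ((\<lambda>(x, y). (x, (- s) * x + y)) \<circ> (\<lambda>(x, y). (x + t * y, y)))
      =
      (\<lambda>(x, y). (of_real c * x + conjugate s * y, - s * x + of_real c * y))"
  proof (intro ext, clarsimp, intro conjI)
    fix x y
    have st': "s * (t * y) = of_real (1 - c) * y" for y by (simp add: mult.assoc[symmetric] st)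
    have ts': "t * (s * y) = of_real (1 - c) * y" for y by (simp add: mult.assoc[symmetric] ts)
    show 2: "y - s * (x + t * y) = of_real c * y - s * x"
      by (simp add: distrib_left st' of_real_diff left_diff_distrib)
    show "x + t * y + t * (y - s * (x + t * y)) = of_real c * x + conjugate s * y"
      unfolding 2 t[symmetric]
      by (simp add: right_diff_distrib ts' of_real_diff left_diff_distrib scaleR_add_left)
        (simp add: of_real_def distrib_right)
  qed
  finally show ?thesis .
qed

lemma \<nu>2_density: "\<nu> \<Otimes>\<^sub>M \<nu> = density lborel2 (\<lambda>(x, y).
    ennreal ((1 / sqrt (2 * pi)) ^ DIM('a) * (1 / sqrt (2 * pi)) ^ DIM('a) * exp
        (- ((norm x)\<^sup>2 + (norm y)\<^sup>2) / 2)))"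
proof -
  let ?g = "\<lambda>x :: 'a. ennreal ((1 / sqrt (2 * pi)) ^ DIM('a) * exp (- (norm x)\<^sup>2 / 2))"
  have "sigma_finite_measure (density lborel ?g)"
    using prob_space_imp_sigma_finite[OF prob_space_\<nu>] unfolding \<nu>_radial .
  then have "density lborel ?g \<Otimes>\<^sub>M density lborel ?g = density lborel2 (\<lambda>(x, y). ?g x * ?g y)"
    by (intro pair_measure_density)
      (auto intro: lborel.sigma_finite_measure_axioms)
  also have "\<dots> = density lborel2 (\<lambda>(x, y).
    ennreal ((1 / sqrt (2 * pi)) ^ DIM('a) * (1 / sqrt (2 * pi)) ^ DIM('a) * exp
        (- ((norm x)\<^sup>2 + (norm y)\<^sup>2) / 2)))"
    by (intro density_cong)
      (auto simp: ennreal_mult[symmetric] exp_add[symmetric] add_divide_distrib mult_ac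
          diff_divide_distrib
         simp flip: ennreal_mult)
  finally show ?thesis unfolding \<nu>_radial[symmetric] .
qed

text \<open>The rotation preserves Lebesgue measure on pairs, and the Gaussian density of a pair is
  a function of the sum of squared norms, which it also preserves.\<close>

lemma \<nu>2_rotation:
  assumes c: "0 \<le> c" and cs: "c\<^sup>2 + (norm s)\<^sup>2 = 1"
  shows "distr (\<nu> \<Otimes>\<^sub>M \<nu>) (\<nu> \<Otimes>\<^sub>M \<nu>) (\<lambda>(x, y). (of_real c * x + conjugate s * y, - s * x +
      of_real c * y)) = \<nu> \<Otimes>\<^sub>M \<nu>"
proof -
  let ?R = "\<lambda>(x, y). (of_real c * x + conjugate s * y, - s * x + of_real c * y)"
  let ?G = "\<lambda>(x, y). ennreal ((1 / sqrt (2 * pi)) ^ DIM('a) * (1 / sqrt (2 * pi)) ^ DIM('a) * exp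
      (- ((norm x)\<^sup>2 + (norm (y :: 'a))\<^sup>2) / 2))"
  have [measurable]: "?R \<in> lborel2 \<rightarrow>\<^sub>M lborel2" by measurable
  have "?G (?R z) = ?G z" for z
    by (cases z) (simp only: prod.case rotation_norm[OF cs])
  then have "distr (density lborel2 ?G) lborel2 ?R =
      distr (density lborel2 (\<lambda>z. ?G (?R z))) lborel2 ?R"
    by simp
  also have "\<dots> = density (distr lborel2 lborel2 ?R) ?G"
    by (rule density_distr[symmetric]) measurable
  also have "\<dots> = density lborel2 ?G"
    by (simp only: lborel2_rotation[OF c cs])
  finally have "distr (\<nu> \<Otimes>\<^sub>M \<nu>) lborel2 ?R = \<nu> \<Otimes>\<^sub>M \<nu>"
    unfolding \<nu>2_density .
  moreover have "distr (\<nu> \<Otimes>\<^sub>M \<nu>) lborel2 ?R = distr (\<nu> \<Otimes>\<^sub>M \<nu>) (\<nu> \<Otimes>\<^sub>M \<nu>) ?R"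
    by (rule distr_cong) (auto cong: sets_pair_measure_cong)
  ultimately show ?thesis by simp
qed

text \<open>In \<open>align\<close> the real coefficient stands off the diagonal, in
  \<open>\<nu>2_rotation\<close> on it. Composition with the quarter turn \<open>c = 0\<close>,
  \<open>s = 1\<close> exchanges the two positions.\<close>

lemma \<nu>2_align_rotation:
  assumes p: "0 \<le> p" and qp: "(norm q)\<^sup>2 + p\<^sup>2 = 1"
  shows "distr (\<nu> \<Otimes>\<^sub>M \<nu>) (\<nu> \<Otimes>\<^sub>M \<nu>) (\<lambda>(x, y). (conjugate q * x + of_real p * y, - of_real p * x +
      q * y)) = \<nu> \<Otimes>\<^sub>M \<nu>"
proof -
  let ?R = "\<lambda>c s (x, y). (of_real c * x + conjugate s * y, - s * x + of_real c * y)"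
  have "distr (\<nu> \<Otimes>\<^sub>M \<nu>) (\<nu> \<Otimes>\<^sub>M \<nu>) (?R p (- q) \<circ> ?R 0 1) = \<nu> \<Otimes>\<^sub>M \<nu>"
    using p qp by (intro distr_comp_eq \<nu>2_rotation) (auto simp: add.commute)
  also have "?R p (- q) \<circ> ?R 0 1 = (\<lambda>(x, y). (conjugate q * x + of_real p * y, - of_real p * x +
      q * y))"
    by (auto simp: fun_eq_iff conj_minus add.commute)
  finally show ?thesis .
qed

text \<open>The degenerate rotation with \<open>p = 0\<close> multiplies the first coordinate of a
  pair by the conjugate of \<open>q\<close>; projecting to that coordinate leaves the claim.\<close>

lemma \<nu>_mult_unit:
  assumes q: "norm q = 1"
  shows "distr \<nu> \<nu> (\<lambda>x. conjugate q * x) = \<nu>"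
proof -
  interpret prob_space \<nu> by (rule prob_space_\<nu>)
  have fst: "distr (\<nu> \<Otimes>\<^sub>M \<nu>) \<nu> fst = \<nu>"
    by (intro measure_eqI) (auto simp: distr_pair_fst prob_space_\<nu>)
  have "distr \<nu> \<nu> (\<lambda>x. conjugate q * x) = distr (\<nu> \<Otimes>\<^sub>M \<nu>) \<nu> ((\<lambda>x. conjugate q * x) \<circ> fst)"
    by (subst fst[symmetric], rule distr_distr) measurable
  also have "(\<lambda>x. conjugate q * x) \<circ> fst = fst \<circ>
      (\<lambda>(x, y). (conjugate q * x + of_real 0 * y, - of_real 0 * x + q * y))"
    by auto
  also have "distr (\<nu> \<Otimes>\<^sub>M \<nu>) \<nu> \<dots> = distr (\<nu> \<Otimes>\<^sub>M \<nu>) \<nu> fst"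
    by (subst distr_distr[symmetric, where N = "\<nu> \<Otimes>\<^sub>M \<nu>"], measurable)
      (subst \<nu>2_align_rotation, use q in auto)
  finally show ?thesis by (simp only: fst)
qed

text \<open>In coordinates conjugation is diagonal, with sign 1 at the unit and -1 at the other
  basis elements. So it preserves Lebesgue measure, and it preserves the norm.\<close>

lemma \<nu>_conj: "distr \<nu> \<nu> conjugate = \<nu>"
proof -
  define c :: "'a \<Rightarrow> real" where "c b = (if b = 1 then 1 else -1)" for b
  have "conjugate x = 0 + (\<Sum>b\<in>Basis. (c b * inner x b) *\<^sub>R b)" for x :: 'a
  proof (rule euclidean_eqI)
    fix b :: 'a assume b: "b \<in> Basis"
    show "inner (conjugate x) b = inner (0 + (\<Sum>b\<in>Basis. (c b * inner x b) *\<^sub>R b)) b"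
      using b one_Basis by (auto simp: conj_eq inner_diff_left of_real_def c_def
          inner_not_same_Basis)
  qed
  then have eq: "(\<lambda>x :: 'a. 0 + (\<Sum>b\<in>Basis. (c b * inner x b) *\<^sub>R b)) = conjugate" by auto
  have "lborel = density (distr lborel borel (conjugate :: 'a \<Rightarrow> 'a))
      (\<lambda>_. ennreal (\<Prod>b\<in>Basis. \<bar>c b\<bar>))"
    unfolding eq[symmetric] by (rule lborel_affine_euclidean) (auto simp: c_def)
  moreover have "(\<Prod>b\<in>Basis. \<bar>c b\<bar>) = 1"
    by (intro prod.neutral) (auto simp: c_def)
  ultimately have lb: "distr lborel borel (conjugate :: 'a \<Rightarrow> 'a) = lborel"
    by (simp add: density_1)
  let ?g = "\<lambda>x :: 'a. ennreal ((1 / sqrt (2 * pi)) ^ DIM('a) * exp (- (norm x)\<^sup>2 / 2))"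
  have "distr (density lborel (\<lambda>x. ?g (conjugate x))) borel conjugate =
      density (distr lborel borel conjugate) ?g"
    by (rule density_distr[symmetric]) measurable
  then have "distr \<nu> borel conjugate = \<nu>"
    unfolding \<nu>_radial lb by simp
  moreover have "distr \<nu> borel conjugate = distr \<nu> \<nu> conjugate"
    by (rule distr_cong) auto
  ultimately show ?thesis by simp
qed

end

lemma distr_pair_assoc':
  assumes "sigma_finite_measure A" "sigma_finite_measure B" "sigma_finite_measure C"
  shows "distr (A \<Otimes>\<^sub>M (B \<Otimes>\<^sub>M C)) ((A \<Otimes>\<^sub>M B) \<Otimes>\<^sub>M C) (\<lambda>p. ((fst p, fst (snd p)), snd (snd p))) =
      (A \<Otimes>\<^sub>M B) \<Otimes>\<^sub>M C"
proof -
  have "distr (A \<Otimes>\<^sub>M (B \<Otimes>\<^sub>M C)) ((A \<Otimes>\<^sub>M B) \<Otimes>\<^sub>M C) (\<lambda>p. ((fst p, fst (snd p)), snd (snd p))) =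
    distr (distr ((A \<Otimes>\<^sub>M B) \<Otimes>\<^sub>M C) (A \<Otimes>\<^sub>M (B \<Otimes>\<^sub>M C)) (\<lambda>p. (fst (fst p), (snd (fst p), snd p))))
      ((A \<Otimes>\<^sub>M B) \<Otimes>\<^sub>M C) (\<lambda>p. ((fst p, fst (snd p)), snd (snd p)))"
    by (simp only: distr_pair_assoc[OF assms])
  also have "\<dots> = distr ((A \<Otimes>\<^sub>M B) \<Otimes>\<^sub>M C) ((A \<Otimes>\<^sub>M B) \<Otimes>\<^sub>M C) (\<lambda>p. p)"
    by (subst distr_distr) (auto simp: comp_def)
  finally show ?thesis by simp
qed

lemma distr_snd_pair:
  assumes "prob_space A" "sigma_finite_measure B"
  shows "distr (A \<Otimes>\<^sub>M B) B snd = B"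
proof (rule measure_eqI)
  interpret A: prob_space A by fact
  interpret B: sigma_finite_measure B by fact
  fix S assume "S \<in> sets (distr (A \<Otimes>\<^sub>M B) B snd)"
  then have S: "S \<in> sets B" by simp
  have "snd -` S \<inter> space (A \<Otimes>\<^sub>M B) = space A \<times> S"
    using sets.sets_into_space[OF S] by (auto simp: space_pair_measure)
  then show "emeasure (distr (A \<Otimes>\<^sub>M B) B snd) S = emeasure B S"
    using S by (simp add: emeasure_distr B.emeasure_pair_measure_Times A.emeasure_space_1)
qed simp

lemma distr_fst_pair:
  assumes "prob_space B"
  shows "distr (A \<Otimes>\<^sub>M B) A fst = A"
  using assms prob_space.distr_pair_fst by blast

context hermitian_scalars
begin

section \<open>Left and right invariance of matrices with independent Gaussian entries\<close>

abbreviation iid :: "nat \<Rightarrow> nat \<Rightarrow> 'a mat measure" where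
  "iid \<equiv> iid_mat_law \<nu>"

lemma prob_space_iid: "prob_space (iid m n)"
  by (rule prob_space_iid_mat_law[OF prob_space_\<nu> sets_\<nu>])

lemma sigma_finite_iid: "sigma_finite_measure (iid m n)"
  by (rule prob_space_imp_sigma_finite[OF prob_space_iid])

lemma sigma_finite_\<nu>: "sigma_finite_measure \<nu>"
  by (rule prob_space_imp_sigma_finite[OF prob_space_\<nu>])

lemmas iid_row_cons = iid_mat_law_row_cons[OF prob_space_\<nu> sets_\<nu>]
lemmas iid_col_cons = iid_mat_law_col_cons[OF prob_space_\<nu> sets_\<nu>]
lemmas iid_vec_cons = iid_mat_law_vec_cons[OF prob_space_\<nu> sets_\<nu>]

lemma row_cons_measurable_iid:
  "(\<lambda>(r, Z). row_cons r Z) \<in> iid 1 n \<Otimes>\<^sub>M iid m n \<rightarrow>\<^sub>M mat_borel (Suc m) n"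
  using measurable_row_cons by (rule measurable_cong_sets[THEN equalityD1, THEN subsetD,
      rotated -1]) (auto cong: sets_pair_measure_cong)

lemma col_cons_measurable_iid:
  "(\<lambda>(y, Y). col_cons y Y) \<in> iid m 1 \<Otimes>\<^sub>M iid m n \<rightarrow>\<^sub>M mat_borel m (Suc n)"
  using measurable_col_cons by (rule measurable_cong_sets[THEN equalityD1, THEN subsetD,
      rotated -1]) (auto cong: sets_pair_measure_cong)

lemma vec_cons_measurable_iid:
  "(\<lambda>(x, v). vec_cons x v) \<in> \<nu> \<Otimes>\<^sub>M iid m 1 \<rightarrow>\<^sub>M mat_borel (Suc m) 1"
  using measurable_vec_cons by (rule measurable_cong_sets[THEN equalityD1, THEN subsetD,
      rotated -1]) (auto cong: sets_pair_measure_cong)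

lemma left_mult_measurable:
  "(U :: 'a mat) \<in> carrier_mat m k \<Longrightarrow> (\<lambda>Y. U * Y) \<in> mat_borel k n \<rightarrow>\<^sub>M mat_borel m n"
  by (rule mat_mult_measurable[OF mat_const_measurable]) auto

text \<open>Invariance of a single Gaussian column is enough, since columns are independent.
  Singling out the matrices with this property, closed under products and block extension, replaces
  the claim that every unitary matrix has it.\<close>

definition preserves_gauss :: "nat \<Rightarrow> 'a mat \<Rightarrow> bool" where
  "preserves_gauss n U \<longleftrightarrow> U \<in> carrier_mat n n \<and> distr (iid n 1) (mat_borel n 1) (\<lambda>v. U * v) =
      iid n 1"

lemma preserves_gauss_one: "preserves_gauss n (1\<^sub>m n)"
  unfolding preserves_gauss_def
proof
  have "distr (iid n 1) (mat_borel n 1) (\<lambda>v. 1\<^sub>m n * v) = distr (iid n 1) (mat_borel n 1) (\<lambda>v. v)"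
    by (rule distr_cong) auto
  then show "distr (iid n 1) (mat_borel n 1) (\<lambda>v. 1\<^sub>m n * v) = iid n 1"
    by (simp add: distr_id2)
qed simp

lemma preserves_gauss_mult:
  assumes U: "preserves_gauss n U" and V: "preserves_gauss n V"
  shows "preserves_gauss n (U * V)"
  unfolding preserves_gauss_def
proof
  have car: "U \<in> carrier_mat n n" "V \<in> carrier_mat n n"
    using U V by (auto simp: preserves_gauss_def)
  then show "U * V \<in> carrier_mat n n" by simp
  have "distr (iid n 1) (mat_borel n 1) (\<lambda>v. U * V * v) =
      distr (iid n 1) (mat_borel n 1) ((\<lambda>v. U * v) \<circ> (\<lambda>v. V * v))"
    by (rule distr_cong) (use car in \<open>auto simp: assoc_mult_mat[of _ n n _ n _ 1]\<close>)
  also have "\<dots> = distr (distr (iid n 1) (mat_borel n 1) (\<lambda>v. V * v)) (mat_borel n 1) (\<lambda>v. U * v)"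
    by (rule distr_distr[symmetric]) (use left_mult_measurable[of _ n n 1] car in auto)
  also have "\<dots> = iid n 1" using U V by (simp add: preserves_gauss_def)
  finally show "distr (iid n 1) (mat_borel n 1) (\<lambda>v. U * V * v) = iid n 1" .
qed

lemma preserves_gauss_one_block:
  assumes U: "preserves_gauss n U"
  shows "preserves_gauss (Suc n) (one_block U)"
  unfolding preserves_gauss_def
proof
  have car: "U \<in> carrier_mat n n" using U by (auto simp: preserves_gauss_def)
  then show "one_block U \<in> carrier_mat (Suc n) (Suc n)" by simp
  note [measurable] = left_mult_measurable[OF car, of 1]
  have "distr (iid (Suc n) 1) (mat_borel (Suc n) 1) (\<lambda>v. one_block U * v) =
      distr (\<nu> \<Otimes>\<^sub>M iid n 1) (mat_borel (Suc n) 1) ((\<lambda>v. one_block U * v) \<circ> (\<lambda>(x, v). vec_cons x v))"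
    unfolding iid_vec_cons[of n]
    by (rule distr_distr[OF left_mult_measurable vec_cons_measurable_iid]) (use car in auto)
  also have "\<dots> = distr (\<nu> \<Otimes>\<^sub>M iid n 1) (mat_borel (Suc n) 1)
      ((\<lambda>(x, v). vec_cons x v) \<circ> (\<lambda>(x, v). (x, U * v)))"
    by (rule distr_cong) (use car in \<open>auto simp: one_block_mult_vec_cons space_pair_measure\<close>)
  also have "\<dots> = distr (distr (\<nu> \<Otimes>\<^sub>M iid n 1) (\<nu> \<Otimes>\<^sub>M mat_borel n 1) (\<lambda>(x, v). (x, U * v)))
      (mat_borel (Suc n) 1) (\<lambda>(x, v). vec_cons x v)"
    by (rule distr_distr[symmetric], use vec_cons_measurable_iid[of n] in
        \<open>simp cong: measurable_cong_sets sets_pair_measure_cong\<close>)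
      measurable
  also have "distr (\<nu> \<Otimes>\<^sub>M iid n 1) (\<nu> \<Otimes>\<^sub>M mat_borel n 1) (\<lambda>(x, v). (x, U * v)) =
      distr \<nu> \<nu> (\<lambda>x. x) \<Otimes>\<^sub>M distr (iid n 1) (mat_borel n 1) (\<lambda>v. U * v)"
    by (rule distr_map_prod[OF prob_space_\<nu> prob_space_iid]) measurable
  also have "\<dots> = \<nu> \<Otimes>\<^sub>M iid n 1"
    using U by (simp add: preserves_gauss_def distr_id)
  finally show "distr (iid (Suc n) 1) (mat_borel (Suc n) 1) (\<lambda>v. one_block U * v) = iid (Suc n) 1"
    by (simp only: iid_vec_cons[of n])
qed

text \<open>The top two entries are bracketed as one pair and the tail stays untouched, so the
  matrix acts on a single factor of a product law, where \<open>\<nu>2_align_rotation\<close>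
  applies. Most of the proof is this rebracketing.\<close>

lemma preserves_gauss_two_block:
  assumes p: "0 \<le> p" and qp: "(norm q)\<^sup>2 + p\<^sup>2 = 1"
  shows "preserves_gauss (Suc (Suc n)) (two_block n (conjugate q) (of_real p) (- of_real p) q)"
  unfolding preserves_gauss_def
proof
  let ?B = "two_block n (conjugate q) (of_real p) (- of_real p) q"
  let ?f = "\<lambda>z. vec_cons (fst (fst z)) (vec_cons (snd (fst z)) (snd z))"
  let ?g = "\<lambda>p. (fst (fst p), (snd (fst p), snd p))"
  let ?R = "\<lambda>(x, y). (conjugate q * x + of_real p * y, - of_real p * x + q * y)"
  let ?P = "(\<nu> \<Otimes>\<^sub>M \<nu>) \<Otimes>\<^sub>M iid n 1"
  note m1 [measurable] = vec_cons_measurable_iid[of n] vec_cons_measurable_iid[of "Suc n"]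
  have f [measurable]: "?f \<in> ?P \<rightarrow>\<^sub>M mat_borel (Suc (Suc n)) 1"
  proof -
    have "(\<lambda>z. (fst (fst z), vec_cons (snd (fst z)) (snd z))) \<in> ?P \<rightarrow>\<^sub>M \<nu> \<Otimes>\<^sub>M iid (Suc n) 1"
      using measurable_compose[of "\<lambda>z. (snd (fst z), snd z)" ?P, OF _ m1(1)]
      by (intro measurable_Pair) (auto simp: split_beta)
    from measurable_compose[OF this m1(2)] show ?thesis by (simp add: split_beta)
  qed
  have eq: "iid (Suc (Suc n)) 1 = distr ?P (mat_borel (Suc (Suc n)) 1) ?f"
  proof -
    have "iid (Suc (Suc n)) 1 = distr (\<nu> \<Otimes>\<^sub>M iid (Suc n) 1) (mat_borel (Suc (Suc n)) 1)
        (\<lambda>(x, v). vec_cons x v)"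
      by (rule iid_vec_cons)
    also have "\<nu> \<Otimes>\<^sub>M iid (Suc n) 1 = distr (\<nu> \<Otimes>\<^sub>M (\<nu> \<Otimes>\<^sub>M iid n 1)) (\<nu> \<Otimes>\<^sub>M mat_borel (Suc n) 1)
        (\<lambda>(x, p). (x, (\<lambda>(x, v). vec_cons x v) p))"
      by (subst distr_map_prod) (auto simp: prob_space_\<nu> prob_space_pair prob_space_iid distr_id
          m1(1)[unfolded One_nat_def] simp flip: iid_vec_cons[unfolded One_nat_def])
    also have "\<nu> \<Otimes>\<^sub>M (\<nu> \<Otimes>\<^sub>M iid n 1) = distr ?P (\<nu> \<Otimes>\<^sub>M (\<nu> \<Otimes>\<^sub>M iid n 1)) ?g"
      by (rule distr_pair_assoc[OF sigma_finite_\<nu> sigma_finite_\<nu> sigma_finite_iid, symmetric])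
    also have "distr (distr (distr ?P (\<nu> \<Otimes>\<^sub>M (\<nu> \<Otimes>\<^sub>M iid n 1)) ?g) (\<nu> \<Otimes>\<^sub>M mat_borel (Suc n) 1)
        (\<lambda>(x, p). (x, (\<lambda>(x, v). vec_cons x v) p)))
        (mat_borel (Suc (Suc n)) 1) (\<lambda>(x, v). vec_cons x v) =
            distr ?P (mat_borel (Suc (Suc n)) 1) ?f"
    proof -
      have a: "(\<lambda>(x, p). (x, (\<lambda>(x, v). vec_cons x v) p)) \<in>
          \<nu> \<Otimes>\<^sub>M (\<nu> \<Otimes>\<^sub>M iid n 1) \<rightarrow>\<^sub>M \<nu> \<Otimes>\<^sub>M mat_borel (Suc n) 1"
        unfolding split_beta using measurable_compose[OF measurable_snd m1(1)]
        by (intro measurable_Pair) (auto simp: split_beta)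
      have b: "(\<lambda>(x, v). vec_cons x v) \<in> \<nu> \<Otimes>\<^sub>M mat_borel (Suc n) 1 \<rightarrow>\<^sub>M mat_borel (Suc (Suc n)) 1"
        using m1(2) by (simp cong: measurable_cong_sets sets_pair_measure_cong)
      have c: "?g \<in> ?P \<rightarrow>\<^sub>M (\<nu> \<Otimes>\<^sub>M (\<nu> \<Otimes>\<^sub>M iid n 1))" by measurable
      show ?thesis
        unfolding distr_distr[OF a c] distr_distr[OF b measurable_comp[OF c a]]
        by (rule distr_cong) auto
    qed
    finally show ?thesis .
  qed
  have "distr (iid (Suc (Suc n)) 1) (mat_borel (Suc (Suc n)) 1) (\<lambda>v. ?B * v) =
      distr ?P (mat_borel (Suc (Suc n)) 1) ((\<lambda>v. ?B * v) \<circ> ?f)"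
    unfolding eq by (rule distr_distr[OF left_mult_measurable f]) auto
  also have "\<dots> = distr ?P (mat_borel (Suc (Suc n)) 1) (?f \<circ> (\<lambda>(z, v). (?R z, v)))"
  proof (rule distr_cong)
    fix z assume "z \<in> space ?P"
    then obtain x y v where z: "z = ((x, y), v)" and v: "v \<in> carrier_mat n 1"
      by (auto simp: space_pair_measure)
    have "?B * vec_cons x (vec_cons y v) = vec_cons (conjugate q * x + of_real p * y)
        (vec_cons (- of_real p * x + q * y) v)"
      by (subst two_block_mult[of _ _ 1]) (use v in \<open>auto intro!: eq_matI simp: vec_cons_def\<close>)
    then show "((\<lambda>v. ?B * v) \<circ> ?f) z = (?f \<circ> (\<lambda>(z, v). (?R z, v))) z"
      by (simp add: z)
  qed simp_all
  also have "\<dots> = distr (distr ?P ?P (\<lambda>(z, v). (?R z, v))) (mat_borel (Suc (Suc n)) 1) ?f"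
    by (rule distr_distr[symmetric]) measurable
  also have "distr ?P ?P (\<lambda>(z, v). (?R z, v)) =
      distr (\<nu> \<Otimes>\<^sub>M \<nu>) (\<nu> \<Otimes>\<^sub>M \<nu>) ?R \<Otimes>\<^sub>M distr (iid n 1) (iid n 1) (\<lambda>v. v)"
    by (rule distr_map_prod) (auto simp: prob_space_\<nu> prob_space_pair prob_space_iid)
  also have "\<dots> = ?P"
    by (subst \<nu>2_align_rotation[OF p qp]) (simp add: distr_id)
  finally show "distr (iid (Suc (Suc n)) 1) (mat_borel (Suc (Suc n)) 1) (\<lambda>v. ?B * v) =
      iid (Suc (Suc n)) 1"
    by (simp only: eq)
qed auto

lemma preserves_gauss_scalar_mat:
  assumes q: "norm q = 1"
  shows "preserves_gauss (Suc 0) (scalar_mat (conjugate q))"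
  unfolding preserves_gauss_def
proof
  note m = vec_cons_measurable_iid[of 0]
  have "distr (iid (Suc 0) 1) (mat_borel (Suc 0) 1) (\<lambda>v. scalar_mat (conjugate q) * v) =
      distr (\<nu> \<Otimes>\<^sub>M iid 0 1) (mat_borel (Suc 0) 1)
          ((\<lambda>v. scalar_mat (conjugate q) * v) \<circ> (\<lambda>(x, v). vec_cons x v))"
    unfolding iid_vec_cons[of 0]
    by (rule distr_distr[OF left_mult_measurable m]) auto
  also have "\<dots> = distr (\<nu> \<Otimes>\<^sub>M iid 0 1) (mat_borel (Suc 0) 1)
      ((\<lambda>(x, v). vec_cons x v) \<circ> (\<lambda>(x, v). (conjugate q * x, v)))"
    by (rule distr_cong) (auto simp: space_pair_measure vec_cons_def scalar_mat_def scalar_prod_def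
        intro!: eq_matI)
  also have "\<dots> = distr (distr (\<nu> \<Otimes>\<^sub>M iid 0 1) (\<nu> \<Otimes>\<^sub>M iid 0 1) (\<lambda>(x, v). (conjugate q * x, v)))
      (mat_borel (Suc 0) 1) (\<lambda>(x, v). vec_cons x v)"
    by (rule distr_distr[symmetric, OF m]) measurable
  also have "distr (\<nu> \<Otimes>\<^sub>M iid 0 1) (\<nu> \<Otimes>\<^sub>M iid 0 1) (\<lambda>(x, v). (conjugate q * x, v)) =
      distr \<nu> \<nu> (\<lambda>x. conjugate q * x) \<Otimes>\<^sub>M distr (iid 0 1) (iid 0 1) (\<lambda>v. v)"
    by (rule distr_map_prod[OF prob_space_\<nu> prob_space_iid]) auto
  also have "\<dots> = \<nu> \<Otimes>\<^sub>M iid 0 1"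
    by (simp add: \<nu>_mult_unit[OF q] distr_id)
  finally show "distr (iid (Suc 0) 1) (mat_borel (Suc 0) 1) (\<lambda>v. scalar_mat (conjugate q) * v) =
      iid (Suc 0) 1"
    by (simp only: iid_vec_cons[of 0])
qed simp

lemma preserves_gauss_align: "w \<in> carrier_mat n 1 \<Longrightarrow> preserves_gauss n (align n w)"
proof (induction n w rule: align.induct)
  case (3 n w)
  show ?case
    unfolding align.simps Let_def
    using 3 by (intro preserves_gauss_mult preserves_gauss_one_block preserves_gauss_two_block
        align_rotation) auto
qed (auto intro: preserves_gauss_one preserves_gauss_scalar_mat simp: norm_scalar_phase)

text \<open>\<open>U\<close> acts on each column separately and the columns are independent:
  induction on their number.\<close>

lemma iid_left_mult:
  assumes U: "preserves_gauss n U"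
  shows "distr (iid n k) (mat_borel n k) (\<lambda>Y. U * Y) = iid n k"
proof (induction k)
  have car: "U \<in> carrier_mat n n" using U by (simp add: preserves_gauss_def)
  {
    case 0
    have "distr (iid n 0) (mat_borel n 0) (\<lambda>Y. U * Y) = distr (iid n 0) (mat_borel n 0) (\<lambda>Y. Y)"
      by (rule distr_cong) (use car in \<open>auto intro!: eq_matI\<close>)
    then show ?case by (simp add: distr_id2)
  next
    case (Suc k)
    note [measurable] = left_mult_measurable[OF car]
    have "distr (iid n (Suc k)) (mat_borel n (Suc k)) (\<lambda>Y. U * Y) =
        distr (iid n 1 \<Otimes>\<^sub>M iid n k) (mat_borel n (Suc k)) ((\<lambda>Y. U * Y) \<circ> (\<lambda>(y, Y). col_cons y Y))"
      unfolding iid_col_cons[of n k]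
      by (rule distr_distr[OF left_mult_measurable col_cons_measurable_iid]) (use car in auto)
    also have "\<dots> = distr (iid n 1 \<Otimes>\<^sub>M iid n k) (mat_borel n (Suc k))
        ((\<lambda>(y, Y). col_cons y Y) \<circ> (\<lambda>(y, Y). (U * y, U * Y)))"
      by (rule distr_cong)
        (use car in \<open>auto simp: space_pair_measure col_cons_def scalar_prod_def intro!: eq_matI
            sum.cong\<close>)
    also have "\<dots> = distr (distr (iid n 1 \<Otimes>\<^sub>M iid n k) (mat_borel n 1 \<Otimes>\<^sub>M mat_borel n k)
        (\<lambda>(y, Y). (U * y, U * Y)))
        (mat_borel n (Suc k)) (\<lambda>(y, Y). col_cons y Y)"
      by (rule distr_distr[symmetric, OF measurable_col_cons]) measurable
    also have "distr (iid n 1 \<Otimes>\<^sub>M iid n k) (mat_borel n 1 \<Otimes>\<^sub>M mat_borel n k)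
        (\<lambda>(y, Y). (U * y, U * Y)) =
        distr (iid n 1) (mat_borel n 1) (\<lambda>y. U * y) \<Otimes>\<^sub>M distr (iid n k) (mat_borel n k) (\<lambda>Y. U * Y)"
      by (rule distr_map_prod[OF prob_space_iid prob_space_iid]) measurable
    also have "\<dots> = iid n 1 \<Otimes>\<^sub>M iid n k"
      using U Suc by (simp add: preserves_gauss_def)
    finally show ?case by (simp only: iid_col_cons[of n k])
  }
qed

text \<open>The adjoint permutes the positions, which an i.i.d. family does not notice, and
  conjugates every entry, which preserves \<nu>.\<close>

lemma iid_conj_transpose: "distr (iid m n) (mat_borel n m) conj_transpose = iid n m"
proof -
  let ?K = "{..<m} \<times> {..<n}" and ?L = "{..<n} \<times> {..<m}"
  note [measurable] = measurable_mat'[OF sets_\<nu>]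
      conj_transpose_measurable[OF measurable_ident_sets[OF refl], of m n]
  have prod: "product_prob_space (\<lambda>_. \<nu>)"
    by (simp add: product_prob_space.intro product_prob_space_axioms.intro
        product_sigma_finite.intro sigma_finite_\<nu> prob_space_\<nu>)
  have r [measurable]: "(\<lambda>\<omega>. \<lambda>k\<in>?L. \<omega> (prod.swap k)) \<in> Pi\<^sub>M ?K (\<lambda>_. \<nu>) \<rightarrow>\<^sub>M Pi\<^sub>M ?L (\<lambda>_. \<nu>)"
    by (rule measurable_restrict) auto
  have c [measurable]: "compose ?L conjugate \<in> Pi\<^sub>M ?L (\<lambda>_. \<nu>) \<rightarrow>\<^sub>M Pi\<^sub>M ?L (\<lambda>_. \<nu>)"
    unfolding compose_def by (rule measurable_restrict) measurable
  have swap: "distr (Pi\<^sub>M ?K (\<lambda>_. \<nu>)) (Pi\<^sub>M ?L (\<lambda>_. \<nu>)) (\<lambda>\<omega>. \<lambda>k\<in>?L. \<omega> (prod.swap k)) =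
      Pi\<^sub>M ?L (\<lambda>_. \<nu>)"
    by (rule distr_PiM_reindex) (auto simp: prob_space_\<nu> inj_on_def)
  have "distr (iid m n) (mat_borel n m) conj_transpose =
      distr (Pi\<^sub>M ?K (\<lambda>_. \<nu>)) (mat_borel n m) (conj_transpose \<circ> mat m n)"
    unfolding iid_mat_law_def by (rule distr_distr) auto
  also have "\<dots> = distr (Pi\<^sub>M ?K (\<lambda>_. \<nu>)) (mat_borel n m)
      (mat n m \<circ> (compose ?L conjugate \<circ> (\<lambda>\<omega>. \<lambda>k\<in>?L. \<omega> (prod.swap k))))"
    by (rule distr_cong) (auto simp: compose_def intro!: eq_matI)
  also have "\<dots> = distr (distr (Pi\<^sub>M ?K (\<lambda>_. \<nu>)) (Pi\<^sub>M ?L (\<lambda>_. \<nu>))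
      (compose ?L conjugate \<circ> (\<lambda>\<omega>. \<lambda>k\<in>?L. \<omega> (prod.swap k)))) (mat_borel n m) (mat n m)"
    by (rule distr_distr[symmetric]) (auto intro: measurable_comp[OF r c])
  also have "distr (Pi\<^sub>M ?K (\<lambda>_. \<nu>)) (Pi\<^sub>M ?L (\<lambda>_. \<nu>))
      (compose ?L conjugate \<circ> (\<lambda>\<omega>. \<lambda>k\<in>?L. \<omega> (prod.swap k))) =
      distr (distr (Pi\<^sub>M ?K (\<lambda>_. \<nu>)) (Pi\<^sub>M ?L (\<lambda>_. \<nu>)) (\<lambda>\<omega>. \<lambda>k\<in>?L. \<omega> (prod.swap k)))
          (Pi\<^sub>M ?L (\<lambda>_. \<nu>)) (compose ?L conjugate)"
    by (rule distr_distr[symmetric, OF c r])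
  also have "\<dots> = Pi\<^sub>M ?L (\<lambda>_. \<nu>)"
    unfolding swap
    by (subst distr_PiM_finite_prob_space[OF _ prod prod]) (auto simp: \<nu>_conj)
  finally show ?thesis by (simp add: iid_mat_law_def)
qed

lemma conj_transpose_meas [measurable]: "conj_transpose \<in>
    mat_borel m n \<rightarrow>\<^sub>M (mat_borel n m :: 'a mat measure)"
  by (rule conj_transpose_measurable) (rule measurable_ident_sets[OF refl])

text \<open>Right multiplication by \<open>U^H\<close> is left multiplication by U between two
  adjoints.\<close>

lemma iid_right_mult:
  assumes U: "preserves_gauss n U"
  shows "distr (iid m n) (mat_borel m n) (\<lambda>Y. Y * conj_transpose U) = iid m n"
proof -
  have car: "U \<in> carrier_mat n n" using U by (simp add: preserves_gauss_def)
  note m = left_mult_measurable[OF car, of m]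
  have "distr (iid m n) (mat_borel m n) (\<lambda>Y. Y * conj_transpose U) =
      distr (iid m n) (mat_borel m n) (conj_transpose \<circ> ((\<lambda>Y. U * Y) \<circ> conj_transpose))"
    by (rule distr_cong) (use car in \<open>auto simp: conj_transpose_mult[of _ n n _ m]\<close>)
  also have "\<dots> = distr (distr (distr (iid m n) (mat_borel n m) conj_transpose) (mat_borel n m)
      (\<lambda>Y. U * Y)) (mat_borel m n) conj_transpose"
    by (subst distr_distr) (auto intro!: distr_distr[symmetric] measurable_comp[OF _ m] m)
  finally show ?thesis
    by (simp add: iid_conj_transpose iid_left_mult[OF U])
qed

end

section \<open>Norms of Gaussian vectors\<close>

text \<open>Integration in polar coordinates without a measure on the sphere: the ball of radius r
  has volume V r^d, and the density is the derivative of this. Half-lines are stable under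
  intersection and generate the Borel sets, so comparing distribution functions suffices.\<close>

lemma distr_lborel_euclidean_norm:
  assumes I: "finite I" "I \<noteq> {}"
  shows "distr (Pi\<^sub>M I (\<lambda>_. lborel)) borel (\<lambda>f. sqrt (\<Sum>i\<in>I. (f i)\<^sup>2)) =
    density lborel (\<lambda>r. ennreal (if 0 < r then real (card I) * unit_ball_vol (card I) * r ^
        (card I - 1) else 0))"
    (is "?M = ?N")
proof (rule measure_eqI_generator_eq[where \<Omega> = UNIV and E = "range (\<lambda>a :: real. {..a})" and A =
    "\<lambda>n. {..real n}"])
  define d where "d = card I"
  have d: "0 < d" using I by (simp add: d_def card_gt_0_iff)
  let ?V = "unit_ball_vol (real d)"
  have V: "0 \<le> ?V" by (simp add: unit_ball_vol_nonneg)
  show "Int_stable (range (\<lambda>a :: real. {..a}))"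
  proof (rule Int_stableI)
    fix A B assume "A \<in> range (\<lambda>a :: real. {..a})" "B \<in> range (\<lambda>a :: real. {..a})"
    then obtain a b where "A = {..a}" "B = {..b}" by auto
    then have "A \<inter> B = {..min a b}" by auto
    then show "A \<inter> B \<in> range (\<lambda>a :: real. {..a})" by auto
  qed
  show "sets ?M = sigma_sets UNIV (range (\<lambda>a :: real. {..a}))"
      "sets ?N = sigma_sets UNIV (range (\<lambda>a :: real. {..a}))"
    by (simp_all add: borel_eq_atMost)
  show "(\<Union>n. {..real n}) = UNIV" using real_arch_simple by auto
  have M: "emeasure ?M {..r} = emeasure (Pi\<^sub>M I (\<lambda>_. lborel))
      ({f. sqrt (\<Sum>i\<in>I. (f i)\<^sup>2) \<le> r} \<inter> space (Pi\<^sub>M I (\<lambda>_. lborel)))" for r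
    by (subst emeasure_distr) (auto intro!: arg_cong2[where f = emeasure])
  have Mpos: "emeasure ?M {..r} = ennreal (?V * r ^ d)" if "0 < r" for r
    unfolding M emeasure_cball_aux[OF I(1) that] d_def ..
  \<comment> \<open>The volume formula needs a positive radius; for the other half-lines the mass is
    squeezed between 0 and the volumes of balls of radius \<open>1 / (k + 1)\<close>.\<close>
  have Mzero: "emeasure ?M {..r} = 0" if "r \<le> 0" for r
  proof -
    have "emeasure ?M {..r} \<le> ennreal (?V * (1 / real (Suc k)) ^ d)" for k
    proof -
      have "emeasure ?M {..r} \<le> emeasure ?M {..1 / real (Suc k)}"
        using that by (intro emeasure_mono) (auto intro: order_trans)
      then show ?thesis by (subst (asm) (2) Mpos) auto
    qed
    moreover have "(\<lambda>k. ?V * (1 / real (Suc k)) ^ d) \<longlonglongrightarrow> ?V * 0 ^ d"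
      by (intro tendsto_intros LIMSEQ_Suc lim_1_over_n)
    then have "(\<lambda>k. ennreal (?V * (1 / real (Suc k)) ^ d)) \<longlonglongrightarrow> ennreal 0"
      using d by (intro tendsto_ennrealI) (simp add: power_0_left)
    ultimately have "emeasure ?M {..r} \<le> ennreal 0"
      by (intro LIMSEQ_le_const) auto
    then show ?thesis by simp
  qed
  have N: "emeasure ?N {..r} = (\<integral>\<^sup>+x. ennreal (if 0 < x then d * ?V * x ^ (d - 1) else 0) *
      indicator {..r} x \<partial>lborel)" for r
    unfolding d_def by (subst emeasure_density) auto
  have Npos: "emeasure ?N {..r} = ennreal (?V * r ^ d)" if "0 < r" for r
  proof -
    have "emeasure ?N {..r} = (\<integral>\<^sup>+x. ennreal (d * ?V * x ^ (d - 1)) * indicator {0..r} x \<partial>lborel)"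
      unfolding N
    proof (rule nn_integral_cong_AE)
      \<comment> \<open>For \<open>d = 1\<close> the integrands differ at 0, where
        \<open>x ^ (d - 1)\<close> is 1 and the other branch gives 0.\<close>
      show "AE x in lborel. ennreal (if 0 < x then d * ?V * x ^ (d - 1) else 0) * indicator {..r} x
          =
          ennreal (d * ?V * x ^ (d - 1)) * indicator {0..r} x"
        using AE_lborel_singleton[of "0 :: real"] by eventually_elim (auto simp: indicator_def)
    qed
    also have "\<dots> = ennreal (?V * r ^ d - ?V * 0 ^ d)"
      using that V by (intro nn_integral_FTC_Icc) (auto intro!: derivative_eq_intros)
    finally show ?thesis using d by (simp add: power_0_left)
  qed
  have Nzero: "emeasure ?N {..r} = 0" if "r \<le> 0" for r
    unfolding N using that by (subst nn_integral_0_iff_AE) (auto simp: indicator_def)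
  show "emeasure ?M X = emeasure ?N X" if X: "X \<in> range (\<lambda>a :: real. {..a})" for X
  proof -
    from X obtain r where [simp]: "X = {..r}" by auto
    show ?thesis by (cases "0 < r") (simp_all add: Mpos Npos Mzero Nzero)
  qed
  show "emeasure ?M {..real n} \<noteq> \<infinity>" for n
    by (cases "0 < real n") (simp_all add: Mpos Mzero)
qed auto

text \<open>The Gaussian density depends on the vector only through its norm, so it passes through
  the pushforward and multiplies the density from polar coordinates. The powers of pi from the ball
  volume and from the normal density cancel.\<close>

lemma distr_normal_euclidean_norm:
  assumes I: "finite I" "I \<noteq> {}"
  shows "distr (Pi\<^sub>M I (\<lambda>_. normal_law 1)) borel (\<lambda>f. sqrt (\<Sum>i\<in>I. (f i)\<^sup>2)) =
      chi_law (real (card I))"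
proof -
  define d where "d = card I"
  have d: "0 < d" using I by (simp add: d_def card_gt_0_iff)
  let ?R = "\<lambda>f. sqrt (\<Sum>i\<in>I. (f i)\<^sup>2)"
  let ?g = "\<lambda>r. ennreal ((1 / sqrt (2 * pi)) ^ d * exp (- r\<^sup>2 / 2))"
  have "Pi\<^sub>M I (\<lambda>_. normal_law 1) = density (Pi\<^sub>M I (\<lambda>_. lborel)) (\<lambda>f. ?g (?R f))"
    unfolding PiM_normal_law[OF I(1)]
  proof (rule density_cong)
    show "AE f in Pi\<^sub>M I (\<lambda>_. lborel). (\<Prod>i\<in>I. ennreal (normal_density 0 1 (f i))) = ?g (?R f)"
    proof (rule AE_I2)
      fix f :: "'a \<Rightarrow> real"
      have "exp (- (?R f)\<^sup>2 / 2) = (\<Prod>i\<in>I. exp (- (f i)\<^sup>2 / 2))"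
        using I(1) by (simp add: sum_nonneg exp_sum[symmetric] sum_negf sum_divide_distrib)
      moreover have "(\<Prod>i\<in>I. normal_density 0 1 (f i)) =
          (\<Prod>i\<in>I. (1 / sqrt (2 * pi)) * exp (- (f i)\<^sup>2 / 2))"
        by (rule prod.cong) (auto simp: normal_density_def)
      ultimately show "(\<Prod>i\<in>I. ennreal (normal_density 0 1 (f i))) = ?g (?R f)"
        by (simp add: prod_ennreal prod_dividef power_one_over d_def)
    qed
  qed (use I in measurable)
  then have "distr (Pi\<^sub>M I (\<lambda>_. normal_law 1)) borel ?R =
      density (distr (Pi\<^sub>M I (\<lambda>_. lborel)) borel ?R) ?g"
    by (simp add: density_distr)
  also have "\<dots> = density lborel (\<lambda>r. ennreal (if 0 < r then d * unit_ball_vol d * r ^ (d - 1) else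
      0) * ?g r)"
    unfolding distr_lborel_euclidean_norm[OF I] d_def[symmetric] by (rule density_density_eq)
        measurable
  also have "\<dots> = chi_law (real d)"
    unfolding chi_law_def
  proof (intro density_cong AE_I2)
    fix r :: real
    have "d * unit_ball_vol d * r ^ (d - 1) * ((1 / sqrt (2 * pi)) ^ d * exp (- r\<^sup>2 / 2)) =
        2 powr (1 - real d / 2) / Gamma (real d / 2) * r powr (real d - 1) * exp
            (- r\<^sup>2 / 2)" if r: "0 < r"
    proof -
      have "Gamma (real d / 2 + 1) = real d / 2 * Gamma (real d / 2)"
        using d by (intro Gamma_plus1) (auto elim!: nonpos_Ints_cases)
      \<comment> \<open>The ball volume has \<open>Gamma (d / 2 + 1)\<close> in its denominator; the
        recurrence of Gamma turns this into \<open>d / 2 * Gamma (d / 2)\<close>, and the factor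
        \<open>d\<close> cancels against the one on the left.\<close>
      then have V: "d * unit_ball_vol d = 2 * pi powr (real d / 2) / Gamma (real d / 2)"
        unfolding unit_ball_vol_def using d by (simp only:) simp
      have "(1 / sqrt (2 * pi)) ^ d = (2 * pi) powr (- (real d / 2))"
      proof -
        have "1 / sqrt (2 * pi) = (2 * pi) powr (- (1 / 2))"
          by (simp only: powr_minus powr_half_sqrt pi_ge_zero mult_nonneg_nonneg zero_le_numeral
              inverse_eq_divide)
        then have "(1 / sqrt (2 * pi)) ^ d = ((2 * pi) powr (- (1 / 2))) powr real d"
          using powr_realpow[of "(2 * pi) powr (- (1 / 2))" d] by (simp del: powr_realpow)
        then show ?thesis by (simp only: powr_powr) simp
      qed
      then have P: "(1 / sqrt (2 * pi)) ^ d = 2 powr (- (real d / 2)) * pi powr (- (real d / 2))"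
        by (simp add: powr_mult)
      have "r ^ (d - 1) = r powr (real d - 1)"
        using r d by (simp add: of_nat_diff flip: powr_realpow)
      moreover have "2 * (2 powr (- (real d / 2))) = 2 powr (1 - real d / 2)"
        using powr_add[of 2 1 "- (real d / 2)"] by simp
      moreover have "pi powr (real d / 2) * pi powr (- (real d / 2)) = 1"
        by (simp flip: powr_add)
      moreover have "2 * P / G * x * (t * P' * e) = (2 * t) / G * x * e * (P * P')" for P G x t P' e
          :: real
        by simp
      ultimately show ?thesis unfolding V P by (simp only: mult_1_right)
    qed
    then show "ennreal (if 0 < r then d * unit_ball_vol d * r ^ (d - 1) else 0) * ?g r =
        ennreal (if 0 < r then 2 powr (1 - real d / 2) / Gamma (real d / 2) * r powr (real d - 1) *
            exp (- r\<^sup>2 / 2) else 0)"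
      by (auto simp flip: ennreal_mult'')
  qed auto
  finally show ?thesis by (simp add: d_def)
qed

text \<open>The two normalizations of the chi law: coordinates of variance 1 lead to
  \<open>chi_law\<close>, coordinates of variance 1/2 to \<open>chi_tilde_law\<close>.\<close>

lemma chi_law_scale:
  assumes k: "0 < k"
  shows "distr (chi_law k) borel (\<lambda>x. x / sqrt 2) = chi_tilde_law k"
proof -
  let ?c = "1 / sqrt 2 :: real"
  let ?g = "\<lambda>x. ennreal (if 0 < x then 2 / Gamma (k / 2) * x powr (k - 1) * exp (- x\<^sup>2) else 0)"
  have "chi_tilde_law k = density lborel ?g"
    by (simp add: chi_tilde_law_def)
  also have "lborel = density (distr lborel borel (\<lambda>x. 0 + ?c * x)) (\<lambda>_. ennreal \<bar>?c\<bar>)"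
    by (rule lborel_real_affine) simp
  also have "density \<dots> ?g = density (distr lborel borel (\<lambda>x. 0 + ?c * x)) (\<lambda>x. ennreal \<bar>?c\<bar> * ?g x)"
    by (rule density_density_eq) measurable
  also have "\<dots> = distr (density lborel (\<lambda>x. ennreal \<bar>?c\<bar> * ?g (0 + ?c * x))) borel (\<lambda>x. 0 + ?c * x)"
    by (rule density_distr) measurable
  also have "density lborel (\<lambda>x. ennreal \<bar>?c\<bar> * ?g (0 + ?c * x)) = chi_law k"
    unfolding chi_law_def
  proof (intro density_cong AE_I2)
    fix x :: real
    have "?c * (2 / Gamma (k / 2) * (?c * x) powr (k - 1) * exp (- (?c * x)\<^sup>2)) =
        2 powr (1 - k / 2) / Gamma (k / 2) * x powr (k - 1) * exp (- x\<^sup>2 / 2)" if x: "0 < x"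
    proof -
      have c: "?c = 2 powr (- (1 / 2))"
        by (simp only: powr_minus powr_half_sqrt zero_le_numeral inverse_eq_divide)
      have "?c * 2 * ?c powr (k - 1) = 2 powr (- (1 / 2)) * 2 powr 1 * 2 powr (- (1 / 2) * (k - 1))"
        unfolding c by (simp add: powr_powr)
      also have "\<dots> = 2 powr (1 - k / 2)"
        unfolding powr_add[symmetric] by (simp add: field_simps)
      finally have "?c * 2 * ?c powr (k - 1) = 2 powr (1 - k / 2)" .
      moreover have "(?c * x) powr (k - 1) = ?c powr (k - 1) * x powr (k - 1)"
        using x by (intro powr_mult)
      moreover have "- (?c * x)\<^sup>2 = - x\<^sup>2 / 2"
        by (simp add: power_mult_distrib power_divide)
      moreover have "c * (2 / G * (c' * y) * e) = c * 2 * c' / G * y * e" for c G c' y e :: real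
        by simp
      ultimately show ?thesis by (simp only:)
    qed
    note eq = this
    show "ennreal \<bar>?c\<bar> * ?g (0 + ?c * x) =
        ennreal (if 0 < x then 2 powr (1 - k / 2) / Gamma (k / 2) * x powr (k - 1) * exp (- x\<^sup>2 / 2)
            else 0)"
    proof (cases "0 < x")
      case True
      then have "ennreal \<bar>?c\<bar> * ?g (0 + ?c * x) =
          ennreal (?c * (2 / Gamma (k / 2) * (?c * x) powr (k - 1) * exp (- (?c * x)\<^sup>2)))"
        by (subst ennreal_mult') auto
      with True show ?thesis by (simp only: eq if_True)
    qed (simp add: zero_less_divide_iff)
  qed auto
  finally show ?thesis by (simp add: divide_inverse mult.commute)
qed

lemma hs_norm_meas [measurable]: "(hs_norm :: 'a :: euclidean_space mat \<Rightarrow> real) \<in>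
    mat_borel m n \<rightarrow>\<^sub>M borel"
  using hs_norm_measurable[OF measurable_ident_sets[OF refl], of m n] by simp

context hermitian_scalars
begin

text \<open>Every \<nu>-variable contributes \<open>DIM('a)\<close> independent normal coordinates.
  The induction removes one variable on the left and the whole group of its coordinates on the
  right.\<close>

lemma distr_\<nu>_norm_sum:
  fixes K :: "'k set"
  assumes "finite K"
  shows "distr (Pi\<^sub>M K (\<lambda>_. \<nu>)) borel (\<lambda>x. \<Sum>k\<in>K. (norm (x k))\<^sup>2) =
    distr (Pi\<^sub>M (K \<times> (Basis :: 'a set)) (\<lambda>_. normal_law 1)) borel (\<lambda>f. \<Sum>k\<in>K \<times> Basis. (f k)\<^sup>2)"
  using assms
proof (induction K)
  case empty
  have "prob_space (Pi\<^sub>M {} (\<lambda>_ :: 'k. \<nu>))" "prob_space (Pi\<^sub>M {} (\<lambda>_ :: 'k \<times> 'a. normal_law 1))"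
    by (auto intro: prob_space_PiM)
  then show ?case
    by (simp add: prob_space.distr_const)
next
  case (insert k K)
  let ?N = "\<lambda>I. Pi\<^sub>M I (\<lambda>_. normal_law 1)"
  let ?B = "Basis :: 'a set"
  have sumsq [measurable]: "(\<lambda>f. \<Sum>i\<in>I. (f i)\<^sup>2) \<in> borel_measurable (?N I)" for I :: "'i set"
    by measurable
  have sumnu [measurable]: "(\<lambda>x. \<Sum>k\<in>K. (norm (x k))\<^sup>2) \<in> borel_measurable (Pi\<^sub>M K (\<lambda>_. \<nu>))" for K ::
      "'k set"
    by measurable
  have p: "prob_space (Pi\<^sub>M K (\<lambda>_. \<nu>))" "prob_space (?N I)" for I :: "'i set"
    by (auto intro: prob_space_PiM prob_space_\<nu> prob_space_normal_law)
  have pN: "prob_space (?N (K \<times> ?B))" "prob_space (?N ?B)"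
    by (auto intro: prob_space_PiM prob_space_normal_law)
  have one: "distr \<nu> borel (\<lambda>x. (norm x)\<^sup>2) = distr (?N ?B) borel (\<lambda>f. \<Sum>b\<in>?B. (f b)\<^sup>2)"
  proof -
    have "(norm (\<Sum>b\<in>?B. f b *\<^sub>R b))\<^sup>2 = (\<Sum>b\<in>?B. (f b)\<^sup>2)" for f
      unfolding power2_norm_eq_inner by (subst euclidean_inner) (simp add: power2_eq_square)
    then show ?thesis
      unfolding \<nu>_coords by (subst distr_distr) (auto simp: comp_def)
  qed
  have "distr (Pi\<^sub>M (insert k K) (\<lambda>_. \<nu>)) borel (\<lambda>x. \<Sum>k\<in>insert k K. (norm (x k))\<^sup>2) =
      distr (\<nu> \<Otimes>\<^sub>M Pi\<^sub>M K (\<lambda>_. \<nu>)) borel ((\<lambda>x. \<Sum>k\<in>insert k K. (norm (x k))\<^sup>2) \<circ>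
          (\<lambda>(x, X). X(k := x)))"
    by (subst distr_pair_PiM_eq_PiM[of K "\<lambda>_. \<nu>" k, symmetric], (simp_all add: prob_space_\<nu>)[2],
        rule distr_distr) measurable
  also have "\<dots> = distr (\<nu> \<Otimes>\<^sub>M Pi\<^sub>M K (\<lambda>_. \<nu>)) borel
      ((\<lambda>(a, b). a + b) \<circ> (\<lambda>(x, X). ((norm x)\<^sup>2, \<Sum>k\<in>K. (norm (X k))\<^sup>2)))"
    using insert by (intro distr_cong) (auto intro!: sum.cong)
  also have "\<dots> = distr (distr (\<nu> \<Otimes>\<^sub>M Pi\<^sub>M K (\<lambda>_. \<nu>)) (borel \<Otimes>\<^sub>M borel)
      (\<lambda>(x, X). ((norm x)\<^sup>2, \<Sum>k\<in>K. (norm (X k))\<^sup>2))) borel (\<lambda>(a, b). a + b)"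
    by (rule distr_distr[symmetric]) measurable
  also have "distr (\<nu> \<Otimes>\<^sub>M Pi\<^sub>M K (\<lambda>_. \<nu>)) (borel \<Otimes>\<^sub>M borel)
      (\<lambda>(x, X). ((norm x)\<^sup>2, \<Sum>k\<in>K. (norm (X k))\<^sup>2)) =
      distr (?N ?B) borel (\<lambda>f. \<Sum>b\<in>?B. (f b)\<^sup>2) \<Otimes>\<^sub>M distr (?N (K \<times> ?B)) borel
          (\<lambda>f. \<Sum>k\<in>K \<times> ?B. (f k)\<^sup>2)"
    unfolding one[symmetric] insert.IH[symmetric] by (rule distr_map_prod[OF prob_space_\<nu> p(1)])
        measurable
  also have "\<dots> = distr (?N ?B \<Otimes>\<^sub>M ?N (K \<times> ?B)) (borel \<Otimes>\<^sub>M borel)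
      (\<lambda>(f, g). (\<Sum>b\<in>?B. (f b)\<^sup>2, \<Sum>k\<in>K \<times> ?B. (g k)\<^sup>2))"
    by (rule distr_map_prod[symmetric, OF pN(2,1)]) measurable
  also have "distr \<dots> borel (\<lambda>(a, b). a + b) = distr (?N ?B \<Otimes>\<^sub>M ?N (K \<times> ?B)) borel
      ((\<lambda>(a, b). a + b) \<circ> (\<lambda>(f, g). (\<Sum>b\<in>?B. (f b)\<^sup>2, \<Sum>k\<in>K \<times> ?B. (g k)\<^sup>2)))"
    by (rule distr_distr) measurable
  also have "\<dots> = distr (?N (insert k K \<times> ?B)) borel (\<lambda>f. \<Sum>k\<in>insert k K \<times> ?B. (f k)\<^sup>2)"
  proof -
    define h where "h = (\<lambda>(k', b :: 'a). if k' = k then Inl b else Inr (k', b))"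
    have h: "bij_betw h (insert k K \<times> ?B) (?B <+> K \<times> ?B)"
      by (rule bij_betwI[of _ _ _ "case_sum (\<lambda>b. (k, b)) (\<lambda>z. z)"])
        (use insert in \<open>auto simp: h_def split: if_splits\<close>)
    note split = PiM_split[OF _ h, of "\<lambda>_. normal_law 1" "\<lambda>_. normal_law 1" "\<lambda>_. normal_law 1"]
    have s1: "distr (?N ?B \<Otimes>\<^sub>M ?N (K \<times> ?B)) (?N (insert k K \<times> ?B))
        (\<lambda>(x, y). \<lambda>z\<in>insert k K \<times> ?B. case_sum x y (h z)) = ?N (insert k K \<times> ?B)"
      by (rule split(1)) (use insert in \<open>auto simp: prob_space_normal_law split: sum.split\<close>)
    have s2: "(\<lambda>(x, y). \<lambda>z\<in>insert k K \<times> ?B. case_sum x y (h z)) \<in>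
        ?N ?B \<Otimes>\<^sub>M ?N (K \<times> ?B) \<rightarrow>\<^sub>M ?N (insert k K \<times> ?B)"
      by (rule split(2)) (use insert in \<open>auto simp: prob_space_normal_law split: sum.split\<close>)
    have "distr (?N (insert k K \<times> ?B)) borel (\<lambda>f. \<Sum>k\<in>insert k K \<times> ?B. (f k)\<^sup>2) =
        distr (?N ?B \<Otimes>\<^sub>M ?N (K \<times> ?B)) borel ((\<lambda>f. \<Sum>k\<in>insert k K \<times> ?B. (f k)\<^sup>2) \<circ>
            (\<lambda>(x, y). \<lambda>z\<in>insert k K \<times> ?B. case_sum x y (h z)))"
      by (subst s1[symmetric], rule distr_distr[OF _ s2]) measurable
    also have "\<dots> = distr (?N ?B \<Otimes>\<^sub>M ?N (K \<times> ?B)) borel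
      ((\<lambda>(a, b). a + b) \<circ> (\<lambda>(f, g). (\<Sum>b\<in>?B. (f b)\<^sup>2, \<Sum>k\<in>K \<times> ?B. (g k)\<^sup>2)))"
    proof (rule distr_cong)
      fix z assume "z \<in> space (?N ?B \<Otimes>\<^sub>M ?N (K \<times> ?B))"
      obtain f g where [simp]: "z = (f, g)" by fastforce
      have "(\<Sum>z\<in>insert k K \<times> ?B. (case_sum f g (h z))\<^sup>2) = (\<Sum>z\<in>?B <+> K \<times> ?B. (case_sum f g z)\<^sup>2)"
        by (rule sum.reindex_bij_betw[OF h])
      also have "\<dots> = (\<Sum>b\<in>?B. (f b)\<^sup>2) + (\<Sum>k\<in>K \<times> ?B. (g k)\<^sup>2)"
        using insert by (subst sum.Plus) auto
      finally show "((\<lambda>f. \<Sum>k\<in>insert k K \<times> ?B. (f k)\<^sup>2) \<circ>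
          (\<lambda>(x, y). \<lambda>z\<in>insert k K \<times> ?B. case_sum x y (h z))) z =
          ((\<lambda>(a, b). a + b) \<circ> (\<lambda>(f, g). (\<Sum>b\<in>?B. (f b)\<^sup>2, \<Sum>k\<in>K \<times> ?B. (g k)\<^sup>2))) z"
        by simp
    qed auto
    finally show ?thesis by simp
  qed
  finally show ?case .
qed

text \<open>There are \<open>m * n\<close> entries with \<open>DIM('a)\<close> real coordinates
  each; this is the source of the factor \<beta> in all chi parameters.\<close>

lemma distr_iid_hs_norm:
  assumes "0 < m" "0 < n"
  shows "distr (iid m n) borel hs_norm = chi_law (DIM('a) * real (m * n))"
proof -
  let ?K = "{..<m} \<times> {..<n}"
  note [measurable] = measurable_mat'[OF sets_\<nu>]
  have "distr (iid m n) borel hs_norm = distr (Pi\<^sub>M ?K (\<lambda>_. \<nu>)) borel (hs_norm \<circ> mat m n)"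
    unfolding iid_mat_law_def by (rule distr_distr) measurable
  also have "\<dots> = distr (Pi\<^sub>M ?K (\<lambda>_. \<nu>)) borel (sqrt \<circ> (\<lambda>x. \<Sum>k\<in>?K. (norm (x k))\<^sup>2))"
    by (rule distr_cong) (auto simp: hs_norm_def sum.cartesian_product)
  also have "\<dots> = distr (distr (Pi\<^sub>M ?K (\<lambda>_. \<nu>)) borel (\<lambda>x. \<Sum>k\<in>?K. (norm (x k))\<^sup>2)) borel sqrt"
    by (rule distr_distr[symmetric]) measurable
  also have "\<dots> = distr (distr (Pi\<^sub>M (?K \<times> (Basis :: 'a set)) (\<lambda>_. normal_law 1)) borel
      (\<lambda>f. \<Sum>k\<in>?K \<times> Basis. (f k)\<^sup>2)) borel sqrt"
    by (subst distr_\<nu>_norm_sum) auto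
  also have "\<dots> = distr (Pi\<^sub>M (?K \<times> (Basis :: 'a set)) (\<lambda>_. normal_law 1)) borel
      (\<lambda>f. sqrt (\<Sum>k\<in>?K \<times> Basis. (f k)\<^sup>2))"
    by (subst distr_distr) (auto simp: comp_def)
  also have "\<dots> = chi_law (real (card (?K \<times> (Basis :: 'a set))))"
    by (rule distr_normal_euclidean_norm) (use assms in auto)
  finally show ?thesis by (simp add: card_cartesian_product mult_ac)
qed

text \<open>Total mass 1 is read off from the fact that this is the law of a norm, so no Gamma
  integral has to be evaluated.\<close>

lemma prob_space_chi_law:
  assumes "0 < j"
  shows "prob_space (chi_law (DIM('a) * real j))"
proof -
  have "prob_space (distr (iid j 1) borel hs_norm)"
    by (rule prob_space.prob_space_distr[OF prob_space_iid]) measurable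
  then show ?thesis using distr_iid_hs_norm[of j 1] assms by simp
qed

lemma prob_space_chi_tilde_law:
  assumes "0 < j"
  shows "prob_space (chi_tilde_law (DIM('a) * real j))"
proof -
  have "prob_space (distr (chi_law (DIM('a) * real j)) borel (\<lambda>x. x / sqrt 2))"
    by (rule prob_space.prob_space_distr[OF prob_space_chi_law[OF assms]]) (simp add: chi_law_def)
  then show ?thesis using chi_law_scale[of "DIM('a) * real j"] assms by simp
qed

lemma sets_chi_law [simp, measurable_cong]: "sets (chi_law k) = sets borel"
    "sets (chi_tilde_law k) = sets borel"
  by (simp_all add: chi_law_def chi_tilde_law_def)

lemma distr_iid_first_col:
  "distr (iid n (Suc k)) (mat_borel n 1) (\<lambda>Y. mat n 1 (\<lambda>(i, j). Y $$ (i, 0))) = iid n 1"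
proof -
  let ?f = "\<lambda>Y :: 'a mat. mat n 1 (\<lambda>(i, j :: nat). Y $$ (i, 0))"
  have f: "?f \<in> mat_borel n (Suc k) \<rightarrow>\<^sub>M mat_borel n 1"
    by (rule measurable_mat_borelI) (auto intro!: measurable_mat_entry measurable_ident_sets)
  have "distr (iid n (Suc k)) (mat_borel n 1) ?f =
      distr (iid n 1 \<Otimes>\<^sub>M iid n k) (mat_borel n 1) (?f \<circ> (\<lambda>(y, Y). col_cons y Y))"
    unfolding iid_col_cons[of n k] by (rule distr_distr[OF f col_cons_measurable_iid])
  also have "\<dots> = distr (iid n 1 \<Otimes>\<^sub>M iid n k) (iid n 1) fst"
    by (rule distr_cong) (auto simp: space_pair_measure col_cons_def intro!: eq_matI)
  finally show ?thesis by (simp only: distr_fst_pair[OF prob_space_iid])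
qed

text \<open>Two independent Gaussian columns form an n by 2 Gaussian matrix. Rotating it by 45
  degrees from the right preserves the law and makes the normalized sum the first column.\<close>

lemma distr_iid_average:
  "distr (iid n 1 \<Otimes>\<^sub>M iid n 1) (mat_borel n 1) (\<lambda>(c, c'). of_real (1 / sqrt 2) \<cdot>\<^sub>m (c + c')) =
      iid n 1"
proof -
  let ?p = "1 / sqrt 2 :: real"
  let ?f = "\<lambda>Y :: 'a mat. mat n 1 (\<lambda>(i, j :: nat). Y $$ (i, 0))"
  define R :: "'a mat" where "R = two_block 0 (conjugate (of_real ?p)) (of_real ?p) (- of_real ?p)
      (of_real ?p)"
  have R: "preserves_gauss 2 R"
    using preserves_gauss_two_block[of ?p "of_real ?p" 0]
    by (simp add: R_def power_divide numeral_2_eq_2 del: of_real_divide)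
  have Rc: "conj_transpose R \<in> carrier_mat 2 2"
    by (simp add: R_def numeral_2_eq_2)
  have f: "?f \<in> mat_borel n 2 \<rightarrow>\<^sub>M mat_borel n 1"
    by (rule measurable_mat_borelI) (auto intro!: measurable_mat_entry measurable_ident_sets)
  have r: "(\<lambda>Y. Y * conj_transpose R) \<in> mat_borel n 2 \<rightarrow>\<^sub>M mat_borel n 2"
    by (rule mat_mult_measurable[OF measurable_ident_sets[OF refl] mat_const_measurable[OF Rc]])
  have c: "(\<lambda>(y, Y). col_cons y Y) \<in> iid n 1 \<Otimes>\<^sub>M iid n 1 \<rightarrow>\<^sub>M mat_borel n 2"
    using col_cons_measurable_iid[of n 1] by (simp add: numeral_2_eq_2)
  have iid2: "iid n 2 = distr (iid n 1 \<Otimes>\<^sub>M iid n 1) (mat_borel n 2) (\<lambda>(y, Y). col_cons y Y)"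
    using iid_col_cons[of n 1] by (simp add: numeral_2_eq_2)
  have "iid n 1 = distr (iid n 2) (mat_borel n 1) ?f"
    using distr_iid_first_col[of n 1] by (simp add: numeral_2_eq_2)
  also have "iid n 2 = distr (iid n 2) (mat_borel n 2) (\<lambda>Y. Y * conj_transpose R)"
    by (rule iid_right_mult[OF R, symmetric])
  also have "distr \<dots> (mat_borel n 1) ?f = distr (iid n 1 \<Otimes>\<^sub>M iid n 1) (mat_borel n 1)
      (?f \<circ> ((\<lambda>Y. Y * conj_transpose R) \<circ> (\<lambda>(y, Y). col_cons y Y)))"
    unfolding iid2 distr_distr[OF r c] by (rule distr_distr[OF f measurable_comp[OF c r]])
  also have "\<dots> = distr (iid n 1 \<Otimes>\<^sub>M iid n 1) (mat_borel n 1)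
      (\<lambda>(c, c'). of_real (1 / sqrt 2) \<cdot>\<^sub>m (c + c'))"
  proof (rule distr_cong)
    fix z assume "z \<in> space (iid n 1 \<Otimes>\<^sub>M iid n 1)"
    then obtain c c' where z: "z = (c, c')" and cc: "c \<in> carrier_mat n 1" "c' \<in> carrier_mat n 1"
      by (auto simp: space_pair_measure)
    have C: "col_cons c c' \<in> carrier_mat n 2" using cc by (simp add: numeral_2_eq_2)
    have "?f (col_cons c c' * conj_transpose R) = of_real ?p \<cdot>\<^sub>m (c + c')"
    proof (rule eq_matI)
      fix i j assume "i < dim_row (of_real ?p \<cdot>\<^sub>m (c + c'))" "j < dim_col (of_real ?p \<cdot>\<^sub>m (c + c'))"
      then have i: "i < n" "j = 0" using cc by auto
      have "(col_cons c c' * conj_transpose R) $$ (i, 0) =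
          c $$ (i, 0) * of_real ?p + c' $$ (i, 0) * of_real ?p"
        using index_mult_mat_sum[OF C Rc, of i 0] i cc
        by (simp add: numeral_2_eq_2 R_def conj_transpose_two_block two_block_def col_cons_def del:
            of_real_divide)
      also have "\<dots> = of_real ?p * (c $$ (i, 0) + c' $$ (i, 0))"
        unfolding of_real_commute[of "c $$ (i, 0)"] of_real_commute[of "c' $$ (i, 0)"] by
            (rule distrib_left[symmetric])
      finally show "?f (col_cons c c' * conj_transpose R) $$ (i, j) =
          (of_real ?p \<cdot>\<^sub>m (c + c')) $$ (i, j)"
        using i cc by simp
    qed (use cc in auto)
    then show "(?f \<circ> ((\<lambda>Y. Y * conj_transpose R) \<circ> (\<lambda>(y, Y). col_cons y Y))) z =
        (case z of (c, c') \<Rightarrow> of_real ?p \<cdot>\<^sub>m (c + c'))"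
      by (simp add: z)
  qed auto
  finally show ?thesis ..
qed

text \<open>Half of a sum is \<open>1 / sqrt 2\<close> times the normalized sum, which is a standard
  Gaussian column; its norm follows a chi law, and the remaining factor turns that into
  \<open>chi_tilde_law\<close>.\<close>

lemma distr_iid_hermitian_norm:
  assumes n: "0 < n"
  shows "distr (iid n 1 \<Otimes>\<^sub>M iid 1 n) borel (\<lambda>(c, r). hs_norm
      (of_real (1 / 2) \<cdot>\<^sub>m (c + conj_transpose r))) = chi_tilde_law (DIM('a) * real n)"
proof -
  have a: "(\<lambda>(c, c'). of_real (1 / sqrt 2) \<cdot>\<^sub>m (c + c') :: 'a mat) \<in>
      iid n 1 \<Otimes>\<^sub>M iid n 1 \<rightarrow>\<^sub>M mat_borel n 1"
    unfolding split_beta by (intro mat_smult_measurable mat_add_measurable) auto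
  have t: "(\<lambda>(c, r). (c, conj_transpose r)) \<in> iid n 1 \<Otimes>\<^sub>M iid 1 n \<rightarrow>\<^sub>M iid n 1 \<Otimes>\<^sub>M iid n 1"
    by measurable
  have hs: "(hs_norm :: 'a mat \<Rightarrow> real) \<in> mat_borel n 1 \<rightarrow>\<^sub>M borel" by (rule hs_norm_meas)
  have T: "distr (iid n 1 \<Otimes>\<^sub>M iid 1 n) (iid n 1 \<Otimes>\<^sub>M iid n 1) (\<lambda>(c, r). (c, conj_transpose r)) =
      iid n 1 \<Otimes>\<^sub>M iid n 1"
  proof -
    have "distr (iid 1 n) (iid n 1) conj_transpose = iid n 1"
      using iid_conj_transpose[of 1 n] by (simp cong: distr_cong)
    then show ?thesis
      using distr_map_prod[OF prob_space_iid prob_space_iid,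
          of "\<lambda>c. c" n 1 "iid n 1" conj_transpose 1 n "iid n 1"]
      by (simp add: distr_id)
  qed
  have "distr (iid n 1 \<Otimes>\<^sub>M iid 1 n) borel (\<lambda>(c, r). hs_norm
      (of_real (1 / 2) \<cdot>\<^sub>m (c + conj_transpose r))) =
      distr (iid n 1 \<Otimes>\<^sub>M iid 1 n) borel ((\<lambda>x. x / sqrt 2) \<circ>
          (hs_norm \<circ> ((\<lambda>(c, c'). of_real (1 / sqrt 2) \<cdot>\<^sub>m (c + c')) \<circ>
          (\<lambda>(c, r). (c, conj_transpose r)))))"
  proof (rule distr_cong)
    fix z :: "'a mat \<times> 'a mat"
    obtain c r where z: "z = (c, r)" by fastforce
    show "(case z of (c, r) \<Rightarrow> hs_norm (of_real (1 / 2) \<cdot>\<^sub>m (c + conj_transpose r))) =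
      ((\<lambda>x. x / sqrt 2) \<circ> (hs_norm \<circ> ((\<lambda>(c, c'). of_real (1 / sqrt 2) \<cdot>\<^sub>m (c + c')) \<circ>
          (\<lambda>(c, r). (c, conj_transpose r))))) z"
      by (simp add: z hs_norm_smult del: of_real_divide)
  qed auto
  also have "\<dots> = distr (distr (distr (distr (iid n 1 \<Otimes>\<^sub>M iid 1 n) (iid n 1 \<Otimes>\<^sub>M iid n 1)
      (\<lambda>(c, r). (c, conj_transpose r)))
      (mat_borel n 1) (\<lambda>(c, c'). of_real (1 / sqrt 2) \<cdot>\<^sub>m (c + c'))) borel hs_norm) borel
          (\<lambda>x. x / sqrt 2)"
    unfolding distr_distr[OF a t] distr_distr[OF hs measurable_comp[OF t a]]
    by (rule distr_distr[symmetric, OF _ measurable_comp[OF measurable_comp[OF t a] hs]]) simp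
  also have "\<dots> = distr (distr (iid n 1) borel hs_norm) borel (\<lambda>x. x / sqrt 2)"
    by (simp only: T distr_iid_average)
  also have "\<dots> = chi_tilde_law (DIM('a) * real n)"
    using n by (simp add: distr_iid_hs_norm chi_law_scale)
  finally show ?thesis .
qed

lemma distr_\<nu>_inner_one: "distr \<nu> borel (\<lambda>x. inner x 1) = normal_law 1"
proof -
  have "distr \<nu> borel (\<lambda>x. inner x 1) = distr (Pi\<^sub>M Basis (\<lambda>_. normal_law 1)) borel
      (\<lambda>f. f (1 :: 'a))"
    unfolding \<nu>_coords using one_Basis by (subst distr_distr) (auto simp: comp_def)
  also have "\<dots> = distr (Pi\<^sub>M Basis (\<lambda>_. normal_law 1)) (normal_law 1) (\<lambda>f. f (1 :: 'a))"
    by (rule distr_cong) auto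
  also have "\<dots> = normal_law 1"
    using distr_PiM_component[of Basis "\<lambda>_. normal_law 1" "1 :: 'a"] one_Basis prob_space_normal_law
        by simp
  finally show ?thesis .
qed

end

section \<open>Recursion for the matrix models\<close>

text \<open>\<open>distr_distr\<close> with the intermediate law as an explicit premise. The
  recursions below are chains of such steps, each replacing an inner random variable by its
  law.\<close>

lemma distr_law:
  assumes "distr M N X = L" "X \<in> M \<rightarrow>\<^sub>M N" "f \<in> N \<rightarrow>\<^sub>M K"
  shows "distr M K (\<lambda>x. f (X x)) = distr L K f"
  using distr_distr[OF assms(3,2)] assms(1) by (simp add: comp_def)

lemma distr_pair_swap_fst:
  assumes "prob_space A" "prob_space B" "prob_space C"
  shows "distr ((A \<Otimes>\<^sub>M B) \<Otimes>\<^sub>M C) ((B \<Otimes>\<^sub>M A) \<Otimes>\<^sub>M C) (\<lambda>p. ((snd (fst p), fst (fst p)), snd p)) =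
      (B \<Otimes>\<^sub>M A) \<Otimes>\<^sub>M C"
proof -
  interpret pair_sigma_finite B A
    using assms by (simp add: pair_sigma_finite_def prob_space_imp_sigma_finite)
  have "distr (A \<Otimes>\<^sub>M B) (B \<Otimes>\<^sub>M A) (\<lambda>p. (snd p, fst p)) = B \<Otimes>\<^sub>M A"
    using distr_pair_swap[symmetric] by (simp add: case_prod_unfold)
  moreover have "distr ((A \<Otimes>\<^sub>M B) \<Otimes>\<^sub>M C) ((B \<Otimes>\<^sub>M A) \<Otimes>\<^sub>M C) (\<lambda>(p, c). ((snd p, fst p), c)) =
      distr (A \<Otimes>\<^sub>M B) (B \<Otimes>\<^sub>M A) (\<lambda>p. (snd p, fst p)) \<Otimes>\<^sub>M distr C C (\<lambda>c. c)"
    by (rule distr_map_prod) (use assms in \<open>auto intro: prob_space_pair\<close>)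
  ultimately show ?thesis by (simp add: case_prod_unfold distr_id)
qed

lemma distr_pair_interchange:
  assumes "prob_space A" "prob_space B" "prob_space C" "prob_space D"
  shows "distr ((A \<Otimes>\<^sub>M B) \<Otimes>\<^sub>M (C \<Otimes>\<^sub>M D)) ((A \<Otimes>\<^sub>M C) \<Otimes>\<^sub>M (B \<Otimes>\<^sub>M D))
      (\<lambda>p. ((fst (fst p), fst (snd p)), (snd (fst p), snd (snd p)))) = (A \<Otimes>\<^sub>M C) \<Otimes>\<^sub>M (B \<Otimes>\<^sub>M D)"
proof (rule measure_eqI)
  interpret A: prob_space A by fact
  interpret B: prob_space B by fact
  interpret C: prob_space C by fact
  interpret D: prob_space D by fact
  interpret CD: pair_sigma_finite C D ..
  interpret BD: pair_sigma_finite B D ..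
  interpret BC: pair_sigma_finite B C ..
  let ?h = "\<lambda>p. ((fst (fst p), fst (snd p)), (snd (fst p), snd (snd p)))"
  fix S assume "S \<in> sets (distr ((A \<Otimes>\<^sub>M B) \<Otimes>\<^sub>M (C \<Otimes>\<^sub>M D)) ((A \<Otimes>\<^sub>M C) \<Otimes>\<^sub>M (B \<Otimes>\<^sub>M D)) ?h)"
  then have S [measurable]: "S \<in> sets ((A \<Otimes>\<^sub>M C) \<Otimes>\<^sub>M (B \<Otimes>\<^sub>M D))" by simp
  have "emeasure (distr ((A \<Otimes>\<^sub>M B) \<Otimes>\<^sub>M (C \<Otimes>\<^sub>M D)) ((A \<Otimes>\<^sub>M C) \<Otimes>\<^sub>M (B \<Otimes>\<^sub>M D)) ?h) S =
      (\<integral>\<^sup>+p. indicator S (?h p) \<partial>((A \<Otimes>\<^sub>M B) \<Otimes>\<^sub>M (C \<Otimes>\<^sub>M D)))"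
    by (subst nn_integral_indicator[symmetric], simp, subst nn_integral_distr) auto
  also have "\<dots> = (\<integral>\<^sup>+p. \<integral>\<^sup>+q. indicator S ((fst p, fst q), (snd p, snd q)) \<partial>(C \<Otimes>\<^sub>M D) \<partial>(A \<Otimes>\<^sub>M B))"
    by (subst CD.nn_integral_fst[symmetric]) auto
  also have "\<dots> = (\<integral>\<^sup>+p. \<integral>\<^sup>+c. \<integral>\<^sup>+d. indicator S ((fst p, c), (snd p, d)) \<partial>D \<partial>C \<partial>(A \<Otimes>\<^sub>M B))"
    by (rule nn_integral_cong, subst D.nn_integral_fst[symmetric]) auto
  also have "\<dots> = (\<integral>\<^sup>+a. \<integral>\<^sup>+b. \<integral>\<^sup>+c. \<integral>\<^sup>+d. indicator S ((a, c), (b, d)) \<partial>D \<partial>C \<partial>B \<partial>A)"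
    by (subst B.nn_integral_fst[symmetric]) auto
  also have "\<dots> = (\<integral>\<^sup>+a. \<integral>\<^sup>+c. \<integral>\<^sup>+b. \<integral>\<^sup>+d. indicator S ((a, c), (b, d)) \<partial>D \<partial>B \<partial>C \<partial>A)"
    by (rule nn_integral_cong, rule BC.Fubini'[symmetric]) measurable
  also have "\<dots> = (\<integral>\<^sup>+a. \<integral>\<^sup>+c. \<integral>\<^sup>+q. indicator S ((a, c), q) \<partial>(B \<Otimes>\<^sub>M D) \<partial>C \<partial>A)"
    by (rule nn_integral_cong, rule nn_integral_cong, subst D.nn_integral_fst[symmetric]) auto
  also have "\<dots> = (\<integral>\<^sup>+p. \<integral>\<^sup>+q. indicator S (p, q) \<partial>(B \<Otimes>\<^sub>M D) \<partial>(A \<Otimes>\<^sub>M C))"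
    by (subst C.nn_integral_fst[symmetric]) auto
  also have "\<dots> = emeasure ((A \<Otimes>\<^sub>M C) \<Otimes>\<^sub>M (B \<Otimes>\<^sub>M D)) S"
    by (subst BD.nn_integral_fst) auto
  finally show "emeasure (distr ((A \<Otimes>\<^sub>M B) \<Otimes>\<^sub>M (C \<Otimes>\<^sub>M D)) ((A \<Otimes>\<^sub>M C) \<Otimes>\<^sub>M (B \<Otimes>\<^sub>M D)) ?h) S =
      emeasure ((A \<Otimes>\<^sub>M C) \<Otimes>\<^sub>M (B \<Otimes>\<^sub>M D)) S" .
qed simp

section \<open>Jacobi matrices enlarged by a first row and column\<close>

definition jborder :: "nat \<Rightarrow> real \<Rightarrow> real \<Rightarrow> real mat \<Rightarrow> real mat" where
  "jborder n b l J = four_block_mat (scalar_mat b) (l \<cdot>\<^sub>m transpose_mat (unit_col n))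
      (l \<cdot>\<^sub>m unit_col n) J"

lemma jborder_measurable:
  assumes "b \<in> borel_measurable M" "l \<in> borel_measurable M" "J \<in> M \<rightarrow>\<^sub>M mat_borel n n"
  shows "(\<lambda>x. jborder n (b x) (l x) (J x)) \<in> M \<rightarrow>\<^sub>M mat_borel (Suc n) (Suc n)"
  unfolding jborder_def
  by (intro four_block_mat_measurable[of _ M 1 1 _ n _ n, unfolded plus_1_eq_Suc]
      scalar_mat_measurable scaleR_unit_col_measurable assms)

lemma jborder_jacobi_mat:
  "jborder n b1 l (jacobi_mat n a b) =
    jacobi_mat (Suc n) (\<lambda>j. if j = 1 then l else a (j - 1)) (\<lambda>j. if j = 1 then b1 else b (j - 1))"
  unfolding jborder_def by (rule four_block_jacobi_mat)

text \<open>Coefficients count from 1, so the new one takes index 1 and the old ones move up. The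
  restriction to \<open>K\<close> makes the result a point of the product space.\<close>

definition shift_cons :: "nat set \<Rightarrow> 'b \<Rightarrow> (nat \<Rightarrow> 'b) \<Rightarrow> nat \<Rightarrow> 'b" where
  "shift_cons K x f = (\<lambda>k\<in>K. if k = 1 then x else f (k - 1))"

lemma PiM_shift_cons:
  assumes K: "finite K" "bij_betw (\<lambda>k. if k = 1 then None else Some (k - 1)) K
      (insert None (Some ` J))"
    and prob: "prob_space M0" "\<And>j. j \<in> J \<Longrightarrow> prob_space (M2 j)"
    and N: "\<And>k. k \<in> K \<Longrightarrow> N k = (if k = 1 then M0 else M2 (k - 1))"
  shows "distr (M0 \<Otimes>\<^sub>M Pi\<^sub>M J M2) (Pi\<^sub>M K N) (\<lambda>p. shift_cons K (fst p) (snd p)) = Pi\<^sub>M K N"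
    and "(\<lambda>p. shift_cons K (fst p) (snd p)) \<in> M0 \<Otimes>\<^sub>M Pi\<^sub>M J M2 \<rightarrow>\<^sub>M Pi\<^sub>M K N"
proof -
  have N': "N k = case_option M0 M2 (if k = 1 then None else Some (k - 1))" if "k \<in> K" for k
    using N[OF that] by simp
  have eq: "(\<lambda>p. shift_cons K (fst p) (snd p)) =
      (\<lambda>(x, y). \<lambda>k\<in>K. case_option x y (if k = 1 then None else Some (k - 1)))"
    by (auto simp: fun_eq_iff shift_cons_def)
  show "distr (M0 \<Otimes>\<^sub>M Pi\<^sub>M J M2) (Pi\<^sub>M K N) (\<lambda>p. shift_cons K (fst p) (snd p)) = Pi\<^sub>M K N"
    unfolding eq by (rule PiM_split_one[OF K prob N'])
  show "(\<lambda>p. shift_cons K (fst p) (snd p)) \<in> M0 \<Otimes>\<^sub>M Pi\<^sub>M J M2 \<rightarrow>\<^sub>M Pi\<^sub>M K N"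
    unfolding eq by (rule PiM_split_one[OF K prob N'])
qed

text \<open>The second set of indices is empty for \<open>n = 0\<close>, where there is no first
  off-diagonal coefficient; hence the recursions start at size one and not at zero.\<close>

lemma bij_shift:
  "bij_betw (\<lambda>k. if k = 1 then None else Some (k - 1)) {1..Suc n} (insert None (Some ` {1..n}))"
  "0 < n \<Longrightarrow> bij_betw (\<lambda>k. if k = 1 then None else Some (k - 1)) {1..<Suc n}
      (insert None (Some ` {1..<n}))"
  by (rule bij_betwI[of _ _ _ "case_option 1 Suc"]; force simp: image_iff split: if_splits
      option.splits)+

lemma jacobi_mat_shift_cons:
  assumes "0 < n"
  shows "jacobi_mat (Suc n) (shift_cons {1..<Suc n} l a) (shift_cons {1..Suc n} b1 b) =
      jborder n b1 l (jacobi_mat n a b)"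
  unfolding jborder_jacobi_mat using assms
  by (intro eq_matI) (auto simp: jacobi_mat_def shift_cons_def)

lemma measurable_component_sets:
  assumes "sets A = sets (Pi\<^sub>M K (\<lambda>_. borel))" "k \<in> K"
  shows "(\<lambda>f. f k) \<in> borel_measurable A"
  using measurable_component_singleton[OF assms(2), of "\<lambda>_. borel"]
  by (simp add: measurable_cong_sets[OF assms(1) refl])

lemma jacobi_mat_measurable:
  assumes "sets A = sets (Pi\<^sub>M {1..<n} (\<lambda>_. borel))" "sets B = sets (Pi\<^sub>M {1..n} (\<lambda>_. borel))"
  shows "(\<lambda>p. jacobi_mat n (fst p) (snd p)) \<in> A \<Otimes>\<^sub>M B \<rightarrow>\<^sub>M mat_borel n n"
proof (rule measurable_mat_borelI)
  have a: "(\<lambda>p. fst p k) \<in> borel_measurable (A \<Otimes>\<^sub>M B)" if "k \<in> {1..<n}" for k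
    using measurable_compose[OF measurable_fst measurable_component_sets[OF assms(1) that]] .
  have b: "(\<lambda>p. snd p k) \<in> borel_measurable (A \<Otimes>\<^sub>M B)" if "k \<in> {1..n}" for k
    using measurable_compose[OF measurable_snd measurable_component_sets[OF assms(2) that]] .
  fix i j assume ij: "i < n" "j < n"
  have "(\<lambda>p. if i = j then snd p (i + 1) else if j = i + 1 then fst p (i + 1) else if i = j +
      1 then fst p (j + 1) else 0)
      \<in> borel_measurable (A \<Otimes>\<^sub>M B)"
  proof -
    consider "i = j" | "i \<noteq> j" "j = i + 1" | "i \<noteq> j" "j \<noteq> i + 1" "i = j + 1" | "i \<noteq> j" "j \<noteq> i + 1"
        "i \<noteq> j + 1"
      by blast
    then show ?thesis
    proof cases
      case 1
      then show ?thesis using b[of "i + 1"] ij by simp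
    next
      case 2
      then show ?thesis using a[of "i + 1"] ij by simp
    next
      case 3
      then show ?thesis using a[of "j + 1"] ij by simp
    next
      case 4
      then show ?thesis by simp
    qed
  qed
  then show "(\<lambda>p. jacobi_mat n (fst p) (snd p) $$ (i, j)) \<in> borel_measurable (A \<Otimes>\<^sub>M B)"
    using ij by (simp add: jacobi_mat_def)
qed (simp add: jacobi_mat_def)

definition bidiag_gram :: "nat \<Rightarrow> (nat \<Rightarrow> real) \<Rightarrow> (nat \<Rightarrow> real) \<Rightarrow> real mat" where
  "bidiag_gram n x y = transpose_mat (bidiag_mat n x y) * bidiag_mat n x y"

lemma bidiag_gram_index:
  assumes "i < n" "j < n"
  shows "bidiag_gram n x y $$ (i, j) =
    (if i = j then (x (i + 1))\<^sup>2 + (if 0 < i then (y i)\<^sup>2 else 0)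
     else if j = i + 1 then x (i + 1) * y (i + 1)
     else if i = j + 1 then x (j + 1) * y (j + 1) else 0)"
proof -
  let ?f = "\<lambda>l k. if l = k then x (l + 1) else if k = l + 1 then y (l + 1) else 0"
  have "bidiag_gram n x y $$ (i, j) = (\<Sum>l<n. ?f l i * ?f l j)"
    using assms by (auto simp: bidiag_gram_def scalar_prod_def bidiag_mat_def lessThan_atLeast0
        intro!: sum.cong)
  \<comment> \<open>Column \<open>i\<close> of the bidiagonal matrix lives in rows \<open>i\<close>
    and \<open>i - 1\<close>. For \<open>i = 0\<close> truncated subtraction lets the two
    coincide.\<close>
  also have "\<dots> = (\<Sum>l\<in>{..<n} \<inter> {i, i - 1}. ?f l i * ?f l j)"
    by (rule sum.mono_neutral_right) auto
  also have "{..<n} \<inter> {i, i - 1} = {i, i - 1}" using assms by auto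
  also have "(\<Sum>l\<in>{i, i - 1}. ?f l i * ?f l j) =
    (if i = j then (x (i + 1))\<^sup>2 + (if 0 < i then (y i)\<^sup>2 else 0)
     else if j = i + 1 then x (i + 1) * y (i + 1)
     else if i = j + 1 then x (j + 1) * y (j + 1) else 0)"
    by (cases i) (auto simp: power2_eq_square)
  finally show ?thesis .
qed

lemma bidiag_gram_carrier [simp]: "bidiag_gram n x y \<in> carrier_mat n n"
  by (simp add: bidiag_gram_def bidiag_mat_def)

text \<open>The enlarged bidiagonal factor has \<open>x1\<close> in the corner, \<open>y1\<close>
  next to it and the old factor B below. Its first row contributes \<open>x1\<^sup>2\<close>,
  \<open>x1 * y1\<close> and, in the corner of the remaining block, \<open>y1\<^sup>2\<close>; the
  other rows contribute \<open>B^T B\<close>.\<close>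

lemma bidiag_gram_shift_cons:
  assumes "0 < n"
  shows "bidiag_gram (Suc n) (shift_cons {1..Suc n} x1 x) (shift_cons {1..<Suc n} y1 y) =
    jborder n (x1\<^sup>2) (x1 * y1) (bidiag_gram n x y + y1\<^sup>2 \<cdot>\<^sub>m unit11 n)"
proof (rule eq_matI)
  fix i j assume "i < dim_row (jborder n (x1\<^sup>2) (x1 * y1) (bidiag_gram n x y + y1\<^sup>2 \<cdot>\<^sub>m unit11 n))"
    "j < dim_col (jborder n (x1\<^sup>2) (x1 * y1) (bidiag_gram n x y + y1\<^sup>2 \<cdot>\<^sub>m unit11 n))"
  then have ij: "i < Suc n" "j < Suc n"
    by (auto simp: jborder_def scalar_mat_def unit11_def)
  have "dim_row (bidiag_gram n x y) = n" "dim_col (bidiag_gram n x y) = n"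
    using bidiag_gram_carrier by blast+
  then show "bidiag_gram (Suc n) (shift_cons {1..Suc n} x1 x) (shift_cons {1..<Suc n} y1 y) $$
      (i, j) =
      jborder n (x1\<^sup>2) (x1 * y1) (bidiag_gram n x y + y1\<^sup>2 \<cdot>\<^sub>m unit11 n) $$ (i, j)"
    using ij assms unfolding bidiag_gram_index[OF ij]
    by (cases i; cases j)
      (auto simp: jborder_def scalar_mat_def unit_col_def unit11_def bidiag_gram_index
          shift_cons_def)
qed (auto simp: jborder_def scalar_mat_def unit11_def bidiag_gram_def bidiag_mat_def)

lemma bidiag_gram_measurable:
  assumes "sets A = sets (Pi\<^sub>M {1..n} (\<lambda>_. borel))" "sets B = sets (Pi\<^sub>M {1..<n} (\<lambda>_. borel))"
  shows "(\<lambda>p. bidiag_gram n (fst p) (snd p)) \<in> A \<Otimes>\<^sub>M B \<rightarrow>\<^sub>M mat_borel n n"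
proof (rule measurable_mat_borelI)
  have a: "(\<lambda>p. fst p k) \<in> borel_measurable (A \<Otimes>\<^sub>M B)" if "k \<in> {1..n}" for k
    using measurable_compose[OF measurable_fst measurable_component_sets[OF assms(1) that]] .
  have b: "(\<lambda>p. snd p k) \<in> borel_measurable (A \<Otimes>\<^sub>M B)" if "k \<in> {1..<n}" for k
    using measurable_compose[OF measurable_snd measurable_component_sets[OF assms(2) that]] .
  fix i j assume ij: "i < n" "j < n"
  show "(\<lambda>p. bidiag_gram n (fst p) (snd p) $$ (i, j)) \<in> borel_measurable (A \<Otimes>\<^sub>M B)"
  proof -
    consider "i = j" "i = 0" | "i = j" "0 < i" | "i \<noteq> j" "j = i + 1" | "i \<noteq> j" "j \<noteq> i + 1"
        "i = j + 1" | "i \<noteq> j" "j \<noteq> i + 1" "i \<noteq> j + 1"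
      by blast
    then show ?thesis
    proof cases
      case 1
      then show ?thesis unfolding bidiag_gram_index[OF ij] using a[of "i + 1"] ij by simp
    next
      case 2
      then show ?thesis unfolding bidiag_gram_index[OF ij] using a[of "i + 1"] b[of i] ij by simp
    next
      case 3
      then show ?thesis unfolding bidiag_gram_index[OF ij] using a[of "i + 1"] b[of "i + 1"] ij by
          simp
    next
      case 4
      then show ?thesis unfolding bidiag_gram_index[OF ij] using a[of "j + 1"] b[of "j + 1"] ij by
          simp
    next
      case 5
      then show ?thesis unfolding bidiag_gram_index[OF ij] by simp
    qed
  qed
qed simp

context hermitian_scalars
begin

lemma sets_normal_PiM: "sets (Pi\<^sub>M K (\<lambda>_. normal_law 1)) = sets (Pi\<^sub>M K (\<lambda>_. borel))"
  by (intro sets_PiM_cong) auto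

lemma sets_chi_tilde_PiM: "sets (Pi\<^sub>M K (\<lambda>j. chi_tilde_law (f j))) = sets (Pi\<^sub>M K (\<lambda>_. borel))"
  by (intro sets_PiM_cong) auto

lemma prob_space_chi_tilde_diff: "j \<in> {1..<n} \<Longrightarrow>
    prob_space (chi_tilde_law (real DIM('a) * (real n - real j)))"
  using prob_space_chi_tilde_law[of "n - j"] by (auto simp: of_nat_diff)

lemma GbetaE_eq: "GbetaE \<beta> n = distr (Pi\<^sub>M {1..<n} (\<lambda>j. chi_tilde_law (\<beta> * (real n - real j))) \<Otimes>\<^sub>M
    Pi\<^sub>M {1..n} (\<lambda>_. normal_law 1))
      (mat_borel n n) (\<lambda>p. jacobi_mat n (fst p) (snd p))"
  by (simp add: GbetaE_def case_prod_unfold)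

text \<open>The parameters depend on size and index only through their difference, so deleting the
  first row and column leaves the ensemble of the next smaller size, and the deleted off-diagonal
  coefficient has parameter \<open>\<beta> * n\<close>.\<close>

lemma GbetaE_Suc:
  assumes n: "0 < n"
  shows "GbetaE (real DIM('a)) (Suc n) =
    distr ((normal_law 1 \<Otimes>\<^sub>M chi_tilde_law (real DIM('a) * real n)) \<Otimes>\<^sub>M GbetaE (real DIM('a)) n)
        (mat_borel (Suc n) (Suc n))
      (\<lambda>p. jborder n (fst (fst p)) (snd (fst p)) (snd p))"
proof -
  let ?c = "chi_tilde_law (real DIM('a) * real n)" and ?N = "normal_law 1"
  let ?A = "Pi\<^sub>M {1..<n} (\<lambda>j. chi_tilde_law (real DIM('a) * (real n - real j)))" and ?B =
      "Pi\<^sub>M {1..n} (\<lambda>_. ?N)"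
  let ?A' = "Pi\<^sub>M {1..<Suc n} (\<lambda>j. chi_tilde_law (real DIM('a) * (real (Suc n) - real j)))" and ?B'
      = "Pi\<^sub>M {1..Suc n} (\<lambda>_. ?N)"
  let ?sA = "\<lambda>p. shift_cons {1..<Suc n} (fst p) (snd p)" and ?sB =
      "\<lambda>p. shift_cons {1..Suc n} (fst p) (snd p)"
  have c: "prob_space ?c" by (rule prob_space_chi_tilde_law[OF n])
  have N: "prob_space ?N" by (rule prob_space_normal_law)
  have A: "prob_space ?A" by (rule prob_space_PiM) (rule prob_space_chi_tilde_diff)
  have B: "prob_space ?B" by (rule prob_space_PiM) (rule N)
  have sA: "distr (?c \<Otimes>\<^sub>M ?A) ?A' ?sA = ?A'" "?sA \<in> ?c \<Otimes>\<^sub>M ?A \<rightarrow>\<^sub>M ?A'"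
    by (rule PiM_shift_cons; use bij_shift(2)[OF n] c prob_space_chi_tilde_diff in
        \<open>auto simp: of_nat_diff algebra_simps\<close>)+
  have sB: "distr (?N \<Otimes>\<^sub>M ?B) ?B' ?sB = ?B'" "?sB \<in> ?N \<Otimes>\<^sub>M ?B \<rightarrow>\<^sub>M ?B'"
    by (rule PiM_shift_cons; use bij_shift(1) N in auto)+
  have J': "(\<lambda>p. jacobi_mat (Suc n) (fst p) (snd p)) \<in> ?A' \<Otimes>\<^sub>M ?B' \<rightarrow>\<^sub>M mat_borel (Suc n) (Suc n)"
    by (rule jacobi_mat_measurable[OF sets_chi_tilde_PiM sets_normal_PiM])
  have J: "(\<lambda>p. jacobi_mat n (fst p) (snd p)) \<in> ?A \<Otimes>\<^sub>M ?B \<rightarrow>\<^sub>M mat_borel n n"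
    by (rule jacobi_mat_measurable[OF sets_chi_tilde_PiM sets_normal_PiM])
  let ?I = "\<lambda>p. ((fst (fst p), fst (snd p)), (snd (fst p), snd (snd p)))"
  have jb: "(\<lambda>p. jborder n (snd (fst p)) (fst (fst p)) (snd p)) \<in>
      (?c \<Otimes>\<^sub>M ?N) \<Otimes>\<^sub>M mat_borel n n \<rightarrow>\<^sub>M mat_borel (Suc n) (Suc n)"
    by (rule jborder_measurable) measurable
  have G: "prob_space (GbetaE (real DIM('a)) n)"
    unfolding GbetaE_eq by (rule prob_space.prob_space_distr[OF prob_space_pair[OF A B] J])
  have "GbetaE (real DIM('a)) (Suc n) = distr (?A' \<Otimes>\<^sub>M ?B') (mat_borel (Suc n) (Suc n))
      (\<lambda>p. jacobi_mat (Suc n) (fst p) (snd p))"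
    by (rule GbetaE_eq)
  also have "\<dots> = distr ((?c \<Otimes>\<^sub>M ?A) \<Otimes>\<^sub>M (?N \<Otimes>\<^sub>M ?B)) (mat_borel (Suc n) (Suc n))
      (\<lambda>p. (\<lambda>p. jacobi_mat (Suc n) (fst p) (snd p)) ((\<lambda>(p, q). (?sA p, ?sB q)) p))"
  proof (rule distr_law[symmetric, OF _ _ J'])
    show "distr ((?c \<Otimes>\<^sub>M ?A) \<Otimes>\<^sub>M (?N \<Otimes>\<^sub>M ?B)) (?A' \<Otimes>\<^sub>M ?B') (\<lambda>(p, q). (?sA p, ?sB q)) = ?A' \<Otimes>\<^sub>M ?B'"
      by (subst distr_map_prod[OF prob_space_pair[OF c A] prob_space_pair[OF N B] sA(2) sB(2)])
          (simp only: sA sB)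
    show "(\<lambda>(p, q). (?sA p, ?sB q)) \<in> (?c \<Otimes>\<^sub>M ?A) \<Otimes>\<^sub>M (?N \<Otimes>\<^sub>M ?B) \<rightarrow>\<^sub>M ?A' \<Otimes>\<^sub>M ?B'"
      using sA(2) sB(2) by measurable
  qed
  also have "\<dots> = distr ((?c \<Otimes>\<^sub>M ?A) \<Otimes>\<^sub>M (?N \<Otimes>\<^sub>M ?B)) (mat_borel (Suc n) (Suc n))
      (\<lambda>p. (\<lambda>p. jborder n (snd (fst p)) (fst (fst p)) (snd p))
          ((\<lambda>(p, q). (p, jacobi_mat n (fst q) (snd q))) (?I p)))"
    by (simp only: jacobi_mat_shift_cons[OF n] case_prod_unfold fst_conv snd_conv)
  also have "\<dots> = distr ((?c \<Otimes>\<^sub>M ?N) \<Otimes>\<^sub>M (?A \<Otimes>\<^sub>M ?B)) (mat_borel (Suc n) (Suc n))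
      (\<lambda>p. (\<lambda>p. jborder n (snd (fst p)) (fst (fst p)) (snd p))
          ((\<lambda>(p, q). (p, jacobi_mat n (fst q) (snd q))) p))"
    by (rule distr_law[OF distr_pair_interchange[OF c A N B]], measurable)
      (intro measurable_compose[OF _ jb], use J in measurable)
  also have "\<dots> = distr ((?c \<Otimes>\<^sub>M ?N) \<Otimes>\<^sub>M GbetaE (real DIM('a)) n) (mat_borel (Suc n) (Suc n))
      (\<lambda>p. jborder n (snd (fst p)) (fst (fst p)) (snd p))"
  proof (rule distr_law[OF _ _ jb])
    show "distr ((?c \<Otimes>\<^sub>M ?N) \<Otimes>\<^sub>M (?A \<Otimes>\<^sub>M ?B)) ((?c \<Otimes>\<^sub>M ?N) \<Otimes>\<^sub>M mat_borel n n)
        (\<lambda>(p, q). (p, jacobi_mat n (fst q) (snd q))) =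
        (?c \<Otimes>\<^sub>M ?N) \<Otimes>\<^sub>M GbetaE (real DIM('a)) n"
      by (subst distr_map_prod[OF prob_space_pair[OF c N] prob_space_pair[OF A B] _ J])
          (simp_all add: GbetaE_eq distr_id)
    show "(\<lambda>(p, q). (p, jacobi_mat n (fst q) (snd q))) \<in>
        (?c \<Otimes>\<^sub>M ?N) \<Otimes>\<^sub>M (?A \<Otimes>\<^sub>M ?B) \<rightarrow>\<^sub>M (?c \<Otimes>\<^sub>M ?N) \<Otimes>\<^sub>M mat_borel n n"
      using J by measurable
  qed
  \<comment> \<open>The interchange above delivers the off-diagonal coefficient first, while the
    statement lists the diagonal one first.\<close>
  also have "\<dots> = distr ((?N \<Otimes>\<^sub>M ?c) \<Otimes>\<^sub>M GbetaE (real DIM('a)) n) (mat_borel (Suc n) (Suc n))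
      (\<lambda>p. (\<lambda>p. jborder n (snd (fst p)) (fst (fst p)) (snd p)) ((snd (fst p), fst (fst p)), snd p))"
    by (rule distr_law[symmetric, OF distr_pair_swap_fst[OF N c G]], measurable)
      (rule jborder_measurable, auto simp: GbetaE_eq)
  finally show ?thesis by simp
qed

lemma GbetaE_one: "GbetaE (real DIM('a)) 1 = distr (normal_law 1) (mat_borel 1 1) scalar_mat"
proof -
  let ?N = "normal_law 1"
  let ?A = "Pi\<^sub>M {1..<1} (\<lambda>j. chi_tilde_law (real DIM('a) * (real 1 - real j)))" and ?B =
      "Pi\<^sub>M {1..1::nat} (\<lambda>_. ?N)"
  have A: "prob_space ?A" by (rule prob_space_PiM) auto
  have B: "prob_space ?B" by (rule prob_space_PiM) (rule prob_space_normal_law)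
  have s: "scalar_mat \<in> borel \<rightarrow>\<^sub>M mat_borel 1 1"
    by (rule scalar_mat_measurable) simp
  have comp: "distr ?B ?N (\<lambda>f. f 1) = ?N"
    using distr_PiM_component[of "{1..1::nat}" "\<lambda>_. ?N" 1] prob_space_normal_law by simp
  have "GbetaE (real DIM('a)) 1 = distr (?A \<Otimes>\<^sub>M ?B) (mat_borel 1 1)
      (\<lambda>p. scalar_mat ((\<lambda>f. f 1) (snd p)))"
    unfolding GbetaE_eq
    by (rule distr_cong) (auto simp: jacobi_mat_def scalar_mat_def intro!: eq_matI)
  also have "\<dots> = distr ?B (mat_borel 1 1) (\<lambda>f. scalar_mat (f 1))"
    by (rule distr_law[OF distr_snd_pair[OF A prob_space_imp_sigma_finite[OF B]] measurable_snd])
      (rule scalar_mat_measurable, measurable)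
  also have "\<dots> = distr ?N (mat_borel 1 1) scalar_mat"
    by (rule distr_law[OF comp]) (use s in \<open>auto cong: measurable_cong_sets\<close>)
  finally show ?thesis .
qed

section \<open>Recursion for the Laguerre model\<close>

definition lx_law :: "nat \<Rightarrow> nat \<Rightarrow> real measure" where
  "lx_law m j = (if j \<le> m then chi_law (real DIM('a) * (real m - real j + 1)) else return borel 0)"

definition ly_law :: "nat \<Rightarrow> nat \<Rightarrow> nat \<Rightarrow> real measure" where
  "ly_law m n j = (if j \<le> m then chi_law (real DIM('a) * (real n - real j)) else return borel 0)"

lemma sets_lx_law [simp, measurable_cong]: "sets (lx_law m j) = sets borel"
  and sets_ly_law [simp, measurable_cong]: "sets (ly_law m n j) = sets borel"
  by (auto simp: lx_law_def ly_law_def)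

lemma prob_space_lx_law: "1 \<le> j \<Longrightarrow> prob_space (lx_law m j)"
  using prob_space_chi_law[of "Suc m - j"]
  by (auto simp: lx_law_def of_nat_diff algebra_simps intro!: prob_space_return)

lemma prob_space_ly_law: "j \<in> {1..<n} \<Longrightarrow> prob_space (ly_law m n j)"
  using prob_space_chi_law[of "n - j"]
  by (auto simp: ly_law_def of_nat_diff intro!: prob_space_return)

lemma LbetaE_eq: "LbetaE (real DIM('a)) m n = distr
    (Pi\<^sub>M {1..n} (lx_law m) \<Otimes>\<^sub>M Pi\<^sub>M {1..<n} (ly_law m n))
      (mat_borel n n) (\<lambda>p. bidiag_gram n (fst p) (snd p))"
  unfolding LbetaE_def bidiag_gram_def lx_law_def[abs_def] ly_law_def[abs_def] by
      (simp add: case_prod_unfold)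

lemma sets_lx_PiM: "sets (Pi\<^sub>M K (lx_law m)) = sets (Pi\<^sub>M K (\<lambda>_. borel))"
  and sets_ly_PiM: "sets (Pi\<^sub>M K (ly_law m n)) = sets (Pi\<^sub>M K (\<lambda>_. borel))"
  by (intro sets_PiM_cong; simp)+

text \<open>Lowering \<open>m\<close>, \<open>n\<close> and the index together changes neither the
  chi parameters nor the condition \<open>j \<le> m\<close> that separates chi laws from point
  masses. So the remaining coefficients are those of size \<open>(m, n)\<close>.\<close>

lemma LbetaE_Suc:
  assumes n: "0 < n"
  shows "LbetaE (real DIM('a)) (Suc m) (Suc n) =
    distr ((chi_law (real DIM('a) * real (Suc m)) \<Otimes>\<^sub>M chi_law (real DIM('a) * real n)) \<Otimes>\<^sub>M LbetaE
        (real DIM('a)) m n) (mat_borel (Suc n) (Suc n))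
      (\<lambda>p. jborder n ((fst (fst p))\<^sup>2) (fst (fst p) * snd (fst p))
          (snd p + (snd (fst p))\<^sup>2 \<cdot>\<^sub>m unit11 n))"
proof -
  let ?c = "chi_law (real DIM('a) * real (Suc m))" and ?d = "chi_law (real DIM('a) * real n)"
  let ?A = "Pi\<^sub>M {1..n} (lx_law m)" and ?B = "Pi\<^sub>M {1..<n} (ly_law m n)"
  let ?A' = "Pi\<^sub>M {1..Suc n} (lx_law (Suc m))" and ?B' = "Pi\<^sub>M {1..<Suc n} (ly_law (Suc m) (Suc n))"
  let ?sA = "\<lambda>p. shift_cons {1..Suc n} (fst p) (snd p)" and ?sB =
      "\<lambda>p. shift_cons {1..<Suc n} (fst p) (snd p)"
  have c: "prob_space ?c" by (rule prob_space_chi_law) simp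
  have d: "prob_space ?d" by (rule prob_space_chi_law[OF n])
  have A: "prob_space ?A" by (rule prob_space_PiM) (simp add: prob_space_lx_law)
  have B: "prob_space ?B" by (rule prob_space_PiM) (rule prob_space_ly_law)
  have sA: "distr (?c \<Otimes>\<^sub>M ?A) ?A' ?sA = ?A'" "?sA \<in> ?c \<Otimes>\<^sub>M ?A \<rightarrow>\<^sub>M ?A'"
    by (rule PiM_shift_cons; use bij_shift(1) c prob_space_lx_law in
        \<open>auto simp: lx_law_def of_nat_diff algebra_simps\<close>)+
  have sB: "distr (?d \<Otimes>\<^sub>M ?B) ?B' ?sB = ?B'" "?sB \<in> ?d \<Otimes>\<^sub>M ?B \<rightarrow>\<^sub>M ?B'"
    by (rule PiM_shift_cons; use bij_shift(2)[OF n] d prob_space_ly_law in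
        \<open>auto simp: ly_law_def of_nat_diff algebra_simps\<close>)+
  have J': "(\<lambda>p. bidiag_gram (Suc n) (fst p) (snd p)) \<in> ?A' \<Otimes>\<^sub>M ?B' \<rightarrow>\<^sub>M mat_borel (Suc n) (Suc n)"
    by (rule bidiag_gram_measurable[OF sets_lx_PiM sets_ly_PiM])
  have J: "(\<lambda>p. bidiag_gram n (fst p) (snd p)) \<in> ?A \<Otimes>\<^sub>M ?B \<rightarrow>\<^sub>M mat_borel n n"
    by (rule bidiag_gram_measurable[OF sets_lx_PiM sets_ly_PiM])
  let ?I = "\<lambda>p. ((fst (fst p), fst (snd p)), (snd (fst p), snd (snd p)))"
  let ?F = "\<lambda>p. jborder n ((fst (fst p))\<^sup>2) (fst (fst p) * snd (fst p))
      (snd p + (snd (fst p))\<^sup>2 \<cdot>\<^sub>m unit11 n)"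
  have jb: "?F \<in> (?c \<Otimes>\<^sub>M ?d) \<Otimes>\<^sub>M mat_borel n n \<rightarrow>\<^sub>M mat_borel (Suc n) (Suc n)"
  proof (rule jborder_measurable)
    show "(\<lambda>p. snd p + (snd (fst p))\<^sup>2 \<cdot>\<^sub>m unit11 n) \<in>
        (?c \<Otimes>\<^sub>M ?d) \<Otimes>\<^sub>M mat_borel n n \<rightarrow>\<^sub>M mat_borel n n"
    proof (rule measurable_mat_borelI)
      fix i j assume ij: "i < n" "j < n"
      have [measurable]: "(\<lambda>p. snd p $$ (i, j)) \<in> borel_measurable ((?c \<Otimes>\<^sub>M ?d) \<Otimes>\<^sub>M mat_borel n n)"
        by (rule measurable_mat_entry[OF measurable_snd ij])
      have "(\<lambda>p. snd p $$ (i, j) + (snd (fst p))\<^sup>2 * unit11 n $$ (i, j)) \<in>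
          borel_measurable ((?c \<Otimes>\<^sub>M ?d) \<Otimes>\<^sub>M mat_borel n n)"
        by measurable
      then show "(\<lambda>p. (snd p + (snd (fst p))\<^sup>2 \<cdot>\<^sub>m unit11 n) $$ (i, j)) \<in>
          borel_measurable ((?c \<Otimes>\<^sub>M ?d) \<Otimes>\<^sub>M mat_borel n n)"
        using ij by (simp add: unit11_def)
    qed (auto simp: space_pair_measure unit11_def)
  qed measurable
  have "LbetaE (real DIM('a)) (Suc m) (Suc n) =
      distr (?A' \<Otimes>\<^sub>M ?B') (mat_borel (Suc n) (Suc n)) (\<lambda>p. bidiag_gram (Suc n) (fst p) (snd p))"
    by (rule LbetaE_eq)
  also have "\<dots> = distr ((?c \<Otimes>\<^sub>M ?A) \<Otimes>\<^sub>M (?d \<Otimes>\<^sub>M ?B)) (mat_borel (Suc n) (Suc n))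
      (\<lambda>p. (\<lambda>p. bidiag_gram (Suc n) (fst p) (snd p)) ((\<lambda>(p, q). (?sA p, ?sB q)) p))"
  proof (rule distr_law[symmetric, OF _ _ J'])
    show "distr ((?c \<Otimes>\<^sub>M ?A) \<Otimes>\<^sub>M (?d \<Otimes>\<^sub>M ?B)) (?A' \<Otimes>\<^sub>M ?B') (\<lambda>(p, q). (?sA p, ?sB q)) = ?A' \<Otimes>\<^sub>M ?B'"
      by (subst distr_map_prod[OF prob_space_pair[OF c A] prob_space_pair[OF d B] sA(2) sB(2)])
          (simp only: sA sB)
    show "(\<lambda>(p, q). (?sA p, ?sB q)) \<in> (?c \<Otimes>\<^sub>M ?A) \<Otimes>\<^sub>M (?d \<Otimes>\<^sub>M ?B) \<rightarrow>\<^sub>M ?A' \<Otimes>\<^sub>M ?B'"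
      using sA(2) sB(2) by measurable
  qed
  also have "\<dots> = distr ((?c \<Otimes>\<^sub>M ?A) \<Otimes>\<^sub>M (?d \<Otimes>\<^sub>M ?B)) (mat_borel (Suc n) (Suc n))
      (\<lambda>p. ?F ((\<lambda>(p, q). (p, bidiag_gram n (fst q) (snd q))) (?I p)))"
    by (simp only: bidiag_gram_shift_cons[OF n] case_prod_unfold fst_conv snd_conv)
  also have "\<dots> = distr ((?c \<Otimes>\<^sub>M ?d) \<Otimes>\<^sub>M (?A \<Otimes>\<^sub>M ?B)) (mat_borel (Suc n) (Suc n))
      (\<lambda>p. ?F ((\<lambda>(p, q). (p, bidiag_gram n (fst q) (snd q))) p))"
    by (rule distr_law[OF distr_pair_interchange[OF c A d B]], measurable)
      (intro measurable_compose[OF _ jb], use J in measurable)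
  also have "\<dots> = distr ((?c \<Otimes>\<^sub>M ?d) \<Otimes>\<^sub>M LbetaE (real DIM('a)) m n) (mat_borel (Suc n) (Suc n)) ?F"
  proof (rule distr_law[OF _ _ jb])
    show "distr ((?c \<Otimes>\<^sub>M ?d) \<Otimes>\<^sub>M (?A \<Otimes>\<^sub>M ?B)) ((?c \<Otimes>\<^sub>M ?d) \<Otimes>\<^sub>M mat_borel n n)
        (\<lambda>(p, q). (p, bidiag_gram n (fst q) (snd q))) =
        (?c \<Otimes>\<^sub>M ?d) \<Otimes>\<^sub>M LbetaE (real DIM('a)) m n"
      by (subst distr_map_prod[OF prob_space_pair[OF c d] prob_space_pair[OF A B] _ J])
          (simp_all add: LbetaE_eq distr_id)
    show "(\<lambda>(p, q). (p, bidiag_gram n (fst q) (snd q))) \<in>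
        (?c \<Otimes>\<^sub>M ?d) \<Otimes>\<^sub>M (?A \<Otimes>\<^sub>M ?B) \<rightarrow>\<^sub>M (?c \<Otimes>\<^sub>M ?d) \<Otimes>\<^sub>M mat_borel n n"
      using J by measurable
  qed
  finally show ?thesis .
qed

lemma LbetaE_one: "LbetaE (real DIM('a)) (Suc m) 1 =
    distr (chi_law (real DIM('a) * real (Suc m))) (mat_borel 1 1) (\<lambda>x. scalar_mat (x\<^sup>2))"
proof -
  let ?c = "chi_law (real DIM('a) * real (Suc m))"
  let ?A = "Pi\<^sub>M {1..1::nat} (lx_law (Suc m))" and ?B = "Pi\<^sub>M {1..<1::nat} (ly_law (Suc m) 1)"
  have B: "prob_space ?B" by (rule prob_space_PiM) auto
  have s: "(\<lambda>x :: real. scalar_mat (x\<^sup>2)) \<in> borel \<rightarrow>\<^sub>M mat_borel 1 1"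
    by (rule scalar_mat_measurable) simp
  have lx: "lx_law (Suc m) 1 = ?c" by (simp add: lx_law_def algebra_simps)
  have comp: "distr ?A ?c (\<lambda>f. f 1) = ?c"
    using distr_PiM_component[of "{1..1::nat}" "lx_law (Suc m)" 1] prob_space_lx_law lx by auto
  have "LbetaE (real DIM('a)) (Suc m) 1 = distr (?A \<Otimes>\<^sub>M ?B) (mat_borel 1 1)
      (\<lambda>p. (\<lambda>f. scalar_mat ((f 1)\<^sup>2)) (fst p))"
    unfolding LbetaE_eq
    by (rule distr_cong) (auto simp: bidiag_gram_def bidiag_mat_def scalar_mat_def scalar_prod_def
        power2_eq_square intro!: eq_matI)
  also have "\<dots> = distr ?A (mat_borel 1 1) (\<lambda>f. scalar_mat ((f 1)\<^sup>2))"
    by (rule distr_law[OF distr_fst_pair[OF B] measurable_fst]) (rule scalar_mat_measurable,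
        measurable)
  also have "\<dots> = distr ?c (mat_borel 1 1) (\<lambda>x. scalar_mat (x\<^sup>2))"
    by (rule distr_law[OF comp]) (use s in \<open>auto cong: measurable_cong_sets\<close>)
  finally show ?thesis .
qed

text \<open>The recursion lowers \<open>m\<close> and \<open>n\<close> together and for
  \<open>m < n\<close> runs out of rows first. All coefficients are then almost surely 0, and so is
  the matrix.\<close>

lemma LbetaE_zero: "LbetaE (real DIM('a)) 0 n = return (mat_borel n n) (0\<^sub>m n n)"
proof -
  let ?A = "Pi\<^sub>M {1..n} (lx_law 0)" and ?B = "Pi\<^sub>M {1..<n} (ly_law 0 n)"
  have A: "prob_space ?A" by (rule prob_space_PiM) (simp add: prob_space_lx_law)
  have B: "prob_space ?B" by (rule prob_space_PiM) (rule prob_space_ly_law)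
  interpret A: prob_space ?A by (rule A)
  interpret B: prob_space ?B by (rule B)
  interpret P: prob_space "?A \<Otimes>\<^sub>M ?B" by (rule prob_space_pair[OF A B])
  have "AE f in ?A. \<forall>j\<in>{1..n}. f j = 0"
  proof (rule AE_finite_allI)
    fix j assume j: "j \<in> {1..n}"
    then have "lx_law 0 j = return borel 0" by (auto simp: lx_law_def)
    moreover have "AE x in return borel 0. x = (0 :: real)"
      by (subst AE_return) auto
    ultimately have "AE x in lx_law 0 j. x = 0" by (simp only:)
    with j show "AE f in ?A. f j = 0"
      by (intro AE_PiM_component[of _ "lx_law 0" j "\<lambda>x. x = 0"]) (auto simp: prob_space_lx_law)
  qed simp
  then have a: "AE p in ?A \<Otimes>\<^sub>M ?B. \<forall>j\<in>{1..n}. fst p j = 0"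
    by (intro AE_distrD[OF measurable_fst]) (simp only: distr_fst_pair[OF B])
  have "AE f in ?B. \<forall>j\<in>{1..<n}. f j = 0"
  proof (rule AE_finite_allI)
    fix j assume j: "j \<in> {1..<n}"
    then have "ly_law 0 n j = return borel 0" by (auto simp: ly_law_def)
    moreover have "AE x in return borel 0. x = (0 :: real)"
      by (subst AE_return) auto
    ultimately have "AE x in ly_law 0 n j. x = 0" by (simp only:)
    with j show "AE f in ?B. f j = 0"
      by (intro AE_PiM_component[of _ "ly_law 0 n" j "\<lambda>x. x = 0"]) (auto simp: prob_space_ly_law)
  qed simp
  then have b: "AE p in ?A \<Otimes>\<^sub>M ?B. \<forall>j\<in>{1..<n}. snd p j = 0"
    by (intro AE_distrD[OF measurable_snd]) (simp only:
        distr_snd_pair[OF A B.sigma_finite_measure_axioms])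
  have "LbetaE (real DIM('a)) 0 n = distr (?A \<Otimes>\<^sub>M ?B) (mat_borel n n) (\<lambda>_. 0\<^sub>m n n)"
    unfolding LbetaE_eq
  proof (rule distr_cong_AE)
    show "AE p in ?A \<Otimes>\<^sub>M ?B. bidiag_gram n (fst p) (snd p) = 0\<^sub>m n n"
      using a b
    proof eventually_elim
      case (elim p)
      show ?case
      proof (rule eq_matI)
        fix i j assume "i < dim_row (0\<^sub>m n n :: real mat)" "j < dim_col (0\<^sub>m n n :: real mat)"
        then show "bidiag_gram n (fst p) (snd p) $$ (i, j) = 0\<^sub>m n n $$ (i, j)"
          using elim by (simp add: bidiag_gram_index)
      qed (auto simp: bidiag_gram_def bidiag_mat_def)
    qed
  qed (rule bidiag_gram_measurable[OF sets_lx_PiM sets_ly_PiM] mat_const_measurable zero_carrier_mat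
      refl)+
  also have "\<dots> = return (mat_borel n n) (0\<^sub>m n n)"
    by (rule P.distr_const) simp
  finally show ?thesis .
qed

end

section \<open>The law of the tridiagonal form\<close>

context hermitian_scalars
begin

lemma tridiag_Suc:
  "tridiag (Suc n) (H :: 'a mat) = jborder n (inner (H $$ (0, 0)) 1) (hs_norm (sub_col H))
    (tridiag n (align n (sub_col H) * sub_mat H * conj_transpose (align n (sub_col H))))"
  by (simp add: Let_def jborder_def)

definition herm :: "'a mat \<Rightarrow> 'a mat" where
  "herm Y = map_mat (\<lambda>z. (1 / 2) *\<^sub>R z) (Y + conj_transpose Y)"

lemma herm_eq: "herm Y = of_real (1 / 2) \<cdot>\<^sub>m (Y + conj_transpose Y)"
  by (rule eq_matI) (auto simp: herm_def of_real_def)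

lemma herm_hermitian: "Y \<in> carrier_mat n n \<Longrightarrow> conj_transpose (herm Y) = herm Y"
  by (rule eq_matI) (auto simp: herm_def conj_scaleR conj_add add.commute)

lemma herm_measurable: "f \<in> M \<rightarrow>\<^sub>M mat_borel n n \<Longrightarrow> (\<lambda>x. herm (f x)) \<in> M \<rightarrow>\<^sub>M mat_borel n n"
  unfolding herm_eq by (intro mat_smult_measurable mat_add_measurable conj_transpose_measurable)
      auto

lemma herm_conjugation:
  assumes "U \<in> carrier_mat n n" "Y \<in> carrier_mat n n"
  shows "herm (U * Y * conj_transpose U) = U * herm Y * conj_transpose U"
proof -
  have "conj_transpose (U * Y * conj_transpose U) = U * conj_transpose Y * conj_transpose U"
    using assms by (simp add: conj_transpose_mult[of _ n n _ n] assoc_mult_mat[of _ n n _ n _ n])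
  then have "herm (U * Y * conj_transpose U) =
      of_real (1 / 2) \<cdot>\<^sub>m (U * Y * conj_transpose U + U * conj_transpose Y * conj_transpose U)"
    by (simp add: herm_eq)
  also have "U * Y * conj_transpose U + U * conj_transpose Y * conj_transpose U =
      U * (Y + conj_transpose Y) * conj_transpose U"
    using assms by (simp add: mult_add_distrib_mat[of _ n n] add_mult_distrib_mat[of _ n n _ _ n])
  finally show ?thesis
    unfolding herm_eq[of Y] using assms by (simp only: mult_of_real_smult[of U n n _ n]
        mult_of_real_smult[of _ n n _ n]
      mult_carrier_square add_carrier_mat conj_transpose_carrier)
qed

lemma iid_conjugation:
  assumes U: "preserves_gauss n U"
  shows "distr (iid n n) (mat_borel n n) (\<lambda>Y. U * Y * conj_transpose U) = iid n n"
proof -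
  have car: "U \<in> carrier_mat n n" using U by (simp add: preserves_gauss_def)
  have "distr (iid n n) (mat_borel n n) (\<lambda>Y. U * Y * conj_transpose U) =
      distr (iid n n) (mat_borel n n) (\<lambda>Y. Y * conj_transpose U)"
    by (rule distr_law[OF iid_left_mult[OF U]])
      (use left_mult_measurable[OF car, of n] mat_mult_measurable[OF measurable_ident_sets[OF refl]
          mat_const_measurable, of "conj_transpose U" n n n] car
        in \<open>auto cong: measurable_cong_sets\<close>)
  then show ?thesis by (simp add: iid_right_mult[OF U])
qed

text \<open>Corner, rest of the first column, rest of the first row, and the remaining block,
  bracketed in the order in which the column and then the row are split off.\<close>

definition block :: "('a \<times> 'a mat) \<times> ('a mat \<times> 'a mat) \<Rightarrow> 'a mat" where
  "block p = col_cons (vec_cons (fst (fst p)) (snd (fst p))) (row_cons (fst (snd p)) (snd (snd p)))"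

lemma block_measurable:
  "block \<in> (\<nu> \<Otimes>\<^sub>M iid n 1) \<Otimes>\<^sub>M (iid 1 n \<Otimes>\<^sub>M iid n n) \<rightarrow>\<^sub>M mat_borel (Suc n) (Suc n)"
  and iid_block: "iid (Suc n) (Suc n) = distr ((\<nu> \<Otimes>\<^sub>M iid n 1) \<Otimes>\<^sub>M (iid 1 n \<Otimes>\<^sub>M iid n n))
      (mat_borel (Suc n) (Suc n)) block"
proof -
  let ?f = "\<lambda>(p, q). ((\<lambda>(x, v). vec_cons x v) p, (\<lambda>(r, Z). row_cons r Z) q)"
  have f: "?f \<in> (\<nu> \<Otimes>\<^sub>M iid n 1) \<Otimes>\<^sub>M (iid 1 n \<Otimes>\<^sub>M iid n n) \<rightarrow>\<^sub>M mat_borel (Suc n) 1 \<Otimes>\<^sub>M mat_borel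
      (Suc n) n"
    using vec_cons_measurable_iid[of n] row_cons_measurable_iid[of n n] by measurable
  have eq: "block = (\<lambda>p. (\<lambda>(y, Y). col_cons y Y) (?f p))"
    by (auto simp: fun_eq_iff block_def)
  show "block \<in> (\<nu> \<Otimes>\<^sub>M iid n 1) \<Otimes>\<^sub>M (iid 1 n \<Otimes>\<^sub>M iid n n) \<rightarrow>\<^sub>M mat_borel (Suc n) (Suc n)"
    unfolding eq by (rule measurable_compose[OF f measurable_col_cons])
  have "distr ((\<nu> \<Otimes>\<^sub>M iid n 1) \<Otimes>\<^sub>M (iid 1 n \<Otimes>\<^sub>M iid n n))
      (mat_borel (Suc n) 1 \<Otimes>\<^sub>M mat_borel (Suc n) n) ?f = iid (Suc n) 1 \<Otimes>\<^sub>M iid (Suc n) n"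
    unfolding iid_vec_cons[of n] iid_row_cons[of n n]
    by (rule distr_map_prod) (use vec_cons_measurable_iid[of n] row_cons_measurable_iid[of n n] in
        \<open>auto intro: prob_space_pair prob_space_\<nu> prob_space_iid\<close>)
  then show "iid (Suc n) (Suc n) = distr ((\<nu> \<Otimes>\<^sub>M iid n 1) \<Otimes>\<^sub>M (iid 1 n \<Otimes>\<^sub>M iid n n))
      (mat_borel (Suc n) (Suc n)) block"
    unfolding eq iid_col_cons[of "Suc n" n] by
        (rule distr_law[symmetric, OF _ f measurable_col_cons])
qed

lemma herm_block:
  assumes "c \<in> carrier_mat n 1" "r \<in> carrier_mat 1 n" "Z \<in> carrier_mat n n"
  shows "inner (herm (block ((y, c), (r, Z))) $$ (0, 0)) 1 = inner y 1"
    and "sub_col (herm (block ((y, c), (r, Z)))) = of_real (1 / 2) \<cdot>\<^sub>m (c + conj_transpose r)"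
    and "sub_mat (herm (block ((y, c), (r, Z)))) = herm Z"
proof -
  have "y + conjugate y = 2 *\<^sub>R of_real (inner y 1)"
    unfolding conj_eq by (simp add: of_real_def)
  then show "inner (herm (block ((y, c), (r, Z))) $$ (0, 0)) 1 = inner y 1"
    using assms by (simp add: herm_def block_def col_cons_def row_cons_def vec_cons_def)
  show "sub_col (herm (block ((y, c), (r, Z)))) = of_real (1 / 2) \<cdot>\<^sub>m (c + conj_transpose r)"
    by (rule eq_matI)
      (use assms in \<open>auto simp: herm_def block_def col_cons_def row_cons_def vec_cons_def
          sub_col_def of_real_def\<close>)
  show "sub_mat (herm (block ((y, c), (r, Z)))) = herm Z"
    by (rule eq_matI)
      (use assms in \<open>auto simp: herm_def block_def col_cons_def row_cons_def vec_cons_def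
          sub_mat_def\<close>)
qed

text \<open>The row is moved to the corner and the column, because a Hermitian matrix
  \<open>herm Y\<close> draws its first column from both; all data that determine the rotation are
  then in one factor.\<close>

lemma distr_pair_regroup:
  assumes "prob_space A" "prob_space B" "prob_space C" "prob_space D"
  shows "distr ((A \<Otimes>\<^sub>M B) \<Otimes>\<^sub>M (C \<Otimes>\<^sub>M D)) ((A \<Otimes>\<^sub>M (B \<Otimes>\<^sub>M C)) \<Otimes>\<^sub>M D)
    (\<lambda>p. ((fst (fst p), (snd (fst p), fst (snd p))), snd (snd p))) = (A \<Otimes>\<^sub>M (B \<Otimes>\<^sub>M C)) \<Otimes>\<^sub>M D"
proof -
  note sf = assms[THEN prob_space_imp_sigma_finite]
  note AB = prob_space_pair[OF assms(1,2)]
  have "distr ((A \<Otimes>\<^sub>M B) \<Otimes>\<^sub>M (C \<Otimes>\<^sub>M D)) ((A \<Otimes>\<^sub>M (B \<Otimes>\<^sub>M C)) \<Otimes>\<^sub>M D)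
      (\<lambda>p. (\<lambda>(q, d). ((\<lambda>q. (fst (fst q), (snd (fst q), snd q))) q, d))
          ((\<lambda>p. ((fst p, fst (snd p)), snd (snd p))) p)) =
    distr (((A \<Otimes>\<^sub>M B) \<Otimes>\<^sub>M C) \<Otimes>\<^sub>M D) ((A \<Otimes>\<^sub>M (B \<Otimes>\<^sub>M C)) \<Otimes>\<^sub>M D)
        (\<lambda>(q, d). ((\<lambda>q. (fst (fst q), (snd (fst q), snd q))) q, d))"
    by (rule distr_law[OF distr_pair_assoc'[OF prob_space_imp_sigma_finite[OF AB] sf(3,4)]])
        measurable
  also have "\<dots> = (A \<Otimes>\<^sub>M (B \<Otimes>\<^sub>M C)) \<Otimes>\<^sub>M distr D D (\<lambda>d. d)"
    by (subst distr_map_prod[OF prob_space_pair[OF AB assms(3)] assms(4)])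
        (simp_all add: distr_pair_assoc[OF sf(1-3)])
  finally show ?thesis by (simp add: distr_id)
qed

text \<open>The column below the corner is half the sum of the column of Y and the adjoint of its
  row, so its rotation F is a function of these, independent of the block Z. Since
  \<open>F Z F^H\<close> has the law of Z for each frozen F, \<open>distr_pair_skew\<close> discards
  F. The real part of the corner, the norm of the column and the tridiagonal form of the block are
  then independent with exactly the laws in \<open>GbetaE_Suc\<close>.\<close>

theorem distr_tridiag_gaussian:
  "0 < n \<Longrightarrow> distr (iid n n) (mat_borel n n) (\<lambda>Y. tridiag n (herm Y)) = GbetaE (real DIM('a)) n"
proof (induction n rule: nat_induct_non_zero)
  case 1
  have v: "(\<lambda>(x, v). vec_cons x v) \<in> \<nu> \<Otimes>\<^sub>M iid 0 1 \<rightarrow>\<^sub>M mat_borel 1 1"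
    using vec_cons_measurable_iid[of 0] by simp
  have s: "scalar_mat \<in> borel \<rightarrow>\<^sub>M (mat_borel 1 1 :: real mat measure)"
    by (rule scalar_mat_measurable) simp
  have eq: "iid 1 1 = distr (\<nu> \<Otimes>\<^sub>M iid 0 1) (mat_borel 1 1) (\<lambda>(x, v). vec_cons x v)"
    using iid_vec_cons[of 0] by simp
  have "distr (iid 1 1) (mat_borel 1 1) (\<lambda>Y. tridiag 1 (herm Y)) =
      distr (\<nu> \<Otimes>\<^sub>M iid 0 1) (mat_borel 1 1) (\<lambda>p. (\<lambda>Y. tridiag 1 (herm Y))
          ((\<lambda>(x, v). vec_cons x v) p))"
    unfolding eq
    by (rule distr_law[symmetric, OF refl v]) (intro tridiag_measurable herm_measurable
        measurable_ident_sets refl)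
  also have "\<dots> = distr (\<nu> \<Otimes>\<^sub>M iid 0 1) (mat_borel 1 1) (\<lambda>p. (\<lambda>x. scalar_mat (inner x 1)) (fst p))"
  proof (rule distr_cong)
    fix p assume "p \<in> space (\<nu> \<Otimes>\<^sub>M iid 0 1)"
    then obtain x v where p: "p = (x, v)" and v: "v \<in> carrier_mat 0 1" by
        (auto simp: space_pair_measure)
    have "x + conjugate x = 2 *\<^sub>R of_real (inner x 1)"
      unfolding conj_eq by (simp add: of_real_def)
    then have "inner (herm (vec_cons x v) $$ (0, 0)) 1 = inner x 1"
      using v by (simp add: herm_def vec_cons_def)
    then show "(\<lambda>Y. tridiag 1 (herm Y)) ((\<lambda>(x, v). vec_cons x v) p) =
        (\<lambda>x. scalar_mat (inner x 1)) (fst p)"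
      by (auto simp: p Let_def unit_col_def scalar_mat_def intro!: eq_matI)
  qed simp_all
  also have "\<dots> = distr \<nu> (mat_borel 1 1) (\<lambda>x. scalar_mat (inner x 1))"
    by (rule distr_law[OF distr_fst_pair[OF prob_space_iid] measurable_fst])
        (rule scalar_mat_measurable, measurable)
  also have "\<dots> = distr (normal_law 1) (mat_borel 1 1) scalar_mat"
    by (rule distr_law[OF distr_\<nu>_inner_one _ s]) measurable
  finally show ?case by (simp only: GbetaE_one)
next
  case (Suc n)
  let ?mb = "mat_borel (Suc n) (Suc n) :: real mat measure"
  let ?P1 = "(\<nu> \<Otimes>\<^sub>M iid n 1) \<Otimes>\<^sub>M (iid 1 n \<Otimes>\<^sub>M iid n n)"
  let ?Q = "\<nu> \<Otimes>\<^sub>M (iid n 1 \<Otimes>\<^sub>M iid 1 n)"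
  let ?P2 = "?Q \<Otimes>\<^sub>M iid n n"
  define w :: "'a \<times> ('a mat \<times> 'a mat) \<Rightarrow> 'a mat" where
      "w q = of_real (1 / 2) \<cdot>\<^sub>m (fst (snd q) + conj_transpose (snd (snd q)))" for q
  define F where "F q = align n (w q)" for q
  define \<psi> where "\<psi> q = (inner (fst q) 1, hs_norm (w q))" for q
  \<comment> \<open>The map is factored into three: \<open>?\<rho>\<close> collects the data that
    determine the rotation, \<open>?S\<close> rotates the block by it, and \<open>?K\<close>
    assembles the Jacobi matrix from what no longer involves the rotation.\<close>
  let ?K = "\<lambda>p. jborder n (fst (\<psi> (fst p))) (snd (\<psi> (fst p))) (tridiag n (herm (snd p)))"
  let ?S = "\<lambda>(q, Z). (q, F q * Z * conj_transpose (F q))"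
  let ?\<rho> = "\<lambda>p. ((fst (fst p), (snd (fst p), fst (snd p))), snd (snd p))"
  have Q: "prob_space ?Q"
    by (intro prob_space_pair prob_space_\<nu> prob_space_iid)
  have w: "w \<in> ?Q \<rightarrow>\<^sub>M mat_borel n 1"
    unfolding w_def by (intro mat_smult_measurable mat_add_measurable conj_transpose_measurable)
        measurable
  have F: "F \<in> ?Q \<rightarrow>\<^sub>M mat_borel n n"
    unfolding F_def by (rule align_measurable[OF w])
  have psi: "\<psi> \<in> ?Q \<rightarrow>\<^sub>M borel \<Otimes>\<^sub>M borel"
    unfolding \<psi>_def by (intro measurable_Pair hs_norm_measurable[OF w]) measurable
  have FZ: "(\<lambda>p. F (fst p) * snd p * conj_transpose (F (fst p))) \<in> ?P2 \<rightarrow>\<^sub>M mat_borel n n"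
    by (intro conjugation_measurable measurable_compose[OF measurable_fst F]) measurable
  have S: "?S \<in> ?P2 \<rightarrow>\<^sub>M ?Q \<Otimes>\<^sub>M mat_borel n n"
    unfolding case_prod_unfold by (intro measurable_Pair FZ measurable_fst)
  have K: "?K \<in> ?Q \<Otimes>\<^sub>M mat_borel n n \<rightarrow>\<^sub>M ?mb"
    by (intro jborder_measurable tridiag_measurable herm_measurable measurable_snd
        measurable_compose[OF measurable_compose[OF measurable_fst psi] measurable_fst]
        measurable_compose[OF measurable_compose[OF measurable_fst psi] measurable_snd])
  have rho: "?\<rho> \<in> ?P1 \<rightarrow>\<^sub>M ?P2" by measurable
  have KS: "(\<lambda>p. ?K (?S p)) \<in> ?P2 \<rightarrow>\<^sub>M ?mb" by (rule measurable_compose[OF S K])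
  have "distr (iid (Suc n) (Suc n)) ?mb (\<lambda>Y. tridiag (Suc n) (herm Y)) =
      distr ?P1 ?mb (\<lambda>p. (\<lambda>Y. tridiag (Suc n) (herm Y)) (block p))"
    unfolding iid_block
    by (rule distr_law[symmetric, OF refl block_measurable])
      (intro tridiag_measurable herm_measurable measurable_ident_sets refl)
  also have "\<dots> = distr ?P1 ?mb (\<lambda>p. (\<lambda>p. ?K (?S p)) (?\<rho> p))"
  proof (rule distr_cong)
    fix p assume "p \<in> space ?P1"
    then obtain y c r Z where p: "p = ((y, c), (r, Z))"
      and car: "c \<in> carrier_mat n 1" "r \<in> carrier_mat 1 n" "Z \<in> carrier_mat n n"
      by (auto simp: space_pair_measure)
    have wc: "w (y, (c, r)) \<in> carrier_mat n (Suc 0)" using car by (simp add: w_def)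
    then have Fc: "F (y, (c, r)) \<in> carrier_mat n n" by (simp add: F_def)
    have "sub_col (herm (block p)) = w (y, (c, r))"
      unfolding p herm_block(2)[OF car] by (simp add: w_def)
    then show "tridiag (Suc n) (herm (block p)) = ?K (?S (?\<rho> p))"
      unfolding tridiag_Suc using herm_block[OF car, of y]
      by (simp add: p \<psi>_def herm_conjugation[OF Fc car(3)]) (simp add: F_def)
  qed simp_all
  also have "\<dots> = distr ?P2 ?mb (\<lambda>p. ?K (?S p))"
    by (rule distr_law[OF distr_pair_regroup[OF prob_space_\<nu> prob_space_iid prob_space_iid
        prob_space_iid] rho KS])
  also have "\<dots> = distr (?Q \<Otimes>\<^sub>M iid n n) ?mb ?K"
  proof (rule distr_law[OF _ S K])
    show "distr ?P2 (?Q \<Otimes>\<^sub>M mat_borel n n) ?S = ?Q \<Otimes>\<^sub>M iid n n"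
    proof (rule distr_pair_skew)
      fix q assume "q \<in> space ?Q"
      then have "w q \<in> carrier_mat n 1" using measurable_space[OF w] by simp
      then show "distr (iid n n) (mat_borel n n) (\<lambda>Z. F q * Z * conj_transpose (F q)) = iid n n"
        unfolding F_def by (intro iid_conjugation preserves_gauss_align)
    qed (use FZ Q in \<open>auto simp: case_prod_unfold intro: sigma_finite_iid
        prob_space_imp_sigma_finite\<close>)
  qed
  also have "\<dots> = distr (?Q \<Otimes>\<^sub>M iid n n) ?mb (\<lambda>p. (\<lambda>p. jborder n (fst (fst p)) (snd (fst p)) (snd p))
      ((\<lambda>(q, Z). (\<psi> q, tridiag n (herm Z))) p))"
    by (simp add: case_prod_unfold)
  also have "\<dots> = distr ((normal_law 1 \<Otimes>\<^sub>M chi_tilde_law (real DIM('a) * real n)) \<Otimes>\<^sub>M GbetaE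
      (real DIM('a)) n) ?mb
      (\<lambda>p. jborder n (fst (fst p)) (snd (fst p)) (snd p))"
  proof (rule distr_law)
    have T: "(\<lambda>Z. tridiag n (herm Z)) \<in> iid n n \<rightarrow>\<^sub>M mat_borel n n"
      by (intro tridiag_measurable herm_measurable) measurable
    have wl: "(\<lambda>(c, r). hs_norm (of_real (1 / 2) \<cdot>\<^sub>m (c + conj_transpose r) :: 'a mat)) \<in>
        iid n 1 \<Otimes>\<^sub>M iid 1 n \<rightarrow>\<^sub>M borel"
      unfolding case_prod_unfold
      by (intro hs_norm_measurable mat_smult_measurable mat_add_measurable
          conj_transpose_measurable) measurable
    have "distr ?Q (borel \<Otimes>\<^sub>M borel) \<psi> = distr ?Q (borel \<Otimes>\<^sub>M borel)
        (\<lambda>(y, z). (inner y 1, (\<lambda>(c, r). hs_norm (of_real (1 / 2) \<cdot>\<^sub>m (c + conj_transpose r))) z))"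
      by (rule distr_cong) (auto simp: \<psi>_def w_def)
    also have "\<dots> = distr \<nu> borel (\<lambda>y. inner y 1) \<Otimes>\<^sub>M distr (iid n 1 \<Otimes>\<^sub>M iid 1 n) borel
        (\<lambda>(c, r). hs_norm (of_real (1 / 2) \<cdot>\<^sub>m (c + conj_transpose r)))"
      by (rule distr_map_prod[OF prob_space_\<nu> prob_space_pair[OF prob_space_iid prob_space_iid] _
          wl]) measurable
    also have "\<dots> = normal_law 1 \<Otimes>\<^sub>M chi_tilde_law (real DIM('a) * real n)"
      by (simp only: distr_\<nu>_inner_one distr_iid_hermitian_norm[OF Suc.hyps])
    finally have psil: "distr ?Q (borel \<Otimes>\<^sub>M borel) \<psi> =
        normal_law 1 \<Otimes>\<^sub>M chi_tilde_law (real DIM('a) * real n)" .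
    show "distr (?Q \<Otimes>\<^sub>M iid n n) ((borel \<Otimes>\<^sub>M borel) \<Otimes>\<^sub>M mat_borel n n)
        (\<lambda>(q, Z). (\<psi> q, tridiag n (herm Z))) =
        (normal_law 1 \<Otimes>\<^sub>M chi_tilde_law (real DIM('a) * real n)) \<Otimes>\<^sub>M GbetaE (real DIM('a)) n"
      by (subst distr_map_prod[OF Q prob_space_iid psi T]) (simp only: psil Suc.IH)
    show "(\<lambda>(q, Z). (\<psi> q, tridiag n (herm Z))) \<in>
        ?Q \<Otimes>\<^sub>M iid n n \<rightarrow>\<^sub>M (borel \<Otimes>\<^sub>M borel) \<Otimes>\<^sub>M mat_borel n n"
      using psi T by measurable
    show "(\<lambda>p. jborder n (fst (fst p)) (snd (fst p)) (snd p)) \<in>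
        (borel \<Otimes>\<^sub>M borel) \<Otimes>\<^sub>M mat_borel n n \<rightarrow>\<^sub>M ?mb"
      by (rule jborder_measurable) measurable
  qed
  also have "\<dots> = GbetaE (real DIM('a)) (Suc n)"
    by (rule GbetaE_Suc[OF Suc.hyps, symmetric])
  finally show ?case .
qed

lemma tridiag_zero: "tridiag n (0\<^sub>m n n :: 'a mat) = 0\<^sub>m n n"
proof (induction n)
  case 0
  show ?case by simp
next
  case (Suc n)
  have c: "sub_col (0\<^sub>m (Suc n) (Suc n) :: 'a mat) = 0\<^sub>m n 1"
    by (rule eq_matI) (auto simp: sub_col_def)
  have m: "sub_mat (0\<^sub>m (Suc n) (Suc n) :: 'a mat) = 0\<^sub>m n n"
    by (rule eq_matI) (auto simp: sub_mat_def)
  have F: "align n (0\<^sub>m n 1 :: 'a mat) \<in> carrier_mat n n" by simp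
  have "align n (0\<^sub>m n 1 :: 'a mat) * 0\<^sub>m n n * conj_transpose (align n (0\<^sub>m n 1)) = 0\<^sub>m n n"
    using F by (simp add: right_mult_zero_mat[of _ n n] left_mult_zero_mat[of _ n n])
  then show ?case
    unfolding tridiag_Suc c m by (simp only: Suc.IH)
        (auto intro!: eq_matI simp: jborder_def scalar_mat_def hs_norm_def unit_col_def)
qed

text \<open>The corner of the matrix is read off as the first diagonal coefficient and influences
  none of the rotations.\<close>

lemma tridiag_add_unit11:
  assumes n: "0 < n" and H: "H \<in> carrier_mat n n"
  shows "tridiag n (H + of_real c \<cdot>\<^sub>m unit11 n :: 'a mat) = tridiag n H + c \<cdot>\<^sub>m unit11 n"
proof -
  obtain k where k: "n = Suc k" using n by (cases n) auto
  have 1: "sub_col (H + of_real c \<cdot>\<^sub>m unit11 n) = sub_col H"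
    by (rule eq_matI) (use H in \<open>auto simp: sub_col_def unit11_def k\<close>)
  have 2: "sub_mat (H + of_real c \<cdot>\<^sub>m unit11 n) = sub_mat H"
    by (rule eq_matI) (use H in \<open>auto simp: sub_mat_def unit11_def k\<close>)
  have 3: "inner ((H + of_real c \<cdot>\<^sub>m unit11 n) $$ (0, 0)) 1 = inner (H $$ (0, 0)) 1 + c"
    using H by (simp add: unit11_def k inner_add_left)
  show ?thesis
    unfolding k tridiag_Suc 1[unfolded k] 2[unfolded k] 3[unfolded k]
    by (rule eq_matI) (auto simp: jborder_def scalar_mat_def unit11_def
        carrier_matD[OF tridiag_carrier])
qed

section \<open>Gram matrices under rotations from the left and from the right\<close>

definition gram :: "'a mat \<Rightarrow> 'a mat" where
  "gram Y = conj_transpose Y * Y"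

lemma gram_carrier [simp]: "Y \<in> carrier_mat m n \<Longrightarrow> gram Y \<in> carrier_mat n n"
  unfolding gram_def by (intro mult_carrier_mat conj_transpose_carrier)

lemma gram_measurable: "f \<in> M \<rightarrow>\<^sub>M mat_borel m n \<Longrightarrow> (\<lambda>x. gram (f x)) \<in> M \<rightarrow>\<^sub>M mat_borel n n"
  unfolding gram_def by (intro mat_mult_measurable[where k = m] conj_transpose_measurable)

lemma gram_hermitian: "Y \<in> carrier_mat m n \<Longrightarrow> conj_transpose (gram Y) = gram Y"
  unfolding gram_def by (simp add: conj_transpose_mult[of _ n m _ n])

lemma gram_index:
  "Y \<in> carrier_mat m n \<Longrightarrow> i < n \<Longrightarrow> j < n \<Longrightarrow> gram Y $$ (i, j) =
      (\<Sum>l<m. conjugate (Y $$ (l, i)) * Y $$ (l, j))"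
  unfolding gram_def by (subst index_mult_mat_sum[of _ n m _ n]) auto

lemma gram_index_00:
  assumes "y \<in> carrier_mat m 1"
  shows "(\<Sum>l<m. conjugate (y $$ (l, 0)) * y $$ (l, 0) :: 'a) = of_real ((hs_norm y)\<^sup>2)"
  using assms by (simp add: conj_mult_self hs_norm_def sum_nonneg)

lemma gram_col_cons:
  assumes y: "y \<in> carrier_mat m 1" and Y: "Y \<in> carrier_mat m n"
  shows "inner (gram (col_cons y Y) $$ (0, 0)) 1 = (hs_norm y)\<^sup>2"
    and "sub_col (gram (col_cons y Y)) = conj_transpose Y * y"
    and "sub_mat (gram (col_cons y Y)) = gram Y"
proof -
  have c: "col_cons y Y \<in> carrier_mat m (Suc n)" using Y by simp
  have g: "gram (col_cons y Y) \<in> carrier_mat (Suc n) (Suc n)" using c by simp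
  have "gram (col_cons y Y) $$ (0, 0) = of_real ((hs_norm y)\<^sup>2)"
    using gram_index[OF c, of 0 0] gram_index_00[OF y] Y by (simp add: col_cons_def)
  then show "inner (gram (col_cons y Y) $$ (0, 0)) 1 = (hs_norm y)\<^sup>2"
    by (simp del: of_real_power)
  show "sub_col (gram (col_cons y Y)) = conj_transpose Y * y"
  proof (rule eq_matI)
    fix i j assume "i < dim_row (conj_transpose Y * y)" "j < dim_col (conj_transpose Y * y)"
    then have ij: "i < n" "j = 0" using y Y by auto
    have "sub_col (gram (col_cons y Y)) $$ (i, 0) = gram (col_cons y Y) $$ (Suc i, 0)"
      using ij g by (simp add: sub_col_def)
    also have "\<dots> = (\<Sum>l<m. conjugate (Y $$ (l, i)) * y $$ (l, 0))"
      using gram_index[OF c, of "Suc i" 0] ij Y by (simp add: col_cons_def)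
    also have "\<dots> = (conj_transpose Y * y) $$ (i, 0)"
      using ij Y y by (subst index_mult_mat_sum[of _ n m _ 1]) auto
    finally show "sub_col (gram (col_cons y Y)) $$ (i, j) = (conj_transpose Y * y) $$ (i, j)"
      by (simp only: ij)
  qed (use y Y g in \<open>auto simp: sub_col_def\<close>)
  show "sub_mat (gram (col_cons y Y)) = gram Y"
  proof (rule eq_matI)
    fix i j assume "i < dim_row (gram Y)" "j < dim_col (gram Y)"
    then have ij: "i < n" "j < n" using Y by (auto simp: gram_def)
    then show "sub_mat (gram (col_cons y Y)) $$ (i, j) = gram Y $$ (i, j)"
      using g gram_index[OF c, of "Suc i" "Suc j"] gram_index[OF Y ij] Y by
          (simp add: sub_mat_def col_cons_def)
  qed (use Y in \<open>auto simp: sub_mat_def gram_def col_cons_def\<close>)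
qed

lemma gram_unitary_mult:
  assumes U: "unitary m U" and Y: "Y \<in> carrier_mat m n" and X: "X \<in> carrier_mat m k"
  shows "conj_transpose (U * Y) * (U * X) = conj_transpose Y * (X :: 'a mat)"
proof -
  have Uc: "U \<in> carrier_mat m m" using U by (rule unitary_carrier)
  have "conj_transpose (U * Y) * (U * X) = conj_transpose Y * conj_transpose U * (U * X)"
    using Uc Y by (simp only: conj_transpose_mult)
  also have "\<dots> = conj_transpose Y * (conj_transpose U * (U * X))"
    by (rule assoc_mult_mat[of _ n m _ m _ k]) (use Uc Y X in auto)
  also have "conj_transpose U * (U * X) = (conj_transpose U * U) * X"
    by (rule assoc_mult_mat[of _ m m _ m _ k, symmetric]) (use Uc Y X in auto)
  also have "\<dots> = X"
    using U X by (simp add: unitary_def)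
  finally show ?thesis .
qed

lemma gram_row_cons:
  assumes r: "r \<in> carrier_mat 1 n" and Z: "Z \<in> carrier_mat m n"
  shows "conj_transpose (row_cons r Z) * unit_col (Suc m) = conj_transpose r"
    and "gram (row_cons r Z) = conj_transpose r * r + gram Z"
proof -
  have c: "row_cons r Z \<in> carrier_mat (Suc m) n" using Z by simp
  show "conj_transpose (row_cons r Z) * unit_col (Suc m) = conj_transpose r"
  proof (rule eq_matI)
    fix i j assume "i < dim_row (conj_transpose r)" "j < dim_col (conj_transpose r)"
    then have ij: "i < n" "j = 0" using r by auto
    have "(conj_transpose (row_cons r Z) * unit_col (Suc m)) $$ (i, 0) =
        (\<Sum>l<Suc m. conj_transpose (row_cons r Z) $$ (i, l) * unit_col (Suc m) $$ (l, 0))"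
      using ij c by (subst index_mult_mat_sum[of _ n "Suc m" _ 1]) auto
    also have "\<dots> = conj_transpose (row_cons r Z) $$ (i, 0)"
      by (subst sum.lessThan_Suc_shift) (simp add: unit_col_def)
    also have "\<dots> = conj_transpose r $$ (i, 0)"
      using ij r Z by (simp add: row_cons_def)
    finally show "(conj_transpose (row_cons r Z) * unit_col (Suc m)) $$ (i, j) =
        conj_transpose r $$ (i, j)"
      by (simp only: ij)
  qed (use r Z in \<open>auto simp: row_cons_def unit_col_def\<close>)
  show "gram (row_cons r Z) = conj_transpose r * r + gram Z"
  proof (rule eq_matI)
    fix i j assume "i < dim_row (conj_transpose r * r + gram Z)"
        "j < dim_col (conj_transpose r * r + gram Z)"
    then have ij: "i < n" "j < n" using Z by (auto simp: gram_def)
    have "gram (row_cons r Z) $$ (i, j) = conjugate (r $$ (0, i)) * r $$ (0, j) +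
        (\<Sum>l<m. conjugate (Z $$ (l, i)) * Z $$ (l, j))"
      unfolding gram_index[OF c ij] using ij Z
      by (subst sum.lessThan_Suc_shift) (simp add: row_cons_def)
    also have "conjugate (r $$ (0, i)) * r $$ (0, j) = (conj_transpose r * r) $$ (i, j)"
      using ij r by (subst index_mult_mat_sum[of _ n 1 _ n]) auto
    finally show "gram (row_cons r Z) $$ (i, j) = (conj_transpose r * r + gram Z) $$ (i, j)"
      using ij r Z gram_index[OF Z ij] by (simp add: gram_def)
  qed (use r Z in \<open>auto simp: row_cons_def gram_def\<close>)
qed

lemma hs_norm_conj_transpose: "hs_norm (conj_transpose r) = hs_norm (r :: 'a mat)"
  by (simp add: hs_norm_def) (subst sum.swap, simp)

text \<open>With F aligning c and e the first basis vector, F c = |c| e, so the conjugate of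
  \<open>c c^H\<close> is |c|^2 times \<open>e e^H\<close>. This serves the first row in the
  Laguerre recursion and the matrix \<Gamma> alike.\<close>

lemma align_rank_one:
  assumes c: "(c :: 'a mat) \<in> carrier_mat n 1"
  shows "align n c * (c * conj_transpose c) * conj_transpose (align n c) =
      of_real ((hs_norm c)\<^sup>2) \<cdot>\<^sub>m unit11 n"
proof -
  let ?F = "align n c"
  have F: "?F \<in> carrier_mat n n" by (rule unitary_carrier[OF unitary_align[OF c]])
  have ct: "conj_transpose c \<in> carrier_mat 1 n" using c by simp
  have cF: "conj_transpose c * conj_transpose ?F =
      of_real (hs_norm c) \<cdot>\<^sub>m transpose_mat (unit_col n)"
    unfolding conj_transpose_mult[OF F c, symmetric] align_mult[OF c]
    by (auto intro!: eq_matI simp: conj_mult unit_col_def)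
  have "?F * (c * conj_transpose c) * conj_transpose ?F =
      (?F * c) * (conj_transpose c * conj_transpose ?F)"
    by (simp only: assoc_mult_mat[OF F c ct, symmetric]
        assoc_mult_mat[OF mult_carrier_mat[OF F c] ct conj_transpose_carrier[OF F]])
  also have "\<dots> = of_real ((hs_norm c)\<^sup>2) \<cdot>\<^sub>m unit11 n"
    unfolding align_mult[OF c] cF
    by (rule eq_matI) (auto simp: scalar_prod_def unit_col_def unit11_def power2_eq_square)
  finally show ?thesis .
qed

lemma gram_mult_conj_transpose:
  assumes F: "F \<in> carrier_mat n n" and Z: "Z \<in> carrier_mat m n"
  shows "F * gram Z * conj_transpose F = gram (Z * conj_transpose F)"
  unfolding gram_def using F Z
  by (simp add: conj_transpose_mult[of Z m n _ n] assoc_mult_mat[of F n n "conj_transpose Z" m Z n,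
      symmetric]
      assoc_mult_mat[of "F * conj_transpose Z" n m Z n "conj_transpose F" n]
          mult_carrier_mat[of F n n _ m])

text \<open>The row r adds the rank one matrix \<open>r^H r\<close> to the Gram matrix of the rows
  below. Aligning the adjoint of r concentrates it in the corner and acts on those rows from the
  right.\<close>

lemma align_row_gram:
  assumes r: "r \<in> carrier_mat 1 n" and Z: "Z \<in> carrier_mat m n"
  defines "F \<equiv> align n (conj_transpose r)"
  shows "F * gram (row_cons r Z) * conj_transpose F =
    gram (Z * conj_transpose F) + of_real ((hs_norm r)\<^sup>2) \<cdot>\<^sub>m unit11 n"
proof -
  have rc: "conj_transpose r \<in> carrier_mat n 1" using r by simp
  have F: "F \<in> carrier_mat n n" unfolding F_def by (rule unitary_carrier[OF unitary_align[OF rc]])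
  have 1: "F * (conj_transpose r * r) * conj_transpose F = of_real ((hs_norm r)\<^sup>2) \<cdot>\<^sub>m unit11 n"
    using align_rank_one[OF rc] by (simp add: F_def hs_norm_conj_transpose)
  have rr: "conj_transpose r * r \<in> carrier_mat n n" using r by (intro mult_carrier_mat) auto
  have "F * gram (row_cons r Z) * conj_transpose F =
      (F * (conj_transpose r * r) + F * gram Z) * conj_transpose F"
    unfolding gram_row_cons(2)[OF r Z] by (subst mult_add_distrib_mat[OF F rr]) (use Z in auto)
  also have "\<dots> = F * (conj_transpose r * r) * conj_transpose F + F * gram Z * conj_transpose F"
    by (rule add_mult_distrib_mat[of _ n n _ _ n]) (use F rr Z in auto)
  also have "\<dots> = gram (Z * conj_transpose F) + of_real ((hs_norm r)\<^sup>2) \<cdot>\<^sub>m unit11 n"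
    unfolding 1 gram_mult_conj_transpose[OF F Z] using Z F
        gram_carrier[OF mult_carrier_mat[OF Z, of "conj_transpose F" n]]
    by (intro comm_add_mat[of _ n n]) (auto simp: unit11_def)
  finally show ?thesis .
qed

text \<open>Supplies the positive factor that \<open>align_smult\<close> demands.\<close>

lemma AE_chi_law_pos: "AE x in chi_law k. 0 < x"
  unfolding chi_law_def by (subst AE_density) auto

lemma add_unit11_measurable:
  assumes f: "f \<in> M \<rightarrow>\<^sub>M mat_borel n n" and [measurable]: "c \<in> borel_measurable M"
  shows "(\<lambda>x. f x + c x \<cdot>\<^sub>m unit11 n :: real mat) \<in> M \<rightarrow>\<^sub>M mat_borel n n"
proof (rule measurable_mat_borelI)
  fix i j assume ij: "i < n" "j < n"
  have [measurable]: "(\<lambda>p. f p $$ (i, j)) \<in> borel_measurable M"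
    by (rule measurable_mat_entry[OF f ij])
  have "(\<lambda>p. f p $$ (i, j) + c p * unit11 n $$ (i, j)) \<in> borel_measurable M"
    by measurable
  then show "(\<lambda>p. (f p + c p \<cdot>\<^sub>m unit11 n) $$ (i, j)) \<in> borel_measurable M"
    using ij by (simp add: unit11_def)
qed (use measurable_mat_carrier[OF f] in \<open>auto simp: unit11_def\<close>)

text \<open>Left multiplication by the rotation of the first column y leaves the Gram matrix
  unchanged and makes that column t = |y| times the first basis vector. The Gram column below the
  corner is then t times the adjoint of the first row r of the rotated rest, which is again Gaussian
  and independent of y. Its rotation depends on r alone and acts on the rows Z below from the right,
  so their law persists as well; |r|^2 is added in the corner. Thus t and |r| are the coefficients
  \<open>x1\<close>, \<open>y1\<close> of the bidiagonal factor, and the induction goes over all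
  \<open>m\<close> because it lowers \<open>m\<close> too.\<close>

theorem distr_tridiag_laguerre:
  "0 < n \<Longrightarrow> distr (iid m n) (mat_borel n n) (\<lambda>Y. tridiag n (gram Y)) = LbetaE (real DIM('a)) m n"
proof (induction n arbitrary: m rule: nat_induct_non_zero)
  \<comment> \<open>Without rows the Gram matrix vanishes; this case is needed at every
    \<open>n\<close>, since the recursion may exhaust the rows before the columns.\<close>
  have zero: "distr (iid 0 n) (mat_borel n n) (\<lambda>Y. tridiag n (gram Y)) = LbetaE (real DIM('a)) 0 n"
      for n
  proof -
    interpret prob_space "iid 0 n" by (rule prob_space_iid)
    have "distr (iid 0 n) (mat_borel n n) (\<lambda>Y. tridiag n (gram Y)) =
        distr (iid 0 n) (mat_borel n n) (\<lambda>Y. 0\<^sub>m n n)"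
    proof (rule distr_cong)
      fix Y assume "Y \<in> space (iid 0 n)"
      then have "gram Y = 0\<^sub>m n n" by (auto simp: gram_def scalar_prod_def intro!: eq_matI)
      then show "tridiag n (gram Y) = 0\<^sub>m n n" by (simp add: tridiag_zero)
    qed simp_all
    also have "\<dots> = return (mat_borel n n) (0\<^sub>m n n)"
      by (rule distr_const) simp
    finally show ?thesis by (simp only: LbetaE_zero)
  qed
  {
    case 1
    show ?case
    proof (cases m)
      case 0
      show ?thesis unfolding 0 by (rule zero)
    next
      case (Suc m')
      have s: "(\<lambda>x :: real. scalar_mat (x\<^sup>2)) \<in> borel \<rightarrow>\<^sub>M (mat_borel 1 1 :: real mat measure)"
        by (rule scalar_mat_measurable) simp
      have hs: "hs_norm \<in> iid m 1 \<rightarrow>\<^sub>M borel" by measurable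
      have "distr (iid m 1) (mat_borel 1 1) (\<lambda>Y. tridiag 1 (gram Y)) =
          distr (iid m 1) (mat_borel 1 1) (\<lambda>Y. (\<lambda>x. scalar_mat (x\<^sup>2)) (hs_norm Y))"
      proof (rule distr_cong)
        fix Y assume "Y \<in> space (iid m 1)"
        then have Y: "Y \<in> carrier_mat m 1" by simp
        have "inner (gram Y $$ (0, 0)) 1 = (hs_norm Y)\<^sup>2"
          using gram_index[OF Y, of 0 0] gram_index_00[OF Y] by (simp del: of_real_power)
        then show "tridiag 1 (gram Y) = scalar_mat ((hs_norm Y)\<^sup>2)"
          by (auto simp: Let_def unit_col_def scalar_mat_def intro!: eq_matI)
      qed simp_all
      also have "\<dots> = distr (chi_law (real DIM('a) * real (m * 1))) (mat_borel 1 1)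
          (\<lambda>x. scalar_mat (x\<^sup>2))"
        by (rule distr_law[OF distr_iid_hs_norm hs s]) (use Suc in auto)
      finally show ?thesis unfolding Suc mult_1_right by (simp only: LbetaE_one)
    qed
  next
    case (Suc n)
    show ?case
    proof (cases m)
      case 0
      show ?thesis unfolding 0 by (rule zero)
    next
      case m: (Suc k)
      let ?mb = "mat_borel (Suc n) (Suc n) :: real mat measure"
      let ?P = "iid (Suc k) 1" and ?R = "iid (Suc k) n"
      let ?c = "chi_law (real DIM('a) * real (Suc k))" and ?d = "chi_law (real DIM('a) * real n)"
      \<comment> \<open>The Gram column below the corner, expressed by the length of the first
        column and the rotated remaining columns; the product with \<open>unit_col\<close> extracts
        the adjoint of their first row.\<close>
      define w where "w p = of_real (fst p) \<cdot>\<^sub>m (conj_transpose (snd p) * unit_col (Suc k))" for p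
          :: "real \<times> 'a mat"
      let ?F = "\<lambda>p. align n (w p)"
      let ?K = "\<lambda>p. jborder n ((fst p)\<^sup>2) (hs_norm (w p))
          (tridiag n (?F p * gram (snd p) * conj_transpose (?F p)))"
      let ?S = "\<lambda>(y, Y). (y, align (Suc k) y * Y)"
      let ?N = "\<lambda>(y, Y). (hs_norm y, Y)"
      let ?Q = "(?c \<Otimes>\<^sub>M iid 1 n) \<Otimes>\<^sub>M iid k n"
      let ?A = "\<lambda>p. ?K (fst (fst p), row_cons (snd (fst p)) (snd p))"
      let ?G = "\<lambda>p. jborder n ((fst (fst p))\<^sup>2) (fst (fst p) * snd (fst p))
          (snd p + (snd (fst p))\<^sup>2 \<cdot>\<^sub>m unit11 n)"
      let ?H = "\<lambda>(q, Z). ((\<lambda>(t, r). (t, hs_norm r)) q, tridiag n (gram Z))"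
      let ?L = "\<lambda>(q, Z). (q, Z * conj_transpose (align n (conj_transpose (snd q))))"
      have c: "prob_space ?c" by (rule prob_space_chi_law) simp
      have d: "prob_space ?d" by (rule prob_space_chi_law[OF Suc.hyps])
      have w: "w \<in> borel \<Otimes>\<^sub>M mat_borel (Suc k) n \<rightarrow>\<^sub>M mat_borel n 1"
        unfolding w_def
        by (intro mat_smult_measurable mat_mult_measurable[where k = "Suc k"]
            conj_transpose_measurable mat_const_measurable) auto
      have K: "?K \<in> borel \<Otimes>\<^sub>M mat_borel (Suc k) n \<rightarrow>\<^sub>M ?mb"
        by (intro jborder_measurable tridiag_measurable conjugation_measurable align_measurable w
            hs_norm_measurable[OF w]
            gram_measurable[of _ _ "Suc k"]) measurable
      have SY: "(\<lambda>p. align (Suc k) (fst p) * snd p) \<in> ?P \<Otimes>\<^sub>M ?R \<rightarrow>\<^sub>M mat_borel (Suc k) n"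
        by (intro mat_mult_measurable[where k = "Suc k"] align_measurable) measurable
      have S: "?S \<in> ?P \<Otimes>\<^sub>M ?R \<rightarrow>\<^sub>M ?P \<Otimes>\<^sub>M mat_borel (Suc k) n"
        unfolding case_prod_unfold by (intro measurable_Pair SY measurable_fst)
      have hsP: "hs_norm \<in> ?P \<rightarrow>\<^sub>M borel" by measurable
      have N: "?N \<in> ?P \<Otimes>\<^sub>M mat_borel (Suc k) n \<rightarrow>\<^sub>M borel \<Otimes>\<^sub>M mat_borel (Suc k) n"
        using hsP by measurable
      have NR: "distr (?P \<Otimes>\<^sub>M ?R) (borel \<Otimes>\<^sub>M mat_borel (Suc k) n) ?N = ?c \<Otimes>\<^sub>M ?R"
      proof -
        have "distr (?P \<Otimes>\<^sub>M ?R) (borel \<Otimes>\<^sub>M mat_borel (Suc k) n) (\<lambda>(y, Y). (hs_norm y, (\<lambda>Y. Y) Y)) =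
            distr ?P borel hs_norm \<Otimes>\<^sub>M distr ?R (mat_borel (Suc k) n) (\<lambda>Y. Y)"
          by (rule distr_map_prod[OF prob_space_iid prob_space_iid hsP]) measurable
        also have "distr ?R (mat_borel (Suc k) n) (\<lambda>Y. Y) = ?R" by (rule distr_id2) simp
        also have "distr ?P borel hs_norm = ?c" using distr_iid_hs_norm[of "Suc k" 1] by simp
        finally show ?thesis .
      qed
      have skew: "distr (?P \<Otimes>\<^sub>M ?R) (?P \<Otimes>\<^sub>M mat_borel (Suc k) n) ?S = ?P \<Otimes>\<^sub>M ?R"
      proof (rule distr_pair_skew)
        fix y assume "y \<in> space ?P"
        then show "distr ?R (mat_borel (Suc k) n) (\<lambda>Y. align (Suc k) y * Y) = ?R"
          by (intro iid_left_mult preserves_gauss_align) simp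
      qed (use SY in \<open>auto simp: case_prod_unfold intro: sigma_finite_iid\<close>)
      have "distr (iid (Suc k) (Suc n)) ?mb (\<lambda>Y. tridiag (Suc n) (gram Y)) =
          distr (?P \<Otimes>\<^sub>M ?R) ?mb (\<lambda>p. (\<lambda>Y. tridiag (Suc n) (gram Y)) ((\<lambda>(y, Y). col_cons y Y) p))"
        unfolding iid_col_cons[of "Suc k" n]
        by (rule distr_law[symmetric, OF refl col_cons_measurable_iid])
          (intro tridiag_measurable gram_measurable[of _ _ "Suc k"] measurable_ident_sets refl)
      also have "\<dots> = distr (?P \<Otimes>\<^sub>M ?R) ?mb (\<lambda>p. (\<lambda>q. ?K (?N q)) (?S p))"
      proof (rule distr_cong)
        fix p assume "p \<in> space (?P \<Otimes>\<^sub>M ?R)"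
        then obtain y Y where p: "p = (y, Y)" and y: "y \<in> carrier_mat (Suc k) 1" and Y:
            "Y \<in> carrier_mat (Suc k) n"
          by (auto simp: space_pair_measure)
        let ?U = "align (Suc k) y"
        have U: "unitary (Suc k) ?U" by (rule unitary_align[OF y])
        note Uc = unitary_carrier[OF U]
        have UY: "conj_transpose (?U * Y) \<in> carrier_mat n (Suc k)"
          by (intro conj_transpose_carrier mult_carrier_mat[OF Uc Y])
        have "conj_transpose Y * y = conj_transpose (?U * Y) * (?U * y)"
          by (rule gram_unitary_mult[OF U Y y, symmetric])
        also have "\<dots> = w (hs_norm y, ?U * Y)"
          unfolding align_mult[OF y] w_def fst_conv snd_conv
          by (rule mult_of_real_smult(1)[OF UY carrier_mat_one])
        finally have 1: "conj_transpose Y * y = w (hs_norm y, ?U * Y)" .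
        have 2: "gram (?U * Y) = gram Y"
          unfolding gram_def by (rule gram_unitary_mult[OF U Y Y])
        show "tridiag (Suc n) (gram ((\<lambda>(y, Y). col_cons y Y) p)) = ?K (?N (?S p))"
          by (simp only: p prod.case tridiag_Suc gram_col_cons[OF y Y] fst_conv snd_conv 1 2)
      qed simp_all
      also have "\<dots> = distr (?P \<Otimes>\<^sub>M ?R) ?mb (\<lambda>q. ?K (?N q))"
        by (rule distr_law[OF skew S]) (rule measurable_compose[OF N K])
      also have "\<dots> = distr (?c \<Otimes>\<^sub>M ?R) ?mb ?K"
      proof (rule distr_law[OF NR _ K])
        show "?N \<in> ?P \<Otimes>\<^sub>M ?R \<rightarrow>\<^sub>M borel \<Otimes>\<^sub>M mat_borel (Suc k) n"
          using hsP by measurable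
      qed
      also have "\<dots> = distr (?c \<Otimes>\<^sub>M (iid 1 n \<Otimes>\<^sub>M iid k n)) ?mb
          (\<lambda>p. ?K ((\<lambda>(t, q). (t, (\<lambda>(r, Z). row_cons r Z) q)) p))"
      proof (rule distr_law[symmetric, OF _ _ K])
        show "distr (?c \<Otimes>\<^sub>M (iid 1 n \<Otimes>\<^sub>M iid k n)) (borel \<Otimes>\<^sub>M mat_borel (Suc k) n)
            (\<lambda>(t, q). (t, (\<lambda>(r, Z). row_cons r Z) q)) = ?c \<Otimes>\<^sub>M ?R"
        proof -
          have "distr (?c \<Otimes>\<^sub>M (iid 1 n \<Otimes>\<^sub>M iid k n)) (borel \<Otimes>\<^sub>M mat_borel (Suc k) n)
              (\<lambda>(t, q). ((\<lambda>t. t) t, (\<lambda>(r, Z). row_cons r Z) q)) =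
              distr ?c borel (\<lambda>t. t) \<Otimes>\<^sub>M distr (iid 1 n \<Otimes>\<^sub>M iid k n) (mat_borel (Suc k) n)
                  (\<lambda>(r, Z). row_cons r Z)"
            by (rule distr_map_prod[OF c prob_space_pair[OF prob_space_iid prob_space_iid] _
                row_cons_measurable_iid]) measurable
          also have "distr ?c borel (\<lambda>t. t) = ?c" by (rule distr_id2) simp
          finally show ?thesis by (simp only: iid_row_cons[of k n])
        qed
        show "(\<lambda>(t, q). (t, (\<lambda>(r, Z). row_cons r Z) q)) \<in>
            ?c \<Otimes>\<^sub>M (iid 1 n \<Otimes>\<^sub>M iid k n) \<rightarrow>\<^sub>M borel \<Otimes>\<^sub>M mat_borel (Suc k) n"
          unfolding case_prod_unfold
          by (rule measurable_Pair, measurable)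
            (rule measurable_compose[OF measurable_snd
                measurable_row_cons[unfolded case_prod_unfold]])
      qed
      also have "\<dots> = distr ((?c \<Otimes>\<^sub>M iid 1 n) \<Otimes>\<^sub>M iid k n) ?mb
          (\<lambda>p. ?K (fst (fst p), row_cons (snd (fst p)) (snd p)))"
      proof -
        let ?a = "\<lambda>p. ((fst p, fst (snd p)), snd (snd p))"
        have rc: "(\<lambda>p. ?K (fst (fst p), row_cons (snd (fst p)) (snd p))) \<in>
            (?c \<Otimes>\<^sub>M iid 1 n) \<Otimes>\<^sub>M iid k n \<rightarrow>\<^sub>M ?mb"
        proof (rule measurable_compose[OF _ K])
          have "(\<lambda>p. (\<lambda>(r, Z). row_cons r Z) (snd (fst p), snd p)) \<in>
              (?c \<Otimes>\<^sub>M iid 1 n) \<Otimes>\<^sub>M iid k n \<rightarrow>\<^sub>M mat_borel (Suc k) n"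
            by (rule measurable_compose[OF _ row_cons_measurable_iid]) measurable
          then show "(\<lambda>p. (fst (fst p), row_cons (snd (fst p)) (snd p))) \<in>
              (?c \<Otimes>\<^sub>M iid 1 n) \<Otimes>\<^sub>M iid k n \<rightarrow>\<^sub>M borel \<Otimes>\<^sub>M mat_borel (Suc k) n"
            by (intro measurable_Pair) (auto intro: measurable_compose[OF measurable_fst])
        qed
        have "distr (?c \<Otimes>\<^sub>M (iid 1 n \<Otimes>\<^sub>M iid k n)) ?mb
            (\<lambda>p. (\<lambda>p. ?K (fst (fst p), row_cons (snd (fst p)) (snd p))) (?a p)) =
            distr ((?c \<Otimes>\<^sub>M iid 1 n) \<Otimes>\<^sub>M iid k n) ?mb
                (\<lambda>p. ?K (fst (fst p), row_cons (snd (fst p)) (snd p)))"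
          by (rule distr_law[OF distr_pair_assoc'[OF prob_space_imp_sigma_finite[OF c]
              sigma_finite_iid sigma_finite_iid] _ rc])
            measurable
        then show ?thesis by (simp add: case_prod_unfold)
      qed
      \<comment> \<open>Equality holds only where the length of the first column is positive: there
        the rotation of \<open>w\<close> is that of the row itself, and its norm is the product of
        the length and the norm of the row.\<close>
      also have "\<dots> = distr ?Q ?mb (\<lambda>p. (\<lambda>p. ?G (?H p)) (?L p))"
      proof (rule distr_cong_AE)
        have pos: "AE p in ?Q. 0 < fst (fst p)"
        proof -
          have "AE q in ?c \<Otimes>\<^sub>M iid 1 n. 0 < fst q"
            using AE_chi_law_pos by (intro AE_distrD[OF measurable_fst])
                (simp only: distr_fst_pair[OF prob_space_iid])
          then show ?thesis
            by (intro AE_distrD[OF measurable_fst]) (simp only: distr_fst_pair[OF prob_space_iid])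
        qed
        show "AE p in ?Q. ?A p = ?G (?H (?L p))"
          using pos AE_space
        proof eventually_elim
          case (elim p)
          then obtain t r Z where p: "p = ((t, r), Z)" and t: "0 < t"
            and r: "r \<in> carrier_mat 1 n" and Z: "Z \<in> carrier_mat k n"
            by (auto simp: space_pair_measure)
          let ?E = "align n (conj_transpose r)"
          have rc: "conj_transpose r \<in> carrier_mat n 1" using r by simp
          have Ec: "conj_transpose ?E \<in> carrier_mat n n"
            by (intro conj_transpose_carrier unitary_carrier[OF unitary_align[OF rc]])
          have wr: "w (t, row_cons r Z) = of_real t \<cdot>\<^sub>m conj_transpose r"
            unfolding w_def fst_conv snd_conv gram_row_cons(1)[OF r Z] ..
          have hw: "hs_norm (w (t, row_cons r Z)) = t * hs_norm r"
            unfolding wr hs_norm_smult hs_norm_conj_transpose using t by simp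
          have aw: "align n (w (t, row_cons r Z)) = ?E"
            unfolding wr by (rule align_smult[OF t rc])
          have td: "tridiag n (gram (Z * conj_transpose ?E) + of_real ((hs_norm r)\<^sup>2) \<cdot>\<^sub>m unit11 n)
              =
              tridiag n (gram (Z * conj_transpose ?E)) + (hs_norm r)\<^sup>2 \<cdot>\<^sub>m unit11 n"
            by (rule tridiag_add_unit11[OF Suc.hyps gram_carrier[OF mult_carrier_mat[OF Z Ec]]])
          show ?case
            by (simp only: p fst_conv snd_conv prod.case hw aw align_row_gram[OF r Z] td)
        qed
        show "?A \<in> ?Q \<rightarrow>\<^sub>M ?mb"
        proof (rule measurable_compose[OF _ K])
          have "(\<lambda>p. (\<lambda>(r, Z). row_cons r Z) (snd (fst p), snd p)) \<in> ?Q \<rightarrow>\<^sub>M mat_borel (Suc k) n"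
            by (rule measurable_compose[OF _ row_cons_measurable_iid]) measurable
          then show "(\<lambda>p. (fst (fst p), row_cons (snd (fst p)) (snd p))) \<in>
              ?Q \<rightarrow>\<^sub>M borel \<Otimes>\<^sub>M mat_borel (Suc k) n"
            by (intro measurable_Pair) (auto intro: measurable_compose[OF measurable_fst])
        qed
        have ZF: "(\<lambda>p. snd p * conj_transpose (align n (conj_transpose (snd (fst p))))) \<in>
            ?Q \<rightarrow>\<^sub>M mat_borel k n"
          by (intro mat_mult_measurable[where k = n] align_measurable
              conj_transpose_measurable[of _ _ 1 n] conj_transpose_measurable[of _ _ n n])
              measurable
        show "(\<lambda>p. (\<lambda>p. ?G (?H p)) (?L p)) \<in> ?Q \<rightarrow>\<^sub>M ?mb"
          unfolding case_prod_unfold fst_conv snd_conv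
          by (intro jborder_measurable add_unit11_measurable tridiag_measurable
              gram_measurable[of _ _ k] ZF
              borel_measurable_power borel_measurable_times hs_norm_measurable[of _ _ 1 n])
                  measurable
      qed simp_all
      also have "\<dots> = distr ?Q ?mb (\<lambda>p. ?G (?H p))"
      proof (rule distr_law)
        have ZF: "(\<lambda>p. snd p * conj_transpose (align n (conj_transpose (snd (fst p))))) \<in>
            ?Q \<rightarrow>\<^sub>M mat_borel k n"
          by (intro mat_mult_measurable[where k = n] align_measurable
              conj_transpose_measurable[of _ _ 1 n] conj_transpose_measurable[of _ _ n n])
              measurable
        show "?L \<in> ?Q \<rightarrow>\<^sub>M (?c \<Otimes>\<^sub>M iid 1 n) \<Otimes>\<^sub>M mat_borel k n"
          unfolding case_prod_unfold by (intro measurable_Pair ZF measurable_fst)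
        show "distr ?Q ((?c \<Otimes>\<^sub>M iid 1 n) \<Otimes>\<^sub>M mat_borel k n) ?L = ?Q"
        proof (rule distr_pair_skew)
          fix q assume "q \<in> space (?c \<Otimes>\<^sub>M iid 1 n)"
          then have "conj_transpose (snd q) \<in> carrier_mat n 1" by (auto simp: space_pair_measure)
          then show "distr (iid k n) (mat_borel k n)
              (\<lambda>Z. Z * conj_transpose (align n (conj_transpose (snd q)))) = iid k n"
            by (intro iid_right_mult preserves_gauss_align)
        next
          show "sigma_finite_measure (?c \<Otimes>\<^sub>M iid 1 n)"
            by (rule prob_space_imp_sigma_finite[OF prob_space_pair[OF c prob_space_iid]])
        qed (use ZF in \<open>simp_all only: case_prod_unfold sigma_finite_iid sets_iid_mat_law\<close>)
        show "(\<lambda>p. ?G (?H p)) \<in> (?c \<Otimes>\<^sub>M iid 1 n) \<Otimes>\<^sub>M mat_borel k n \<rightarrow>\<^sub>M ?mb"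
          unfolding case_prod_unfold fst_conv snd_conv
          by (intro jborder_measurable add_unit11_measurable tridiag_measurable
              gram_measurable[of _ _ k]
              borel_measurable_power borel_measurable_times hs_norm_measurable[of _ _ 1 n])
                  measurable
      qed
      also have "\<dots> = distr ((?c \<Otimes>\<^sub>M ?d) \<Otimes>\<^sub>M LbetaE (real DIM('a)) k n) ?mb ?G"
      proof (rule distr_law)
        have T: "(\<lambda>Z. tridiag n (gram Z)) \<in> iid k n \<rightarrow>\<^sub>M mat_borel n n"
          by (intro tridiag_measurable gram_measurable[of _ _ k]) measurable
        have hs1: "hs_norm \<in> iid 1 n \<rightarrow>\<^sub>M borel" by measurable
        have h: "(\<lambda>(t, r). (t, hs_norm r)) \<in> ?c \<Otimes>\<^sub>M iid 1 n \<rightarrow>\<^sub>M borel \<Otimes>\<^sub>M borel"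
          using hs1 by measurable
        have "distr (?c \<Otimes>\<^sub>M iid 1 n) (borel \<Otimes>\<^sub>M borel) (\<lambda>(t, r). ((\<lambda>t. t) t, hs_norm r)) =
            distr ?c borel (\<lambda>t. t) \<Otimes>\<^sub>M distr (iid 1 n) borel hs_norm"
          by (rule distr_map_prod[OF c prob_space_iid _ hs1]) measurable
        also have "distr ?c borel (\<lambda>t. t) = ?c" by (rule distr_id2) simp
        also have "distr (iid 1 n) borel hs_norm = ?d"
          using distr_iid_hs_norm[of 1 n] Suc.hyps by simp
        finally have hl: "distr (?c \<Otimes>\<^sub>M iid 1 n) (borel \<Otimes>\<^sub>M borel) (\<lambda>(t, r). (t, hs_norm r)) =
            ?c \<Otimes>\<^sub>M ?d" .
        show "distr ?Q ((borel \<Otimes>\<^sub>M borel) \<Otimes>\<^sub>M mat_borel n n) ?H =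
            (?c \<Otimes>\<^sub>M ?d) \<Otimes>\<^sub>M LbetaE (real DIM('a)) k n"
          by (subst distr_map_prod[OF prob_space_pair[OF c prob_space_iid] prob_space_iid h T])
              (simp only: hl Suc.IH)
        show "?H \<in> ?Q \<rightarrow>\<^sub>M (borel \<Otimes>\<^sub>M borel) \<Otimes>\<^sub>M mat_borel n n"
          using h T by measurable
        show "?G \<in> (borel \<Otimes>\<^sub>M borel) \<Otimes>\<^sub>M mat_borel n n \<rightarrow>\<^sub>M ?mb"
          by (intro jborder_measurable add_unit11_measurable) measurable
      qed
      also have "\<dots> = LbetaE (real DIM('a)) (Suc k) (Suc n)"
        by (rule LbetaE_Suc[OF Suc.hyps, symmetric])
      finally show ?thesis by (simp only: m)
    qed
  }
qed

end

section \<open>Positive semidefinite matrices of rank one\<close>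

text \<open>The common consequence of both notions of rank one, over a field and over the
  quaternions. Together with positive semidefiniteness it determines the shape of \<Gamma>, and from
  here on all three cases agree.\<close>

definition dependent_cols :: "'a :: semiring_0 mat \<Rightarrow> bool" where
  "dependent_cols A \<longleftrightarrow> (\<forall>j<dim_col A. \<forall>k<dim_col A. j \<noteq> k \<longrightarrow> \<not> right_indep_cols A {j, k})"

lemma right_rank_dependent_cols:
  assumes "right_rank A = 1"
  shows "dependent_cols A"
  unfolding dependent_cols_def
proof (intro allI impI notI)
  fix j k assume jk: "j < dim_col A" "k < dim_col A" "j \<noteq> k" "right_indep_cols A {j, k}"
  let ?S = "{card S | S. S \<subseteq> {..<dim_col A} \<and> right_indep_cols A S}"
  have "?S \<subseteq> {..card {..<dim_col A}}"
    using card_mono[of "{..<dim_col A}"] by (auto simp del: card_lessThan)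
  then have "finite ?S" by (rule finite_subset) simp
  moreover have "2 \<in> ?S"
    using jk by (intro CollectI exI[of _ "{j, k}"]) auto
  ultimately have "2 \<le> Max ?S" by (rule Max_ge)
  then show False using assms by (simp add: right_rank_def)
qed

lemma rank_dependent_cols:
  fixes A :: "'a :: field mat"
  assumes A: "A \<in> carrier_mat n n" and rank: "vec_space.rank n A = 1"
  shows "dependent_cols A"
  unfolding dependent_cols_def
proof (intro allI impI notI)
  interpret vec_space "TYPE('a)" n .
  fix j k assume jk: "j < dim_col A" "k < dim_col A" "j \<noteq> k" and ind: "right_indep_cols A {j, k}"
  let ?u = "col A j" and ?v = "col A k"
  have ind': "c j = 0 \<and> c k = 0" if "\<And>i. i < n \<Longrightarrow> A $$ (i, j) * c j + A $$ (i, k) * c k = 0" for c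
    using ind that jk(3) A unfolding right_indep_cols_def by auto
  \<comment> \<open>Independence in a vector space is a property of sets, where equal columns would
    collapse to one vector. They are excluded by the relation with coefficients 1 and -1.\<close>
  have uv: "?u \<noteq> ?v"
  proof
    assume eq: "?u = ?v"
    have "A $$ (i, j) = A $$ (i, k)" if "i < n" for i
      using arg_cong[OF eq, of "\<lambda>v. v $ i"] that jk A by simp
    then show False using ind'[of "\<lambda>l. if l = j then 1 else - 1"] jk(3) by auto
  qed
  have car: "{?u, ?v} \<subseteq> carrier_vec n" using A jk by auto
  have "lin_indpt {?u, ?v}"
  proof (rule finite_lin_indpt2)
    fix a assume lc: "lincomb a {?u, ?v} = 0\<^sub>v n"
    have "A $$ (i, j) * a ?u + A $$ (i, k) * a ?v = 0" if i: "i < n" for i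
    proof -
      have "lincomb a {?u, ?v} $ i = (\<Sum>x\<in>{?u, ?v}. a x * x $ i)"
        by (rule lincomb_index[OF i car])
      then show ?thesis using lc uv i jk A by (simp add: mult.commute)
    qed
    then show "\<forall>v\<in>{?u, ?v}. a v = 0"
      using ind'[of "\<lambda>l. if l = j then a ?u else a ?v"] jk(3) by auto
  qed (use car in auto)
  then have "card {?u, ?v} \<le> rank A"
    using jk A by (intro rank_ge_card_indpt) (auto simp: cols_def)
  then show False using uv rank by simp
qed

context hermitian_scalars
begin

lemma mult_eq_0_iff': "x * y = 0 \<longleftrightarrow> x = 0 \<or> y = (0 :: 'a)"
  by (metis norm_mult' mult_eq_0_iff norm_eq_zero)

lemma right_inverse_exists: "x \<noteq> 0 \<Longrightarrow> \<exists>y. x * y = (1 :: 'a)"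
  by (rule exI[of _ "conjugate x /\<^sub>R (norm x)\<^sup>2"]) (simp add: mult_conj_self of_real_def)

text \<open>In a nontrivial relation between the two columns the coefficient of column
  \<open>j\<close> cannot vanish, as column \<open>k\<close> is nonzero; dividing by it from the
  right gives \<open>s\<close>.\<close>

lemma dependent_cols_multiple:
  assumes A: "A \<in> carrier_mat n n" and dep: "dependent_cols (A :: 'a mat)"
    and j: "j < n" and k: "k < n" and nz: "i0 < n" "A $$ (i0, k) \<noteq> 0"
  shows "\<exists>s. \<forall>i<n. A $$ (i, j) = A $$ (i, k) * s"
proof (cases "j = k")
  case True
  then show ?thesis by (intro exI[of _ 1]) simp
next
  case False
  then obtain c where eq: "\<And>i. i < n \<Longrightarrow> A $$ (i, j) * c j + A $$ (i, k) * c k = 0" and c: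
      "c j \<noteq> 0 \<or> c k \<noteq> 0"
    using dep A j k unfolding dependent_cols_def right_indep_cols_def by fastforce
  have cj: "c j \<noteq> 0"
    using eq[OF nz(1)] nz c by (auto simp: mult_eq_0_iff')
  then obtain d where d: "c j * d = 1" using right_inverse_exists by blast
  show ?thesis
  proof (intro exI[of _ "- (c k * d)"] allI impI)
    fix i assume "i < n"
    then have "A $$ (i, j) * c j = - (A $$ (i, k) * c k)"
      using eq by (simp add: eq_neg_iff_add_eq_0)
    then have "A $$ (i, j) * (c j * d) = - (A $$ (i, k) * c k) * d"
      by (simp add: mult.assoc[symmetric])
    then show "A $$ (i, j) = A $$ (i, k) * - (c k * d)"
      by (simp add: d mult.assoc)
  qed
qed

lemma pos_semidef_diag:
  assumes psd: "pos_semidef n (A :: 'a mat)" and k: "k < n"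
  shows "\<exists>g\<ge>0. A $$ (k, k) = of_real g"
proof -
  have A: "A \<in> carrier_mat n n" using psd by (simp add: pos_semidef_def)
  have "unit_vec n k \<in> carrier_vec n" by simp
  then obtain g where g: "0 \<le> g" "scalar_prod (conjugate (unit_vec n k)) (A *\<^sub>v unit_vec n k) =
      of_real g"
    using psd unfolding pos_semidef_def by blast
  have "(A *\<^sub>v unit_vec n k) $ i = A $$ (i, k)" if "i < n" for i
  proof -
    have "(A *\<^sub>v unit_vec n k) $ i = (\<Sum>j<n. A $$ (i, j) * unit_vec n k $ j)"
      using that A by (auto simp: scalar_prod_def lessThan_atLeast0)
    also have "\<dots> = (\<Sum>j<n. if j = k then A $$ (i, k) else 0)"
      using k by (intro sum.cong) auto
    finally show ?thesis using k by simp
  qed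
  then have "scalar_prod (conjugate (unit_vec n k)) (A *\<^sub>v unit_vec n k) =
      (\<Sum>i<n. conjugate (unit_vec n k $ i) * A $$ (i, k))"
    using A by (auto simp: scalar_prod_def lessThan_atLeast0)
  also have "\<dots> = (\<Sum>i<n. if i = k then A $$ (k, k) else 0)"
    using k by (intro sum.cong) auto
  finally show ?thesis using g k by auto
qed

text \<open>A column of a positive semidefinite matrix of rank one that spans its column space.
  If all diagonal entries vanish, the matrix is zero and the choice is irrelevant.\<close>

definition pivot_index :: "nat \<Rightarrow> 'a mat \<Rightarrow> nat" where
  "pivot_index n A = (LEAST k. k < n \<and> A $$ (k, k) \<noteq> 0)"

definition pivot_col :: "nat \<Rightarrow> 'a mat \<Rightarrow> 'a mat" where
  "pivot_col n A = mat n 1 (\<lambda>(i, j). \<Sum>k<n. if pivot_index n A = k then A $$ (i, k) else 0)"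

lemma pivot_col_carrier [simp]: "pivot_col n A \<in> carrier_mat n (Suc 0)"
  by (simp add: pivot_col_def)

text \<open>The pivot is the least index that satisfies a Borel condition, and the sum in
  \<open>pivot_col\<close> lets this random index enter only through the events that it equals a
  given \<open>k\<close>.\<close>

lemma pivot_col_measurable: "pivot_col n \<in> mat_borel n n \<rightarrow>\<^sub>M mat_borel n 1"
proof (rule measurable_mat_borelI)
  fix i j assume ij: "i < n" "j < (1 :: nat)"
  have [measurable]: "(\<lambda>A. A $$ (i, k) :: 'a) \<in> borel_measurable (mat_borel n n)" if "i < n" "k < n"
      for i k
    by (rule measurable_mat_entry[OF measurable_ident_sets[OF refl] that])
  have P: "Measurable.pred (mat_borel n n) (\<lambda>A :: 'a mat. k < n \<and> A $$ (k, k) \<noteq> 0)" for k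
    by (cases "k < n") auto
  have [measurable]: "pivot_index n \<in> mat_borel n n \<rightarrow>\<^sub>M count_space UNIV"
    unfolding pivot_index_def by (rule measurable_Least[OF P])
  have "(\<lambda>A. \<Sum>k<n. if pivot_index n A = k then A $$ (i, k) else 0) \<in>
      borel_measurable (mat_borel n n)"
    using ij by measurable
  then show "(\<lambda>A. pivot_col n A $$ (i, j)) \<in> borel_measurable (mat_borel n n)"
    using ij by (simp add: pivot_col_def)
qed simp

lemma hs_norm_col_mult:
  assumes c: "c \<in> carrier_mat n 1"
  shows "hs_norm (c * conj_transpose c :: 'a mat) = (hs_norm c)\<^sup>2"
proof -
  have e: "(c * conj_transpose c) $$ (i, j) = c $$ (i, 0) * conjugate (c $$ (j, 0))" if "i < n"
      "j < n" for i j
    using that c by (subst index_mult_mat_sum[of _ n 1 _ n]) auto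
  have "hs_norm (c * conj_transpose c) = sqrt (\<Sum>i<n. \<Sum>j<n. (norm (c $$ (i, 0)))\<^sup>2 *
      (norm (c $$ (j, 0)))\<^sup>2)"
    using c by (simp add: hs_norm_def e norm_mult' power_mult_distrib del: index_mult_mat(1))
  also have "(\<Sum>i<n. \<Sum>j<n. (norm (c $$ (i, 0)))\<^sup>2 * (norm (c $$ (j, 0)))\<^sup>2) =
      (\<Sum>i<n. (norm (c $$ (i, 0)))\<^sup>2)\<^sup>2"
    by (simp add: power2_eq_square sum_product)
  finally show ?thesis using c by (simp add: hs_norm_def sum_nonneg)
qed

text \<open>With c the pivot column and g > 0 its diagonal entry, A is \<open>c c^H\<close> divided
  by g. Aligning c makes this |c|^2 / g times the corner projection, and that factor is the
  Hilbert-Schmidt norm of A, because the norm of \<open>c c^H\<close> is |c|^2.\<close>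

lemma align_pivot_col:
  assumes psd: "pos_semidef n (A :: 'a mat)" and dep: "dependent_cols A"
  defines "F \<equiv> align n (pivot_col n A)"
  shows "F * A * conj_transpose F = of_real (hs_norm A) \<cdot>\<^sub>m unit11 n"
proof -
  have A: "A \<in> carrier_mat n n" and herm: "conj_transpose A = A"
    using psd by (auto simp: pos_semidef_def)
  have Aij: "A $$ (i, j) = conjugate (A $$ (j, i))" if "i < n" "j < n" for i j
    using arg_cong[OF herm, of "\<lambda>B. B $$ (i, j)"] A that by simp
  let ?c = "pivot_col n A"
  have c: "?c \<in> carrier_mat n 1" by simp
  have F: "F \<in> carrier_mat n n" unfolding F_def by (rule unitary_carrier[OF unitary_align[OF c]])
  show ?thesis
  proof (cases "\<exists>k<n. A $$ (k, k) \<noteq> 0")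
    case True
    define k where "k = pivot_index n A"
    have k: "k < n" "A $$ (k, k) \<noteq> 0"
      unfolding k_def pivot_index_def using LeastI_ex[of "\<lambda>k. k < n \<and> A $$ (k, k) \<noteq> 0"] True by auto
    obtain g where g: "0 \<le> g" "A $$ (k, k) = of_real g"
      using pos_semidef_diag[OF psd k(1)] by blast
    then have g0: "0 < g" using k(2) by (cases "g = 0") auto
    have ci: "?c $$ (i, 0) = A $$ (i, k)" if "i < n" for i
      using that k(1) by (simp add: pivot_col_def k_def[symmetric])
    \<comment> \<open>Column \<open>j\<close> is c times some \<open>s\<close>. Row \<open>k\<close>
      gives \<open>s\<close> as the entry \<open>(k, j)\<close> divided by \<open>g\<close>, and by
      Hermitian symmetry that entry is the conjugate of entry \<open>j\<close> of c.\<close>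
    have A_eq: "A = of_real (1 / g) \<cdot>\<^sub>m (?c * conj_transpose ?c)"
    proof (rule eq_matI)
      fix i j assume "i < dim_row (of_real (1 / g) \<cdot>\<^sub>m (?c * conj_transpose ?c))"
          "j < dim_col (of_real (1 / g) \<cdot>\<^sub>m (?c * conj_transpose ?c))"
      then have ij: "i < n" "j < n" by (auto simp: pivot_col_def)
      obtain s where s: "\<And>i. i < n \<Longrightarrow> A $$ (i, j) = A $$ (i, k) * s"
        using dependent_cols_multiple[OF A dep ij(2) k(1) k] by blast
      have "A $$ (k, j) = of_real g * s" using s[OF k(1)] g by simp
      then have "s = of_real (1 / g) * A $$ (k, j)" using g0 by (simp add: of_real_def)
      then have "A $$ (i, j) = A $$ (i, k) * (of_real (1 / g) * conjugate (A $$ (j, k)))"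
        using s[OF ij(1)] Aij[OF k(1) ij(2)] by simp
      also have "\<dots> = of_real (1 / g) * (A $$ (i, k) * conjugate (A $$ (j, k)))"
        by (simp add: of_real_def)
      also have "A $$ (i, k) * conjugate (A $$ (j, k)) = (?c * conj_transpose ?c) $$ (i, j)"
        using ij c ci by (subst index_mult_mat_sum[of _ n 1 _ n]) (auto simp: pivot_col_def)
      finally show "A $$ (i, j) = (of_real (1 / g) \<cdot>\<^sub>m (?c * conj_transpose ?c)) $$ (i, j)"
        using ij by (simp add: pivot_col_def)
    qed (use A in \<open>auto simp: pivot_col_def\<close>)
    have l: "hs_norm A = (hs_norm ?c)\<^sup>2 / g"
      by (subst A_eq) (use g0 in \<open>simp only: hs_norm_smult hs_norm_col_mult[OF c], simp\<close>)
    have cc: "?c * conj_transpose ?c \<in> carrier_mat n n"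
      by (rule mult_carrier_mat[OF c conj_transpose_carrier[OF c]])
    have "F * A * conj_transpose F = of_real (1 / g) \<cdot>\<^sub>m
        (F * (?c * conj_transpose ?c) * conj_transpose F)"
      by (subst A_eq) (simp only: mult_of_real_smult[OF F cc]
          mult_of_real_smult[OF mult_carrier_square[OF F cc] conj_transpose_carrier[OF F]])
    also have "F * (?c * conj_transpose ?c) * conj_transpose F =
        of_real ((hs_norm ?c)\<^sup>2) \<cdot>\<^sub>m unit11 n"
      unfolding F_def by (rule align_rank_one[OF c])
    also have "of_real (1 / g) \<cdot>\<^sub>m (of_real ((hs_norm ?c)\<^sup>2) \<cdot>\<^sub>m unit11 n) =
        of_real (hs_norm A) \<cdot>\<^sub>m (unit11 n :: 'a mat)"
      unfolding l by (rule eq_matI) (simp_all add: unit11_def of_real_def)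
    finally show ?thesis .
  next
    case False
    \<comment> \<open>If the entry were nonzero, column \<open>i\<close> would be a multiple of
      column \<open>k\<close>, whose entry in row \<open>k\<close> is 0 by assumption. So entry
      \<open>(k, i)\<close> would vanish, and by symmetry entry \<open>(i, k)\<close> too.\<close>
    have "A $$ (i, k) = 0" if ik: "i < n" "k < n" for i k
    proof (rule ccontr)
      assume nz: "A $$ (i, k) \<noteq> 0"
      obtain s where "\<And>j. j < n \<Longrightarrow> A $$ (j, i) = A $$ (j, k) * s"
        using dependent_cols_multiple[OF A dep ik(1,2,1) nz] by blast
      then have "A $$ (k, i) = 0" using False ik by auto
      then have "conjugate (A $$ (i, k)) = 0" using Aij[OF ik(2,1)] by simp
      then have "norm (A $$ (i, k)) = 0" using norm_conj[of "A $$ (i, k)"] by simp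
      with nz show False by simp
    qed
    then have A0: "A = 0\<^sub>m n n" using A by (auto intro!: eq_matI)
    have "hs_norm A = 0" unfolding A0 by (simp add: hs_norm_def)
    then show ?thesis
      unfolding A0 using F by (auto intro!: eq_matI simp: right_mult_zero_mat[of _ n n]
          left_mult_zero_mat[of _ n n] unit11_def)
  qed
qed

section \<open>Reduction of a rank one perturbation\<close>

text \<open>The corner projection is the product of the first basis vector with its adjoint, and
  \<open>tridiag_basis\<close> fixes that vector.\<close>

lemma tridiag_basis_unit11:
  assumes H: "H \<in> carrier_mat n n"
  shows "tridiag_basis n H * (of_real l \<cdot>\<^sub>m unit11 n) * conj_transpose (tridiag_basis n H) =
      of_real l \<cdot>\<^sub>m (unit11 n :: 'a mat)"
proof -
  let ?Q = "tridiag_basis n H" and ?e = "unit_col n :: 'a mat"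
  have Q: "?Q \<in> carrier_mat n n" using H by simp
  have e: "?e \<in> carrier_mat n 1" "conj_transpose ?e \<in> carrier_mat 1 n" by auto
  have ee: "unit11 n = ?e * conj_transpose ?e"
    by (rule eq_matI) (auto simp: unit11_def unit_col_def scalar_prod_def)
  have u: "unit11 n \<in> carrier_mat n n" by (simp add: unit11_def)
  have "?Q * (of_real l \<cdot>\<^sub>m unit11 n) * conj_transpose ?Q =
      of_real l \<cdot>\<^sub>m (?Q * unit11 n * conj_transpose ?Q)"
    by (simp only: mult_of_real_smult[OF Q u] mult_of_real_smult[OF mult_carrier_square[OF Q u]
        conj_transpose_carrier[OF Q]])
  also have "?Q * unit11 n * conj_transpose ?Q = (?Q * ?e) * conj_transpose (?Q * ?e)"
    unfolding ee conj_transpose_mult[OF Q e(1)]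
    using Q e by (simp add: assoc_mult_mat[of ?Q n n ?e 1 "conj_transpose ?e" n, symmetric]
        assoc_mult_mat[of "?Q * ?e" n 1 "conj_transpose ?e" n "conj_transpose ?Q" n]
            mult_carrier_mat[of ?Q n n ?e 1])
  also have "\<dots> = unit11 n"
    by (simp only: tridiag_basis_unit_col[OF H] ee)
  finally show ?thesis .
qed

lemma unitary_conjugation_inverse:
  assumes W: "unitary n (W :: 'a mat)" and A: "A \<in> carrier_mat n n"
  shows "A = conj_transpose W * (W * A * conj_transpose W) * W"
proof -
  have Wc: "W \<in> carrier_mat n n" using W by (rule unitary_carrier)
  have "conj_transpose W * (W * A * conj_transpose W) * W =
      (conj_transpose W * W) * A * (conj_transpose W * W)"
    using Wc A by (simp add: assoc_mult_mat[of _ n n _ n _ n])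
  also have "\<dots> = A"
    using W A by (simp add: unitary_def right_mult_one_mat[of _ n n] left_mult_one_mat[of _ n n])
  finally show ?thesis ..
qed

text \<open>The properties of an ensemble on which the reduction rests, apart from the law of its
  tridiagonal form. Being properties of a law, they state Hermitian symmetry only almost
  everywhere.\<close>

definition invariant_law :: "nat \<Rightarrow> 'a mat measure \<Rightarrow> bool" where
  "invariant_law n L \<longleftrightarrow> prob_space L \<and> sets L = sets (mat_borel n n) \<and>
    (\<forall>U. unitary n U \<longrightarrow> preserves_gauss n U \<longrightarrow> distr L (mat_borel n n) (\<lambda>H. U * H * conj_transpose U)
        = L) \<and>
    (AE H in L. conj_transpose H = H)"

lemma hermitian_pred:
  "Measurable.pred (mat_borel n n) (\<lambda>A :: 'a mat. conj_transpose A = A)"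
proof -
  have m [measurable]: "(\<lambda>A. A $$ (i, j) :: 'a) \<in> borel_measurable (mat_borel n n)" if "i < n"
      "j < n" for i j
    by (rule measurable_mat_entry[OF measurable_ident_sets[OF refl] that])
  have "Measurable.pred (mat_borel n n) (\<lambda>A :: 'a mat. \<forall>i\<in>{..<n}. \<forall>j\<in>{..<n}. conjugate (A $$ (j, i))
      = A $$ (i, j))"
    by measurable
  then show ?thesis
  proof (rule measurable_cong[THEN iffD1, rotated])
    fix A :: "'a mat" assume "A \<in> space (mat_borel n n)"
    then have A: "A \<in> carrier_mat n n" by simp
    show "(\<forall>i\<in>{..<n}. \<forall>j\<in>{..<n}. conjugate (A $$ (j, i)) = A $$ (i, j)) = (conj_transpose A = A)"
      using A by (auto simp: mat_eq_iff)
  qed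
qed

lemma gaussian_ensemble_eq: "gaussian_ensemble \<nu> n = distr (iid n n) (mat_borel n n) herm"
  by (simp add: gaussian_ensemble_def herm_def[abs_def])

lemma laguerre_ensemble_eq: "laguerre_ensemble \<nu> m n = distr (iid m n) (mat_borel n n) gram"
  by (simp add: laguerre_ensemble_def gram_def[abs_def])

lemma herm_meas: "herm \<in> mat_borel n n \<rightarrow>\<^sub>M mat_borel n n"
  by (rule herm_measurable[OF measurable_ident_sets[OF refl]])

lemma gram_meas: "gram \<in> mat_borel m n \<rightarrow>\<^sub>M mat_borel n n"
  by (rule gram_measurable[OF measurable_ident_sets[OF refl]])

lemma conj_meas: "U \<in> carrier_mat n n \<Longrightarrow> (\<lambda>H. U * H * conj_transpose U :: 'a mat) \<in>
    mat_borel n n \<rightarrow>\<^sub>M mat_borel n n"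
  by (rule conjugation_measurable[OF mat_const_measurable measurable_ident_sets[OF refl]])

text \<open>Conjugation of the image is traced back to a law-preserving map \<open>g\<close> of the
  Gaussian source: conjugation by U for the Gaussian ensembles, right multiplication by
  \<open>U^H\<close> for the Laguerre ensembles.\<close>

lemma invariant_law_distr:
  assumes f: "f \<in> iid m n \<rightarrow>\<^sub>M mat_borel n' n'"
    and herm: "\<And>Y. Y \<in> carrier_mat m n \<Longrightarrow> conj_transpose (f Y) = f Y"
    and inv: "\<And>U. unitary n' U \<Longrightarrow> preserves_gauss n' U \<Longrightarrow> \<exists>g \<in>
        iid m n \<rightarrow>\<^sub>M iid m n. distr (iid m n) (iid m n) g = iid m n \<and>
      (\<forall>Y\<in>carrier_mat m n. U * f Y * conj_transpose U = f (g Y))"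
  shows "invariant_law n' (distr (iid m n) (mat_borel n' n') f)"
  unfolding invariant_law_def
proof (intro conjI allI impI)
  show "prob_space (distr (iid m n) (mat_borel n' n') f)"
    by (rule prob_space.prob_space_distr[OF prob_space_iid f])
  show "AE H in distr (iid m n) (mat_borel n' n') f. conj_transpose H = H"
    by (subst AE_distr_iff[OF f]) (use hermitian_pred herm in \<open>auto simp: pred_def\<close>)
  fix U assume U: "unitary n' U" "preserves_gauss n' U"
  from inv[OF this] obtain g where g: "g \<in> iid m n \<rightarrow>\<^sub>M iid m n" "distr (iid m n) (iid m n) g =
      iid m n"
    "\<And>Y. Y \<in> carrier_mat m n \<Longrightarrow> U * f Y * conj_transpose U = f (g Y)" by blast
  have "distr (distr (iid m n) (mat_borel n' n') f) (mat_borel n' n') (\<lambda>H. U * H * conj_transpose U)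
      =
      distr (iid m n) (mat_borel n' n') (\<lambda>Y. U * f Y * conj_transpose U)"
    by (rule distr_law[symmetric, OF refl f conj_meas[OF unitary_carrier[OF U(1)]]])
  also have "\<dots> = distr (iid m n) (mat_borel n' n') (\<lambda>Y. f (g Y))"
    by (rule distr_cong) (auto simp: g(3))
  also have "\<dots> = distr (iid m n) (mat_borel n' n') f"
    by (rule distr_law[OF g(2,1) f])
  finally show "distr (distr (iid m n) (mat_borel n' n') f) (mat_borel n' n')
      (\<lambda>H. U * H * conj_transpose U) =
      distr (iid m n) (mat_borel n' n') f" .
qed simp

lemma invariant_law_gaussian: "invariant_law n (gaussian_ensemble \<nu> n)"
  unfolding gaussian_ensemble_eq
proof (rule invariant_law_distr)
  show "herm \<in> iid n n \<rightarrow>\<^sub>M mat_borel n n" using herm_meas by (simp cong: measurable_cong_sets)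
  fix U assume U: "unitary n U" "preserves_gauss n U"
  note Uc = unitary_carrier[OF U(1)]
  have "distr (iid n n) (iid n n) (\<lambda>Y. U * Y * conj_transpose U) = iid n n"
    using iid_conjugation[OF U(2)] by (simp cong: distr_cong)
  then show "\<exists>g\<in>iid n n \<rightarrow>\<^sub>M iid n n. distr (iid n n) (iid n n) g = iid n n \<and>
      (\<forall>Y\<in>carrier_mat n n. U * herm Y * conj_transpose U = herm (g Y))"
    using conj_meas[OF Uc] herm_conjugation[OF Uc]
    by (intro bexI[of _ "\<lambda>Y. U * Y * conj_transpose U"]) (auto cong: measurable_cong_sets)
qed (rule herm_hermitian)

lemma invariant_law_laguerre: "invariant_law n (laguerre_ensemble \<nu> m n)"
  unfolding laguerre_ensemble_eq
proof (rule invariant_law_distr)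
  show "gram \<in> iid m n \<rightarrow>\<^sub>M mat_borel n n" using gram_meas by (simp cong: measurable_cong_sets)
  fix U assume U: "unitary n U" "preserves_gauss n U"
  note Uc = unitary_carrier[OF U(1)]
  have "distr (iid m n) (iid m n) (\<lambda>Y. Y * conj_transpose U) = iid m n"
    using iid_right_mult[OF U(2)] by (simp cong: distr_cong)
  moreover have "(\<lambda>Y. Y * conj_transpose U) \<in> mat_borel m n \<rightarrow>\<^sub>M mat_borel m n"
    by (rule mat_mult_measurable[OF measurable_ident_sets[OF refl] mat_const_measurable])
        (use Uc in simp)
  ultimately show "\<exists>g\<in>iid m n \<rightarrow>\<^sub>M iid m n. distr (iid m n) (iid m n) g = iid m n \<and>
      (\<forall>Y\<in>carrier_mat m n. U * gram Y * conj_transpose U = gram (g Y))"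
    using gram_mult_conj_transpose[OF Uc]
    by (intro bexI[of _ "\<lambda>Y. Y * conj_transpose U"]) (auto cong: measurable_cong_sets)
qed (rule gram_hermitian)

text \<open>\<open>E\<close> is a function of \<Gamma>, so conjugating \<open>H\<close> by it leaves
  the joint law with \<Gamma> a product: \<open>H'\<close> is independent of all of \<Gamma>, even
  though the rotation was built from it. \<open>J\<close> is a function of \<open>H'\<close> and the
  norm one of \<Gamma>, whence their independence. \<open>W\<close> combines \<open>E\<close> with
  the basis change for \<open>H'\<close>.\<close>

theorem rank_one_reduction:
  assumes M: "prob_space M"
    and L: "invariant_law n L" and LJ: "distr L (mat_borel n n) (tridiag n) = LJ"
    and H: "has_law M n H L"
    and \<Gamma>: "\<Gamma> \<in> M \<rightarrow>\<^sub>M mat_borel n n"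
    and rank1: "AE \<omega> in M. pos_semidef n (\<Gamma> \<omega> :: 'a mat) \<and> dependent_cols (\<Gamma> \<omega>)"
    and indep: "prob_space.indep_var M (mat_borel n n) H (mat_borel n n) \<Gamma>"
  shows "\<exists>J W. has_law M n J LJ \<and> (\<forall>\<omega>\<in>space M. is_jacobi n (J \<omega>)) \<and>
      indep_rv M (mat_borel n n) J borel (\<lambda>\<omega>. hs_norm (\<Gamma> \<omega>)) \<and>
      random_unitary M n W \<and>
      (AE \<omega> in M. H \<omega> = conj_transpose (W \<omega>) * map_mat of_real (J \<omega>) * W \<omega> \<and>
        \<Gamma> \<omega> = conj_transpose (W \<omega>) * (of_real (hs_norm (\<Gamma> \<omega>)) \<cdot>\<^sub>m unit11 n) * W \<omega>)"
proof -
  interpret M: prob_space M by fact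
  have pL: "prob_space L" and sL: "sets L = sets (mat_borel n n)"
    and Linv: "\<And>U. unitary n U \<Longrightarrow> preserves_gauss n U \<Longrightarrow>
        distr L (mat_borel n n) (\<lambda>H. U * H * conj_transpose U) = L"
    and Lherm: "AE H in L. conj_transpose H = H"
    using L by (auto simp: invariant_law_def)
  have Hm: "H \<in> M \<rightarrow>\<^sub>M mat_borel n n" and HL: "distr M (mat_borel n n) H = L"
    using H by (auto simp: has_law_def)
  let ?D = "distr M (mat_borel n n) \<Gamma>"
  have pD: "prob_space ?D" by (rule M.prob_space_distr[OF \<Gamma>])
  define E where "E A = align n (pivot_col n A)" for A
  have Em: "E \<in> mat_borel n n \<rightarrow>\<^sub>M mat_borel n n"
    unfolding E_def by (rule align_measurable[OF pivot_col_measurable])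
  have Eu: "unitary n (E A)" and Eg: "preserves_gauss n (E A)" for A
    unfolding E_def by (intro unitary_align preserves_gauss_align; simp)+
  define H' where "H' \<omega> = E (\<Gamma> \<omega>) * H \<omega> * conj_transpose (E (\<Gamma> \<omega>))" for \<omega>
  have H'm: "H' \<in> M \<rightarrow>\<^sub>M mat_borel n n"
    unfolding H'_def by (rule conjugation_measurable[OF measurable_compose[OF \<Gamma> Em] Hm])
  interpret LD: pair_sigma_finite ?D L
    using pD pL by (simp add: pair_sigma_finite_def prob_space_imp_sigma_finite)
  \<comment> \<open>\<Gamma> is put first, since in \<open>distr_pair_skew\<close> the first
    variable selects the map that acts on the second.\<close>
  have joint: "distr M (mat_borel n n \<Otimes>\<^sub>M mat_borel n n) (\<lambda>\<omega>. (\<Gamma> \<omega>, H \<omega>)) = ?D \<Otimes>\<^sub>M L"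
  proof -
    have HG: "distr M (mat_borel n n \<Otimes>\<^sub>M mat_borel n n) (\<lambda>\<omega>. (H \<omega>, \<Gamma> \<omega>)) = L \<Otimes>\<^sub>M ?D"
      using indep unfolding M.indep_var_distribution_eq HL by simp
    have "distr M (mat_borel n n \<Otimes>\<^sub>M mat_borel n n) (\<lambda>\<omega>. (\<lambda>(X, A). (A, X)) (H \<omega>, \<Gamma> \<omega>)) =
        distr (L \<Otimes>\<^sub>M ?D) (mat_borel n n \<Otimes>\<^sub>M mat_borel n n) (\<lambda>(X, A). (A, X))"
      by (rule distr_law[OF HG measurable_Pair[OF Hm \<Gamma>] measurable_pair_swap'])
    also have "\<dots> = distr (L \<Otimes>\<^sub>M ?D) (?D \<Otimes>\<^sub>M L) (\<lambda>(X, A). (A, X))"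
      by (rule distr_cong) (auto simp: sL cong: sets_pair_measure_cong)
    also have "\<dots> = ?D \<Otimes>\<^sub>M L" by (rule LD.distr_pair_swap[symmetric])
    finally show ?thesis by simp
  qed
  have cj: "(\<lambda>p. E (fst p) * snd p * conj_transpose (E (fst p))) \<in>
      mat_borel n n \<Otimes>\<^sub>M mat_borel n n \<rightarrow>\<^sub>M mat_borel n n"
    by (rule conjugation_measurable[OF measurable_compose[OF measurable_fst Em] measurable_snd])
  have mD: "measurable (?D \<Otimes>\<^sub>M L) N = measurable (mat_borel n n \<Otimes>\<^sub>M mat_borel n n) N" for N ::
      "'x measure"
    using sL by (intro measurable_cong_sets sets_pair_measure_cong) auto
  have joint': "distr M (mat_borel n n \<Otimes>\<^sub>M mat_borel n n) (\<lambda>\<omega>. (\<Gamma> \<omega>, H' \<omega>)) = ?D \<Otimes>\<^sub>M L"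
  proof -
    have "distr M (mat_borel n n \<Otimes>\<^sub>M mat_borel n n)
        (\<lambda>\<omega>. (\<lambda>p. (fst p, E (fst p) * snd p * conj_transpose (E (fst p)))) (\<Gamma> \<omega>, H \<omega>)) =
        distr (?D \<Otimes>\<^sub>M L) (mat_borel n n \<Otimes>\<^sub>M mat_borel n n)
            (\<lambda>p. (fst p, E (fst p) * snd p * conj_transpose (E (fst p))))"
      by (rule distr_law[OF joint measurable_Pair[OF \<Gamma> Hm] measurable_Pair[OF measurable_fst cj]])
    also have "\<dots> = distr (?D \<Otimes>\<^sub>M L) (?D \<Otimes>\<^sub>M mat_borel n n)
        (\<lambda>(A, X). (A, E A * X * conj_transpose (E A)))"
      by (rule distr_cong) (auto cong: sets_pair_measure_cong)
    also have "\<dots> = ?D \<Otimes>\<^sub>M L"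
    proof (rule distr_pair_skew)
      show "(\<lambda>(A, X). E A * X * conj_transpose (E A)) \<in> ?D \<Otimes>\<^sub>M L \<rightarrow>\<^sub>M mat_borel n n"
        unfolding mD case_prod_unfold by (rule cj)
      show "distr L (mat_borel n n) (\<lambda>X. E A * X * conj_transpose (E A)) = L" for A
        by (rule Linv[OF Eu Eg])
    qed (use pD pL sL in \<open>auto intro: prob_space_imp_sigma_finite\<close>)
    finally show ?thesis by (simp add: H'_def)
  qed
  have H'L: "distr M (mat_borel n n) H' = L"
  proof -
    have "distr M (mat_borel n n) (\<lambda>\<omega>. snd (\<Gamma> \<omega>, H' \<omega>)) = distr (?D \<Otimes>\<^sub>M L) (mat_borel n n) snd"
      by (rule distr_law[OF joint' measurable_Pair[OF \<Gamma> H'm] measurable_snd])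
    also have "\<dots> = distr (?D \<Otimes>\<^sub>M L) L snd"
      by (rule distr_cong) (auto simp: sL)
    also have "\<dots> = L"
      by (rule distr_snd_pair[OF pD prob_space_imp_sigma_finite[OF pL]])
    finally show ?thesis by simp
  qed
  have ind': "M.indep_var (mat_borel n n) \<Gamma> (mat_borel n n) H'"
    unfolding M.indep_var_distribution_eq H'L using joint' \<Gamma> H'm by simp
  define J where "J \<omega> = tridiag n (H' \<omega>)" for \<omega>
  define W where "W \<omega> = tridiag_basis n (H' \<omega>) * E (\<Gamma> \<omega>)" for \<omega>
  have T: "tridiag n \<in> (mat_borel n n :: 'a mat measure) \<rightarrow>\<^sub>M mat_borel n n"
    by (rule tridiag_measurable[OF measurable_ident_sets[OF refl]])
  have Jm: "J \<in> M \<rightarrow>\<^sub>M mat_borel n n"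
    unfolding J_def by (rule tridiag_measurable[OF H'm])
  have Wm: "W \<in> M \<rightarrow>\<^sub>M mat_borel n n"
    unfolding W_def by (rule mat_mult_measurable[OF tridiag_basis_measurable[OF H'm]
        measurable_compose[OF \<Gamma> Em]])
  have Wu: "unitary n (W \<omega>)" if "\<omega> \<in> space M" for \<omega>
    unfolding W_def using measurable_mat_carrier[OF H'm that] by
        (intro unitary_mult unitary_tridiag_basis Eu)
  have J_law: "has_law M n J LJ"
    unfolding has_law_def
  proof
    show "distr M (mat_borel n n) J = LJ"
      unfolding J_def LJ[symmetric] by (rule distr_law[OF H'L H'm T])
  qed (rule Jm)
  have lm: "(\<lambda>\<omega>. hs_norm (\<Gamma> \<omega>)) \<in> borel_measurable M"
    by (rule hs_norm_measurable[OF \<Gamma>])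
  have J_ind: "indep_rv M (mat_borel n n) J borel (\<lambda>\<omega>. hs_norm (\<Gamma> \<omega>))"
    unfolding indep_rv_def
  proof (intro conjI Jm lm)
    \<comment> \<open>Events of \<open>J\<close> are events of \<open>H'\<close>, and events of the
      norm are events of \<Gamma>, so the product rule for \<open>H'\<close> and \<Gamma> is
      inherited by the smaller families.\<close>
    have sub1: "\<exists>A'\<in>sets (mat_borel n n). J -` A \<inter> space M = H' -` A' \<inter> space M" if
        "A \<in> sets (mat_borel n n)" for A
      using measurable_sets[OF T that] measurable_space[OF H'm]
      by (intro bexI[of _ "tridiag n -` A \<inter> space (mat_borel n n)"]) (auto simp: J_def)
    have hs: "(hs_norm :: 'a mat \<Rightarrow> real) \<in> mat_borel n n \<rightarrow>\<^sub>M borel" by (rule hs_norm_meas)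
    have sub2: "\<exists>B'\<in>sets (mat_borel n n). (\<lambda>\<omega>. hs_norm (\<Gamma> \<omega>)) -` B \<inter> space M = \<Gamma> -` B' \<inter> space M" if
        "B \<in> sets borel" for B
      using measurable_sets[OF hs that] measurable_space[OF \<Gamma>]
      by (intro bexI[of _ "hs_norm -` B \<inter> space (mat_borel n n)"]) auto
    have prod: "M.prob (\<Gamma> -` B \<inter> space M \<inter> (H' -` A \<inter> space M)) =
        M.prob (\<Gamma> -` B \<inter> space M) * M.prob (H' -` A \<inter> space M)"
      if "A \<in> sets (mat_borel n n)" "B \<in> sets (mat_borel n n)" for A B
    proof -
      have "M.indep_set (sigma_sets (space M) {\<Gamma> -` A \<inter> space M |A. A \<in> sets (mat_borel n n)})
          (sigma_sets (space M) {H' -` A \<inter> space M |A. A \<in> sets (mat_borel n n)})"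
        using ind' unfolding M.indep_var_eq by blast
      then show ?thesis
        unfolding M.indep_sets2_eq using that by (blast intro: sigma_sets.Basic)
    qed
    show "M.indep_set {J -` A \<inter> space M |A. A \<in> sets (mat_borel n n)}
        {(\<lambda>\<omega>. hs_norm (\<Gamma> \<omega>)) -` A \<inter> space M |A. A \<in> sets borel}"
      unfolding M.indep_sets2_eq
    proof (intro conjI ballI)
      show "{J -` A \<inter> space M |A. A \<in> sets (mat_borel n n)} \<subseteq> M.events"
        using measurable_sets[OF Jm] by auto
      show "{(\<lambda>\<omega>. hs_norm (\<Gamma> \<omega>)) -` A \<inter> space M |A. A \<in> sets borel} \<subseteq> M.events"
        using measurable_sets[OF lm] by auto
      fix a b assume "a \<in> {J -` A \<inter> space M |A. A \<in> sets (mat_borel n n)}"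
          "b \<in> {(\<lambda>\<omega>. hs_norm (\<Gamma> \<omega>)) -` A \<inter> space M |A. A \<in> sets borel}"
      then obtain A0 B0 where AB0: "A0 \<in> sets (mat_borel n n)" "a = J -` A0 \<inter> space M"
          "B0 \<in> sets borel" "b = (\<lambda>\<omega>. hs_norm (\<Gamma> \<omega>)) -` B0 \<inter> space M"
        by auto
      obtain A where A: "A \<in> sets (mat_borel n n)" "a = H' -` A \<inter> space M"
        using sub1[OF AB0(1)] AB0(2) by auto
      obtain B where B: "B \<in> sets (mat_borel n n)" "b = \<Gamma> -` B \<inter> space M"
        using sub2[OF AB0(3)] AB0(4) by auto
      have "M.prob (b \<inter> a) = M.prob b * M.prob a"
        unfolding A(2) B(2) by (rule prod[OF A(1) B(1)])
      then show "M.prob (a \<inter> b) = M.prob a * M.prob b"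
        by (simp only: Int_commute[of a b] mult.commute[of "M.prob a"])
    qed
  qed
  have "AE \<omega> in M. conj_transpose (H \<omega>) = H \<omega>"
    using Lherm unfolding HL[symmetric] by (rule AE_distrD[OF Hm])
  then have eqs: "AE \<omega> in M. H \<omega> = conj_transpose (W \<omega>) * map_mat of_real (J \<omega>) * W \<omega> \<and>
        \<Gamma> \<omega> = conj_transpose (W \<omega>) * (of_real (hs_norm (\<Gamma> \<omega>)) \<cdot>\<^sub>m unit11 n) * W \<omega>"
    using rank1 AE_space
  proof eventually_elim
    case (elim \<omega>)
    let ?E = "E (\<Gamma> \<omega>)" and ?Q = "tridiag_basis n (H' \<omega>)"
    have car: "H \<omega> \<in> carrier_mat n n" "\<Gamma> \<omega> \<in> carrier_mat n n" "H' \<omega> \<in> carrier_mat n n"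
      using elim(3) measurable_mat_carrier[OF Hm] measurable_mat_carrier[OF \<Gamma>]
          measurable_mat_carrier[OF H'm] by auto
    have Ec: "?E \<in> carrier_mat n n" by (rule unitary_carrier[OF Eu])
    have Qc: "?Q \<in> carrier_mat n n" using car by simp
    have conj: "W \<omega> * A * conj_transpose (W \<omega>) =
        ?Q * (?E * A * conj_transpose ?E) * conj_transpose ?Q"
      if "A \<in> carrier_mat n n" for A
      using that Ec Qc by (simp add: W_def conj_transpose_mult[OF Qc Ec]
          assoc_mult_mat[of _ n n _ n _ n])
    have "conj_transpose (H' \<omega>) = H' \<omega>"
      unfolding H'_def by (rule hermitian_conjugation[OF Ec car(1) elim(1)])
    then have "W \<omega> * H \<omega> * conj_transpose (W \<omega>) = map_mat of_real (J \<omega>)"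
      unfolding conj[OF car(1)] H'_def[symmetric] J_def by (rule tridiag_eq[OF car(3)])
    moreover have "W \<omega> * \<Gamma> \<omega> * conj_transpose (W \<omega>) = of_real (hs_norm (\<Gamma> \<omega>)) \<cdot>\<^sub>m unit11 n"
      unfolding conj[OF car(2)] using align_pivot_col[of n "\<Gamma> \<omega>"] elim(2)
      by (simp add: E_def tridiag_basis_unit11[OF car(3)])
    ultimately show ?case
      using unitary_conjugation_inverse[OF Wu[OF elim(3)] car(1)]
          unitary_conjugation_inverse[OF Wu[OF elim(3)] car(2)]
      by simp
  qed
  show ?thesis
    using J_law J_ind Wm Wu eqs
    by (intro exI[of _ J] exI[of _ W]) (auto simp: random_unitary_def J_def is_jacobi_tridiag)
qed

end

section \<open>Real, complex and quaternion scalars\<close>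

lemma real_hermitian_scalars: "hermitian_scalars (normal_law 1)"
  by unfold_locales (auto simp: normal_law_def power2_eq_square)

text \<open>Pairs of reals carry the Lebesgue measure of the complex plane, as a comparison on boxes
  shows; the product of the two normal densities is then a density in the coordinates of the complex
  number.\<close>

lemma distr_normal_pair_complex:
  "complex_normal_law 1 = density lborel (\<lambda>x. \<Prod>b\<in>Basis. ennreal (normal_density 0 1 (inner x b)))"
proof -
  let ?n = "\<lambda>x. ennreal (normal_density 0 1 x)"
  let ?C = "\<lambda>(x, y). Complex x y"
  have C_eq: "?C = (\<lambda>p. fst p *\<^sub>R 1 + snd p *\<^sub>R \<i>)"
    by (auto simp: fun_eq_iff complex_eq_iff)
  have C [measurable]: "?C \<in> lborel \<Otimes>\<^sub>M lborel \<rightarrow>\<^sub>M borel"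
    unfolding C_eq by measurable
  have N: "normal_law 1 = density lborel ?n" by (simp add: normal_law_def)
  have sf: "sigma_finite_measure (density lborel ?n)"
    using prob_space_imp_sigma_finite[OF prob_space_normal_law] by (simp add: N)
  have lb: "distr (lborel \<Otimes>\<^sub>M lborel) borel ?C = lborel"
  proof (rule lborel_eqI[symmetric])
    fix l u :: complex assume le: "\<And>b. b \<in> Basis \<Longrightarrow> l \<bullet> b \<le> u \<bullet> b"
    have "?C -` box l u \<inter> space (lborel \<Otimes>\<^sub>M lborel) = {Re l<..<Re u} \<times> {Im l<..<Im u}"
      by (auto simp: box_def Basis_complex_def space_pair_measure)
    then have "emeasure (distr (lborel \<Otimes>\<^sub>M lborel) borel ?C) (box l u) =
        emeasure (lborel \<Otimes>\<^sub>M lborel) ({Re l<..<Re u} \<times> {Im l<..<Im u})"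
      by (simp add: emeasure_distr)
    also have "\<dots> = ennreal (Re u - Re l) * ennreal (Im u - Im l)"
      using le[of 1] le[of \<i>] by (subst lborel.emeasure_pair_measure_Times)
          (auto simp: Basis_complex_def)
    finally show "emeasure (distr (lborel \<Otimes>\<^sub>M lborel) borel ?C) (box l u) =
        ennreal (\<Prod>b\<in>Basis. (u - l) \<bullet> b)"
      using le[of 1] le[of \<i>] by (simp add: Basis_complex_def ennreal_mult[symmetric])
  qed simp
  have "complex_normal_law 1 = distr (density (lborel \<Otimes>\<^sub>M lborel) (\<lambda>(x, y). ?n x * ?n y)) borel ?C"
    unfolding complex_normal_law_def N
    by (subst pair_measure_density[OF _ _ lborel.sigma_finite_measure_axioms sf]) auto
  also have "(\<lambda>(x, y). ?n x * ?n y) = (\<lambda>p. (\<lambda>z. ?n (Re z) * ?n (Im z)) (?C p))"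
    by auto
  also have "distr (density (lborel \<Otimes>\<^sub>M lborel) \<dots>) borel ?C =
      density (distr (lborel \<Otimes>\<^sub>M lborel) borel ?C) (\<lambda>z. ?n (Re z) * ?n (Im z))"
    by (rule density_distr[symmetric]) measurable
  finally show ?thesis by (simp add: lb Basis_complex_def)
qed

lemma complex_hermitian_scalars: "hermitian_scalars (complex_normal_law 1)"
proof
  show "complex_normal_law 1 = density lborel (\<lambda>x. \<Prod>b\<in>Basis. ennreal
      (normal_density 0 1 (inner x b)))"
    by (rule distr_normal_pair_complex)
  show "(1 :: complex) \<in> Basis" by (simp add: Basis_complex_def)
  show "conjugate x = of_real (2 * inner x 1) - x" for x :: complex
    by (simp add: conjugate_complex_def complex_eq_iff)
  show "conjugate (x * y) = conjugate y * conjugate x" for x y :: complex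
    by (simp add: conjugate_complex_def mult.commute)
  show "conjugate x * x = of_real ((norm x)\<^sup>2)" for x :: complex
    unfolding conjugate_complex_def complex_norm_square by (simp add: mult.commute)
qed

lemma quaternion_of_real: "(of_real r :: 'a :: {comm_ring_1, real_algebra_1} quaternion) =
    Quaternion (of_real r) 0 0 0"
  by (simp add: of_real_def quaternion_eq_iff)

lemma Basis_real_quaternion:
  "(Basis :: real quaternion set) = {Quaternion 1 0 0 0, Quaternion 0 1 0 0, Quaternion 0 0 1 0,
      Quaternion 0 0 0 1}"
  by (auto simp: Basis_quaternion_def)

lemma DIM_real_quaternion: "DIM(real quaternion) = 4"
  by (simp add: Basis_real_quaternion)

text \<open>The same comparison on boxes with four coordinates. The density is built up one factor
  at a time in the right-nested order of \<open>quaternion_normal_law\<close>, with sigma-finiteness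
  at each stage taken from the probability measure.\<close>

lemma quaternion_normal_law_density:
  "quaternion_normal_law 1 = density lborel (\<lambda>x. \<Prod>b\<in>Basis. ennreal
      (normal_density 0 1 (inner x b)))"
proof -
  let ?n = "\<lambda>x. ennreal (normal_density 0 1 x)"
  let ?C = "\<lambda>(x1, x2, x3, x4). Quaternion x1 x2 x3 x4 :: real quaternion"
  let ?L = "lborel :: real measure"
  let ?L2 = "?L \<Otimes>\<^sub>M ?L" and ?L3 = "?L \<Otimes>\<^sub>M (?L \<Otimes>\<^sub>M ?L)" and ?L4 = "?L \<Otimes>\<^sub>M (?L \<Otimes>\<^sub>M (?L \<Otimes>\<^sub>M ?L))"
  have C_eq: "?C = (\<lambda>p. fst p *\<^sub>R Quaternion 1 0 0 0 + fst (snd p) *\<^sub>R Quaternion 0 1 0 0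
      + fst (snd (snd p)) *\<^sub>R Quaternion 0 0 1 0 + snd (snd (snd p)) *\<^sub>R Quaternion 0 0 0 1)"
    by (auto simp: fun_eq_iff quaternion_eq_iff)
  have C [measurable]: "?C \<in> ?L4 \<rightarrow>\<^sub>M borel"
    unfolding C_eq by measurable
  have N: "normal_law 1 = density ?L ?n" by (simp add: normal_law_def)
  have sf1: "sigma_finite_measure (density ?L ?n)"
    using prob_space_imp_sigma_finite[OF prob_space_normal_law] by (simp add: N)
  have s2: "sigma_finite_measure ?L2" by (simp add: lborel_prod lborel.sigma_finite_measure_axioms)
  have s3: "sigma_finite_measure ?L3" by (simp add: lborel_prod lborel.sigma_finite_measure_axioms)
  have d2: "density ?L ?n \<Otimes>\<^sub>M density ?L ?n = density ?L2 (\<lambda>(x, y). ?n x * ?n y)"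
    by (rule pair_measure_density[OF _ _ lborel.sigma_finite_measure_axioms sf1]) auto
  have sf2: "sigma_finite_measure (density ?L2 (\<lambda>(x, y). ?n x * ?n y))"
    using prob_space_imp_sigma_finite[OF prob_space_pair[OF prob_space_normal_law
        prob_space_normal_law]] by (simp add: N d2)
  have d3: "density ?L ?n \<Otimes>\<^sub>M (density ?L ?n \<Otimes>\<^sub>M density ?L ?n) =
      density ?L3 (\<lambda>(x, y). ?n x * (\<lambda>(x, y). ?n x * ?n y) y)"
    unfolding d2 by (rule pair_measure_density[OF _ _ s2 sf2]) auto
  have sf3: "sigma_finite_measure (density ?L3 (\<lambda>(x, y). ?n x * (\<lambda>(x, y). ?n x * ?n y) y))"
    using prob_space_imp_sigma_finite[OF prob_space_pair[OF prob_space_normal_law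
        prob_space_pair[OF prob_space_normal_law prob_space_normal_law]]]
    by (simp only: N d3)
  have d4: "density ?L ?n \<Otimes>\<^sub>M (density ?L ?n \<Otimes>\<^sub>M (density ?L ?n \<Otimes>\<^sub>M density ?L ?n)) =
      density ?L4 (\<lambda>(x, y). ?n x * (\<lambda>(x, y). ?n x * (\<lambda>(x, y). ?n x * ?n y) y) y)"
    unfolding d3 by (rule pair_measure_density[OF _ _ s3 sf3]) (auto simp: case_prod_unfold)
  have lb: "distr ?L4 borel ?C = lborel"
  proof (rule lborel_eqI[symmetric])
    fix l u :: "real quaternion" assume le: "\<And>b. b \<in> Basis \<Longrightarrow> inner l b \<le> inner u b"
    have le': "qre l \<le> qre u" "qim1 l \<le> qim1 u" "qim2 l \<le> qim2 u" "qim3 l \<le> qim3 u"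
      using le[of "Quaternion 1 0 0 0"] le[of "Quaternion 0 1 0 0"] le[of "Quaternion 0 0 1 0"]
          le[of "Quaternion 0 0 0 1"]
      by (auto simp: Basis_real_quaternion inner_quaternion_def)
    have "?C -` box l u \<inter> space ?L4 = {qre l<..<qre u} \<times>
        ({qim1 l<..<qim1 u} \<times> ({qim2 l<..<qim2 u} \<times> {qim3 l<..<qim3 u}))"
      by (auto simp: box_def Basis_real_quaternion inner_quaternion_def space_pair_measure)
    then have "emeasure (distr ?L4 borel ?C) (box l u) =
        emeasure ?L4 ({qre l<..<qre u} \<times> ({qim1 l<..<qim1 u} \<times>
        ({qim2 l<..<qim2 u} \<times> {qim3 l<..<qim3 u})))"
      by (simp only: emeasure_distr[OF C] borel_open[OF open_box])
    also have "\<dots> = ennreal (qre u - qre l) * (ennreal (qim1 u - qim1 l) *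
        (ennreal (qim2 u - qim2 l) * ennreal (qim3 u - qim3 l)))"
      using le' by (simp add: lborel.emeasure_pair_measure_Times
          sigma_finite_measure.emeasure_pair_measure_Times[OF s2]
          sigma_finite_measure.emeasure_pair_measure_Times[OF s3])
    finally show "emeasure (distr ?L4 borel ?C) (box l u) = ennreal (\<Prod>b\<in>Basis. inner (u - l) b)"
      using le' by (simp add: Basis_real_quaternion inner_quaternion_def ennreal_mult[symmetric])
  qed simp
  let ?g = "\<lambda>z :: real quaternion. ?n (qre z) * (?n (qim1 z) * (?n (qim2 z) * ?n (qim3 z)))"
  have comp: "qre z = inner z (Quaternion 1 0 0 0)" "qim1 z = inner z (Quaternion 0 1 0 0)"
    "qim2 z = inner z (Quaternion 0 0 1 0)" "qim3 z = inner z (Quaternion 0 0 0 1)" for z ::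
        "real quaternion"
    by (auto simp: inner_quaternion_def)
  have g: "?g \<in> borel_measurable borel"
    unfolding comp by measurable
  have "quaternion_normal_law 1 = distr (density ?L4
      (\<lambda>(x, y). ?n x * (\<lambda>(x, y). ?n x * (\<lambda>(x, y). ?n x * ?n y) y) y)) borel ?C"
    unfolding quaternion_normal_law_def N d4 ..
  also have "(\<lambda>(x, y). ?n x * (\<lambda>(x, y). ?n x * (\<lambda>(x, y). ?n x * ?n y) y) y) = (\<lambda>p. ?g (?C p))"
    by auto
  also have "distr (density ?L4 \<dots>) borel ?C = density (distr ?L4 borel ?C) ?g"
    by (rule density_distr[symmetric, OF g C])
  finally show ?thesis
    by (simp add: lb Basis_real_quaternion inner_quaternion_def)
qed

lemma quaternion_hermitian_scalars: "hermitian_scalars (quaternion_normal_law 1)"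
proof
  show "quaternion_normal_law 1 = density lborel
      (\<lambda>x. \<Prod>b\<in>Basis. ennreal (normal_density 0 1 (inner x b)))"
    by (rule quaternion_normal_law_density)
  show "(1 :: real quaternion) \<in> Basis"
    by (simp add: Basis_real_quaternion one_quaternion_def)
  show "conjugate x = of_real (2 * inner x 1) - x" for x :: "real quaternion"
    by (simp add: conjugate_quaternion_def quaternion_eq_iff quaternion_of_real inner_quaternion_def
        del: of_real_mult)
  show "conjugate (x * y) = conjugate y * conjugate x" for x y :: "real quaternion"
    by (simp add: conjugate_quaternion_def quaternion_eq_iff algebra_simps)
  show "conjugate x * x = of_real ((norm x)\<^sup>2)" for x :: "real quaternion"
    by (simp add: conjugate_quaternion_def quaternion_eq_iff quaternion_of_real norm_quaternion_def
        inner_quaternion_def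
        algebra_simps del: of_real_power)
qed

section \<open>Adding the imaginary unit\<close>

lemma map_mat_mult_hom:
  fixes \<phi> :: "'a :: ring_1 \<Rightarrow> 'c :: ring_1"
  assumes hom: "\<phi> 0 = 0" "\<And>x y. \<phi> (x + y) = \<phi> x + \<phi> y" "\<And>x y. \<phi> (x * y) = \<phi> x * \<phi> y"
    and "A \<in> carrier_mat m k" "B \<in> carrier_mat k n"
  shows "map_mat \<phi> (A * B) = map_mat \<phi> A * map_mat \<phi> B"
proof -
  have "\<phi> (sum f S) = (\<Sum>i\<in>S. \<phi> (f i))" for f and S :: "nat set"
    by (induction S rule: infinite_finite_induct) (auto simp: hom)
  then show ?thesis
    using assms by (intro eq_matI) (auto simp: scalar_prod_def)
qed

text \<open>The three cases differ only in \<open>\<phi>\<close>, which is the embedding of the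
  reals, the identity, or \<open>complexify\<close>. Centrality lets \<open>\<iota>\<close> pass the
  left factor, so both conjugated terms can be collected into one.\<close>

lemma add_imaginary_part:
  fixes \<phi> :: "'a :: real_algebra_1 \<Rightarrow> 'c :: real_algebra_1"
  assumes hom: "\<phi> 0 = 0" "\<And>x y. \<phi> (x + y) = \<phi> x + \<phi> y" "\<And>x y. \<phi> (x * y) = \<phi> x * \<phi> y"
      "\<And>r. \<phi> (of_real r) = of_real r"
    and central: "\<And>z. z * \<iota> = \<iota> * z"
    and car: "V \<in> carrier_mat n n" "W \<in> carrier_mat n n" "J \<in> carrier_mat n n"
  shows "map_mat \<phi> (V * map_mat of_real J * W) +
      \<iota> \<cdot>\<^sub>m map_mat \<phi> (V * (of_real l \<cdot>\<^sub>m unit11 n) * W) =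
    map_mat \<phi> V * (map_mat of_real J + (\<iota> * of_real l) \<cdot>\<^sub>m unit11 n) * map_mat \<phi> W"
proof -
  let ?V = "map_mat \<phi> V" and ?W = "map_mat \<phi> W"
  let ?J = "map_mat of_real J :: 'c mat" and ?U = "of_real l \<cdot>\<^sub>m unit11 n :: 'c mat"
  have u: "(unit11 n :: 'a mat) \<in> carrier_mat n n" by (simp add: unit11_def)
  have c: "?V \<in> carrier_mat n n" "?W \<in> carrier_mat n n" "?J \<in> carrier_mat n n"
      "?U \<in> carrier_mat n n" "\<iota> \<cdot>\<^sub>m ?U \<in> carrier_mat n n"
    using car by (auto simp: unit11_def)
  have J: "map_mat \<phi> (map_mat of_real J) = ?J"
    by (rule eq_matI) (auto simp: hom(4))
  have U: "map_mat \<phi> (of_real l \<cdot>\<^sub>m unit11 n) = ?U"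
    by (rule eq_matI) (auto simp: unit11_def hom(1) hom(4))
  have i1: "\<iota> \<cdot>\<^sub>m (A * B) = (\<iota> \<cdot>\<^sub>m A) * B" "\<iota> \<cdot>\<^sub>m (A * B) = A * (\<iota> \<cdot>\<^sub>m B)"
    if "A \<in> carrier_mat n n" "B \<in> carrier_mat n n" for A B :: "'c mat"
  proof -
    have "x * (\<iota> * y) = \<iota> * (x * y)" for x y by (metis central mult.assoc)
    then show "\<iota> \<cdot>\<^sub>m (A * B) = (\<iota> \<cdot>\<^sub>m A) * B" "\<iota> \<cdot>\<^sub>m (A * B) = A * (\<iota> \<cdot>\<^sub>m B)"
      using that by (auto intro!: eq_matI sum.cong simp: scalar_prod_def sum_distrib_left
          mult.assoc)
  qed
  have "map_mat \<phi> (V * map_mat of_real J * W) = ?V * ?J * ?W"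
    using car by (simp add: map_mat_mult_hom[OF hom(1-3), of _ n n _ n] J)
  moreover have "map_mat \<phi> (V * (of_real l \<cdot>\<^sub>m unit11 n) * W) = ?V * ?U * ?W"
    using car u by (simp add: map_mat_mult_hom[OF hom(1-3), of _ n n _ n] U)
  moreover have "\<iota> \<cdot>\<^sub>m (?V * ?U * ?W) = ?V * (\<iota> \<cdot>\<^sub>m ?U) * ?W"
    by (simp only: i1(1)[OF mult_carrier_square[OF c(1,4)] c(2)] i1(2)[OF c(1,4)])
  moreover have "?V * ?J * ?W + ?V * (\<iota> \<cdot>\<^sub>m ?U) * ?W = ?V * (?J + \<iota> \<cdot>\<^sub>m ?U) * ?W"
    using c by (simp only: mult_add_distrib_mat[of _ n n] add_mult_distrib_mat[of _ n n _ _ n]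
        mult_carrier_square)
  moreover have "\<iota> \<cdot>\<^sub>m ?U = (\<iota> * of_real l) \<cdot>\<^sub>m unit11 n"
    by (rule eq_matI) (auto simp: unit11_def)
  ultimately show ?thesis by simp
qed

context hermitian_scalars
begin

lemma rank_one_reduction_ensembles:
  assumes "prob_space M" "0 < n"
    and L: "(L, LJ) \<in> {(gaussian_ensemble \<nu> n, GbetaE (real DIM('a)) n),
        (laguerre_ensemble \<nu> m n, LbetaE (real DIM('a)) m n)}"
    and H: "has_law M n H L"
    and \<Gamma>: "\<Gamma> \<in> M \<rightarrow>\<^sub>M mat_borel n n"
    and rank1: "AE \<omega> in M. pos_semidef n (\<Gamma> \<omega> :: 'a mat) \<and> dependent_cols (\<Gamma> \<omega>)"
    and indep: "prob_space.indep_var M (mat_borel n n) H (mat_borel n n) \<Gamma>"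
  shows "\<exists>J W. has_law M n J LJ \<and> (\<forall>\<omega>\<in>space M. is_jacobi n (J \<omega>)) \<and>
      indep_rv M (mat_borel n n) J borel (\<lambda>\<omega>. hs_norm (\<Gamma> \<omega>)) \<and>
      random_unitary M n W \<and>
      (AE \<omega> in M. H \<omega> = conj_transpose (W \<omega>) * map_mat of_real (J \<omega>) * W \<omega> \<and>
        \<Gamma> \<omega> = conj_transpose (W \<omega>) * (of_real (hs_norm (\<Gamma> \<omega>)) \<cdot>\<^sub>m unit11 n) * W \<omega>)"
proof -
  have "invariant_law n L \<and> distr L (mat_borel n n) (tridiag n) = LJ"
  proof -
    have T: "tridiag n \<in> (mat_borel n n :: 'a mat measure) \<rightarrow>\<^sub>M mat_borel n n"
      by (rule tridiag_measurable[OF measurable_ident_sets[OF refl]])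
    have h: "herm \<in> iid n n \<rightarrow>\<^sub>M mat_borel n n" using herm_meas by (simp cong: measurable_cong_sets)
    have g: "gram \<in> iid m n \<rightarrow>\<^sub>M mat_borel n n" using gram_meas by (simp cong: measurable_cong_sets)
    have "distr (gaussian_ensemble \<nu> n) (mat_borel n n) (tridiag n) = GbetaE (real DIM('a)) n"
      using distr_law[OF refl h T] distr_tridiag_gaussian[OF assms(2)] by
          (simp add: gaussian_ensemble_eq)
    moreover have "distr (laguerre_ensemble \<nu> m n) (mat_borel n n) (tridiag n) =
        LbetaE (real DIM('a)) m n"
      using distr_law[OF refl g T] distr_tridiag_laguerre[OF assms(2)] by
          (simp add: laguerre_ensemble_eq)
    ultimately show ?thesis
      using L invariant_law_gaussian invariant_law_laguerre by auto
  qed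
  then show ?thesis
    using rank_one_reduction[OF assms(1) _ _ H \<Gamma> rank1 indep] by blast
qed

end

lemma random_unitary_carrier:
  "random_unitary M n W \<Longrightarrow> \<omega> \<in> space M \<Longrightarrow> W \<omega> \<in> carrier_mat n n"
  by (simp add: random_unitary_def unitary_def)

lemma has_law_carrier:
  "has_law M n X L \<Longrightarrow> \<omega> \<in> space M \<Longrightarrow> X \<omega> \<in> carrier_mat n n"
  by (auto simp: has_law_def dest: measurable_mat_carrier)

lemma complex_of_real_conj_transpose:
  "conj_transpose (map_mat complex_of_real W) = map_mat complex_of_real (conj_transpose W)"
  by (rule eq_matI) (auto simp: conjugate_complex_def)

text \<open>For \<beta> = 1 the reduction produces a real orthogonal matrix; it is read as a complex
  unitary one because \<open>H + i \<Gamma>\<close> is complex.\<close>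

lemma random_unitary_complex_of_real:
  assumes "random_unitary M n W"
  shows "random_unitary M n (\<lambda>\<omega>. map_mat complex_of_real (W \<omega>))"
  unfolding random_unitary_def
proof (intro conjI ballI)
  show "(\<lambda>\<omega>. map_mat complex_of_real (W \<omega>)) \<in> M \<rightarrow>\<^sub>M mat_borel n n"
    using assms by (intro map_mat_measurable) (auto simp: random_unitary_def)
  fix \<omega> assume "\<omega> \<in> space M"
  then have W: "unitary n (W \<omega>)" using assms by (simp add: random_unitary_def)
  then have Wc: "W \<omega> \<in> carrier_mat n n" by (simp add: unitary_def)
  have one: "map_mat complex_of_real (1\<^sub>m n) = 1\<^sub>m n" by (rule eq_matI) auto
  show "unitary n (map_mat complex_of_real (W \<omega>))"
    using W Wc unfolding unitary_def complex_of_real_conj_transpose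
    by (simp add: map_mat_mult_hom[of complex_of_real _ n n _ n, symmetric] one)
qed

lemma real_ensembles_reduction:
  fixes H :: "'w \<Rightarrow> real mat"
  assumes "prob_space M" "0 < n"
    and L: "(L, LJ) \<in> {(GOE n, GbetaE 1 n), (LOE m n, LbetaE 1 m n)}"
    and H: "has_law M n H L" and \<Gamma>: "\<Gamma> \<in> M \<rightarrow>\<^sub>M mat_borel n n"
    and rank1: "AE \<omega> in M. pos_semidef n (\<Gamma> \<omega>) \<and> vec_space.rank n (\<Gamma> \<omega>) = 1"
    and indep: "prob_space.indep_var M (mat_borel n n) H (mat_borel n n) \<Gamma>"
  shows "\<exists>J (W :: 'w \<Rightarrow> complex mat).
          has_law M n J LJ \<and> (\<forall>\<omega>\<in>space M. is_jacobi n (J \<omega>)) \<and>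
          indep_rv M (mat_borel n n) J borel (\<lambda>\<omega>. hs_norm (\<Gamma> \<omega>)) \<and>
          random_unitary M n W \<and>
          (AE \<omega> in M.
            map_mat complex_of_real (H \<omega>) + \<i> \<cdot>\<^sub>m map_mat complex_of_real (\<Gamma> \<omega>) =
            conj_transpose (W \<omega>) *
              (map_mat complex_of_real (J \<omega>) + (\<i> * of_real (hs_norm (\<Gamma> \<omega>))) \<cdot>\<^sub>m unit11 n) *
              W \<omega>)"
proof -
  interpret hermitian_scalars "normal_law 1" by (rule real_hermitian_scalars)
  have rank1': "AE \<omega> in M. pos_semidef n (\<Gamma> \<omega>) \<and> dependent_cols (\<Gamma> \<omega>)"
    using rank1 by eventually_elim (auto intro!: rank_dependent_cols simp: pos_semidef_def)
  have L': "(L, LJ) \<in> {(gaussian_ensemble (normal_law 1) n, GbetaE (real DIM(real)) n),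
      (laguerre_ensemble (normal_law 1) m n, LbetaE (real DIM(real)) m n)}"
    using L by (simp add: GOE_def LOE_def)
  from rank_one_reduction_ensembles[OF assms(1,2) L' H \<Gamma> rank1' indep] obtain J W where
    J: "has_law M n J LJ" "\<forall>\<omega>\<in>space M. is_jacobi n (J \<omega>)"
        "indep_rv M (mat_borel n n) J borel (\<lambda>\<omega>. hs_norm (\<Gamma> \<omega>))"
    and W: "random_unitary M n W"
    and eq: "AE \<omega> in M. H \<omega> = conj_transpose (W \<omega>) * map_mat of_real (J \<omega>) * W \<omega> \<and>
        \<Gamma> \<omega> = conj_transpose (W \<omega>) * (of_real (hs_norm (\<Gamma> \<omega>)) \<cdot>\<^sub>m unit11 n) * W \<omega>" by blast
  have "AE \<omega> in M. map_mat complex_of_real (H \<omega>) + \<i> \<cdot>\<^sub>m map_mat complex_of_real (\<Gamma> \<omega>) =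
            conj_transpose (map_mat complex_of_real (W \<omega>)) *
              (map_mat complex_of_real (J \<omega>) + (\<i> * of_real (hs_norm (\<Gamma> \<omega>))) \<cdot>\<^sub>m unit11 n) *
              map_mat complex_of_real (W \<omega>)"
    using eq AE_space
  proof eventually_elim
    case (elim \<omega>)
    have "map_mat complex_of_real (conj_transpose (W \<omega>) * map_mat of_real (J \<omega>) * W \<omega>) +
        \<i> \<cdot>\<^sub>m map_mat complex_of_real (conj_transpose (W \<omega>) * (of_real (hs_norm (\<Gamma> \<omega>)) \<cdot>\<^sub>m unit11 n)
            * W \<omega>) =
      map_mat complex_of_real (conj_transpose (W \<omega>)) * (map_mat of_real (J \<omega>) +
          (\<i> * of_real (hs_norm (\<Gamma> \<omega>))) \<cdot>\<^sub>m unit11 n) * map_mat complex_of_real (W \<omega>)"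
      by (rule add_imaginary_part)
        (use random_unitary_carrier[OF W elim(2)] has_law_carrier[OF J(1) elim(2)] in
            \<open>auto simp: mult.commute\<close>)
    then show ?case
      using elim(1) by (simp only: complex_of_real_conj_transpose)
  qed
  with J random_unitary_complex_of_real[OF W] show ?thesis
    by (intro exI[of _ J] exI[of _ "\<lambda>\<omega>. map_mat complex_of_real (W \<omega>)"]) auto
qed

lemma complex_ensembles_reduction:
  fixes H :: "'w \<Rightarrow> complex mat"
  assumes "prob_space M" "0 < n"
    and L: "(L, LJ) \<in> {(GUE n, GbetaE 2 n), (LUE m n, LbetaE 2 m n)}"
    and H: "has_law M n H L" and \<Gamma>: "\<Gamma> \<in> M \<rightarrow>\<^sub>M mat_borel n n"
    and rank1: "AE \<omega> in M. pos_semidef n (\<Gamma> \<omega>) \<and> vec_space.rank n (\<Gamma> \<omega>) = 1"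
    and indep: "prob_space.indep_var M (mat_borel n n) H (mat_borel n n) \<Gamma>"
  shows "\<exists>J (W :: 'w \<Rightarrow> complex mat).
          has_law M n J LJ \<and> (\<forall>\<omega>\<in>space M. is_jacobi n (J \<omega>)) \<and>
          indep_rv M (mat_borel n n) J borel (\<lambda>\<omega>. hs_norm (\<Gamma> \<omega>)) \<and>
          random_unitary M n W \<and>
          (AE \<omega> in M.
            H \<omega> + \<i> \<cdot>\<^sub>m \<Gamma> \<omega> =
            conj_transpose (W \<omega>) *
              (map_mat complex_of_real (J \<omega>) + (\<i> * of_real (hs_norm (\<Gamma> \<omega>))) \<cdot>\<^sub>m unit11 n) *
              W \<omega>)"
proof -
  interpret hermitian_scalars "complex_normal_law 1" by (rule complex_hermitian_scalars)
  have rank1': "AE \<omega> in M. pos_semidef n (\<Gamma> \<omega>) \<and> dependent_cols (\<Gamma> \<omega>)"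
    using rank1 by eventually_elim (auto intro!: rank_dependent_cols simp: pos_semidef_def)
  have L': "(L, LJ) \<in> {(gaussian_ensemble (complex_normal_law 1) n, GbetaE (real DIM(complex)) n),
      (laguerre_ensemble (complex_normal_law 1) m n, LbetaE (real DIM(complex)) m n)}"
    using L by (simp add: GUE_def LUE_def)
  from rank_one_reduction_ensembles[OF assms(1,2) L' H \<Gamma> rank1' indep] obtain J W where
    J: "has_law M n J LJ" "\<forall>\<omega>\<in>space M. is_jacobi n (J \<omega>)"
        "indep_rv M (mat_borel n n) J borel (\<lambda>\<omega>. hs_norm (\<Gamma> \<omega>))"
    and W: "random_unitary M n W"
    and eq: "AE \<omega> in M. H \<omega> = conj_transpose (W \<omega>) * map_mat of_real (J \<omega>) * W \<omega> \<and>
        \<Gamma> \<omega> = conj_transpose (W \<omega>) * (of_real (hs_norm (\<Gamma> \<omega>)) \<cdot>\<^sub>m unit11 n) * W \<omega>" by blast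
  have id: "map_mat (\<lambda>z. z) A = A" for A :: "complex mat" by (rule eq_matI) auto
  have "AE \<omega> in M. H \<omega> + \<i> \<cdot>\<^sub>m \<Gamma> \<omega> =
            conj_transpose (W \<omega>) *
              (map_mat complex_of_real (J \<omega>) + (\<i> * of_real (hs_norm (\<Gamma> \<omega>))) \<cdot>\<^sub>m unit11 n) * W \<omega>"
    using eq AE_space
  proof eventually_elim
    case (elim \<omega>)
    have "map_mat (\<lambda>z. z) (conj_transpose (W \<omega>) * map_mat of_real (J \<omega>) * W \<omega>) +
        \<i> \<cdot>\<^sub>m map_mat (\<lambda>z. z) (conj_transpose (W \<omega>) * (of_real (hs_norm (\<Gamma> \<omega>)) \<cdot>\<^sub>m unit11 n) * W \<omega>)
            =
      map_mat (\<lambda>z. z) (conj_transpose (W \<omega>)) * (map_mat of_real (J \<omega>) +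
          (\<i> * of_real (hs_norm (\<Gamma> \<omega>))) \<cdot>\<^sub>m unit11 n) * map_mat (\<lambda>z. z) (W \<omega>)"
      by (rule add_imaginary_part)
        (use random_unitary_carrier[OF W elim(2)] has_law_carrier[OF J(1) elim(2)] in
            \<open>auto simp: mult.commute\<close>)
    then show ?case
      using elim(1) by (simp only: id)
  qed
  with J W show ?thesis by blast
qed

lemma quaternion_ensembles_reduction:
  fixes H :: "'w \<Rightarrow> real quaternion mat"
  assumes "prob_space M" "0 < n"
    and L: "(L, LJ) \<in> {(GSE n, GbetaE 4 n), (LSE m n, LbetaE 4 m n)}"
    and H: "has_law M n H L" and \<Gamma>: "\<Gamma> \<in> M \<rightarrow>\<^sub>M mat_borel n n"
    and rank1: "AE \<omega> in M. pos_semidef n (\<Gamma> \<omega>) \<and> right_rank (\<Gamma> \<omega>) = 1"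
    and indep: "prob_space.indep_var M (mat_borel n n) H (mat_borel n n) \<Gamma>"
  shows "\<exists>J (W :: 'w \<Rightarrow> real quaternion mat).
          has_law M n J LJ \<and> (\<forall>\<omega>\<in>space M. is_jacobi n (J \<omega>)) \<and>
          indep_rv M (mat_borel n n) J borel (\<lambda>\<omega>. hs_norm (\<Gamma> \<omega>)) \<and>
          random_unitary M n W \<and>
          (AE \<omega> in M.
            map_mat complexify (H \<omega>) + imag_unit \<cdot>\<^sub>m map_mat complexify (\<Gamma> \<omega>) =
            map_mat complexify (conj_transpose (W \<omega>)) *
              (map_mat of_real (J \<omega>) + (imag_unit * of_real (hs_norm (\<Gamma> \<omega>))) \<cdot>\<^sub>m unit11 n) *
              map_mat complexify (W \<omega>))"
proof -
  interpret hermitian_scalars "quaternion_normal_law 1" by (rule quaternion_hermitian_scalars)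
  have rank1': "AE \<omega> in M. pos_semidef n (\<Gamma> \<omega>) \<and> dependent_cols (\<Gamma> \<omega>)"
    using rank1 by eventually_elim (auto intro: right_rank_dependent_cols)
  have L': "(L, LJ) \<in> {(gaussian_ensemble (quaternion_normal_law 1) n,
      GbetaE (real DIM(real quaternion)) n),
      (laguerre_ensemble (quaternion_normal_law 1) m n, LbetaE (real DIM(real quaternion)) m n)}"
    using L by (simp add: GSE_def LSE_def DIM_real_quaternion)
  from rank_one_reduction_ensembles[OF assms(1,2) L' H \<Gamma> rank1' indep] obtain J W where
    J: "has_law M n J LJ" "\<forall>\<omega>\<in>space M. is_jacobi n (J \<omega>)"
        "indep_rv M (mat_borel n n) J borel (\<lambda>\<omega>. hs_norm (\<Gamma> \<omega>))"
    and W: "random_unitary M n W"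
    and eq: "AE \<omega> in M. H \<omega> = conj_transpose (W \<omega>) * map_mat of_real (J \<omega>) * W \<omega> \<and>
        \<Gamma> \<omega> = conj_transpose (W \<omega>) * (of_real (hs_norm (\<Gamma> \<omega>)) \<cdot>\<^sub>m unit11 n) * W \<omega>" by blast
  have sel: "qre (complexify z) = of_real (qre z)" "qim1 (complexify z) = of_real (qim1 z)"
    "qim2 (complexify z) = of_real (qim2 z)" "qim3 (complexify z) = of_real (qim3 z)" for z
    by (cases z; simp)+
  have "AE \<omega> in M. map_mat complexify (H \<omega>) + imag_unit \<cdot>\<^sub>m map_mat complexify (\<Gamma> \<omega>) =
            map_mat complexify (conj_transpose (W \<omega>)) *
              (map_mat of_real (J \<omega>) + (imag_unit * of_real (hs_norm (\<Gamma> \<omega>))) \<cdot>\<^sub>m unit11 n) *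
              map_mat complexify (W \<omega>)"
    using eq AE_space
  proof eventually_elim
    case (elim \<omega>)
    have "map_mat complexify (conj_transpose (W \<omega>) * map_mat of_real (J \<omega>) * W \<omega>) +
        imag_unit \<cdot>\<^sub>m map_mat complexify (conj_transpose (W \<omega>) *
            (of_real (hs_norm (\<Gamma> \<omega>)) \<cdot>\<^sub>m unit11 n) * W \<omega>) =
      map_mat complexify (conj_transpose (W \<omega>)) * (map_mat of_real (J \<omega>) +
          (imag_unit * of_real (hs_norm (\<Gamma> \<omega>))) \<cdot>\<^sub>m unit11 n) * map_mat complexify (W \<omega>)"
      \<comment> \<open>Everything is checked in coordinates: \<open>complexify\<close> acts on each
        of them by an embedding of fields, and \<open>imag_unit\<close> is central because only its
        scalar coordinate is nonzero.\<close>
      by (rule add_imaginary_part)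
        (use random_unitary_carrier[OF W elim(2)] has_law_carrier[OF J(1) elim(2)] in
          \<open>auto simp: quaternion_eq_iff sel quaternion_of_real mult.commute\<close>)
    then show ?case using elim(1) by (simp only:)
  qed
  with J W show ?thesis by blast
qed

theorem theorem1:
  fixes M :: "'w measure" and m n :: nat
  assumes "prob_space M" and "0 < m" and "0 < n"
  shows
    "(\<forall>(H :: 'w \<Rightarrow> real mat) \<Gamma> L LJ.
        (L, LJ) \<in> {(GOE n, GbetaE 1 n), (LOE m n, LbetaE 1 m n)} \<longrightarrow>
        has_law M n H L \<longrightarrow>
        \<Gamma> \<in> M \<rightarrow>\<^sub>M mat_borel n n \<longrightarrow>
        (AE \<omega> in M. pos_semidef n (\<Gamma> \<omega>) \<and> vec_space.rank n (\<Gamma> \<omega>) = 1) \<longrightarrow>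
        prob_space.indep_var M (mat_borel n n) H (mat_borel n n) \<Gamma> \<longrightarrow>
        (\<exists>J (W :: 'w \<Rightarrow> complex mat).
          has_law M n J LJ \<and> (\<forall>\<omega>\<in>space M. is_jacobi n (J \<omega>)) \<and>
          indep_rv M (mat_borel n n) J borel (\<lambda>\<omega>. hs_norm (\<Gamma> \<omega>)) \<and>
          random_unitary M n W \<and>
          (AE \<omega> in M.
            map_mat complex_of_real (H \<omega>) + \<i> \<cdot>\<^sub>m map_mat complex_of_real (\<Gamma> \<omega>) =
            conj_transpose (W \<omega>) *
              (map_mat complex_of_real (J \<omega>) + (\<i> * of_real (hs_norm (\<Gamma> \<omega>))) \<cdot>\<^sub>m unit11 n) *
              W \<omega>)))
   \<and> (\<forall>(H :: 'w \<Rightarrow> complex mat) \<Gamma> L LJ.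
        (L, LJ) \<in> {(GUE n, GbetaE 2 n), (LUE m n, LbetaE 2 m n)} \<longrightarrow>
        has_law M n H L \<longrightarrow>
        \<Gamma> \<in> M \<rightarrow>\<^sub>M mat_borel n n \<longrightarrow>
        (AE \<omega> in M. pos_semidef n (\<Gamma> \<omega>) \<and> vec_space.rank n (\<Gamma> \<omega>) = 1) \<longrightarrow>
        prob_space.indep_var M (mat_borel n n) H (mat_borel n n) \<Gamma> \<longrightarrow>
        (\<exists>J (W :: 'w \<Rightarrow> complex mat).
          has_law M n J LJ \<and> (\<forall>\<omega>\<in>space M. is_jacobi n (J \<omega>)) \<and>
          indep_rv M (mat_borel n n) J borel (\<lambda>\<omega>. hs_norm (\<Gamma> \<omega>)) \<and>
          random_unitary M n W \<and>
          (AE \<omega> in M.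
            H \<omega> + \<i> \<cdot>\<^sub>m \<Gamma> \<omega> =
            conj_transpose (W \<omega>) *
              (map_mat complex_of_real (J \<omega>) + (\<i> * of_real (hs_norm (\<Gamma> \<omega>))) \<cdot>\<^sub>m unit11 n) *
              W \<omega>)))
   \<and> (\<forall>(H :: 'w \<Rightarrow> real quaternion mat) \<Gamma> L LJ.
        (L, LJ) \<in> {(GSE n, GbetaE 4 n), (LSE m n, LbetaE 4 m n)} \<longrightarrow>
        has_law M n H L \<longrightarrow>
        \<Gamma> \<in> M \<rightarrow>\<^sub>M mat_borel n n \<longrightarrow>
        (AE \<omega> in M. pos_semidef n (\<Gamma> \<omega>) \<and> right_rank (\<Gamma> \<omega>) = 1) \<longrightarrow>
        prob_space.indep_var M (mat_borel n n) H (mat_borel n n) \<Gamma> \<longrightarrow>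
        (\<exists>J (W :: 'w \<Rightarrow> real quaternion mat).
          has_law M n J LJ \<and> (\<forall>\<omega>\<in>space M. is_jacobi n (J \<omega>)) \<and>
          indep_rv M (mat_borel n n) J borel (\<lambda>\<omega>. hs_norm (\<Gamma> \<omega>)) \<and>
          random_unitary M n W \<and>
          (AE \<omega> in M.
            map_mat complexify (H \<omega>) + imag_unit \<cdot>\<^sub>m map_mat complexify (\<Gamma> \<omega>) =
            map_mat complexify (conj_transpose (W \<omega>)) *
              (map_mat of_real (J \<omega>) + (imag_unit * of_real (hs_norm (\<Gamma> \<omega>))) \<cdot>\<^sub>m unit11 n) *
              map_mat complexify (W \<omega>))))"
proof (intro conjI allI impI, goal_cases)
  case 1
  then show ?case by (rule real_ensembles_reduction[OF assms(1,3)])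
next
  case 2
  then show ?case by (rule complex_ensembles_reduction[OF assms(1,3)])
next
  case 3
  then show ?case by (rule quaternion_ensembles_reduction[OF assms(1,3)])
qed

end
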